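(* There exists an $O(n^3)$ time algorithm that finds a minimum coloring of any $(P_7,C_4,C_5)$-free graph with $n$ vertices and $m$ edges.
   Context: All graphs are finite, simple and nonnull. $P_k$ is the path on $k$ vertices and $C_k$ the cycle on $k$ vertices. A graph is $\mathcal{H}$-free if no induced subgraph of it is isomorphic to a member of $\mathcal{H}$. A $q$-coloring of $G$ is a function $c:V(G)\to\{1,\dots,q\}$ with $c(u)\neq c(v)$ for every edge $uv$; a minimum coloring of $G$ is a $q$-coloring of $G$ with $q=\chi(G)$, the minimum possible value of $q$. *)

theory Defs
  imports Complex_Main "HOL-Library.FuncSet" "HOL-Library.Landau_Symbols"
begin

section \<open>Graphs and colorings\<close>

record 'a ugraph =
  verts :: "'a set"
  edges :: "'a set set"

definition simple_graph :: "'a ugraph \<Rightarrow> bool" where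
  "simple_graph G \<longleftrightarrow>
     finite (verts G) \<and> verts G \<noteq> {} \<and> (\<forall>e\<in>edges G. e \<subseteq> verts G \<and> card e = 2)"

definition induced_subgraph :: "'a ugraph \<Rightarrow> 'a set \<Rightarrow> 'a ugraph" where
  "induced_subgraph G S = \<lparr>verts = S, edges = {e \<in> edges G. e \<subseteq> S}\<rparr>"

definition graph_isomorphic :: "'a ugraph \<Rightarrow> 'b ugraph \<Rightarrow> bool" where
  "graph_isomorphic G H \<longleftrightarrow>
     (\<exists>f. bij_betw f (verts G) (verts H) \<and>
          (\<forall>u\<in>verts G. \<forall>v\<in>verts G. {u, v} \<in> edges G \<longleftrightarrow> {f u, f v} \<in> edges H))"

definition graph_free :: "'b ugraph set \<Rightarrow> 'a ugraph \<Rightarrow> bool" where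
  "graph_free \<H> G \<longleftrightarrow>
     (\<forall>H\<in>\<H>. \<forall>S\<subseteq>verts G. \<not> graph_isomorphic (induced_subgraph G S) H)"

definition path_graph :: "nat \<Rightarrow> nat ugraph" where
  "path_graph k = \<lparr>verts = {..<k}, edges = {{i, Suc i} | i. Suc i < k}\<rparr>"

text \<open>Meaningful for \<open>k \<ge> 3\<close>.\<close>

definition cycle_graph :: "nat \<Rightarrow> nat ugraph" where
  "cycle_graph k = \<lparr>verts = {..<k}, edges = {{i, Suc i mod k} | i. i < k}\<rparr>"

definition is_coloring :: "nat \<Rightarrow> 'a ugraph \<Rightarrow> ('a \<Rightarrow> nat) \<Rightarrow> bool" where
  "is_coloring q G c \<longleftrightarrow>
     c \<in> verts G \<rightarrow> {1..q} \<and> (\<forall>u v. {u, v} \<in> edges G \<longrightarrow> c u \<noteq> c v)"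

definition chromatic_number :: "'a ugraph \<Rightarrow> nat" where
  "chromatic_number G = (LEAST q. \<exists>c. is_coloring q G c)"

definition is_minimum_coloring :: "'a ugraph \<Rightarrow> ('a \<Rightarrow> nat) \<Rightarrow> bool" where
  "is_minimum_coloring G c \<longleftrightarrow> is_coloring (chromatic_number G) G c"


section \<open>A word RAM with structured programs\<close>

text \<open>
  A program uses finitely many scalar variables and finitely many arrays, all holding machine
  words, that is, natural numbers below the word bound \<open>W\<close>. Addition and multiplication are
  modulo \<open>W\<close>, so that every computed value and every array index is a word; subtraction is
  truncated at \<open>0\<close>.
\<close>

type_synonym name = string

record state =
  scalar :: "name \<Rightarrow> nat"
  array :: "name \<Rightarrow> nat \<Rightarrow> nat"

datatype aexp =
    Const nat
  | Var name
  | Read name aexp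
  | Add aexp aexp
  | Sub aexp aexp
  | Mul aexp aexp
  | Div aexp aexp
  | Mod aexp aexp

datatype bexp =
    Less aexp aexp
  | Equal aexp aexp
  | Neg bexp
  | Conj bexp bexp

datatype com =
    Skip
  | Assign name aexp
  | Write name aexp aexp
  | Seq com com
  | If bexp com com
  | While bexp com

fun aval :: "nat \<Rightarrow> state \<Rightarrow> aexp \<Rightarrow> nat" where
  "aval W s (Const k) = k mod W"
| "aval W s (Var x) = scalar s x"
| "aval W s (Read a e) = array s a (aval W s e)"
| "aval W s (Add e f) = (aval W s e + aval W s f) mod W"
| "aval W s (Sub e f) = aval W s e - aval W s f"
| "aval W s (Mul e f) = (aval W s e * aval W s f) mod W"
| "aval W s (Div e f) = aval W s e div aval W s f"
| "aval W s (Mod e f) = aval W s e mod aval W s f"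

fun bval :: "nat \<Rightarrow> state \<Rightarrow> bexp \<Rightarrow> bool" where
  "bval W s (Less e f) \<longleftrightarrow> aval W s e < aval W s f"
| "bval W s (Equal e f) \<longleftrightarrow> aval W s e = aval W s f"
| "bval W s (Neg b) \<longleftrightarrow> \<not> bval W s b"
| "bval W s (Conj b b') \<longleftrightarrow> bval W s b \<and> bval W s b'"

text \<open>Every operation, including each operand access, costs one time unit.\<close>

fun acost :: "aexp \<Rightarrow> nat" where
  "acost (Const k) = 1"
| "acost (Var x) = 1"
| "acost (Read a e) = 1 + acost e"
| "acost (Add e f) = 1 + acost e + acost f"
| "acost (Sub e f) = 1 + acost e + acost f"
| "acost (Mul e f) = 1 + acost e + acost f"
| "acost (Div e f) = 1 + acost e + acost f"
| "acost (Mod e f) = 1 + acost e + acost f"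

fun bcost :: "bexp \<Rightarrow> nat" where
  "bcost (Less e f) = 1 + acost e + acost f"
| "bcost (Equal e f) = 1 + acost e + acost f"
| "bcost (Neg b) = 1 + bcost b"
| "bcost (Conj b b') = 1 + bcost b + bcost b'"

definition set_scalar :: "name \<Rightarrow> nat \<Rightarrow> state \<Rightarrow> state" where
  "set_scalar x v s = s\<lparr>scalar := (scalar s)(x := v)\<rparr>"

definition set_array :: "name \<Rightarrow> nat \<Rightarrow> nat \<Rightarrow> state \<Rightarrow> state" where
  "set_array a i v s = s\<lparr>array := (array s)(a := (array s a)(i := v))\<rparr>"

text \<open>
  \<open>exec W p s t s'\<close>: with word bound \<open>W\<close>, the program \<open>p\<close> started in state \<open>s\<close> halts in
  state \<open>s'\<close> after exactly \<open>t\<close> time units.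
\<close>

inductive exec :: "nat \<Rightarrow> com \<Rightarrow> state \<Rightarrow> nat \<Rightarrow> state \<Rightarrow> bool" for W where
  Skip: "exec W Skip s 1 s"
| Assign: "exec W (Assign x e) s (1 + acost e) (set_scalar x (aval W s e) s)"
| Write: "exec W (Write a e f) s (1 + acost e + acost f)
            (set_array a (aval W s e) (aval W s f) s)"
| Seq: "exec W p s t s' \<Longrightarrow> exec W q s' t' s'' \<Longrightarrow> exec W (Seq p q) s (t + t') s''"
| IfTrue: "bval W s b \<Longrightarrow> exec W p s t s' \<Longrightarrow> exec W (If b p q) s (1 + bcost b + t) s'"
| IfFalse: "\<not> bval W s b \<Longrightarrow> exec W q s t s' \<Longrightarrow> exec W (If b p q) s (1 + bcost b + t) s'"
| WhileFalse: "\<not> bval W s b \<Longrightarrow> exec W (While b p) s (1 + bcost b) s"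
| WhileTrue: "bval W s b \<Longrightarrow> exec W p s t s' \<Longrightarrow> exec W (While b p) s' t' s'' \<Longrightarrow>
    exec W (While b p) s (1 + bcost b + t + t') s''"

lemma exec_deterministic:
  "exec W p s t s' \<Longrightarrow> exec W p s u s'' \<Longrightarrow> u = t \<and> s'' = s'"
proof (induction arbitrary: u s'' rule: exec.induct)
  case (Seq p s t s' q t' s2)
  from Seq.prems show ?case by cases (use Seq.IH in blast)
next
  case (IfTrue s b p t s' q)
  from IfTrue.prems show ?case by cases (use IfTrue in blast)+
next
  case (IfFalse s b q t s' p)
  from IfFalse.prems show ?case by cases (use IfFalse in blast)+
next
  case (WhileTrue s b p t s' t' s2)
  from WhileTrue.prems show ?case by cases (use WhileTrue in blast)+
qed (auto elim: exec.cases)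


section \<open>Coloring algorithms\<close>

text \<open>
  A graph with vertex set \<open>{..<n}\<close> is given by \<open>n\<close> and its adjacency matrix, stored row by row.
  All other memory is \<open>0\<close>.
\<close>

definition input_state :: "nat ugraph \<Rightarrow> state" where
  "input_state G =
     (let n = card (verts G) in
      \<lparr>scalar = (\<lambda>x. if x = ''n'' then n else 0),
       array = (\<lambda>a i. if a = ''adj'' \<and> i < n * n \<and> {i div n, i mod n} \<in> edges G
                      then 1 else 0)\<rparr>)"

text \<open>The color of vertex \<open>v\<close> is read off at index \<open>v\<close> of the array \<open>col\<close>.\<close>

definition output_coloring :: "state \<Rightarrow> nat \<Rightarrow> nat" where
  "output_coloring s v = array s ''col'' v"

text \<open>
  On graphs with \<open>n\<close> vertices the machine words have \<open>k * log 2 (n + 1)\<close> bits, for a constant \<open>k\<close>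
  belonging to the algorithm.
\<close>

definition finds_minimum_coloring ::
    "com \<Rightarrow> nat \<Rightarrow> (nat \<Rightarrow> nat) \<Rightarrow> (nat ugraph \<Rightarrow> bool) \<Rightarrow> bool" where
  "finds_minimum_coloring p k T \<C> \<longleftrightarrow>
     (\<forall>n G. simple_graph G \<and> verts G = {..<n} \<and> \<C> G \<longrightarrow>
        (\<exists>t s. exec ((n + 1) ^ k) p (input_state G) t s \<and> t \<le> T n \<and>
               is_minimum_coloring G (output_coloring s)))"

end

theory Submission
  imports Defs "HOL-Combinatorics.Permutations"
begin

notation iff (infixr "<->" 25)

text \<open>The vertices are processed in LexBFS order, and an optimal colouring of the set \<open>P\<close> of processed vertices is maintained. Let \<open>v\<close> be the next
  vertex, \<open>T\<close> its neighbourhood in \<open>P\<close>, \<open>M\<close> the vertices of \<open>T\<close> adjacent to all of \<open>T\<close>, and \<open>S = T - M\<close>. By LexBFS the vertices of \<open>S\<close> have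
  neighbours in one component of \<open>P - T\<close>, so if \<open>S\<close> is not a disjoint union of cliques, then \<open>v\<close> lies on an induced 7-cycle. Otherwise choose a
  colour \<open>b\<close> missing on \<open>M\<close>; if there is none, or if for every other colour \<open>a\<close> some clique of \<open>T\<close> has both colours, then \<open>v\<close> needs a new colour.
  Kempe changes with the colours \<open>a\<close> and \<open>b\<close> bring about one of these situations or free \<open>b\<close> at \<open>v\<close>, unless again an induced 7-cycle through \<open>v\<close> shows up.

  Given a 7-cycle \<open>h\<close> through \<open>v\<close>, the set \<open>U\<close> of vertices complete to \<open>h\<close> is a clique complete to the set \<open>W\<close> of vertices mixed on \<open>h\<close>. The vertices of \<open>W\<close>
  fall into 14 classes in cyclic order and form a proper circular arc graph without stable sets of size 4, so that the larger of its clique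
  bound and \<open>card W / 3\<close> colours are necessary; a greedy insertion of gaps shows that they suffice. Each component of the remaining vertices sees only a clique of \<open>W\<close>
  and vertices of \<open>U\<close>, so its old colouring extends the new one up to a permutation of colours.\<close>

section \<open>Induced paths and LexBFS\<close>

text \<open>The running time shapes the proof: each of the \<open>n\<close> vertices may cost only
  O(n^2), the search for a hole and the repair of the colouring included.
  \<open>P_7\<close>-freeness bounds every search, since at most five rounds of exploration exhaust
  a component. Up to \<open>q\<close> Kempe changes per vertex are affordable because the change for
  colour \<open>a\<close> costs O(n) plus O(n) for each vertex coloured \<open>a\<close>, and the
  colour classes add up to at most \<open>n\<close>; the components that miss a hole are charged in
  the same way.

  Optimality is never searched for. A new colour is spent only on a clique that shows all old
  colours at \<open>v\<close>, or on a hole, where the old optimum and \<open>card U\<close> plus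
  the number for \<open>W\<close> are both lower bounds whose maximum is attained.

  Time and word size must be established for the word RAM. Therefore the algorithm is written in a
  small language of bounded loops over natural numbers, for which cost and size of values are read
  off the syntax, and a compiler is verified once.\<close>

locale pcc_free =
  fixes E :: "'a => 'a => bool"
  assumes E_sym: "E x y ==> E y x"
    and E_irrefl [simp]: "~ E x x"
    \<comment> \<open>Opposite vertices have to be required distinct only here: in the other two
      patterns an equality would contradict one of the listed adjacencies.\<close>
    and no_C4: "[|E a b; E b c; E c d; E d a; ~ E a c; ~ E b d; a ~= c; b ~= d|] ==> False"
    and no_C5: "[|E a b; E b c; E c d; E d e; E e a;
      ~ E a c; ~ E a d; ~ E b d; ~ E b e; ~ E c e|] ==> False"
    and no_P7: "[|E a b; E b c; E c d; E d e; E e f; E f g;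
      ~ E a c; ~ E a d; ~ E a e; ~ E a f; ~ E a g;
      ~ E b d; ~ E b e; ~ E b f; ~ E b g; ~ E c e; ~ E c f; ~ E c g;
      ~ E d f; ~ E d g; ~ E e g|] ==> False"
begin

lemma E_comm: "E x y = E y x"
  using E_sym by blast

lemma E_neq: "E x y ==> x ~= y"
  by auto

section \<open>Shortest walks and the holes they close\<close>

definition walk :: "'a set => 'a => 'a set => nat => (nat => 'a) => bool" where
  "walk S x T k f <-> f 0 = x & f k \<in> T & (\<forall>i<k. E (f i) (f (Suc i))) & (\<forall>i. 0 < i & i < k --> f i \<in> S)"

text \<open>Minimality gives everything: a chord or a repetition would allow a piece to be cut out,
  and a vertex in \<open>T\<close>, or with a neighbour in \<open>T\<close>, would allow the walk to
  end earlier. The step into \<open>T\<close> itself is exempt, hence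
  \<open>i + 1 < k\<close>.\<close>

lemma shortest_walk:
  assumes "walk S x T k0 f0"
  obtains k f where "walk S x T k f" "k <= k0"
    "!!i j. i + 1 < j ==> j <= k ==> ~ E (f i) (f j)"
    "!!i j. i < j ==> j <= k ==> f i ~= f j"
    "!!i t. i + 1 < k ==> t \<in> T ==> ~ E (f i) t"
    "!!i. i < k ==> f i \<notin> T"
proof -
  define k where "k = (LEAST k. \<exists>f. walk S x T k f)"
  have ex: "\<exists>f. walk S x T k f" unfolding k_def by (rule LeastI_ex) (use assms in blast)
  then obtain f where w: "walk S x T k f" by blast
  have min: "k <= k'" if "walk S x T k' f'" for k' f' unfolding k_def by (rule Least_le) (use that in blast)
  have f0: "f 0 = x" and fk: "f k \<in> T" and st: "!!i. i < k ==> E (f i) (f (Suc i))"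
    and inn: "!!i. 0 < i ==> i < k ==> f i \<in> S" using w by (auto simp: walk_def)
  have shortcut: False if ij: "i < j" "j <= k" and e: "E (f i) (f (Suc j))" "Suc j <= k" for i j
  proof -
    define g where "g l = (if l <= i then f l else f (l + (j - i)))" for l
    have "walk S x T (k - (j - i)) g" unfolding walk_def
    proof (intro conjI allI impI)
      show "g 0 = x" by (simp add: g_def f0)
      show "g (k - (j - i)) \<in> T" using ij e fk by (auto simp: g_def)
      fix l assume l: "l < k - (j - i)"
      show "E (g l) (g (Suc l))"
      proof (cases "l = i")
        case True thus ?thesis using e ij by (simp add: g_def)
      next
        case False thus ?thesis using st[of l] st[of "l + (j - i)"] l ij by (auto simp: g_def)
      qed
    next
      fix l assume "0 < l & l < k - (j - i)"
      thus "g l \<in> S" using inn ij by (auto simp: g_def)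
    qed
    from min[OF this] ij show False by simp
  qed
  have nadj: "~ E (f i) (f j)" if "i + 1 < j" "j <= k" for i j
    using shortcut[of i "j - 1"] that by (cases j) auto
  have nT: "f i \<notin> T" if "i < k" for i
  proof
    assume "f i \<in> T"
    hence "walk S x T i f" using w that by (auto simp: walk_def)
    from min[OF this] that show False by simp
  qed
  have nadjT: "~ E (f i) t" if "i + 1 < k" "t \<in> T" for i t
  proof
    assume e: "E (f i) t"
    define g where "g l = (if l <= i then f l else t)" for l
    have "walk S x T (Suc i) g" using w that e by (auto simp: walk_def g_def less_Suc_eq)
    from min[OF this] that show False by simp
  qed
  have dist: "f i ~= f j" if ij: "i < j" "j <= k" for i j
  proof (cases "j = k")
    case True thus ?thesis using nT[of i] fk ij by auto
  next
    case False
    thus ?thesis using nadj[of i "Suc j"] st[of j] ij E_irrefl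
      by (metis Suc_eq_plus1 Suc_less_eq Suc_leI le_neq_implies_less)
  qed
  show thesis using that[OF w min[OF assms]] nadj dist nadjT nT by blast
qed

definition conn :: "'a set => bool" where
  "conn S <-> (\<forall>x\<in>S. \<forall>y\<in>S. (x, y) \<in> {(a, b). a \<in> S & b \<in> S & E a b}\<^sup>*)"

lemma rtrancl_walk:
  assumes "(x, y) \<in> {(a, b). a \<in> S & b \<in> S & E a b}\<^sup>*" "x \<in> S"
  obtains k f where "f 0 = x" "f k = y" "\<forall>i<k. E (f i) (f (Suc i))" "\<forall>i\<le>k. f i \<in> S"
  using assms(1)
proof (induction arbitrary: thesis rule: rtrancl_induct)
  case base
  show ?case by (rule base[of "%_. x" 0]) (use assms(2) in auto)
next
  case (step y z)
  from step.IH obtain k f where f: "f 0 = x" "f k = y" "\<forall>i<k. E (f i) (f (Suc i))" "\<forall>i\<le>k. f i \<in> S" by blast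
  show ?case by (rule step.prems[of "f(Suc k := z)" "Suc k"]) (use f step.hyps in "auto simp: less_Suc_eq le_Suc_eq")
qed

lemma conn_walk:
  assumes "conn D" "d \<in> D" "E x d" "e \<in> D" "e' \<in> T" "E e e'"
  obtains k f where "walk D x T k f"
proof -
  from assms have "(d, e) \<in> {(a, b). a \<in> D & b \<in> D & E a b}\<^sup>*" by (auto simp: conn_def)
  then obtain k f where f: "f 0 = d" "f k = e" "\<forall>i<k. E (f i) (f (Suc i))" "\<forall>i\<le>k. f i \<in> D"
    by (rule rtrancl_walk[OF _ assms(2)])
  define g where "g i = (case i of 0 => x | Suc j => if j <= k then f j else e')" for i
  have "E (g i) (g (Suc i))" if "i < Suc (Suc k)" for i
    using that f assms by (cases i) (auto simp: g_def less_Suc_eq Suc_le_eq)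
  moreover have "g i \<in> D" if "0 < i" "i < Suc (Suc k)" for i
    using that f by (cases i) (auto simp: g_def)
  ultimately have "walk D x T (Suc (Suc k)) g"
    using assms by (auto simp: walk_def g_def)
  thus thesis by (rule that)
qed

text \<open>Together with \<open>v\<close> a shortest path from \<open>x\<close> to \<open>y\<close>
  through \<open>D\<close> closes to a hole. Two or three edges give a forbidden cycle, and six or
  more edges give an induced path on seven vertices that begins with \<open>v\<close>. What remains
  is a 6-hole or a 7-hole.\<close>

lemma hole_through:
  assumes D: "conn D" "d \<in> D" "E x d" "e \<in> D" "E y e"
    and v: "E v x" "E v y" "~ E x y" "x ~= y" "!!u. u \<in> D ==> ~ E v u" "v \<notin> D"
  obtains a b c where "a \<in> D" "b \<in> D" "c \<in> D" "E x a" "E a b" "E b c" "E c y"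
      "~ E x b" "~ E x c" "~ E a c" "~ E a y" "~ E b y"
  | a b c d where "a \<in> D" "b \<in> D" "c \<in> D" "d \<in> D" "E x a" "E a b" "E b c" "E c d" "E d y"
      "~ E x b" "~ E x c" "~ E x d" "~ E a c" "~ E a d" "~ E a y" "~ E b d" "~ E b y" "~ E c y"
proof -
  obtain k0 f0 where "walk D x {y} k0 f0" using conn_walk[OF D(1-4), of y "{y}"] D(5) E_sym by blast
  then obtain k f where w: "walk D x {y} k f"
    and na: "!!i j. i + 1 < j ==> j <= k ==> ~ E (f i) (f j)" using shortest_walk by metis
  have f0: "f 0 = x" and fk: "f k = y" and st: "!!i. i < k ==> E (f i) (f (Suc i))"
    and inn: "!!i. 0 < i ==> i < k ==> f i \<in> D" using w by (auto simp: walk_def)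
  have nv: "~ E v (f i)" if "0 < i" "i < k" for i using inn v(5) that by blast
  consider "k = 0" | "k = 1" | "k = 2" | "k = 3" | "k = 4" | "k = 5" | "k \<ge> 6" by linarith
  thus thesis
  proof cases
    case 1 thus ?thesis using f0 fk v by simp
  next
    case 2 thus ?thesis using st[of 0] f0 fk v by simp
  next
    case 3
    have "E x (f 1)" "E (f 1) y" "~ E v (f 1)" "f 1 ~= v"
      using st[of 0] st[of 1] nv[of 1] inn[of 1] v(6) f0 fk 3 by (auto simp: numeral_2_eq_2)
    thus ?thesis using no_C4[of v x "f 1" y] v E_comm by metis
  next
    case 4
    have "E (f 1) (f 2)" "E x (f 1)" "E (f 2) y" "~ E x (f 2)" "~ E (f 1) y" "~ E v (f 1)" "~ E v (f 2)"
      using st[of 0] st[of 1] st[of 2] na[of 0 2] na[of 1 3] nv f0 fk 4 by (auto simp: numeral_2_eq_2 numeral_3_eq_3)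
    thus ?thesis using no_C5[of v x "f 1" "f 2" y] v E_comm by metis
  next
    case 5
    show ?thesis by (rule that(1)[of "f 1" "f 2" "f 3"])
      (use st[of 0] st[of 1] st[of 2] st[of 3] na[of 0 2] na[of 0 3] na[of 1 3] na[of 1 4] na[of 2 4] inn f0 fk 5 in
        \<open>auto simp: eval_nat_numeral\<close>)
  next
    case 6
    show ?thesis by (rule that(2)[of "f 1" "f 2" "f 3" "f 4"])
      (use st[of 0] st[of 1] st[of 2] st[of 3] st[of 4] na[of 0 2] na[of 0 3] na[of 0 4] na[of 1 3] na[of 1 4] na[of 1 5]
         na[of 2 4] na[of 2 5] na[of 3 5] inn f0 fk 6 in "auto simp: eval_nat_numeral")
  next
    case 7
    have "E (f 0) (f 1)" "E (f 1) (f 2)" "E (f 2) (f 3)" "E (f 3) (f 4)" "E (f 4) (f 5)"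
      using st[of 0] st[of 1] st[of 2] st[of 3] st[of 4] 7 by (auto simp: eval_nat_numeral)
    moreover have "E v (f 0)" using f0 v by simp
    moreover have "~ E v (f 1)" "~ E v (f 2)" "~ E v (f 3)" "~ E v (f 4)" "~ E v (f 5)" using nv 7 by auto
    ultimately show ?thesis
      using no_P7[of v "f 0" "f 1" "f 2" "f 3" "f 4" "f 5"] na 7 by auto
  qed
qed

section \<open>LexBFS and the component behind a neighbourhood\<close>

text \<open>\<open>lexless p i u w\<close>: with respect to the first \<open>i\<close> vertices of the order \<open>p\<close>, the LexBFS label of \<open>u\<close> is smaller than the label of \<open>w\<close>.\<close>

definition lexless :: "(nat => 'a) => nat => 'a => 'a => bool" where
  "lexless p i u w <-> (\<exists>l<i. ~ E (p l) u & E (p l) w & (\<forall>l'<l. E (p l') u = E (p l') w))"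

definition lexbfs :: "(nat => 'a) => nat => bool" where
  "lexbfs p m <-> inj_on p {..m} & (\<forall>j\<le>m. \<forall>i<j. ~ lexless p i (p i) (p j))"

text \<open>The first position at which the adjacencies to \<open>p b\<close> and \<open>p c\<close>
  differ is at most \<open>a\<close>. As \<open>p b\<close> was preferred to \<open>p c\<close>, it
  favours \<open>p b\<close>, so it cannot be \<open>a\<close> itself.\<close>

lemma lexbfs_4point:
  assumes "lexbfs p m" "a < b" "b < c" "c <= m" "E (p a) (p c)" "~ E (p a) (p b)"
  obtains d where "d < a" "E (p d) (p b)" "~ E (p d) (p c)"
proof -
  define l where "l = (LEAST l. E (p l) (p b) ~= E (p l) (p c))"
  have l: "E (p l) (p b) ~= E (p l) (p c)" unfolding l_def by (rule LeastI[of _ a]) (use assms in simp)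
  have le: "l <= a" unfolding l_def by (rule Least_le) (use assms in simp)
  have eq: "E (p l') (p b) = E (p l') (p c)" if "l' < l" for l' using not_less_Least that unfolding l_def by blast
  have "~ lexless p b (p b) (p c)" using assms by (auto simp: lexbfs_def)
  hence "E (p l) (p b) & ~ E (p l) (p c)" using l le eq assms(2) by (auto simp: lexless_def)
  moreover have "l ~= a" using calculation assms by auto
  ultimately show thesis using that[of l] le by auto
qed

text \<open>The right component is the one whose earliest vertex \<open>p d\<close> comes last. With
  respect to the vertices before \<open>d\<close>, all vertices from \<open>d\<close> on have the
  same neighbours as \<open>v\<close>. So a component that began before \<open>d\<close> cannot
  continue after \<open>d\<close>, and the vertices delivered by the four-point property are forced
  into \<open>D\<close>.\<close>

lemma lexbfs_component:
  assumes lb: "lexbfs p m"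
  obtains D where "conn D" "p m \<notin> D" "D \<subseteq> p ` {..<m}" "!!u. u \<in> D ==> ~ E (p m) u"
    "!!s x. [|s \<in> p ` {..<m}; x \<in> p ` {..<m}; E (p m) s; E (p m) x; x ~= s; ~ E s x|] ==> \<exists>d\<in>D. E s d"
proof -
  define v where "v = p m"
  define R where "R = {p i |i. i < m & ~ E (p i) v}"
  define rel where "rel = {(a, b). a \<in> R & b \<in> R & E a b}"
  have inj: "inj_on p {..m}" using lb by (simp add: lexbfs_def)
  have inR: "p i \<in> R <-> ~ E (p i) v" if "i < m" for i
    using that inj_onD[OF inj, of _ i] unfolding R_def by (auto; metis atMost_iff less_imp_le)
  have RE: "\<exists>i<m. r = p i & ~ E (p i) v" if "r \<in> R" for r using that R_def by blast
  have vR: "v \<notin> R" using inj_onD[OF inj, of m] unfolding R_def v_def by fastforce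
  have sym_rel: "(a, b) \<in> rel\<^sup>* ==> (b, a) \<in> rel\<^sup>*" for a b
    by (rule symD[OF sym_rtrancl]) (auto simp: sym_def rel_def E_sym)
  have fp: "\<exists>d<a. E (p d) (p b) & ~ E (p d) v" if "a < b" "b < m" "E v (p a)" "~ E (p a) (p b)" for a b
    using lexbfs_4point[OF lb that(1,2) order_refl] that E_sym unfolding v_def by metis
  show thesis
  proof (cases "R = {}")
    case True
    have "False" if h: "i < m" "j < m" "E v (p i)" "E v (p j)" "i < j" "~ E (p i) (p j)" for i j
    proof -
      obtain d where "d < i" "E (p d) (p j)" "~ E (p d) v"
        using fp[of i j] h by blast
      thus False using inR[of d] True that by auto
    qed
    hence "\<exists>d\<in>{}. E s d" if "s \<in> p ` {..<m}" "x \<in> p ` {..<m}" "E v s" "E v x" "x ~= s" "~ E s x" for s x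
      using that E_comm by (metis imageE lessThan_iff linorder_neqE_nat)
    thus thesis by (intro that[of "{}"]) (auto simp: conn_def v_def)
  next
    case False
    define F where "F = {i. i < m & p i \<in> R & (\<forall>j<i. p j \<in> R --> (p i, p j) \<notin> rel\<^sup>*)}"
    have firstF: "\<exists>f\<in>F. f <= i & (p i, p f) \<in> rel\<^sup>*" if "i < m" "p i \<in> R" for i
    proof -
      define f where "f = (LEAST f. p f \<in> R & (p i, p f) \<in> rel\<^sup>*)"
      have f: "p f \<in> R & (p i, p f) \<in> rel\<^sup>*" unfolding f_def by (rule LeastI[of _ i]) (use that in simp)
      have "f <= i" unfolding f_def by (rule Least_le) (use that in simp)
      have "(p f, p j) \<notin> rel\<^sup>*" if "j < f" "p j \<in> R" for j
        using not_less_Least[of j "%f. p f \<in> R & (p i, p f) \<in> rel\<^sup>*"] that f rtrancl_trans unfolding f_def by metis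
      with f \<open>f <= i\<close> that have "f \<in> F" by (auto simp: F_def)
      with f \<open>f <= i\<close> show ?thesis by blast
    qed
    have "finite F" unfolding F_def by auto
    moreover have "F ~= {}" using False RE firstF by blast
    ultimately obtain d where dF: "d \<in> F" and dmax: "!!f. f \<in> F ==> f <= d"
      using Max_in Max_ge by metis
    have d: "d < m" "p d \<in> R" "!!j. j < d ==> p j \<in> R ==> (p d, p j) \<notin> rel\<^sup>*" using dF by (auto simp: F_def)
    define D where "D = {r. (p d, r) \<in> rel\<^sup>*}"
    have DR: "D \<subseteq> R"
    proof
      fix r assume "r \<in> D"
      hence "(p d, r) \<in> rel\<^sup>*" by (simp add: D_def)
      thus "r \<in> R" by (induction rule: rtrancl_induct) (use d in "auto simp: rel_def")
    qed
    have lab_d: "E (p l) v" if "l < d" "E (p l) (p d)" for l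
      using d(3)[of l] that d inR[of l] E_comm unfolding rel_def by (auto intro: r_into_rtrancl)
    have lab0: "E (p l) (p d) = E (p l) v" if h: "l < d" for l
    proof (rule ccontr)
      assume "~ ?thesis"
      then obtain l where l: "l < d" "E (p l) (p d) ~= E (p l) v" "!!l'. l' < l ==> E (p l') (p d) = E (p l') v"
        using h exists_least_iff[of "%l. l < d & E (p l) (p d) ~= E (p l) v"] by (metis order.strict_trans)
      hence "~ E (p l) (p d)" "E (p l) v" using lab_d by blast+
      hence "lexless p d (p d) (p m)" using l by (auto simp: lexless_def v_def)
      thus False using lb d by (auto simp: lexbfs_def)
    qed
    \<comment> \<open>The label is squeezed: at time \<open>d\<close> that of \<open>p d\<close>,
      which equals that of \<open>v\<close>, is maximal, and at time \<open>j\<close> that of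
      \<open>p j\<close> is at least that of \<open>v\<close>.\<close>
    have lab: "E (p l) (p j) = E (p l) v" if h: "l < d" "d <= j" "j <= m" for l j
    proof (cases "j = d | j = m")
      case True thus ?thesis using lab0 h v_def by auto
    next
      case False
      show ?thesis
      proof (rule ccontr)
        assume "~ ?thesis"
        then obtain l where l: "l < d" "E (p l) (p j) ~= E (p l) v" "!!l'. l' < l ==> E (p l') (p j) = E (p l') v"
          using h exists_least_iff[of "%l. l < d & E (p l) (p j) ~= E (p l) v"] by (metis order.strict_trans)
        have "lexless p d (p d) (p j)" if "E (p l) (p j)" using l lab0 that by (auto simp: lexless_def)
        moreover have "lexless p j (p j) (p m)" if "~ E (p l) (p j)"
          using l that h False by (auto simp: lexless_def v_def intro!: exI[of _ l])
        ultimately show False using lb h False by (auto simp: lexbfs_def)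
      qed
    qed
    \<comment> \<open>By \<open>lab\<close> no non-neighbour of \<open>v\<close> before
      \<open>d\<close> is adjacent to a vertex from \<open>d\<close> on. Hence the component of
      \<open>p i\<close> stays behind \<open>d\<close>, and its earliest index, being at most
      \<open>d\<close> by maximality, is \<open>d\<close>.\<close>
    have late: "p i \<in> D" if "d <= i" "i < m" "p i \<in> R" for i
    proof -
      obtain f where f: "f \<in> F" "(p i, p f) \<in> rel\<^sup>*" using firstF \<open>i < m\<close> \<open>p i \<in> R\<close> by blast
      have "\<exists>j. r = p j & d <= j & j < m" if "(p i, r) \<in> rel\<^sup>*" for r using that
      proof (induction rule: rtrancl_induct)
        case base thus ?case using \<open>d <= i\<close> \<open>i < m\<close> by blast
      next
        case (step y z)
        then obtain j where j: "y = p j" "d <= j" "j < m" by blast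
        from step.hyps obtain l where l: "z = p l" "l < m" "~ E (p l) v" "E (p l) (p j)"
          using RE[of z] j E_comm by (auto simp: rel_def)
        hence "d <= l" using lab[of l j] j by (metis less_imp_le not_less)
        thus ?case using l by blast
      qed
      from this[OF f(2)] obtain j where "p f = p j" "d <= j" "j < m" by blast
      moreover have "f < m" using f by (simp add: F_def)
      ultimately have "f = j" using inj_onD[OF inj] by simp
      hence "f = d" using dmax[OF f(1)] \<open>d <= j\<close> by simp
      thus ?thesis using f sym_rel by (simp add: D_def)
    qed
    have outside: "p e \<in> D" if "e < j" "d <= j" "j < m" "E (p e) (p j)" "~ E (p e) v" for e j
    proof -
      have "d <= e" using lab[of e j] that by (metis less_imp_le not_less)
      thus ?thesis using late[of e] inR[of e] that by simp
    qed
    have main: "\<exists>u\<in>D. E (p s) u" if sx: "s < m" "x < m" "E v (p s)" "E v (p x)" "s ~= x" "~ E (p s) (p x)" for s x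
    proof (cases "s < d")
      case True
      thus ?thesis using lab0[of s] sx(3) E_comm by (auto simp: D_def)
    next
      case sd: False
      have xd: "d <= x"
      proof (rule ccontr)
        assume "~ d <= x"
        thus False using lab[of x s] sd sx E_comm by auto
      qed
      show ?thesis
      proof (cases "x < s")
        case True
        then obtain e where e: "e < x" "E (p e) (p s)" "~ E (p e) v"
          using fp[of x s] sx True E_comm by blast
        hence "p e \<in> D" using outside[of e s] sd sx True by auto
        thus ?thesis using e E_comm by blast
      next
        case False
        hence sx': "s < x" using sx by simp
        show ?thesis
        proof (rule ccontr)
          assume none: "~ ?thesis"
          \<comment> \<open>Infinite descent: as long as \<open>p s\<close> has no neighbour in
            \<open>D\<close>, every such \<open>e\<close> produces a smaller one.\<close>
          have "\<exists>e'<e. E (p e') (p x) & ~ E (p e') v" if e: "e < s" "E (p e) (p x)" "~ E (p e) v" for e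
          proof -
            have eD: "p e \<in> D" using outside[of e x] e xd sx sx' by auto
            hence "~ E (p e) (p s)" using none E_comm by blast
            then obtain f where f: "f < e" "E (p f) (p s)" "~ E (p f) (p x)"
              using lexbfs_4point[OF lb, of e s x] e sx' sx by auto
            have "E (p f) v"
            proof (rule ccontr)
              assume "~ E (p f) v"
              hence "p f \<in> D" using outside[of f s] f e sd sx by auto
              thus False using none f E_comm by blast
            qed
            then obtain e' where "e' < f" "E (p e') (p x)" "~ E (p e') v"
              using fp[of f x] f e sx sx' E_comm by (meson order.strict_trans)
            thus ?thesis using f by (meson order.strict_trans)
          qed
          hence "\<forall>e<s. ~ (E (p e) (p x) & ~ E (p e) v)"
            using exists_least_iff[of "%e. e < s & E (p e) (p x) & ~ E (p e) v"] by (metis order.strict_trans)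
          moreover obtain e where "e < s" "E (p e) (p x)" "~ E (p e) v"
            using fp[of s x] sx sx' by blast
          ultimately show False by blast
        qed
      qed
    qed
    have connD: "conn D"
    proof -
      have "(p d, r) \<in> {(a, b). a \<in> D & b \<in> D & E a b}\<^sup>*" if "(p d, r) \<in> rel\<^sup>*" for r using that
      proof (induction rule: rtrancl_induct)
        case (step y z)
        hence "(y, z) \<in> {(a, b). a \<in> D & b \<in> D & E a b}"
          by (auto simp: D_def rel_def intro: rtrancl_into_rtrancl[of _ y])
        from step.IH this show ?case by (rule rtrancl_into_rtrancl)
      qed simp
      moreover have "sym ({(a, b). a \<in> D & b \<in> D & E a b}\<^sup>*)"
        by (rule sym_rtrancl) (auto simp: sym_def E_sym)
      ultimately show ?thesis unfolding conn_def by (metis (no_types, lifting) D_def mem_Collect_eq rtrancl_trans symD)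
    qed
    show thesis
    proof (rule that[OF connD])
      show "p m \<notin> D" using vR DR v_def by blast
      show "D \<subseteq> p ` {..<m}" using DR R_def by auto
      show "~ E (p m) u" if "u \<in> D" for u using that DR RE E_comm v_def by blast
      show "\<exists>d\<in>D. E s d" if "s \<in> p ` {..<m}" "x \<in> p ` {..<m}" "E (p m) s" "E (p m) x" "x ~= s" "~ E s x" for s x
        using that main unfolding v_def by auto
    qed
  qed
qed

end

section \<open>The vertices around a 7-hole\<close>

context pcc_free begin

definition C7 :: "'a => 'a => 'a => 'a => 'a => 'a => 'a => bool" where
  "C7 a b c d e f g <-> E a b & E b c & E c d & E d e & E e f & E f g & E g a &
    ~ E a c & ~ E a d & ~ E a e & ~ E a f & ~ E b d & ~ E b e & ~ E b f & ~ E b g &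
    ~ E c e & ~ E c f & ~ E c g & ~ E d f & ~ E d g & ~ E e g"

lemma C7_rot: "C7 a b c d e f g ==> C7 b c d e f g a"
  by (auto simp: C7_def E_comm)

lemma C7_rev: "C7 a b c d e f g ==> C7 a g f e d c b"
  by (auto simp: C7_def E_comm)

lemma C7_gap2: "[|C7 a b c d e f g; E w a; E w c; w ~= b|] ==> E w b"
  using no_C4[of w a b c] E_comm by (auto simp: C7_def)

lemma C7_gap3: "[|C7 a b c d e f g; E w a; E w d; ~ E w b|] ==> E w c"
  using no_C5[of w a b c d] E_comm by (auto simp: C7_def)

lemma C7_single: "[|C7 a b c d e f g; E w a; ~ E w b; ~ E w c; ~ E w d; ~ E w e; ~ E w f|] ==> False"
  using no_P7[of w a b c d e f] by (auto simp: C7_def)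

lemma C7_pair: "[|C7 a b c d e f g; E w b; ~ E w c; ~ E w d; ~ E w e; ~ E w f; ~ E w g|] ==> False"
  using no_P7[of w b c d e f g] by (auto simp: C7_def)

text \<open>The gap lemmas, applied in both directions around the hole, spread the non-adjacency to
  all vertices other than \<open>a\<close>; then \<open>C7_single\<close> applies.\<close>

lemma C7_nbr:
  assumes c: "C7 a b c d e f g" and w: "E w a" "~ E w b" "~ E w g" "w ~= b" "w ~= g"
  shows False
proof -
  note r = C7_rot[OF C7_rev[OF c]]
  have "~ E w c" using C7_gap2[OF c] w by blast
  moreover have "~ E w d" using C7_gap3[OF c] w calculation by blast
  moreover have "~ E w f" using C7_gap2[OF C7_rev[OF c], of w] w by blast
  moreover have "~ E w e" using C7_gap3[OF C7_rev[OF c], of w] w calculation by blast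
  ultimately show False using C7_single[OF c] w by blast
qed

text \<open>The path from \<open>x\<close> to \<open>y\<close> closes to a 6-hole, because in a
  7-hole \<open>w\<close> would contradict \<open>C7_nbr\<close>. A shortest path from
  \<open>w\<close> to \<open>d\<close>, \<open>e\<close>, \<open>d'\<close> then has length two or
  three; in the second case its last inner vertex takes over the role of the branching vertex
  \<open>e\<close>.\<close>

lemma theta:
  assumes D: "conn D" "v \<notin> D" "!!u. u \<in> D ==> ~ E v u"
    and at: "dx \<in> D" "E x dx" "dy \<in> D" "E y dy" "dw \<in> D" "E w dw"
    and v: "E v x" "E v y" "E v w" "~ E x y" "~ E x w" "~ E y w" "x ~= y" "x ~= w" "y ~= w"
  obtains d e d' f where "d \<in> D" "e \<in> D" "d' \<in> D" "f \<in> D"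
    "E x d" "E d e" "E e d'" "E d' y" "E w f" "E f e"
    "~ E x e" "~ E x d'" "~ E d d'" "~ E d y" "~ E e y" "~ E w d" "~ E w e" "~ E w d'"
    "~ E f x" "~ E f y" "~ E f d" "~ E f d'"
  using D(1) at(1-4) v(1,2,4,7) D(3,2)
proof (rule hole_through)
  fix a b c d assume i: "a \<in> D" "b \<in> D" "c \<in> D" "d \<in> D" and h: "E x a" "E a b" "E b c" "E c d" "E d y"
      "~ E x b" "~ E x c" "~ E x d" "~ E a c" "~ E a d" "~ E a y" "~ E b d" "~ E b y" "~ E c y"
  have "C7 v x a b c d y" using h v i D(3) E_comm by (auto simp: C7_def)
  from C7_nbr[OF this, of w] v E_comm show thesis by blast
next
  fix d e d' assume i: "d \<in> D" "e \<in> D" "d' \<in> D" and h: "E x d" "E d e" "E e d'" "E d' y"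
      "~ E x e" "~ E x d'" "~ E d d'" "~ E d y" "~ E e y"
  note nv = D(3)[OF i(1)] D(3)[OF i(2)] D(3)[OF i(3)]
  have ne: "v ~= d" "v ~= d'" "v ~= e" using i D(2) by auto
  have wd: "~ E w d" using no_C4[of v x d w] v h nv ne E_comm by metis
  have wd': "~ E w d'" using no_C4[of v y d' w] v h nv ne E_comm by metis
  have we: "~ E w e" using no_C5[of v x d e w] v h nv wd E_comm by metis
  have wex: "\<exists>k0 f0. walk D w {d, e, d'} k0 f0"
  proof -
    have "(dw, e) \<in> {(a, b). a \<in> D & b \<in> D & E a b}\<^sup>*" using D(1) at(5) i by (auto simp: conn_def)
    then obtain k f where f: "f 0 = dw" "f k = e" "\<forall>i<k. E (f i) (f (Suc i))" "\<forall>i\<le>k. f i \<in> D"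
      by (rule rtrancl_walk[OF _ at(5)])
    have "walk D w {d, e, d'} (Suc k) (case_nat w f)"
      using f at(6) by (auto simp: walk_def split: nat.split)
    thus ?thesis by blast
  qed
  then obtain k f where wk: "walk D w {d, e, d'} k f"
    and na: "!!i j. i + 1 < j ==> j <= k ==> ~ E (f i) (f j)"
    and nT: "!!i t. i + 1 < k ==> t \<in> {d, e, d'} ==> ~ E (f i) t" using shortest_walk by metis
  have f0: "f 0 = w" and fk: "f k \<in> {d, e, d'}" and st: "!!i. i < k ==> E (f i) (f (Suc i))"
    and inn: "!!i. 0 < i ==> i < k ==> f i \<in> D" using wk by (auto simp: walk_def)
  have k0: "k ~= 0" using fk f0 wd v h by (metis E_comm insertE singletonD)
  have k1: "k ~= 1" using fk f0 st[of 0] wd wd' we by auto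
  have f1: "E w (f 1)" "f 1 \<in> D" using st[of 0] inn[of 1] f0 k0 k1 by auto
  have f1n: "~ E v (f 1)" "f 1 ~= v" using f1 D by auto
  have f1x: "~ E (f 1) x" using no_C4[of v x "f 1" w] v f1 f1n E_comm by metis
  have f1y: "~ E (f 1) y" using no_C4[of v y "f 1" w] v f1 f1n E_comm by metis
  have f1d: "~ E (f 1) d" using no_C5[of v x d "f 1" w] v f1 f1n f1x h nv wd E_comm by metis
  have f1d': "~ E (f 1) d'" using no_C5[of v y d' "f 1" w] v f1 f1n f1y h nv wd' E_comm by metis
  consider "k = 2" | "k = 3" | "k \<ge> 4" using k0 k1 by linarith
  thus thesis
  proof cases
    case 1
    hence "E (f 1) (f 2)" using st[of 1] by (simp add: numeral_2_eq_2)
    hence "E (f 1) e" using fk 1 f1d f1d' by auto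
    thus thesis using that[of d e d' "f 1"] i h f1 wd we wd' f1x f1y f1d f1d' by blast
  next
    case 2
    have f2: "E (f 1) (f 2)" "f 2 \<in> D" "~ E w (f 2)" "~ E (f 1) e"
      using st[of 1] inn[of 2] na[of 0 2] nT[of 1 e] f0 2 by (auto simp: eval_nat_numeral)
    have f2n: "~ E v (f 2)" "f 2 ~= v" using f2 D by auto
    have f2x: "~ E (f 2) x" using no_C5[of v x "f 2" "f 1" w] v f1 f1n f1x f2 f2n E_comm by metis
    have f2y: "~ E (f 2) y" using no_C5[of v y "f 2" "f 1" w] v f1 f1n f1y f2 f2n E_comm by metis
    have adj: "E (f 2) (f 3)" using st[of 2] 2 by (simp add: eval_nat_numeral)
    \<comment> \<open>If \<open>f 2\<close> sees one of \<open>d\<close> and \<open>d'\<close>, it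
      sees all three vertices and can replace \<open>e\<close>.\<close>
    have both: "E (f 2) d' & E (f 2) e" if "E (f 2) d"
    proof (cases "E (f 2) e")
      case True
      have False if n: "~ E (f 2) d'"
      proof -
        have "C7 v w (f 1) (f 2) e d' y"
          using v f1 f1n f2 f2n f2x f2y f1y f1d' h nv True n we wd' E_comm by (auto simp: C7_def)
        from C7_nbr[OF this, of x] v E_comm show False by blast
      qed
      thus ?thesis using True by blast
    next
      case False
      have ed: "f 2 ~= e" using that False nT[of 1 e] f2(1) f2(4) by auto
      have "~ E (f 2) d'"
        using no_C4[of d e d' "f 2"] False that h ed E_comm by metis
      hence False using no_P7[of w "f 1" "f 2" d e d' y] f1 f2 that False h f2y f1y f1d f1d' wd we wd' v E_comm by metis
      thus ?thesis ..
    qed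
    have both': "E (f 2) d & E (f 2) e" if "E (f 2) d'"
    proof (cases "E (f 2) e")
      case True
      have False if n: "~ E (f 2) d"
      proof -
        have "C7 v w (f 1) (f 2) e d x"
          using v f1 f1n f2 f2n f2x f2y f1x f1d h nv True n we wd E_comm by (auto simp: C7_def)
        from C7_nbr[OF this, of y] v E_comm show False by blast
      qed
      thus ?thesis using True by blast
    next
      case False
      have ed: "f 2 ~= e" using f2(1) f2(4) by auto
      have "~ E (f 2) d"
        using no_C4[of d e d' "f 2"] False that h ed E_comm by metis
      hence False using no_P7[of w "f 1" "f 2" d' e d x] f1 f2 that False h f2x f1x f1d f1d' wd we wd' v E_comm by metis
      thus ?thesis ..
    qed
    show thesis
    proof (cases "E (f 2) d | E (f 2) d'")
      case True
      hence "E (f 2) d" "E (f 2) d'" using both both' by blast+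
      thus thesis using that[of d "f 2" d' "f 1"] i h f1 f2 wd wd' f1x f1y f1d f1d' f2x f2y E_comm by metis
    next
      case False
      hence "E (f 2) e" using adj fk 2 by auto
      hence "C7 v x d e (f 2) (f 1) w"
        using v f1 f1n f1x f1d f2 f2n f2x h nv False we wd E_comm by (auto simp: C7_def)
      from C7_nbr[OF this, of y] v E_comm show thesis by blast
    qed
  next
    case 3
    have f2: "E (f 1) (f 2)" "f 2 \<in> D" "~ E w (f 2)" "~ E (f 1) e" "~ E (f 2) d" "~ E (f 2) e"
      using st[of 1] inn[of 2] na[of 0 2] nT[of 1 e] nT[of 2 d] nT[of 2 e] f0 3 by (auto simp: eval_nat_numeral)
    have f2n: "~ E v (f 2)" "f 2 ~= v" using f2 D by auto
    have f2x: "~ E (f 2) x" using no_C5[of v x "f 2" "f 1" w] v f1 f1n f1x f2 f2n E_comm by metis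
    show thesis
      using no_P7[of "f 2" "f 1" w v x d e] f1 f1n f1x f1d f2 f2n f2x v h nv wd we E_comm by metis
  qed
qed

text \<open>In the configuration of \<open>theta\<close> the vertex \<open>z\<close> can see neither
  \<open>f\<close>, \<open>e\<close> nor \<open>d\<close>, and then \<open>w\<close>,
  \<open>f\<close>, \<open>e\<close>, \<open>d\<close>, \<open>x\<close>, \<open>z\<close>,
  \<open>y\<close> is an induced path.\<close>

lemma no_P3_K1:
  assumes D: "conn D" "v \<notin> D" "!!u. u \<in> D ==> ~ E v u"
    and at: "dx \<in> D" "E x dx" "dy \<in> D" "E y dy" "dw \<in> D" "E w dw"
    and v: "E v x" "E v y" "E v w" "E v z" "E x z" "E z y" "~ E x y" "x ~= y"
      "~ E x w" "~ E y w" "~ E z w" "x ~= w" "y ~= w" "z ~= w"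
  shows False
proof (rule theta[OF D at v(1,2,3,7,9,10,8,12,13)])
  fix d e d' f
  assume i: "d \<in> D" "e \<in> D" "d' \<in> D" "f \<in> D"
    and h: "E x d" "E d e" "E e d'" "E d' y" "E w f" "E f e"
    "~ E x e" "~ E x d'" "~ E d d'" "~ E d y" "~ E e y" "~ E w d" "~ E w e" "~ E w d'"
    "~ E f x" "~ E f y" "~ E f d" "~ E f d'"
  have nv: "~ E v d" "~ E v e" "~ E v d'" "~ E v f" using i D by auto
  have ne: "v ~= f" using i D by auto
  have zf: "~ E z f" using no_C4[of v z f w] v h nv ne E_comm by metis
  have ze: "~ E z e" using no_C5[of v z e f w] v h nv zf E_comm by metis
  have zed: "z ~= e" using v(4) nv by auto
  have zd: "~ E z d"
  proof
    assume a: "E z d"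
    hence "E z d'" using no_C5[of z d e d' y] v h ze E_comm by metis
    thus False using no_C4[of z d e d'] a ze h zed E_comm h by (metis E_irrefl)
  qed
  show False using no_P7[of w f e d x z y] v h zd ze zf E_comm by metis
qed

text \<open>The adjacencies left open by the hypotheses form a finite propositional problem. Each
  clause is one instance of a forbidden subgraph, and together they force the edges and non-edges of
  the 7-hole.\<close>

lemma emerald_C7:
  assumes K: "E v p" "E v q" "E v r" "E v s" "E p q" "E q r" "E r s" "~ E p r" "~ E p s" "~ E q s"
    "~ E v a" "~ E v b" "~ E v c" "~ E v a'" "~ E v b'" "~ E v c'"
    "E p a" "E a b" "E b c" "E c r" "~ E p b" "~ E p c" "~ E a c" "~ E a r" "~ E b r"
    "E q a'" "E a' b'" "E b' c'" "E c' s" "~ E q b'" "~ E q c'" "~ E a' c'" "~ E a' s" "~ E b' s"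
  shows "C7 v s c b b' a' p"
proof -
  have c0: "~ E s a" using no_C4[of v p a s] K E_comm by metis
  have c1: "~ E p a' | ~ E r a'" using no_C4[of v p a' r] K E_comm by metis
  have c2: "~ E p c'" using no_C4[of v p c' s] K E_comm by metis
  have c3: "~ E q c | ~ E s c" using no_C4[of v q c s] K E_comm by metis
  have c4: "~ E a a' | E p a' | E q a" using no_C4[of p q a' a] K E_comm by metis
  have c5: "~ E q b | E q c" using no_C4[of q r c b] K E_comm by metis
  have c6: "~ E r b' | E r a'" using no_C4[of q r b' a'] K E_comm by metis
  have c7: "~ E c c' | E r c' | E s c" using no_C4[of r s c' c] K E_comm by metis
  have c8: "~ E s b | E s a" using no_C5[of v p a b s] K by (auto simp: E_comm)
  have c9: "~ E a c' | E p c' | E s a" using no_C5[of v p a c' s] K by (auto simp: E_comm)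
  have c10: "~ E p a' | ~ E c a' | E r a'" using no_C5[of v p a' c r] K by (auto simp: E_comm)
  have c11: "~ E p b' | E p c'" using no_C5[of v p b' c' s] K by (auto simp: E_comm)
  have c12: "~ E q b | ~ E b c' | E s b" using no_C5[of v q b c' s] K by (auto simp: E_comm)
  have c13: "~ E q c | ~ E c c' | E s c" using no_C5[of v q c c' s] K by (auto simp: E_comm)
  have c14: "~ E a b' | E p a' | E p b' | E q a | E a a'" using no_C5[of p q a' b' a] K by (auto simp: E_comm)
  have c15: "~ E q a | E q c | E q b" using no_C5[of q r c b a] K by (auto simp: E_comm)
  have c16: "~ E b a' | E q c | E q b | E r a' | E c a'" using no_C5[of q r c b a'] K by (auto simp: E_comm)
  have c17: "~ E c b' | E q c | E r b' | E r a' | E c a'" using no_C5[of q r c b' a'] K by (auto simp: E_comm)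
  have c18: "~ E r c' | ~ E b c' | ~ E q a | E q b | E a c'" using no_C5[of q r c' b a] K by (auto simp: E_comm)
  have c19: "~ E r c' | E r b' | E r a'" using no_C5[of q r c' b' a'] K by (auto simp: E_comm)
  have c20: "~ E b c' | E r c' | E s b | E s c | E c c'" using no_C5[of r s c' b c] K by (auto simp: E_comm)
  have c21: "E s a | E p c' | E a c' | E p b' | E a b' | E p a' | E a a' | E q a" using no_P7[of s c' b' a' q p a] K by (auto simp: E_comm)
  have c22: "~ E p a' | E b a' | E b b' | E c a' | E c b' | E r a' | E r b' | E p b'" using no_P7[of b c r v p a' b'] K by (auto simp: E_comm)
  have c23: "E s c | E c c' | E s b | E b c' | E s a | E a c' | E p c'" using no_P7[of c b a p v s c'] K by (auto simp: E_comm)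
  have "E s c & ~ E s b & ~ E c b' & E b b' & ~ E c a' & ~ E b a' & ~ E p b' & E p a'"
    using c0 c1 c2 c3 c4 c5 c6 c7 c8 c9 c10 c11 c12 c13 c14 c15 c16 c17 c18 c19 c20 c21 c22 c23 by sat
  thus ?thesis using K by (auto simp: C7_def E_comm)
qed

definition tA :: "'a => 'a => 'a => 'a => 'a => 'a => 'a => 'a => bool" where
  "tA a b c d e f g w <-> E w a & (w = b | E w b) & E w c & ~ E w d & ~ E w e & ~ E w f & ~ E w g &
     w ~= d & w ~= e & w ~= f & w ~= g"

definition tB :: "'a => 'a => 'a => 'a => 'a => 'a => 'a => 'a => bool" where
  "tB a b c d e f g w <-> E w a & E w b & E w c & E w d & ~ E w e & ~ E w f & ~ E w g &
     w ~= e & w ~= f & w ~= g"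

lemmas t_defs = tA_def tB_def C7_def

context
  fixes a b c d e f g
  assumes H: "C7 a b c d e f g"
begin

text \<open>In the two-letter names the letters are the kinds of the two vertices, A for windows of
  three and B for windows of four hole vertices, and the digit is the shift between the starts of
  their windows.\<close>

lemma AA0: "[|tA a b c d e f g w; tA a b c d e f g w'; w ~= w'|] ==> E w w'"
  using H no_C4[of w a w' c] E_neq[of a c] by (auto simp: t_defs E_comm)

lemma BB0: "[|tB a b c d e f g w; tB a b c d e f g w'; w ~= w'|] ==> E w w'"
  using H no_C4[of w a w' c] by (auto simp: t_defs E_comm)

lemma AB0: "[|tA a b c d e f g w; tB a b c d e f g w'|] ==> E w w'"
  using H no_C4[of w a w' c] by (auto simp: t_defs E_comm)

lemma BA1: "[|tB a b c d e f g w; tA b c d e f g a w'|] ==> E w w'"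
  using H no_C4[of w b w' d] by (auto simp: t_defs E_comm)

lemma AA1: "[|tA a b c d e f g w; tA b c d e f g a w'|] ==> E w w'"
  using H no_P7[of w' d e f g a w] by (auto simp: t_defs E_comm)

lemma BB1: "[|tB a b c d e f g w; tB b c d e f g a w'|] ==> E w w'"
  using H no_C4[of w b w' d] by (auto simp: t_defs E_comm)

lemma BB2: "[|tB a b c d e f g w; tB c d e f g a b w'|] ==> ~ E w w'"
  using H no_C5[of w w' f g a] by (auto simp: t_defs E_comm)

lemma AB2: "[|tA a b c d e f g w; tB c d e f g a b w'|] ==> ~ E w w'"
  using H no_C5[of w w' f g a] by (auto simp: t_defs E_comm)

lemma BA3: "[|tB a b c d e f g w; tA d e f g a b c w'|] ==> ~ E w w'"
  using H no_C5[of w w' f g a] by (auto simp: t_defs E_comm)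

lemma AA3: "[|tA a b c d e f g w; tA d e f g a b c w'|] ==> ~ E w w'"
  using H no_C4[of w w' d c] by (auto simp: t_defs E_comm)

lemma BB3: "[|tB a b c d e f g w; tB d e f g a b c w'|] ==> False"
  using H no_C4[of w w' g a] no_C5[of d w' g a w] by (auto simp: t_defs E_comm)

lemma AB3: "[|tA a b c d e f g w; tB d e f g a b c w'|] ==> ~ E w w'"
  using H no_C4[of w w' d c] by (auto simp: t_defs E_comm)

lemma BA4: "[|tB a b c d e f g w; tA e f g a b c d w'|] ==> ~ E w w'"
  using H no_C4[of w w' e d] by (auto simp: t_defs E_comm)

lemma AA2_B0: "[|tA a b c d e f g w; tA c d e f g a b w'; E w w'; tB a b c d e f g x|] ==> E x w'"
  using H AB0[of w x] no_C4[of w x d w'] by (auto simp: t_defs E_comm)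

lemma AA2_B1: "[|tA a b c d e f g w; tA c d e f g a b w'; E w w'; tB b c d e f g a x; E w' x|] ==> E w x"
  using H no_C4[of w w' x b] by (auto simp: t_defs E_comm)

lemma conflict_A:
  assumes "tA a b c d e f g u" "tA c d e f g a b w | tB b c d e f g a w" "tA f g a b c d e z | tB f g a b c d e z"
    "E u w" "E u z" "~ E w z"
  shows False
  using assms H no_C5[of u w e f z] by (auto simp: t_defs E_comm)

lemma conflict_B: "[|tB a b c d e f g u; tA c d e f g a b w; tA g a b c d e f z; ~ E u w; ~ E u z; ~ E w z|] ==> False"
  using H no_P7[of u c w e f g z] by (auto simp: t_defs E_comm)

lemma stable4:
  assumes "tA a b c d e f g u" "tB b c d e f g a u1" "tA d e f g a b c u2 | tB d e f g a b c u2" "tA f g a b c d e u3"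
    "~ E u u1" "~ E u u2" "~ E u u3" "~ E u1 u2" "~ E u1 u3" "~ E u2 u3"
  shows False
  using assms H no_P7[of u1 d u2 f u3 a u] by (auto simp: t_defs E_comm)

lemma hang_A:
  assumes "tA a b c d e f g w" "E y w" "~ E y c" "~ E y d" "~ E y e" "~ E y f" "~ E y g"
  shows False
  using assms H no_P7[of y w c d e f g] by (auto simp: t_defs E_comm)

end

end

lemma all_lt7: "(\<forall>k<7::nat. P k) <-> P 0 & P 1 & P 2 & P 3 & P 4 & P 5 & P 6"
  by (simp only: All_less_Suc eval_nat_numeral BitM.simps One_nat_def) auto

context pcc_free begin

section \<open>The fourteen classes around a hole\<close>

definition hole :: "(nat => 'a) => bool" where
  "hole h <-> C7 (h 0) (h 1) (h 2) (h 3) (h 4) (h 5) (h 6)"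

abbreviation hh :: "(nat => 'a) => nat => 'a" where "hh h i \<equiv> h (i mod 7)"

definition cn :: "(nat => 'a) => 'a => nat => bool" where
  "cn h w i <-> w = hh h i | E w (hh h i)"

definition hW :: "(nat => 'a) => 'a set" where "hW h = {w. (\<exists>i<7. cn h w i) & (\<exists>i<7. ~ cn h w i)}"
definition hU :: "(nat => 'a) => 'a set" where "hU h = {w. \<forall>i<7. cn h w i}"
definition hZ :: "(nat => 'a) => 'a set" where "hZ h = {w. \<forall>i<7. ~ cn h w i}"

text \<open>Twice the midpoint of the window of seen hole vertices, minus 2: midpoints advance in
  half steps and give the circular order of the 14 classes. Even classes have windows of length
  three, odd ones of length four.\<close>

definition cls :: "(nat => 'a) => 'a => nat" where
  "cls h w = 2 * (LEAST s. cn h w s & ~ cn h w (s + 6)) + card {i. i < 7 & cn h w i} - 3"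

text \<open>\<open>kind h s m w\<close>: the vertex \<open>w\<close> is adjacent or equal to exactly the 3 (\<open>m\<close> even) or 4 (\<open>m\<close> odd)
  hole vertices starting with number \<open>s + m div 2\<close>.\<close>

definition kind :: "(nat => 'a) => nat => nat => 'a => bool" where
  "kind h s m w <-> (\<forall>k<7. cn h w (s + m div 2 + k) <-> k < 3 + m mod 2)"

lemma hole_C7:
  assumes "hole h"
  shows "C7 (hh h i) (hh h (i + 1)) (hh h (i + 2)) (hh h (i + 3)) (hh h (i + 4)) (hh h (i + 5)) (hh h (i + 6))"
proof -
  note r0 = assms[unfolded hole_def]
  note r1 = C7_rot[OF r0] note r2 = C7_rot[OF r1] note r3 = C7_rot[OF r2] note r4 = C7_rot[OF r3]
  note r5 = C7_rot[OF r4] note r6 = C7_rot[OF r5]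
  define j where "j = i mod 7"
  have "C7 (hh h j) (hh h (j + 1)) (hh h (j + 2)) (hh h (j + 3)) (hh h (j + 4)) (hh h (j + 5)) (hh h (j + 6))"
  proof -
    have "j < 7" by (simp add: j_def)
    then consider "j = 0" | "j = 1" | "j = 2" | "j = 3" | "j = 4" | "j = 5" | "j = 6" by linarith
    thus ?thesis by cases (use r0 r1 r2 r3 r4 r5 r6 in "simp_all add: numeral_2_eq_2")
  qed
  moreover have "(j + k) mod 7 = (i + k) mod 7" for k by (simp add: j_def mod_add_left_eq)
  moreover have "j mod 7 = i mod 7" by (simp add: j_def)
  ultimately show ?thesis by (simp only:)
qed

lemma cn_mod: "cn h w (i mod 7) = cn h w i"
  by (simp add: cn_def)

lemma cn_shift: "i mod 7 = j mod 7 ==> cn h w i = cn h w j"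
  by (simp add: cn_def)

text \<open>Since \<open>i + 6\<close> is missed, the gap lemmas exclude \<open>i + 5\<close> and
  \<open>i + 4\<close>, so at most four vertices remain; \<open>C7_single\<close> and
  \<open>C7_pair\<close> exclude windows of one or two.\<close>

lemma hole_start:
  assumes H: "hole h" and i: "cn h w i" "~ cn h w (i + 6)"
  shows "(\<forall>k<7. cn h w (i + k) <-> k < 3) | (\<forall>k<7. cn h w (i + k) <-> k < 4)"
proof -
  define a where "a k = hh h (i + k)" for k
  have C: "C7 (a 0) (a 1) (a 2) (a 3) (a 4) (a 5) (a 6)" using hole_C7[OF H, of i] by (simp add: a_def)
  have cna: "cn h w (i + k) <-> w = a k | E w (a k)" for k by (simp add: cn_def a_def)
  have w0: "w = a 0 | E w (a 0)" "w ~= a 6" "~ E w (a 6)" using i cna[of 0] cna[of 6] by auto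
  show ?thesis
  proof (cases "w = a 0 | w = a 1 | w = a 2 | w = a 3 | w = a 4 | w = a 5")
    case True
    hence "w = a 1" using w0 C by (auto simp: C7_def E_comm)
    thus ?thesis unfolding all_lt7 cna using C by (auto simp: C7_def E_comm)
  next
    case False
    hence e0: "E w (a 0)" using w0 by blast
    note C2 = C7_rot[OF C7_rot[OF C]] note C4 = C7_rot[OF C7_rot[OF C2]] note C5 = C7_rot[OF C4]
    have n5: "~ E w (a 5)" using C7_gap2[OF C5, of w] e0 w0 by blast
    have n4: "~ E w (a 4)" using C7_gap3[OF C4, of w] e0 w0 n5 by blast
    have e1: "E w (a 1)"
    proof (rule ccontr)
      assume n1: "~ ?thesis"
      hence n2: "~ E w (a 2)" using C7_gap2[OF C, of w] e0 False by blast
      hence n3: "~ E w (a 3)" using C7_gap3[OF C, of w] e0 n1 by blast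
      show False using C7_single[OF C, of w] e0 n1 n2 n3 n4 n5 by blast
    qed
    have e2: "E w (a 2)"
    proof (rule ccontr)
      assume n2: "~ ?thesis"
      hence n3: "~ E w (a 3)" using C7_gap2[OF C7_rot[OF C], of w] e1 False by blast
      show False using C7_pair[OF C, of w] e1 n2 n3 n4 n5 w0 by blast
    qed
    show ?thesis unfolding all_lt7 cna using e0 e1 e2 n4 n5 w0 False by auto
  qed
qed

lemma cls_kind:
  assumes H: "hole h" and w: "w \<in> hW h"
  shows "cls h w < 14 & kind h 0 (cls h w) w"
proof -
  obtain i j where ij: "i < 7" "cn h w i" "j < 7" "~ cn h w j" using w by (auto simp: hW_def)
  have "\<exists>s. cn h w s & ~ cn h w (s + 6)"
  proof (rule ccontr)
    assume n: "~ ?thesis"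
    have "cn h w (i + 6 * k)" for k
    proof (induction k)
      case (Suc k)
      hence "cn h w (i + 6 * k + 6)" using n by blast
      moreover have "i + 6 * k + 6 = i + 6 * Suc k" by simp
      ultimately show ?case by metis
    qed (use ij in simp)
    \<comment> \<open>As 6 is -1 modulo 7, going back \<open>i - j\<close> times leads from
      \<open>i\<close> to \<open>j\<close>.\<close>
    moreover have "i + 6 * (i + 6 * j) = j + 7 * (i + 5 * j)" by simp
    hence "(i + 6 * (i + 6 * j)) mod 7 = j mod 7" by (metis mod_mult_self2)
    ultimately show False using cn_shift[of "i + 6 * (i + 6 * j)" j h w] ij(4) by blast
  qed
  define s where "s = (LEAST s. cn h w s & ~ cn h w (s + 6))"
  have s: "cn h w s" "~ cn h w (s + 6)" unfolding s_def using LeastI_ex[OF \<open>\<exists>s. _ s\<close>] by auto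
  have "s <= s mod 7" unfolding s_def
    by (rule Least_le) (use s cn_shift[of "s mod 7" s h w] cn_shift[of "s mod 7 + 6" "s + 6" h w] in
        \<open>auto simp: s_def[symmetric] mod_add_left_eq\<close>)
  hence s7: "s < 7" by (metis mod_less_divisor not_less order_le_less_trans zero_less_numeral)
  obtain l where l: "l = 3 | l = 4" "\<forall>k<7. cn h w (s + k) <-> k < l" using hole_start[OF H s] by blast
  have "bij_betw (%k. (s + k) mod 7) {k. k < l} {i. i < 7 & cn h w i}"
  proof (rule bij_betwI[where g = "%i. (i + 7 - s) mod 7"])
    show "(%k. (s + k) mod 7) \<in> {k. k < l} \<rightarrow> {i. i < 7 & cn h w i}" using l cn_mod by auto
    show "(%i. (i + 7 - s) mod 7) \<in> {i. i < 7 & cn h w i} \<rightarrow> {k. k < l}"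
    proof safe
      fix i :: nat assume i: "i < 7" "cn h w i"
      have "(s + (i + 7 - s) mod 7) mod 7 = i mod 7" using s7 i by (simp add: mod_add_right_eq)
      hence "cn h w (s + (i + 7 - s) mod 7)" using cn_shift i by blast
      thus "(i + 7 - s) mod 7 < l" using l by simp
    qed
    show "(((s + k) mod 7) + 7 - s) mod 7 = k" if "k \<in> {k. k < l}" for k
    proof (cases "s + k < 7")
      case False
      hence "(s + k) mod 7 = s + k - 7" using that l s7 by (subst le_mod_geq) auto
      thus ?thesis using False that l s7 by auto
    qed (use that l s7 in auto)
    show "(s + (i + 7 - s) mod 7) mod 7 = i" if "i \<in> {i. i < 7 & cn h w i}" for i using that s7 by (simp add: mod_add_right_eq)
  qed
  hence card: "card {i. i < 7 & cn h w i} = l" using bij_betw_same_card by fastforce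
  have c: "cls h w = 2 * s + (l - 3)" unfolding cls_def s_def[symmetric] card using l by auto
  hence "cls h w < 14" using s7 l by auto
  moreover have "kind h 0 (cls h w) w" using l c by (auto simp: kind_def)
  ultimately show ?thesis by blast
qed

lemma W_kind:
  assumes H: "hole h" and w: "w \<in> hW h" and c: "cls h w = (2 * s + m) mod 14"
  shows "kind h s m w"
proof -
  have a: "kind h 0 (cls h w) w" using cls_kind[OF H w] by blast
  have m2: "cls h w mod 2 = m mod 2" unfolding c by (subst mod_mod_cancel) auto
  define q where "q = (2 * s + m) div 14"
  have "2 * s + m = cls h w + 14 * q" unfolding c q_def by simp
  moreover have "cls h w = 2 * (cls h w div 2) + m mod 2" unfolding m2[symmetric] by simp
  moreover have "m = 2 * (m div 2) + m mod 2" by simp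
  ultimately have "s + m div 2 = cls h w div 2 + 7 * q" by linarith
  hence d: "(cls h w div 2) mod 7 = (s + m div 2) mod 7" by simp
  have "cn h w (cls h w div 2 + k) = cn h w (s + m div 2 + k)" for k
    by (rule cn_shift) (use d in "metis mod_add_left_eq")
  thus ?thesis using a m2 by (simp add: kind_def)
qed

lemma tA_intro:
  assumes C: "C7 a b c d e f g"
    and w: "w = a | E w a" "w = b | E w b" "w = c | E w c" "~ (w = d | E w d)" "~ (w = e | E w e)"
      "~ (w = f | E w f)" "~ (w = g | E w g)"
  shows "tA a b c d e f g w"
proof -
  have "w ~= a" "w ~= c" using C w by (auto simp: C7_def E_comm)
  thus ?thesis using w by (auto simp: tA_def)
qed

lemma tB_intro:
  assumes C: "C7 a b c d e f g"
    and w: "w = a | E w a" "w = b | E w b" "w = c | E w c" "w = d | E w d" "~ (w = e | E w e)"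
      "~ (w = f | E w f)" "~ (w = g | E w g)"
  shows "tB a b c d e f g w"
proof -
  have "w ~= a" "w ~= d" using C w(5-7) by (auto simp: C7_def E_comm)
  moreover have "w ~= b" using C w(4) calculation by (auto simp: C7_def E_comm)
  moreover have "w ~= c" using C w(1) calculation by (auto simp: C7_def E_comm)
  ultimately show ?thesis using w by (auto simp: tB_def)
qed

lemma kind_tA:
  assumes "hole h" "kind h s m w" "even m"
  defines "a \<equiv> %k. hh h (s + m div 2 + k)"
  shows "tA (a 0) (a 1) (a 2) (a 3) (a 4) (a 5) (a 6) w"
proof (rule tA_intro)
  show "C7 (a 0) (a 1) (a 2) (a 3) (a 4) (a 5) (a 6)" using hole_C7[OF assms(1), of "s + m div 2"] by (simp add: a_def)
  have "m mod 2 = 0" using assms(3) by auto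
  thus "w = a 0 | E w (a 0)" "w = a 1 | E w (a 1)" "w = a 2 | E w (a 2)" "~ (w = a 3 | E w (a 3))"
    "~ (w = a 4 | E w (a 4))" "~ (w = a 5 | E w (a 5))" "~ (w = a 6 | E w (a 6))"
    using assms(2) unfolding kind_def all_lt7 cn_def a_def by simp_all
qed

lemma kind_tB:
  assumes "hole h" "kind h s m w" "odd m"
  defines "a \<equiv> %k. hh h (s + m div 2 + k)"
  shows "tB (a 0) (a 1) (a 2) (a 3) (a 4) (a 5) (a 6) w"
proof (rule tB_intro)
  show "C7 (a 0) (a 1) (a 2) (a 3) (a 4) (a 5) (a 6)" using hole_C7[OF assms(1), of "s + m div 2"] by (simp add: a_def)
  have "m mod 2 = 1" using assms(3) by presburger
  thus "w = a 0 | E w (a 0)" "w = a 1 | E w (a 1)" "w = a 2 | E w (a 2)" "w = a 3 | E w (a 3)"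
    "~ (w = a 4 | E w (a 4))" "~ (w = a 5 | E w (a 5))" "~ (w = a 6 | E w (a 6))"
    using assms(2) unfolding kind_def all_lt7 cn_def a_def by simp_all
qed

section \<open>Clockwise class distances and rotated frames\<close>

definition dl :: "(nat => 'a) => 'a => 'a => nat" where
  "dl h u w = (cls h w + 14 - cls h u) mod 14"

lemma dl_cls:
  assumes "hole h" "u \<in> hW h" "w \<in> hW h"
  shows "cls h w = (cls h u + dl h u w) mod 14" "dl h u w < 14"
proof -
  have "cls h u < 14" "cls h w < 14" using cls_kind assms by blast+
  thus "cls h w = (cls h u + dl h u w) mod 14" unfolding dl_def by (simp add: mod_add_right_eq)
qed (simp add: dl_def)

lemma dl_rev:
  assumes "hole h" "u \<in> hW h" "w \<in> hW h"
  shows "dl h w u = (14 - dl h u w) mod 14"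
proof -
  have "cls h u < 14" "cls h w < 14" using cls_kind assms by blast+
  hence eq: "cls h u + 14 - cls h w = 28 - (cls h w + 14 - cls h u)" and le: "cls h w + 14 - cls h u <= 28" by arith+
  have *: "(28 - k) mod 14 = (14 - k mod 14) mod 14" if k28: "k <= 28" for k :: nat
  proof -
    consider "k < 14" | "14 <= k" "k < 28" | "k = 28" using k28 by linarith
    thus ?thesis by cases (auto simp: le_mod_geq)
  qed
  show ?thesis unfolding dl_def eq by (rule *[OF le])
qed

lemma dl_add:
  assumes "hole h" "u \<in> hW h" "w \<in> hW h" "x \<in> hW h"
  shows "dl h u x = (dl h u w + dl h w x) mod 14"
proof -
  have "cls h u < 14" "cls h w < 14" "cls h x < 14" using cls_kind assms by blast+
  hence "(cls h w + 14 - cls h u) + (cls h x + 14 - cls h w) = (cls h x + 14 - cls h u) + 14" by arith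
  thus ?thesis unfolding dl_def mod_add_eq by simp
qed

text \<open>Adjacency facts are proved for one fixed position of the windows. A frame rotates the
  hole so that \<open>u\<close> has class 0 or 1, according to its parity \<open>l\<close>, and
  makes these facts available for arbitrary classes.\<close>

lemma frame:
  assumes H: "hole h" and u: "u \<in> hW h"
  obtains a l where "l = cls h u mod 2" "C7 (a 0) (a 1) (a 2) (a 3) (a 4) (a 5) (a 6)" "!!k. a (k + 7) = (a k :: 'a)"
    "!!k. a k \<in> h ` {..<7}"
    "!!w m. [|w \<in> hW h; dl h u w = (m + 14 - l) mod 14; even m|] ==>
       tA (a (m div 2)) (a (m div 2 + 1)) (a (m div 2 + 2)) (a (m div 2 + 3)) (a (m div 2 + 4)) (a (m div 2 + 5)) (a (m div 2 + 6)) w"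
    "!!w m. [|w \<in> hW h; dl h u w = (m + 14 - l) mod 14; odd m|] ==>
       tB (a (m div 2)) (a (m div 2 + 1)) (a (m div 2 + 2)) (a (m div 2 + 3)) (a (m div 2 + 4)) (a (m div 2 + 5)) (a (m div 2 + 6)) w"
proof -
  define l s a where "l = cls h u mod 2" and "s = cls h u div 2" and "a k = hh h (s + k)" for k
  have cu: "cls h u = 2 * s + l" by (simp add: s_def l_def)
  have l2: "l < 2" by (simp add: l_def)
  have k: "kind h s m w" if "w \<in> hW h" "dl h u w = (m + 14 - l) mod 14" for w m
  proof (rule W_kind[OF H that(1)])
    have "cls h w = (cls h u + (m + 14 - l) mod 14) mod 14" using dl_cls[OF H u that(1)] that(2) by simp
    also have "\<dots> = (cls h u + (m + 14 - l)) mod 14" by (simp add: mod_add_right_eq)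
    also have "cls h u + (m + 14 - l) = 2 * s + m + 14" using cu l2 by simp
    finally show "cls h w = (2 * s + m) mod 14" by simp
  qed
  show thesis
  proof (rule that[of l a])
    show "l = cls h u mod 2" by (rule l_def)
    show "C7 (a 0) (a 1) (a 2) (a 3) (a 4) (a 5) (a 6)" using hole_C7[OF H, of s] by (simp add: a_def)
    show "a k \<in> h ` {..<7}" for k by (auto simp: a_def)
    show "a (k + 7) = a k" for k by (simp add: a_def flip: add.assoc)
    fix w m assume w: "w \<in> hW h" "dl h u w = (m + 14 - l) mod 14"
    show "tA (a (m div 2)) (a (m div 2 + 1)) (a (m div 2 + 2)) (a (m div 2 + 3)) (a (m div 2 + 4)) (a (m div 2 + 5)) (a (m div 2 + 6)) w" if "even m"
      using kind_tA[OF H k[OF w] that] by (simp add: a_def add.assoc)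
    show "tB (a (m div 2)) (a (m div 2 + 1)) (a (m div 2 + 2)) (a (m div 2 + 3)) (a (m div 2 + 4)) (a (m div 2 + 5)) (a (m div 2 + 6)) w" if "odd m"
      using kind_tB[OF H k[OF w] that] by (simp add: a_def add.assoc)
  qed
qed

text \<open>The vertices relative to a frame: \<open>rA j\<close> and \<open>rB j\<close> are the vertices of class \<open>2 * j\<close> and \<open>2 * j + 1\<close>, counted from \<open>u\<close> or its predecessor.\<close>

lemma frame':
  assumes H: "hole h" and u: "u \<in> hW h"
  obtains a b c d e f g l where "l = cls h u mod 2" "C7 a b c d e f g" "{a, b, c, d, e, f, g} \<subseteq> h ` {..<7}"
    "!!w. w \<in> hW h ==> dl h u w = (14 - l) mod 14 ==> tA a b c d e f g w"
    "!!w. w \<in> hW h ==> dl h u w = 1 - l ==> tB a b c d e f g w"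
    "!!w. w \<in> hW h ==> dl h u w = 2 - l ==> tA b c d e f g a w"
    "!!w. w \<in> hW h ==> dl h u w = 3 - l ==> tB b c d e f g a w"
    "!!w. w \<in> hW h ==> dl h u w = 4 - l ==> tA c d e f g a b w"
    "!!w. w \<in> hW h ==> dl h u w = 5 - l ==> tB c d e f g a b w"
    "!!w. w \<in> hW h ==> dl h u w = 6 - l ==> tA d e f g a b c w"
    "!!w. w \<in> hW h ==> dl h u w = 7 - l ==> tB d e f g a b c w"
    "!!w. w \<in> hW h ==> dl h u w = 8 - l ==> tA e f g a b c d w"
    "!!w. w \<in> hW h ==> dl h u w = 10 - l ==> tA f g a b c d e w"
    "!!w. w \<in> hW h ==> dl h u w = 11 - l ==> tB f g a b c d e w"
    "!!w. w \<in> hW h ==> dl h u w = 12 - l ==> tA g a b c d e f w"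
proof -
  obtain a l where l: "l = cls h u mod 2" and C: "C7 (a 0) (a 1) (a 2) (a 3) (a 4) (a 5) (a 6)"
    and p: "!!k. a (k + 7) = (a k :: 'a)"
    and im: "!!k. a k \<in> h ` {..<7}"
    and A: "!!w m. [|w \<in> hW h; dl h u w = (m + 14 - l) mod 14; even m|] ==>
       tA (a (m div 2)) (a (m div 2 + 1)) (a (m div 2 + 2)) (a (m div 2 + 3)) (a (m div 2 + 4)) (a (m div 2 + 5)) (a (m div 2 + 6)) w"
    and B: "!!w m. [|w \<in> hW h; dl h u w = (m + 14 - l) mod 14; odd m|] ==>
       tB (a (m div 2)) (a (m div 2 + 1)) (a (m div 2 + 2)) (a (m div 2 + 3)) (a (m div 2 + 4)) (a (m div 2 + 5)) (a (m div 2 + 6)) w"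
    by (rule frame[OF H u], rule that) assumption+
  have q: "a 7 = a 0" "a 8 = a 1" "a 9 = a 2" "a 10 = a 3" "a 11 = a 4" "a 12 = a 5"
    using p[of 0] p[of 1] p[of 2] p[of 3] p[of 4] p[of 5] by simp_all
  have l01: "l = 0 | l = 1" using l by auto
  show thesis
    by (rule that[of l "a 0" "a 1" "a 2" "a 3" "a 4" "a 5" "a 6"]; (rule l C)?)
      (use A[of _ 0] B[of _ 1] A[of _ 2] B[of _ 3] A[of _ 4] B[of _ 5] A[of _ 6] B[of _ 7] A[of _ 8] A[of _ 10] B[of _ 11] A[of _ 12]
        q l01 im in "auto simp: numeral_2_eq_2[symmetric]")
qed

lemma W_complete:
  assumes H: "hole h" and w: "u \<in> hW h" "w \<in> hW h" "u ~= w" "dl h u w <= 2"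
  shows "E u w"
proof (rule frame'[OF H w(1)])
  fix a b c d e f g l
  assume l: "l = cls h u mod 2" and C: "C7 a b c d e f g"
    and T: "!!w. w \<in> hW h ==> dl h u w = (14 - l) mod 14 ==> tA a b c d e f g w"
    "!!w. w \<in> hW h ==> dl h u w = 1 - l ==> tB a b c d e f g w"
    "!!w. w \<in> hW h ==> dl h u w = 2 - l ==> tA b c d e f g a w"
    "!!w. w \<in> hW h ==> dl h u w = 3 - l ==> tB b c d e f g a w"
  have u0: "dl h u u = 0" by (simp add: dl_def)
  have "l = 0 | l = 1" using l by auto
  moreover have "dl h u w = 0 | dl h u w = 1 | dl h u w = 2" using w by auto
  ultimately show ?thesis
    using T[of u] T[of w] w u0 AA0[OF C, of u w] AB0[OF C, of u w] AA1[OF C, of u w] BB0[OF C, of u w] BA1[OF C, of u w] BB1[OF C, of u w]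
    by auto
qed

lemma W_anticomplete1:
  assumes H: "hole h" and w: "u \<in> hW h" "w \<in> hW h" and d: "dl h u w \<in> {5, 6, 7} | dl h u w = 4 & odd (cls h u)"
  shows "~ E u w"
proof (rule frame'[OF H w(1)])
  fix a b c d e f g l
  assume l: "l = cls h u mod 2" and C: "C7 a b c d e f g"
    and T: "!!w. w \<in> hW h ==> dl h u w = (14 - l) mod 14 ==> tA a b c d e f g w"
    "!!w. w \<in> hW h ==> dl h u w = 1 - l ==> tB a b c d e f g w"
    and T': "!!w. w \<in> hW h ==> dl h u w = 5 - l ==> tB c d e f g a b w"
    "!!w. w \<in> hW h ==> dl h u w = 6 - l ==> tA d e f g a b c w"
    "!!w. w \<in> hW h ==> dl h u w = 7 - l ==> tB d e f g a b c w"
    "!!w. w \<in> hW h ==> dl h u w = 8 - l ==> tA e f g a b c d w"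
  have u0: "dl h u u = 0" by (simp add: dl_def)
  have l01: "l = 0 | l = 1" using l by auto
  hence "dl h u w = 5 | dl h u w = 6 | dl h u w = 7 | dl h u w = 4 & l = 1" using d l by auto
  thus ?thesis
    using l01 T[of u] T'[of w] w u0 AB2[OF C, of u w] AA3[OF C, of u w] AB3[OF C, of u w] BB2[OF C, of u w] BA3[OF C, of u w]
      BB3[OF C, of u w] BA4[OF C, of u w]
    by auto
qed

lemma W_anticomplete:
  assumes H: "hole h" and w: "u \<in> hW h" "w \<in> hW h" "E u w"
  shows "dl h u w <= 4 | dl h u w \<ge> 10" "dl h u w = 4 ==> even (cls h u)" "dl h u w = 10 ==> even (cls h u)"
proof -
  have r: "dl h w u = (14 - dl h u w) mod 14" using dl_rev[OF H] w by blast
  have lt: "dl h u w < 14" using dl_cls[OF H] w by blast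
  have e: "E w u" using w E_sym by blast
  have "dl h u w \<notin> {5,6,7}" using W_anticomplete1[OF H] w by blast
  moreover have "dl h w u \<notin> {5,6,7}" using W_anticomplete1[OF H] w e by blast
  ultimately show "dl h u w <= 4 | dl h u w \<ge> 10" using r lt by (cases "dl h u w = 0") auto
  show "dl h u w = 4 ==> even (cls h u)" using W_anticomplete1[OF H] w by blast
  assume d: "dl h u w = 10"
  hence "dl h w u = 4" using r by simp
  hence "even (cls h w)" using W_anticomplete1[OF H] w e by blast
  moreover have "cls h w = (cls h u + 10) mod 14" using dl_cls[OF H w(1,2)] d by simp
  ultimately show "even (cls h u)" by (simp add: dvd_mod_iff)
qed

context
  fixes h
  assumes H: "hole h"
begin

lemma dl_self [simp]: "dl h u u = 0"
  by (simp add: dl_def)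

text \<open>The conclusion of \<open>frame'\<close> as a predicate, so that it can be split by the
  parity of \<open>cls h u\<close> in each application.\<close>

definition fr :: "'a => 'a => 'a => 'a => 'a => 'a => 'a => 'a => bool" where
  "fr a b c d e f g u <-> C7 a b c d e f g & {a, b, c, d, e, f, g} \<subseteq> h ` {..<7} &
    (\<forall>w\<in>hW h.
      (dl h u w = (14 - cls h u mod 2) mod 14 --> tA a b c d e f g w) &
      (dl h u w = 1 - cls h u mod 2 --> tB a b c d e f g w) &
      (dl h u w = 3 - cls h u mod 2 --> tB b c d e f g a w) &
      (dl h u w = 4 - cls h u mod 2 --> tA c d e f g a b w) &
      (dl h u w = 5 - cls h u mod 2 --> tB c d e f g a b w) &
      (dl h u w = 6 - cls h u mod 2 --> tA d e f g a b c w) &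
      (dl h u w = 7 - cls h u mod 2 --> tB d e f g a b c w) &
      (dl h u w = 10 - cls h u mod 2 --> tA f g a b c d e w) &
      (dl h u w = 11 - cls h u mod 2 --> tB f g a b c d e w) &
      (dl h u w = 12 - cls h u mod 2 --> tA g a b c d e f w))"

lemma fr_ex: "u \<in> hW h ==> \<exists>a b c d e f g. fr a b c d e f g u"
  unfolding fr_def by (rule frame'[OF H, of u], assumption) (intro exI conjI ballI impI; simp)

lemma fr_C7: "fr a b c d e f g u ==> C7 a b c d e f g"
  by (simp add: fr_def)

lemma fr_im: "fr a b c d e f g u ==> {a, b, c, d, e, f, g} \<subseteq> h ` {..<7}"
  by (simp add: fr_def)

lemma fr_even:
  assumes "fr a b c d e f g u" "even (cls h u)" "w \<in> hW h"
  shows "dl h u w = 0 ==> tA a b c d e f g w" "dl h u w = 1 ==> tB a b c d e f g w"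
    "dl h u w = 3 ==> tB b c d e f g a w" "dl h u w = 4 ==> tA c d e f g a b w"
    "dl h u w = 6 ==> tA d e f g a b c w" "dl h u w = 7 ==> tB d e f g a b c w"
    "dl h u w = 10 ==> tA f g a b c d e w" "dl h u w = 11 ==> tB f g a b c d e w"
  using assms by (auto simp: fr_def even_iff_mod_2_eq_zero)

lemma fr_odd:
  assumes "fr a b c d e f g u" "odd (cls h u)" "w \<in> hW h"
  shows "dl h u w = 0 ==> tB a b c d e f g w" "dl h u w = 3 ==> tA c d e f g a b w" "dl h u w = 4 ==> tB c d e f g a b w"
    "dl h u w = 6 ==> tB d e f g a b c w" "dl h u w = 11 ==> tA g a b c d e f w"
  using assms by (auto simp: fr_def odd_iff_mod_2_eq_one)

text \<open>At distances 3 and 4 the classes do not decide adjacency. These are the two situations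
  in which the interval property of arcs between different classes needs more than
  \<open>W_complete\<close>.\<close>

lemma W_umbrella:
  assumes "u \<in> hW h" "w \<in> hW h" "x \<in> hW h" "E u w" "dl h u w = 4"
  shows "dl h u x = 1 ==> E x w" "dl h u x = 3 ==> E u x"
proof -
  have ev: "even (cls h u)" using W_anticomplete[OF H] assms by blast
  obtain a b c d e f g where F: "fr a b c d e f g u" using fr_ex[OF assms(1)] by blast
  note Fe = fr_even[OF F ev]
  note tu = Fe(1)[OF assms(1) dl_self] and tw = Fe(4)[OF assms(2,5)]
  show "E x w" if "dl h u x = 1" using AA2_B0[OF fr_C7[OF F] tu tw assms(4) Fe(2)[OF assms(3) that]] .
  assume x: "dl h u x = 3"
  have "4 = (3 + dl h x w) mod 14" using dl_add[OF H assms(1,3,2)] x assms(5) by simp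
  hence "dl h x w = 1" using dl_cls(2)[OF H assms(3,2)] by presburger
  hence "E x w" using W_complete[OF H assms(3,2)] by (cases "x = w") auto
  thus "E u x" using AA2_B1[OF fr_C7[OF F] tu tw assms(4) Fe(3)[OF assms(3) x]] E_sym by blast
qed

text \<open>A vertex cannot surpass another one of its class in both directions at once. This is
  what makes a consistent order inside a class possible.\<close>

lemma W_conflict:
  assumes "u \<in> hW h" "u' \<in> hW h" "w \<in> hW h" "z \<in> hW h" "dl h u u' = 0" "dl h u w \<in> {3, 4}" "dl h u z \<in> {10, 11}"
    "E u w" "E u z" "~ E u' w" "~ E u' z"
  shows False
proof -
  obtain a b c d e f g where F: "fr a b c d e f g u" using fr_ex[OF assms(1)] by blast
  have "dl h u z = (dl h u w + dl h w z) mod 14" by (rule dl_add[OF H assms(1,3,4)])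
  hence "dl h w z = 6 | dl h w z = 7 | dl h w z = 8"
    using dl_cls(2)[OF H assms(3,4)] assms(6,7) by (elim insertE emptyE) (simp; presburger)+
  hence nwz: "~ E w z" using W_anticomplete(1)[OF H assms(3,4)] by auto
  show False
  proof (cases "even (cls h u)")
    case True
    note Fe = fr_even[OF F True]
    show False using conflict_A[OF fr_C7[OF F] Fe(1)[OF assms(1) dl_self] _ _ assms(8,9) nwz]
        Fe(3,4)[OF assms(3)] Fe(7,8)[OF assms(4)] assms(6,7) by blast
  next
    case False
    note Fo = fr_odd[OF F False]
    have "dl h u w = 3" "dl h u z = 11"
      using W_anticomplete(2)[OF H assms(1,3)] W_anticomplete(3)[OF H assms(1,4)] assms False by auto
    thus False using conflict_B[OF fr_C7[OF F] Fo(1)[OF assms(2,5)] Fo(2)[OF assms(3)] Fo(5)[OF assms(4)] assms(10,11) nwz] by blast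
  qed
qed

text \<open>Private neighbours in nearby classes would close a 4-cycle, so within a class the
  neighbourhoods in one direction form a chain.\<close>

lemma W_nested:
  assumes "u \<in> hW h" "u' \<in> hW h" "w \<in> hW h" "w' \<in> hW h" "dl h u u' = 0" "dl h w w' <= 2 | dl h w' w <= 2"
    "E u w" "E u' w'" "~ E u' w" "~ E u w'" "u ~= w'" "u' ~= w"
  shows False
proof -
  have "E u u'" using W_complete[OF H assms(1,2)] assms by (cases "u = u'") auto
  moreover have "E w w'" using W_complete[OF H assms(3,4)] W_complete[OF H assms(4,3)] assms(6-) E_sym by (cases "w = w'") auto
  ultimately show False using no_C4[of u w w' u'] assms E_comm by metis
qed

lemma W_BB6:
  assumes "u \<in> hW h" "w \<in> hW h" "odd (cls h u)" "dl h u w = 6"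
  shows False
proof -
  obtain a b c d e f g where F: "fr a b c d e f g u" using fr_ex[OF assms(1)] by blast
  show False using BB3[OF fr_C7[OF F] fr_odd(1)[OF F assms(3,1) dl_self] fr_odd(4)[OF F assms(3,2,4)]] .
qed

lemma W_stable_pattern:
  assumes "u \<in> hW h" "u1 \<in> hW h" "u2 \<in> hW h" "u3 \<in> hW h" "even (cls h u)"
    "dl h u u1 = 3" "dl h u u2 = 6 | dl h u u2 = 7" "dl h u u3 = 10"
    "~ E u u1" "~ E u u2" "~ E u u3" "~ E u1 u2" "~ E u1 u3" "~ E u2 u3"
  shows False
proof -
  obtain a b c d e f g where F: "fr a b c d e f g u" using fr_ex[OF assms(1)] by blast
  note Fe = fr_even[OF F assms(5)]
  show False
    using stable4[OF fr_C7[OF F] Fe(1)[OF assms(1) dl_self] Fe(3)[OF assms(2,6)] _ Fe(7)[OF assms(4,8)] assms(9-14)]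
      Fe(5,6)[OF assms(3)] assms(7) by blast
qed

text \<open>By \<open>W_complete\<close> the four cyclic class distances are at least 3, and they
  add up to 14. So they are three 3s and one 5, or two 3s and two 4s, and the rest is a finite check
  with parities.\<close>

lemma W_stable_sorted:
  assumes W: "u0 \<in> hW h" "u1 \<in> hW h" "u2 \<in> hW h" "u3 \<in> hW h"
    and s: "~ E u0 u1" "~ E u0 u2" "~ E u0 u3" "~ E u1 u2" "~ E u1 u3" "~ E u2 u3"
    and d: "distinct [u0, u1, u2, u3]" and o: "cls h u0 <= cls h u1" "cls h u1 <= cls h u2" "cls h u2 <= cls h u3"
  shows False
proof -
  have lt: "cls h u3 < 14" using cls_kind[OF H W(4)] by blast
  have gap: "3 <= dl h x y" if "x \<in> hW h" "y \<in> hW h" "~ E x y" "x ~= y" for x y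
    using W_complete[OF H that(1,2)] that by (cases "dl h x y <= 2") auto
  define p q r where "p = cls h u1 - cls h u0" and "q = cls h u2 - cls h u1" and "r = cls h u3 - cls h u2"
  define c where "c = cls h u0"
  have c: "cls h u0 = c" "cls h u1 = c + p" "cls h u2 = c + p + q" "cls h u3 = c + p + q + r"
    using o by (auto simp: p_def q_def r_def c_def)
  have lt': "c + p + q + r < 14" using lt c by simp
  have D: "dl h u0 u1 = p" "dl h u1 u2 = q" "dl h u2 u3 = r" "dl h u3 u0 = (14 - p - q - r) mod 14"
    "dl h u0 u2 = p + q" "dl h u0 u3 = p + q + r" "dl h u1 u3 = q + r" "dl h u1 u0 = (14 - p) mod 14"
    "dl h u2 u0 = (14 - p - q) mod 14" "dl h u2 u1 = (14 - q) mod 14" "dl h u3 u1 = (14 - q - r) mod 14" "dl h u3 u2 = (14 - r) mod 14"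
    unfolding dl_def c using lt' by (auto simp: le_mod_geq add.assoc)
  have "3 <= p" "3 <= q" "3 <= r" using gap[of u0 u1] gap[of u1 u2] gap[of u2 u3] D W s d by auto
  moreover have "3 <= (14 - p - q - r) mod 14" using gap[of u3 u0] D W s d E_comm by auto
  moreover have "(14 - p - q - r) mod 14 = 14 - p - q - r" using calculation by auto
  ultimately have g: "3 <= p" "3 <= q" "3 <= r" "p + q + r <= 11" by auto
  have s': "~ E u1 u0" "~ E u2 u0" "~ E u3 u0" "~ E u2 u1" "~ E u3 u1" "~ E u3 u2" using s E_comm by auto
  have D': "dl h u3 u0 = 14 - (p + q + r)" "dl h u1 u0 = 14 - p" "dl h u2 u0 = 14 - (p + q)"
    "dl h u2 u1 = 14 - q" "dl h u3 u1 = 14 - (q + r)" "dl h u3 u2 = 14 - r" using D g by auto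
  \<comment> \<open>\<open>S0\<close> to \<open>S3\<close> are the rotations of
    \<open>W_stable_pattern\<close>; \<open>B0\<close> to \<open>B3\<close> treat the pairs
    \<open>u0\<close>, \<open>u2\<close> and \<open>u1\<close>, \<open>u3\<close>, read in both
    directions, as odd classes at distance 6.\<close>
  have S0: "~ (even c & p = 3 & (q = 3 | q = 4) & p + q + r = 10)"
  proof
    assume a: "even c & p = 3 & (q = 3 | q = 4) & p + q + r = 10"
    show False
    proof (rule W_stable_pattern[of u0 u1 u2 u3])
      show "even (cls h u0)" using a unfolding c by blast
      show "dl h u0 u1 = 3" unfolding D D' using a by auto
      show "dl h u0 u2 = 6 | dl h u0 u2 = 7" unfolding D D' using a by auto
      show "dl h u0 u3 = 10" unfolding D D' using a by auto
    qed (use W s s' in blast)+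
  qed
  have S1: "~ (even (c + p) & q = 3 & (r = 3 | r = 4) & p = 4)"
  proof
    assume a: "even (c + p) & q = 3 & (r = 3 | r = 4) & p = 4"
    show False
    proof (rule W_stable_pattern[of u1 u2 u3 u0])
      show "even (cls h u1)" using a unfolding c by blast
      show "dl h u1 u2 = 3" unfolding D D' using a by auto
      show "dl h u1 u3 = 6 | dl h u1 u3 = 7" unfolding D D' using a by auto
      show "dl h u1 u0 = 10" unfolding D D' using a by auto
    qed (use W s s' in blast)+
  qed
  have S2: "~ (even (c + p + q) & r = 3 & (p + q + r = 10 | p + q + r = 11) & q = 4)"
  proof
    assume a: "even (c + p + q) & r = 3 & (p + q + r = 10 | p + q + r = 11) & q = 4"
    show False
    proof (rule W_stable_pattern[of u2 u3 u0 u1])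
      show "even (cls h u2)" using a unfolding c by blast
      show "dl h u2 u3 = 3" unfolding D D' using a by auto
      show "dl h u2 u0 = 6 | dl h u2 u0 = 7" unfolding D D' using a by auto
      show "dl h u2 u1 = 10" unfolding D D' using a by auto
    qed (use W s s' in blast)+
  qed
  have S3: "~ (even (c + p + q + r) & p + q + r = 11 & (p = 3 | p = 4) & r = 4)"
  proof
    assume a: "even (c + p + q + r) & p + q + r = 11 & (p = 3 | p = 4) & r = 4"
    show False
    proof (rule W_stable_pattern[of u3 u0 u1 u2])
      show "even (cls h u3)" using a unfolding c by blast
      show "dl h u3 u0 = 3" unfolding D D' using a by auto
      show "dl h u3 u1 = 6 | dl h u3 u1 = 7" unfolding D D' using a by auto
      show "dl h u3 u2 = 10" unfolding D D' using a by auto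
    qed (use W s s' in blast)+
  qed
  have B0: "~ (odd c & p + q = 6)"
  proof
    assume a: "odd c & p + q = 6"
    show False
    proof (rule W_BB6[of u0 u2])
      show "odd (cls h u0)" using a unfolding c by blast
      show "dl h u0 u2 = 6" unfolding D D' using a by auto
    qed (use W in blast)+
  qed
  have B1: "~ (odd (c + p) & q + r = 6)"
  proof
    assume a: "odd (c + p) & q + r = 6"
    show False
    proof (rule W_BB6[of u1 u3])
      show "odd (cls h u1)" using a unfolding c by blast
      show "dl h u1 u3 = 6" unfolding D D' using a by auto
    qed (use W in blast)+
  qed
  have B2: "~ (odd (c + p + q) & p + q = 8)"
  proof
    assume a: "odd (c + p + q) & p + q = 8"
    show False
    proof (rule W_BB6[of u2 u0])
      show "odd (cls h u2)" using a unfolding c by blast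
      show "dl h u2 u0 = 6" unfolding D D' using a by auto
    qed (use W in blast)+
  qed
  have B3: "~ (odd (c + p + q + r) & q + r = 8)"
  proof
    assume a: "odd (c + p + q + r) & q + r = 8"
    show False
    proof (rule W_BB6[of u3 u1])
      show "odd (cls h u3)" using a unfolding c by blast
      show "dl h u3 u1 = 6" unfolding D D' using a by auto
    qed (use W in blast)+
  qed
  from g have "p = 3 | p = 4 | p = 5" "q = 3 | q = 4 | q = 5" "r = 3 | r = 4 | r = 5" by auto
  thus False using g S0 S1 S2 S3 B0 B1 B2 B3 by (elim disjE) auto
qed

lemma W_stable:
  assumes T: "T \<subseteq> hW h" "finite T" "!!x y. x \<in> T ==> y \<in> T ==> ~ E x y"
  shows "card T <= 3"
proof (rule ccontr)
  assume "~ ?thesis"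
  then obtain T' where T': "T' \<subseteq> T" "card T' = 4" using obtain_subset_with_card_n[of 4 T] by auto
  have fT': "finite T'" using T' T finite_subset by blast
  define xs where "xs = sorted_key_list_of_set (cls h) T'"
  obtain xs where xs: "set xs = T'" "distinct xs" "sorted (map (cls h) xs)"
  proof -
    obtain ys where "set ys = T'" "distinct ys" using finite_distinct_list[OF fT'] by blast
    thus thesis using that[of "sort_key (cls h) ys"] by auto
  qed
  have "length xs = 4" using xs T' distinct_card by fastforce
  then obtain u0 u1 u2 u3 where u: "xs = [u0, u1, u2, u3]" by (auto simp: length_Suc_conv numeral_eq_Suc)
  show False
    by (rule W_stable_sorted[of u0 u1 u2 u3]) (use xs u T T' in auto)
qed

text \<open>Both vertices see two non-adjacent vertices of the hole, so without an edge between them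
  there would be an induced 4-cycle.\<close>

lemma U_complete: "[|u \<in> hU h; w \<in> hU h \<union> hW h; u ~= w|] ==> E u w"
proof -
  assume u: "u \<in> hU h" and w: "w \<in> hU h \<union> hW h" "u ~= w"
  have Eu: "E u (h i)" if U: "u \<in> hU h" "i < 7" for u i
  proof (rule ccontr)
    assume n: "~ E u (h i)"
    have cu: "!!j. cn h u j" using U cn_mod[of h u] by (auto simp: hU_def)
    hence "u = h i" using n U cu[of i] by (auto simp: cn_def)
    moreover have "cn h u (i + 2)" using cu by blast
    ultimately show False using hole_C7[OF H, of i] U by (auto simp: cn_def C7_def)
  qed
  show "E u w"
  proof (cases "w \<in> hU h")
    case True
    have "E (h 0) (h 1)" "~ E (h 0) (h 2)" "E (h 1) (h 2)" using H by (auto simp: hole_def C7_def)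
    moreover have "h 0 ~= h 2" using H E_irrefl by (auto simp: hole_def C7_def)
    ultimately show ?thesis using no_C4[of u "h 0" w "h 2"] Eu[OF u, of 0] Eu[OF u, of 2] Eu[OF True, of 0] Eu[OF True, of 2] w E_comm by auto
  next
    case False
    hence wW: "w \<in> hW h" using w by blast
    obtain a b c d e f g where F: "fr a b c d e f g w" using fr_ex[OF wW] by blast
    have "E w a & E w c" using fr_even(1)[OF F _ wW] fr_odd(1)[OF F _ wW] by (cases "even (cls h w)") (auto simp: tA_def tB_def)
    moreover have "E u a" "E u c" using fr_im[OF F] Eu[OF u] by auto
    ultimately show "E u w" using no_C4[of u a w c] fr_C7[OF F] w by (auto simp: C7_def E_comm)
  qed
qed

section \<open>Components that miss the hole\<close>

lemma hZ_hole: "y \<in> hZ h ==> x \<in> h ` {..<7} ==> ~ E y x"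
  by (auto simp: hZ_def cn_def)

lemma hZ_neq: "y \<in> hZ h ==> x \<in> h ` {..<7} ==> y ~= x"
  by (auto simp: hZ_def cn_def)

text \<open>With a window of only three, \<open>y\<close>, \<open>w\<close> and the five hole
  vertices from the end of the window onwards form an induced path on seven vertices.\<close>

lemma hang_odd:
  assumes w: "w \<in> hW h" "y \<in> hZ h" "E y w"
  shows "odd (cls h w)"
proof
  assume ev: "even (cls h w)"
  obtain a b c d e f g where F: "fr a b c d e f g w" using fr_ex[OF w(1)] by blast
  show False using hang_A[OF fr_C7[OF F] fr_even(1)[OF F ev w(1) dl_self] w(3)] fr_im[OF F] hZ_hole[OF w(2)] by simp
qed

text \<open>The two windows share the hole vertex \<open>c\<close>. With it a short path through
  \<open>Y\<close> closes to a 4- or 5-cycle; a longer one gives an induced path on seven vertices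
  around the other side of the hole.\<close>

lemma hang_aux:
  assumes Y: "conn Y" "Y \<subseteq> hZ h" and w: "w \<in> hW h" "w' \<in> hW h" "y \<in> Y" "E w y" "y' \<in> Y" "E w' y'"
    and d: "dl h w w' = 4" "odd (cls h w)"
  shows "E w w'"
proof (rule ccontr)
  assume n: "~ ?thesis"
  have "w ~= w'" using d by auto
  obtain k0 f0 where "walk Y w {w'} k0 f0" using conn_walk[OF Y(1) w(3,4,5), of w' "{w'}"] w(6) E_sym by blast
  then obtain k f where wk: "walk Y w {w'} k f"
    and na: "!!i j. i + 1 < j ==> j <= k ==> ~ E (f i) (f j)" using shortest_walk by metis
  have f0: "f 0 = w" and fk: "f k = w'" and st: "!!i. i < k ==> E (f i) (f (Suc i))"
    and inn: "!!i. 0 < i ==> i < k ==> f i \<in> Y" using wk by (auto simp: walk_def)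
  have k0: "k ~= 0" using f0 fk \<open>w ~= w'\<close> by metis
  have k1: "k ~= 1" using f0 fk n st[of 0] by auto
  obtain a b c d' e f' g where F: "fr a b c d' e f' g w" using fr_ex[OF w(1)] by blast
  note C = fr_C7[OF F] and im = fr_im[OF F] and tw = fr_odd(1)[OF F d(2) w(1) dl_self] and tw' = fr_odd(3)[OF F d(2) w(2) d(1)]
    have nf: "~ E (f i) x" "f i ~= c" if "0 < i" "i < k" "x \<in> {a, b, c, d', e, f', g}" for i x
      using inn[OF that(1,2)] Y(2) hZ_hole[of "f i" x] hZ_neq[of "f i" c] im that(3) by auto
    have nc: "c ~= f i" if "0 < i" "i < k" for i using nf(2)[OF that, of a] by auto
    consider "k = 2" | "k = 3" | "k \<ge> 4" using k0 k1 by linarith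
    thus False
    proof cases
      case 1
      hence "E w (f 1)" "E (f 1) w'" using st[of 0] st[of 1] f0 fk by (auto simp: numeral_2_eq_2)
      thus False using no_C4[of w "f 1" w' c] tw tw' nf(1)[of 1 c] nc[of 1] 1 n \<open>w ~= w'\<close> by (auto simp: tB_def E_comm)
    next
      case 2
      hence "E w (f 1)" "E (f 1) (f 2)" "E (f 2) w'" "~ E w (f 2)" "~ E (f 1) w'"
        using st[of 0] st[of 1] st[of 2] na[of 0 2] na[of 1 3] f0 fk by (auto simp: eval_nat_numeral)
      thus False using no_C5[of w "f 1" "f 2" w' c] tw tw' nf(1)[of 1 c] nf(1)[of 2 c] 2 n by (auto simp: tB_def E_comm)
    next
      case 3
      hence "E w (f 1)" "E (f (k - 1)) w'" "~ E w (f (k - 1))" "~ E (f 1) w'" "~ E (f 1) (f (k - 1))"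
        using st[of 0] st[of "k - 1"] na[of 0 "k - 1"] na[of 1 k] na[of 1 "k - 1"] f0 fk by auto
      thus False
        using no_P7[of "f 1" w a g f' w' "f (k - 1)"] tw tw' C n nf(1)[of 1] nf(1)[of "k - 1"] 3
        by (auto simp: tB_def E_comm C7_def)
    qed
qed

text \<open>Both classes are odd, so their distance is even. Distances up to 2 are settled by
  \<open>W_complete\<close> and distance 4 by \<open>hang_aux\<close>, while distance 6 does not
  occur by \<open>W_BB6\<close>.\<close>

lemma hang_clique:
  assumes Y: "conn Y" "Y \<subseteq> hZ h" and w: "w \<in> hW h" "w' \<in> hW h" "y \<in> Y" "E w y" "y' \<in> Y" "E w' y'" "w ~= w'"
  shows "E w w'"
proof -
  have o: "odd (cls h w)" "odd (cls h w')" using hang_odd w Y E_sym by blast+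
  have r: "dl h w' w = (14 - dl h w w') mod 14" using dl_rev[OF H] w by blast
  have lt: "dl h w w' < 14" "cls h w' = (cls h w + dl h w w') mod 14" using dl_cls[OF H w(1,2)] by auto
  have "even (dl h w w')" using o lt(2) by (metis dvd_mod_iff even_add even_numeral dvd_trans)
  then obtain m where m: "dl h w w' = 2 * m" by (elim evenE)
  hence "m = 0 | m = 1 | m = 2 | m = 3 | m = 4 | m = 5 | m = 6" using lt by linarith
  hence "dl h w w' <= 2 | dl h w' w <= 2 | dl h w w' = 4 | dl h w' w = 4 | dl h w w' = 6 | dl h w' w = 6"
    using r m by (elim disjE) auto
  then consider "dl h w w' <= 2" | "dl h w' w <= 2" | "dl h w w' = 4" | "dl h w' w = 4" | "dl h w w' = 6" | "dl h w' w = 6"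
    by blast
  thus ?thesis
  proof cases
    case 1 thus ?thesis using W_complete[OF H] w by blast
  next
    case 2 thus ?thesis using W_complete[OF H w(2,1)] w E_sym by metis
  next
    case 3 thus ?thesis using hang_aux[OF Y w(1-6)] o by blast
  next
    case 4 thus ?thesis using hang_aux[OF Y w(2,1,5,6,3,4)] o E_sym by blast
  next
    case 5 thus ?thesis using W_BB6 w o by blast
  next
    case 6 thus ?thesis using W_BB6 w o by blast
  qed
qed

end

end

section \<open>Circular arcs\<close>

text \<open>Colouring a proper circular arc graph. The vertices are the residues of \<open>0, 1, \<dots>\<close> modulo \<open>N\<close> in circular order and
  \<open>r i\<close> is the last vertex that is adjacent to \<open>i\<close> in clockwise direction. Inserting \<open>g i\<close> dummy vertices behind vertex \<open>i\<close>, greedily as long as no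
  clique window gets more than \<open>k\<close> positions, yields \<open>3 * k\<close> positions, which are coloured periodically.\<close>

locale arc_gaps =
  fixes N k :: nat and r :: "nat => nat" and D :: "nat => nat => nat" and g rem :: "nat => nat" and cov :: "nat => nat => bool"
  assumes N: "0 < N"
    and r_gt: "i < r i" and r_mono: "i <= j ==> r i <= r j" and r_per: "r (i + N) = r i + N"
    \<comment> \<open>\<open>r5\<close> is the trace of the forbidden cycles: five arcs in a row do
      not get around the circle. In \<open>rem_zero\<close> it keeps three disjoint full windows
      within one turn.\<close>
    and r_k: "r i + 1 <= i + k" and r5: "r (r (r (r (r i)))) < i + N" and N3k: "N <= 3 * k"
    and cov: "[|s < N; i < N|] ==> cov s i <-> s <= i & i < r s | i + N < r s"
    \<comment> \<open>\<open>D i s\<close> is the number of positions from vertex \<open>s\<close>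
      to vertex \<open>r s\<close> once the first \<open>i\<close> gaps are filled; a window with
      value \<open>k - 1\<close> therefore occupies \<open>k\<close> positions and admits no further
      dummy.\<close>
    and D0: "s < N ==> D 0 s = r s - s" and rem0: "rem 0 = 3 * k - N"
    and gi: "i < N ==> \<exists>mx. (\<forall>s<N. cov s i --> D i s <= mx) & (\<exists>s<N. cov s i & D i s = mx) & g i = min (rem i) (k - 1 - mx)"
    and DS: "[|i < N; s < N|] ==> D (Suc i) s = D i s + (if cov s i then g i else 0)"
    and remS: "i < N ==> rem (Suc i) = rem i - g i"
begin

lemma rN: "r i < i + N"
proof -
  have "r i <= r (r (r (r (r i))))" using r_gt by (meson less_imp_le order_trans)
  thus ?thesis using r5[of i] by simp
qed

lemma D_le: "[|i <= N; s < N|] ==> D i s <= k - 1"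
proof (induction i)
  case 0
  thus ?case using D0[of s] r_k[of s] by simp
next
  case (Suc i)
  then obtain mx where "\<forall>s<N. cov s i --> D i s <= mx" "\<exists>s<N. cov s i & D i s = mx" "g i = min (rem i) (k - 1 - mx)"
    using gi[of i] by auto
  moreover from this have "mx <= k - 1 | k - 1 <= mx & g i = 0" by auto
  ultimately show ?case using Suc DS[of i s] by auto
qed

lemma D_mono: "[|i <= j; j <= N; s < N|] ==> D i s <= D j s"
  by (induction j) (auto simp: le_Suc_eq DS)

lemma g_le: "i < N ==> g i <= rem i"
  using gi[of i] by auto

lemma rem_eq: "i <= N ==> rem i + (\<Sum>j<i. g j) = 3 * k - N"
  by (induction i) (use rem0 remS g_le in "auto simp: less_eq_Suc_le")

lemma rem_mono: "[|i <= j; j <= N|] ==> rem j <= rem i"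
  by (induction j) (auto simp: le_Suc_eq remS)

lemma D_eq: "[|i <= N; s < N|] ==> D i s = (r s - s) + (\<Sum>j | j < i & cov s j. g j)"
proof (induction i)
  case 0
  thus ?case using D0 by simp
next
  case (Suc i)
  have "{j. j < Suc i & cov s j} = (if cov s i then insert i {j. j < i & cov s j} else {j. j < i & cov s j})"
    by (auto simp: less_Suc_eq)
  thus ?case using Suc DS[of i s] by simp
qed

text \<open>The final position of vertex \<open>i\<close>, continued periodically to the unrolled
  circle.\<close>

definition PP :: "nat => nat" where "PP i = (\<Sum>j<i. 1 + g (j mod N))"

lemma PP_Suc: "PP (Suc i) = PP i + 1 + g (i mod N)"
  by (simp add: PP_def)

lemma PP_less: "i < j ==> PP i < PP j"
  by (induction j) (auto simp: PP_Suc less_Suc_eq)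

lemma PP_N: "PP N = 3 * k - rem N"
proof -
  have "PP N = (\<Sum>j<N. 1 + g j)" by (simp add: PP_def)
  also have "\<dots> = N + (\<Sum>j<N. g j)" by (simp add: sum_Suc)
  finally show ?thesis using rem_eq[of N] N3k by simp
qed

lemma PP_add: "PP (i + N) = PP i + PP N"
  by (induction i) (simp_all add: PP_def)

text \<open>The positions gained between \<open>s\<close> and \<open>r s\<close> are vertices and
  dummies; an arc is shorter than one turn by \<open>rN\<close>, so reduction modulo
  \<open>N\<close> counts no gap twice.\<close>

lemma PP_D:
  assumes s: "s < N"
  shows "PP (r s) = PP s + D N s"
proof -
  have "PP j = PP s + (\<Sum>i\<in>{s..<j}. 1 + g (i mod N))" if "s <= j" for j
    using that by (induction j) (auto simp: le_Suc_eq PP_Suc)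
  hence "PP (r s) = PP s + (\<Sum>i\<in>{s..<r s}. 1 + g (i mod N))" using r_gt less_imp_le by blast
  also have "(\<Sum>i\<in>{s..<r s}. 1 + g (i mod N)) = (r s - s) + (\<Sum>i\<in>{s..<r s}. g (i mod N))" by (simp add: sum_Suc)
  also have "(\<Sum>i\<in>{s..<r s}. g (i mod N)) = (\<Sum>j | j < N & cov s j. g j)"
  proof (rule sum.reindex_bij_betw[of "%i. i mod N" "{s..<r s}" "{j. j < N & cov s j}" g])
    show "bij_betw (%i. i mod N) {s..<r s} {j. j < N & cov s j}"
    proof (rule bij_betw_imageI)
      show "inj_on (%i. i mod N) {s..<r s}"
      proof (rule inj_onI)
        fix x y assume xy: "x \<in> {s..<r s}" "y \<in> {s..<r s}" "x mod N = y mod N"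
        show "x = y"
        proof (rule ccontr)
          assume "x ~= y"
          moreover have "u + N <= v" if "u < v" "u mod N = v mod N" for u v
          proof -
            have "N dvd v - u" using that mod_eq_dvd_iff_nat[of u v N] by simp
            thus ?thesis using that dvd_imp_le[of N "v - u"] by simp
          qed
          ultimately have "x + N <= y | y + N <= x" using xy(3) by (metis nat_neq_iff)
          thus False using xy rN[of s] by auto
        qed
      qed
      show "(%i. i mod N) ` {s..<r s} = {j. j < N & cov s j}"
      proof safe
        fix i assume i: "i \<in> {s..<r s}"
        show "i mod N < N" using N by simp
        show "cov s (i mod N)"
        proof (cases "i < N")
          case True thus ?thesis using cov[OF s] i by auto
        next
          case False
          hence "i mod N = i - N" using i rN[of s] s by (simp add: le_mod_geq)
          thus ?thesis using cov[OF s, of "i - N"] i rN[of s] s False by auto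
        qed
      next
        fix j assume j: "j < N" "cov s j"
        then consider "s <= j" "j < r s" | "j + N < r s" using cov[OF s] by blast
        thus "j \<in> (%i. i mod N) ` {s..<r s}"
          by cases (use j s in \<open>auto intro: image_eqI[of _ _ j] image_eqI[of _ _ "j + N"]\<close>)
      qed
    qed
  qed
  finally show ?thesis using D_eq[of N s] s by simp
qed

text \<open>If dummies were left over, every gap would have been stopped by a tight window, that is,
  one with exactly \<open>k\<close> positions. Moving around the circle by tight windows that reach
  farthest yields three disjoint ones, \<open>t0\<close>, \<open>t2\<close> and \<open>t4\<close>,
  within a single turn. They alone fill \<open>3 * k\<close> positions, which leaves nothing
  over.\<close>

lemma rem_zero: "rem N = 0"
proof (rule ccontr)
  assume "rem N ~= 0"
  hence rpos: "0 < rem N" by simp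
  define tight where "tight t <-> PP (r t) + 1 = PP t + k" for t
  have tN: "tight (t + N) = tight t" for t by (simp add: tight_def r_per PP_add)
  have eqN: "t + Suc q * N = (t + q * N) + N" for t q by simp
  have tqN: "tight (t + q * N) = tight t" for t q
    by (induction q) (simp, simp only: eqN tN)
  have rqN: "r (t + q * N) = r t + q * N" for t q
    by (induction q) (simp, simp only: eqN r_per)
  have k1: "1 <= k" using r_k[of 0] r_gt[of 0] by simp
  have tight0: "\<exists>s<N. cov s i & tight s" if i: "i < N" for i
  proof -
    obtain mx where mx: "\<forall>s<N. cov s i --> D i s <= mx" "g i = min (rem i) (k - 1 - mx)"
      and s: "\<exists>s<N. cov s i & D i s = mx" using gi[OF i] by blast
    then obtain s where s: "s < N" "cov s i" "D i s = mx" by blast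
    have "0 < rem (Suc i)" using rem_mono[of "Suc i" N] i rpos by simp
    hence "g i = k - 1 - mx" using mx remS[OF i] by auto
    hence "D (Suc i) s = k - 1" using DS[OF i s(1)] s D_le[of i s] i by simp
    hence "D N s = k - 1" using D_mono[of "Suc i" N s] D_le[of N s] i s by simp
    hence "tight s" using PP_D[OF s(1)] k1 by (simp add: tight_def)
    thus ?thesis using s by blast
  qed
  \<comment> \<open>From position \<open>N\<close> on there is room for a window that begins in the
    preceding turn.\<close>
  have cover: "\<exists>t. tight t & t <= i & i < r t" if "N <= i" for i
  proof -
    define q j where "q = i div N" and "j = i mod N"
    have ij: "i = j + q * N" and jN: "j < N" and q: "1 <= q" using that N by (auto simp: q_def j_def div_greater_zero_iff Suc_le_eq)
    obtain s where s: "s < N" "cov s j" "tight s" using tight0[OF jN] by blast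
    then consider "s <= j" "j < r s" | "j + N < r s" using cov[OF s(1) jN] by blast
    thus ?thesis
    proof cases
      case 1
      thus ?thesis using s tqN[of s q] rqN[of s q] ij by (intro exI[of _ "s + q * N"]) auto
    next
      case 2
      obtain q' where q': "q = Suc q'" using q by (cases q) auto
      thus ?thesis using 2 s tqN[of s q'] rqN[of s q'] ij by (intro exI[of _ "s + q' * N"]) auto
    qed
  qed
  have best: "\<exists>t. tight t & t <= i & i < r t & (\<forall>t'. tight t' & t' <= i & i < r t' --> r t' <= r t)" if "N <= i" for i
  proof -
    define S where "S = {t. tight t & t <= i & i < r t}"
    have fin: "finite S" unfolding S_def by (rule finite_subset[of _ "{..i}"]) auto
    moreover have "S ~= {}" using cover[OF that] by (auto simp: S_def)
    ultimately have "Max (r ` S) \<in> r ` S" by (intro Max_in) auto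
    then obtain t where "t \<in> S" "r t = Max (r ` S)" by auto
    moreover have "r t' <= Max (r ` S)" if "t' \<in> S" for t' using fin that by simp
    ultimately show ?thesis by (auto simp: S_def)
  qed
  obtain t0 where t0: "tight t0" "N <= t0"
  proof -
    obtain t where t: "tight t" using cover[of N] by blast
    show thesis by (rule that[of "t + N"]) (use t tN in auto)
  qed
  define e0 where "e0 = r t0"
  have e0: "t0 < e0" "N <= e0" using r_gt[of t0] t0 by (auto simp: e0_def)
  obtain t1 where t1: "t1 <= e0" "e0 < r t1" "!!t'. tight t' ==> t' <= e0 ==> e0 < r t' ==> r t' <= r t1" using best[OF e0(2)] by blast
  define e1 where "e1 = r t1"
  obtain t2 where t2: "tight t2" "t2 <= e1" "e1 < r t2" using best[of e1] e0 t1 by (auto simp: e1_def)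
  define e2 where "e2 = r t2"
  have e2: "N <= e2" using e0 t1 t2 by (auto simp: e1_def e2_def)
  obtain t3 where t3: "t3 <= e2" "e2 < r t3" "!!t'. tight t' ==> t' <= e2 ==> e2 < r t' ==> r t' <= r t3" using best[OF e2] by blast
  define e3 where "e3 = r t3"
  obtain t4 where t4: "tight t4" "t4 <= e3" "e3 < r t4" using cover[of e3] e2 t3 by (auto simp: e3_def)
  define e4 where "e4 = r t4"
  \<comment> \<open>A tight window \<open>t2\<close> starting at \<open>e0\<close> or before would
    contain \<open>e0\<close> and reach farther than \<open>t1\<close>, against the choice of
    \<open>t1\<close>.\<close>
  have d2: "e0 < t2" using t1(3)[OF t2(1)] t1(2) t2 by (force simp: e1_def)
  have d4: "e2 < t4" using t3(3)[OF t4(1)] t3(2) t4 by (force simp: e3_def)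
  have "e1 <= r e0" using r_mono[OF t1(1)] by (simp add: e1_def)
  moreover have "e2 <= r e1" using r_mono[OF t2(2)] by (simp add: e2_def)
  moreover have "e3 <= r e2" using r_mono[OF t3(1)] by (simp add: e3_def)
  moreover have "e4 <= r e3" using r_mono[OF t4(2)] by (simp add: e4_def)
  ultimately have "e4 <= r (r (r (r (r t0))))" unfolding e0_def by (meson order_trans r_mono)
  hence "e4 < t0 + N" using r5[of t0] by simp
  hence "PP e4 + 1 <= PP t0 + PP N" using PP_less[of e4 "t0 + N"] by (simp add: PP_add)
  moreover have "PP e4 + 1 = PP t4 + k" using t4 by (simp add: tight_def e4_def)
  moreover have "PP e2 + 1 <= PP t4" using PP_less[OF d4] by simp
  moreover have "PP e2 + 1 = PP t2 + k" using t2 by (simp add: tight_def e2_def)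
  moreover have "PP e0 + 1 <= PP t2" using PP_less[OF d2] by simp
  moreover have "PP e0 + 1 = PP t0 + k" using t0 by (simp add: tight_def e0_def)
  ultimately have "3 * k <= PP N" by linarith
  thus False using PP_N rpos rem_eq[of N] k1 by linarith
qed

text \<open>One turn has \<open>3 * k\<close> positions, a multiple of \<open>k\<close>, so residues
  modulo \<open>k\<close> are consistent around the circle; along an arc positions differ by at
  least 1 and at most \<open>k - 1\<close>.\<close>

lemma positions:
  assumes s: "s < N" and j: "s < j" "j <= r s"
  shows "PP s mod k ~= PP (j mod N) mod k"
proof -
  have k1: "1 <= k" using r_k[of 0] r_gt[of 0] by simp
  have PN: "PP N = 3 * k" using PP_N rem_zero by simp
  have "PP j mod k = PP (j mod N) mod k"
  proof (cases "j < N")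
    case False
    hence "j = (j mod N) + N" using j rN[of s] s by (simp add: le_mod_geq)
    hence "PP j = PP (j mod N) + 3 * k" using PP_add[of "j mod N"] PN by metis
    thus ?thesis by simp
  qed simp
  moreover have "PP j <= PP s + (k - 1)"
  proof -
    have "PP j <= PP (r s)" using PP_less[of j "r s"] j by (cases "j = r s") auto
    thus ?thesis using PP_D[OF s] D_le[of N s] s by simp
  qed
  moreover have "PP s < PP j" by (rule PP_less[OF j(1)])
  moreover have "PP s mod k ~= PP j mod k" if "PP s < PP j" "PP j <= PP s + (k - 1)"
  proof
    assume "PP s mod k = PP j mod k"
    hence "k dvd PP j - PP s" using that mod_eq_dvd_iff_nat[of "PP s" "PP j" k] by (metis less_imp_le mod_eq_dvd_iff_nat)
    moreover have "0 < PP j - PP s" "PP j - PP s < k" using that k1 by auto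
    ultimately show False by (meson nat_dvd_not_less)
  qed
  ultimately show ?thesis by metis
qed

lemma PP_small: "i <= N ==> PP i = i + (\<Sum>j<i. g j)"
  by (simp add: PP_def sum_Suc)

end

context pcc_free begin

lemma C7_distinct: "C7 a b c d e f g ==> distinct [a, b, c, d, e, f, g]"
  using E_irrefl by (auto simp: C7_def E_comm)

text \<open>A hole vertex sees itself and its two neighbours, so its window of three starts at
  \<open>j - 1\<close>, which is \<open>j + 6\<close> modulo 7.\<close>

lemma cls_hole:
  assumes H: "hole h" and j: "j < 7"
  shows "h j \<in> hW h" "cls h (h j) = 2 * ((j + 6) mod 7)"
proof -
  have C: "C7 (h 0) (h 1) (h 2) (h 3) (h 4) (h 5) (h 6)" using H by (simp add: hole_def)
  have cn: "cn h (h j) i <-> (i + 8 - j) mod 7 < 3" if "i < 7" for i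
  proof -
    have "\<forall>j<7. \<forall>i<7. cn h (h j) i <-> (i + 8 - j) mod 7 < 3"
      unfolding all_lt7 cn_def using C C7_distinct[OF C] E_irrefl by (simp add: C7_def E_comm) (metis E_irrefl)
    thus ?thesis using j that by blast
  qed
  have "(j + 8 - j) mod 7 < 3" by simp
  hence 1: "cn h (h j) j" using cn[of j] j by blast
  have "~ ((j + 3) mod 7 + 8 - j) mod 7 < 3"
    using j by (cases "j < 4") (auto simp: le_mod_geq Suc_diff_le)
  hence 2: "~ cn h (h j) ((j + 3) mod 7)" using cn[of "(j + 3) mod 7"] by simp
  have "(j + 3) mod 7 < 7" by simp
  thus W: "h j \<in> hW h" unfolding hW_def using 1 2 j by blast
  define c where "c = cls h (h j)"
  have k: "c < 14" "kind h 0 c (h j)" using cls_kind[OF H W] by (auto simp: c_def)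
  have "(((c div 2 + k) mod 7 + 8 - j) mod 7 < 3) = (k < 3 + c mod 2)" if "k < 7" for k
    using k(2) cn[of "(c div 2 + k) mod 7"] that by (simp add: kind_def cn_mod)
  hence a: "\<forall>k<7. (((c div 2 + k) mod 7 + 8 - j) mod 7 < 3) = (k < 3 + c mod 2)" by blast
  have "\<forall>j\<in>set [0..<7]. \<forall>c\<in>set [0..<14]. (\<forall>k\<in>set [0..<7]. (((c div 2 + k) mod 7 + 8 - j) mod 7 < 3) = (k < 3 + c mod 2)) --> c = 2 * ((j + 6) mod 7)"
    by code_simp
  thus "cls h (h j) = 2 * ((j + 6) mod 7)" using a j k(1) by (auto simp: c_def)
qed

end

text \<open>\<open>K\<close> is an injective key that refines the order of classes. Inside a class
  it sorts by the number of neighbours at the undecided forward distances 3 and 4 minus the number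
  at the undecided backward distances 4 and 3, here 10 and 11. The condition uses sums in place of
  truncated differences.\<close>

locale arcs = pcc_free E for E :: "'a => 'a => bool" +
  fixes h :: "nat => 'a" and Wp :: "'a set" and K :: "'a => nat"
  assumes H: "hole h" and Wp: "Wp \<subseteq> hW h" "finite Wp" "h ` {..<7} \<subseteq> Wp"
    and K_inj: "inj_on K Wp" and K_cls: "[|u \<in> Wp; w \<in> Wp; cls h u < cls h w|] ==> K u < K w"
    and K_key: "[|u \<in> Wp; w \<in> Wp; cls h u = cls h w; K u < K w|] ==>
      card {x\<in>Wp. E u x & dl h u x \<in> {3, 4}} + card {x\<in>Wp. E w x & dl h w x \<in> {10, 11}}
      <= card {x\<in>Wp. E w x & dl h w x \<in> {3, 4}} + card {x\<in>Wp. E u x & dl h u x \<in> {10, 11}}"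
begin

lemma WpW: "w \<in> Wp ==> w \<in> hW h"
  using Wp by blast

text \<open>Otherwise \<open>y\<close> has properly fewer neighbours behind it than
  \<open>w\<close>, since these sets form a chain by \<open>W_nested\<close>. The key then provides
  a neighbour of \<open>w\<close> ahead that \<open>y\<close> lacks, and \<open>w\<close> surpasses
  \<open>y\<close> on both sides, against \<open>W_conflict\<close>.\<close>

lemma key_bwd:
  assumes y: "y \<in> Wp" "w \<in> Wp" "cls h y = cls h w" "K y < K w" and u: "u \<in> Wp" "E w u" "dl h w u \<in> {10, 11}"
  shows "E y u"
proof (rule ccontr)
  assume n: "~ E y u"
  have dyw: "dl h w y = 0" "dl h y w = 0" and dd: "!!x. dl h y x = dl h w x" using y by (auto simp: dl_def)
  have key: "E w x" if x: "x \<in> Wp" "E y x" "dl h y x \<in> {10, 11}" for x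
  proof (rule ccontr)
    assume nx: "~ E w x"
    have "dl h w x = (dl h w u + dl h u x) mod 14" using dl_add[OF H] WpW y u x by blast
    moreover have "dl h w u = (dl h w x + dl h x u) mod 14" using dl_add[OF H] WpW y u x by blast
    moreover have "dl h u x < 14" "dl h x u < 14" using dl_cls[OF H] WpW u x by blast+
    ultimately have "dl h u x <= 2 | dl h x u <= 2" using u(3) x(3) dd by (elim insertE emptyE) (simp; presburger)+
    moreover have "w ~= x" "y ~= u" using x u dyw dd by auto
    ultimately show False using W_nested[OF H, of w y u x] WpW y u x n nx dyw by auto
  qed
  moreover have "{x\<in>Wp. E y x & dl h y x \<in> {10, 11}} ~= {x\<in>Wp. E w x & dl h w x \<in> {10, 11}}" using u n by blast
  ultimately have "{x\<in>Wp. E y x & dl h y x \<in> {10, 11}} \<subset> {x\<in>Wp. E w x & dl h w x \<in> {10, 11}}" using dd by auto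
  hence "card {x\<in>Wp. E y x & dl h y x \<in> {10, 11}} < card {x\<in>Wp. E w x & dl h w x \<in> {10, 11}}"
    by (rule psubset_card_mono[rotated]) (use Wp in auto)
  hence "card {x\<in>Wp. E y x & dl h y x \<in> {3, 4}} < card {x\<in>Wp. E w x & dl h w x \<in> {3, 4}}" using K_key[OF y] by linarith
  hence "~ {x\<in>Wp. E w x & dl h w x \<in> {3, 4}} \<subseteq> {x\<in>Wp. E y x & dl h y x \<in> {3, 4}}"
    using card_mono[of "{x\<in>Wp. E y x & dl h y x \<in> {3, 4}}" "{x\<in>Wp. E w x & dl h w x \<in> {3, 4}}"] Wp by auto
  then obtain z where z: "z \<in> Wp" "E w z" "dl h w z \<in> {3, 4}" "~ E y z" using dd by auto
  show False using W_conflict[OF H, of w y z u] WpW y u z n dyw by blast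
qed

lemma key_fwd:
  assumes y: "y \<in> Wp" "w \<in> Wp" "cls h y = cls h w" "K y < K w" and z: "z \<in> Wp" "E y z" "dl h y z \<in> {3, 4}"
  shows "E w z"
proof (rule ccontr)
  assume n: "~ E w z"
  have dyw: "dl h w y = 0" "dl h y w = 0" and dd: "!!x. dl h y x = dl h w x" using y by (auto simp: dl_def)
  have key: "E y x" if x: "x \<in> Wp" "E w x" "dl h w x \<in> {3, 4}" for x
  proof (rule ccontr)
    assume nx: "~ E y x"
    have "dl h y x = (dl h y z + dl h z x) mod 14" using dl_add[OF H] WpW y z x by blast
    moreover have "dl h y z = (dl h y x + dl h x z) mod 14" using dl_add[OF H] WpW y z x by blast
    moreover have "dl h z x < 14" "dl h x z < 14" using dl_cls[OF H] WpW z x by blast+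
    ultimately have "dl h z x <= 2 | dl h x z <= 2" using z(3) x(3) dd by (elim insertE emptyE) (simp; presburger)+
    moreover have "y ~= x" "w ~= z" using x z dyw dd by auto
    ultimately show False using W_nested[OF H, of y w z x] WpW y z x n nx dyw by auto
  qed
  moreover have "{x\<in>Wp. E w x & dl h w x \<in> {3, 4}} ~= {x\<in>Wp. E y x & dl h y x \<in> {3, 4}}" using z n by blast
  ultimately have "{x\<in>Wp. E w x & dl h w x \<in> {3, 4}} \<subset> {x\<in>Wp. E y x & dl h y x \<in> {3, 4}}" using dd by auto
  hence "card {x\<in>Wp. E w x & dl h w x \<in> {3, 4}} < card {x\<in>Wp. E y x & dl h y x \<in> {3, 4}}"
    by (rule psubset_card_mono[rotated]) (use Wp in auto)
  hence "card {x\<in>Wp. E w x & dl h w x \<in> {10, 11}} < card {x\<in>Wp. E y x & dl h y x \<in> {10, 11}}" using K_key[OF y] by linarith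
  hence "~ {x\<in>Wp. E y x & dl h y x \<in> {10, 11}} \<subseteq> {x\<in>Wp. E w x & dl h w x \<in> {10, 11}}"
    using card_mono[of "{x\<in>Wp. E w x & dl h w x \<in> {10, 11}}" "{x\<in>Wp. E y x & dl h y x \<in> {10, 11}}"] Wp by auto
  then obtain u where u: "u \<in> Wp" "E y u" "dl h y u \<in> {10, 11}" "~ E w u" using dd by auto
  show False using W_conflict[OF H, of y w z u] WpW y u z n dyw by blast
qed

definition N :: nat where "N = card Wp"
definition rk :: "'a => nat" where "rk w = card {u\<in>Wp. K u < K w}"
definition fwd :: "'a => 'a => bool" where
  "fwd w x <-> 1 <= dl h w x & dl h w x <= 4 | dl h w x = 0 & K w < K x"
definition fw :: "'a => nat" where "fw w = card {x\<in>Wp. E w x & fwd w x}"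
definition sq :: "nat => 'a" where "sq i = inv_into Wp rk (i mod N)"
text \<open>The class on the unrolled circle, where one turn of \<open>N\<close> positions adds 14.
  It is monotone, which turns cyclic class distances into plain differences.\<close>

definition gam :: "nat => nat" where "gam i = cls h (sq i) + 14 * (i div N)"
definition r :: "nat => nat" where "r i = i + fw (sq i)"
definition Fw :: "nat => nat => bool" where "Fw i j <-> i < j & gam j <= gam i + 4 & E (sq i) (sq j)"

lemma rk_less: "[|u \<in> Wp; w \<in> Wp|] ==> rk u < rk w <-> K u < K w"
proof -
  have *: "rk u < rk w" if "u \<in> Wp" "w \<in> Wp" "K u < K w" for u w
    unfolding rk_def by (rule psubset_card_mono) (use that Wp in auto)
  assume "u \<in> Wp" "w \<in> Wp"
  thus ?thesis using *[of u w] *[of w u] inj_onD[OF K_inj, of u w] by (metis nat_neq_iff not_less_iff_gr_or_eq)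
qed

lemma N_pos: "0 < N"
proof -
  have "h 0 \<in> Wp" using Wp by auto
  thus ?thesis using Wp by (auto simp: N_def card_gt_0_iff)
qed

lemma rk_bij: "bij_betw rk Wp {..<N}"
proof -
  have inj: "inj_on rk Wp"
  proof (rule inj_onI)
    fix u w assume "u \<in> Wp" "w \<in> Wp" "rk u = rk w"
    thus "u = w" using rk_less[of u w] rk_less[of w u] inj_onD[OF K_inj, of u w] by (metis nat_neq_iff)
  qed
  have "rk ` Wp \<subseteq> {..<N}"
    unfolding rk_def N_def by (auto intro!: psubset_card_mono Wp)
  moreover have "card (rk ` Wp) = card {..<N}" using card_image[OF inj] by (simp add: N_def)
  ultimately have "rk ` Wp = {..<N}" by (intro card_subset_eq) auto
  thus ?thesis using inj by (simp add: bij_betw_def)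
qed

lemma rk_lt: "w \<in> Wp ==> rk w < N"
  using rk_bij by (auto simp: bij_betw_def)

lemma sq_in: "sq i \<in> Wp" and rk_sq: "rk (sq i) = i mod N"
proof -
  have "i mod N \<in> rk ` Wp" using rk_bij N_pos by (auto simp: bij_betw_def)
  thus "sq i \<in> Wp" "rk (sq i) = i mod N" unfolding sq_def by (rule inv_into_into, rule f_inv_into_f)
qed

lemma sq_rk: "w \<in> Wp ==> sq (rk w + N * q) = w"
  unfolding sq_def using rk_bij rk_lt by (simp add: inv_into_f_f bij_betw_def)

lemma sq_N: "sq (i + N) = sq i" and gam_N: "gam (i + N) = gam i + 14"
  using N_pos by (simp_all add: sq_def gam_def)

lemma r_N: "r (i + N) = r i + N"
  by (simp add: r_def sq_N)

lemma clsN: "cls h (sq i) < 14"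
  using cls_kind[OF H] WpW sq_in by blast

lemma K_sq: "i div N = j div N ==> i < j ==> K (sq i) < K (sq j)"
proof -
  assume d: "i div N = j div N" "i < j"
  hence "i mod N < j mod N" by (metis add_less_cancel_left div_mult_mod_eq)
  thus ?thesis using rk_less[OF sq_in sq_in] rk_sq by simp
qed

lemma gam_mono: assumes "i < j" shows "gam i <= gam j"
proof (cases "i div N = j div N")
  case True
  hence "K (sq i) < K (sq j)" using K_sq assms by blast
  hence "~ cls h (sq j) < cls h (sq i)" using K_cls[OF sq_in sq_in, of j i] by auto
  thus ?thesis using True by (simp add: gam_def)
next
  case False
  hence "i div N + 1 <= j div N" using assms div_le_mono[of i j N] by simp
  thus ?thesis using clsN[of i] unfolding gam_def by linarith
qed

lemma gam_same: assumes "i < j" "gam i = gam j" shows "cls h (sq i) = cls h (sq j)" "K (sq i) < K (sq j)"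
proof -
  have "i div N = j div N" using assms(2) clsN[of i] clsN[of j] unfolding gam_def by linarith
  thus "cls h (sq i) = cls h (sq j)" "K (sq i) < K (sq j)" using assms K_sq by (auto simp: gam_def)
qed

lemma dl_gam: "i <= j ==> gam j <= gam i + 13 ==> dl h (sq i) (sq j) = gam j - gam i"
proof -
  assume "i <= j" "gam j <= gam i + 13"
  define p q where "p = i div N" and "q = j div N"
  have ge: "gam i <= gam j" using gam_mono[of i j] \<open>i <= j\<close> by (cases "i = j") auto
  have "p <= q" using \<open>i <= j\<close> by (simp add: p_def q_def div_le_mono)
  moreover have g: "gam i = cls h (sq i) + 14 * p" "gam j = cls h (sq j) + 14 * q" by (simp_all add: gam_def p_def q_def)
  ultimately have "q = p | q = p + 1" using \<open>gam j <= gam i + 13\<close> clsN[of i] clsN[of j] by linarith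
  thus ?thesis unfolding dl_def g using ge \<open>gam j <= gam i + 13\<close> clsN[of i] clsN[of j] g
    by (elim disjE) (auto simp: le_mod_geq)
qed

lemma lt_period: "gam j < gam i + 14 ==> j < i + N"
  using gam_mono[of "i + N" j] gam_N[of i] by (cases rule: linorder_cases[of j "i + N"]) auto

lemma sq_neq: "i < j ==> j < i + N ==> sq i ~= sq j"
proof
  assume ij: "i < j" "j < i + N" and "sq i = sq j"
  hence "i mod N = j mod N" using rk_sq by metis
  hence "N dvd j - i" using ij by (metis less_imp_le mod_eq_dvd_iff_nat)
  thus False using ij dvd_imp_le[of N "j - i"] by simp
qed

text \<open>Distances up to 2 are adjacencies by \<open>W_complete\<close>. There remain an inner
  vertex at distance 1 or 3 in a span of 4, which is \<open>W_umbrella\<close>, and an inner vertex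
  in the class of one of the ends, where the key decides.\<close>

lemma umbrella:
  assumes F: "Fw i j" and x: "i < x" "x < j"
  shows "Fw i x" "Fw x j"
proof -
  have ij: "i < j" "gam j <= gam i + 4" "E (sq i) (sq j)" using F by (auto simp: Fw_def)
  have g: "gam i <= gam x" "gam x <= gam j" using gam_mono x by auto
  have W: "sq i \<in> hW h" "sq x \<in> hW h" "sq j \<in> hW h" using sq_in WpW by auto
  have d: "dl h (sq i) (sq j) = gam j - gam i" "dl h (sq i) (sq x) = gam x - gam i" "dl h (sq x) (sq j) = gam j - gam x"
    using dl_gam[of i j] dl_gam[of i x] dl_gam[of x j] ij x g by auto
  have jN: "j < i + N" using lt_period ij by auto
  have ne: "sq i ~= sq x" "sq x ~= sq j" using sq_neq[of i x] sq_neq[of x j] x jN by auto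
  have c1: "E (sq i) (sq x)"
  proof -
    consider "gam x - gam i <= 2" | "gam x - gam i = 3" "gam j - gam i = 4" | "gam x = gam j" "gam j - gam i = 3 | gam j - gam i = 4"
      using ij g by linarith
    thus ?thesis
    proof cases
      case 1 thus ?thesis using W_complete[OF H W(1,2)] ne d by simp
    next
      case 2 thus ?thesis using W_umbrella(2)[OF H W(1,3,2) ij(3)] d by simp
    next
      case 3
      have "dl h (sq j) (sq i) = (14 - (gam j - gam i)) mod 14" using dl_rev[OF H W(1,3)] d by simp
      hence "dl h (sq j) (sq i) \<in> {10, 11}" using 3 by auto
      hence "E (sq x) (sq i)" using key_bwd[OF sq_in sq_in gam_same[OF x(2) 3(1)] sq_in, of i] ij(3) E_sym by blast
      thus ?thesis by (rule E_sym)
    qed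
  qed
  have c2: "E (sq x) (sq j)"
  proof -
    consider "gam j - gam x <= 2" | "gam x - gam i = 1" "gam j - gam i = 4" | "gam i = gam x" "gam j - gam i = 3 | gam j - gam i = 4"
      using ij g by linarith
    thus ?thesis
    proof cases
      case 1 thus ?thesis using W_complete[OF H W(2,3)] ne d by simp
    next
      case 2 thus ?thesis using W_umbrella(1)[OF H W(1,3,2) ij(3)] d by simp
    next
      case 3
      thus ?thesis using key_fwd[OF sq_in sq_in gam_same[OF x(1) 3(1)] sq_in ij(3)] d by auto
    qed
  qed
  show "Fw i x" "Fw x j" using c1 c2 x g ij by (auto simp: Fw_def)
qed

lemma initial_segment:
  fixes S :: "nat set"
  assumes "finite S" "!!j. j \<in> S ==> i < j" "!!j x. j \<in> S ==> i < x ==> x < j ==> x \<in> S"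
  shows "S = {i<..i + card S}"
proof (cases "S = {}")
  case False
  hence m: "Max S \<in> S" "!!j. j \<in> S ==> j <= Max S" using assms(1) by auto
  have "x \<in> S <-> i < x & x <= Max S" for x
    using assms(2)[of x] assms(3)[OF m(1), of x] m le_neq_implies_less[of x "Max S"] by blast
  hence "S = {i<..Max S}" by (auto simp: set_eq_iff)
  hence "card S = Max S - i" by (metis card_greaterThanAtMost)
  thus ?thesis using \<open>S = {i<..Max S}\<close> assms(2)[OF m(1)] by simp
qed simp

lemma Fw_fwd: "Fw i j ==> fwd (sq i) (sq j)"
proof -
  assume F: "Fw i j"
  hence ij: "i < j" "gam j <= gam i + 4" by (auto simp: Fw_def)
  hence "dl h (sq i) (sq j) = gam j - gam i" using dl_gam[of i j] by simp
  thus ?thesis using gam_same[OF ij(1)] gam_mono[OF ij(1)] ij by (cases "gam i = gam j") (auto simp: fwd_def)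
qed

lemma fwd_Fw:
  assumes "x \<in> Wp" "E (sq i) x" "fwd (sq i) x"
  shows "\<exists>j. Fw i j & sq j = x"
proof -
  define q where "q = i div N"
  define d where "d = dl h (sq i) x"
  have d4: "d <= 4" using assms(3) by (auto simp: fwd_def d_def)
  have cx: "cls h x = (cls h (sq i) + d) mod 14" using dl_cls(1)[OF H, of "sq i" x] assms sq_in WpW by (simp add: d_def)
  have i: "i = rk (sq i) + N * q" using rk_sq[of i] by (simp add: q_def)
  have rl: "rk x < N" "rk (sq i) < N" using rk_lt assms sq_in by auto
  \<comment> \<open>The position of \<open>x\<close> in the turn of \<open>i\<close>, or in the next
    turn if its class lies beyond the end of the current one.\<close>
  define j where "j = rk x + N * (if cls h (sq i) + d < 14 then q else q + 1)"
  have sj: "sq j = x" using sq_rk assms by (simp add: j_def)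
  have dj: "j div N = (if cls h (sq i) + d < 14 then q else q + 1)" using rl N_pos by (auto simp: j_def)
  have gj: "gam j = gam i + d"
    using cx clsN[of i] d4 unfolding gam_def sj dj q_def[symmetric] by (auto simp: le_mod_geq)
  have "i < j"
  proof (cases "cls h (sq i) + d < 14")
    case True
    have "K (sq i) < K x"
    proof (cases "d = 0")
      case True thus ?thesis using assms(3) by (auto simp: fwd_def d_def)
    next
      case False
      hence "cls h (sq i) < cls h x" using cx True by simp
      thus ?thesis using K_cls sq_in assms by blast
    qed
    hence "rk (sq i) < rk x" using rk_less sq_in assms by blast
    hence "rk (sq i) + N * q < rk x + N * q" by simp
    thus ?thesis using i True by (simp add: j_def)
  next
    case False
    have "rk (sq i) + N * q < N + N * q" using rl by simp
    also have "\<dots> <= rk x + N * (q + 1)" by simp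
    finally show ?thesis using i False by (simp add: j_def)
  qed
  hence "Fw i j" using gj d4 assms sj by (simp add: Fw_def)
  thus ?thesis using sj by blast
qed

text \<open>By \<open>umbrella\<close> the forward neighbours form an interval directly behind
  \<open>i\<close>, and \<open>r i\<close> is defined by their number.\<close>

lemma Fw_iff: "Fw i j <-> i < j & j <= r i"
proof -
  have sub: "{j. Fw i j} \<subseteq> {i<..<i + N}" using lt_period[of _ i] by (auto simp: Fw_def)
  hence fin: "finite {j. Fw i j}" by (rule finite_subset) simp
  have inj: "inj_on sq {j. Fw i j}"
  proof (rule inj_onI)
    fix a b assume ab: "a \<in> {j. Fw i j}" "b \<in> {j. Fw i j}" "sq a = sq b"
    hence "a \<in> {i<..<i + N}" "b \<in> {i<..<i + N}" using sub by blast+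
    hence "a < b + N" "b < a + N" by auto
    thus "a = b" using sq_neq[of a b] sq_neq[of b a] ab(3) by (metis nat_neq_iff)
  qed
  have "sq ` {j. Fw i j} = {x\<in>Wp. E (sq i) x & fwd (sq i) x}"
    using Fw_fwd[of i] fwd_Fw[of _ i] sq_in by (auto simp: Fw_def image_iff)
  hence "card {j. Fw i j} = fw (sq i)" using card_image[OF inj] by (simp add: fw_def)
  moreover have "{j. Fw i j} = {i<..i + card {j. Fw i j}}"
  proof (rule initial_segment[OF fin])
    show "i < j" if "j \<in> {j. Fw i j}" for j using that by (simp add: Fw_def)
    show "x \<in> {j. Fw i j}" if "j \<in> {j. Fw i j}" "i < x" "x < j" for j x using umbrella(1)[of i j x] that by blast
  qed
  ultimately have "{j. Fw i j} = {i<..r i}" by (simp add: r_def)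
  thus ?thesis by auto
qed

text \<open>A hole vertex is always among the forward neighbours: hole vertices occupy all even
  classes, so one of them is at distance 1 or 2.\<close>

lemma r_gt: "i < r i"
proof -
  define c where "c = cls h (sq i)"
  \<comment> \<open>\<open>2 * m\<close> is the next even class after \<open>c\<close>, cyclically,
    and \<open>h ((m + 1) mod 7)\<close> is the hole vertex in it.\<close>
  define m where "m = ((c + 2) div 2) mod 7"
  define x where "x = h ((m + 1) mod 7)"
  have m7: "m < 7" by (simp add: m_def)
  have c14: "c < 14" using clsN by (simp add: c_def)
  have "x \<in> h ` {..<7}" by (simp add: x_def)
  hence x: "x \<in> Wp" "x \<in> hW h" using Wp by blast+
  have "cls h x = 2 * (((m + 1) mod 7 + 6) mod 7)" using cls_hole(2)[OF H, of "(m + 1) mod 7"] by (simp add: x_def)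
  also have "((m + 1) mod 7 + 6) mod 7 = m" using m7 by (cases "m = 6") auto
  finally have cx: "cls h x = 2 * m" .
  have "\<forall>c\<in>set [0..<14]. \<exists>d\<in>{1, 2::nat}. (2 * (((c + 2) div 2) mod 7) + 14 - c) mod 14 = d" by code_simp
  hence "dl h (sq i) x = 1 | dl h (sq i) x = 2" using c14 unfolding dl_def cx m_def c_def[symmetric] by auto
  then obtain d where d: "d = 1 | d = 2" "dl h (sq i) x = d" by blast
  hence "sq i ~= x" by (auto simp: dl_def)
  hence "E (sq i) x" using W_complete[OF H WpW[OF sq_in] x(2)] d by auto
  moreover have "fwd (sq i) x" using d by (auto simp: fwd_def)
  ultimately show ?thesis using fwd_Fw[OF x(1)] Fw_iff by fastforce
qed

lemma Fw_r: "Fw i (r i)"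
  using Fw_iff r_gt by blast

lemma r_mono: "i <= j ==> r i <= r j"
proof (cases "r i <= j | i = j")
  case True
  thus ?thesis using r_gt[of j] by auto
next
  case False
  assume "i <= j"
  hence "Fw j (r i)" using umbrella(2)[OF Fw_r, of i j] False by auto
  thus ?thesis using Fw_iff by blast
qed

lemma gam_r: "gam (r i) <= gam i + 4"
  using Fw_r by (auto simp: Fw_def)

text \<open>By \<open>W_anticomplete\<close> the class of a neighbour is at most 4 ahead or at most
  4 behind; being behind means being ahead after one more turn.\<close>

lemma adj_Fw:
  assumes ij: "i < j" "j < i + N" and e: "E (sq i) (sq j)"
  shows "Fw i j | Fw j (i + N)"
proof -
  have W: "sq i \<in> hW h" "sq j \<in> hW h" using sq_in WpW by auto
  have *: "Fw a b" if ab: "fwd (sq a) (sq b)" "E (sq a) (sq b)" "a < b" "b < a + N" for a b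
  proof -
    obtain j' where j': "Fw a j'" "sq j' = sq b" using fwd_Fw[OF sq_in ab(2,1)] by blast
    hence "a < j'" "j' < a + N" using lt_period[of j' a] by (auto simp: Fw_def)
    hence "j' = b" using j' sq_neq[of b j'] sq_neq[of j' b] ab by (cases rule: linorder_cases[of b j']) auto
    thus ?thesis using j' by simp
  qed
  have f: "fwd (sq i) (sq j) ==> ?thesis" using *[of i j] ij e by blast
  have b: "fwd (sq j) (sq i) ==> ?thesis" using *[of j "i + N"] ij e E_sym sq_N by auto
  have r: "dl h (sq j) (sq i) = (14 - dl h (sq i) (sq j)) mod 14" using dl_rev[OF H W] .
  have lt: "dl h (sq i) (sq j) < 14" using dl_cls(2)[OF H W] .
  consider "dl h (sq i) (sq j) = 0" | "1 <= dl h (sq i) (sq j)" "dl h (sq i) (sq j) <= 4" | "10 <= dl h (sq i) (sq j)"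
    using W_anticomplete(1)[OF H W e] by linarith
  thus ?thesis
  proof cases
    case 1
    have "K (sq i) ~= K (sq j)" using sq_neq[OF ij] inj_onD[OF K_inj _ sq_in sq_in] by blast
    hence "fwd (sq i) (sq j) | fwd (sq j) (sq i)" using 1 r by (auto simp: fwd_def)
    thus ?thesis using f b by blast
  next
    case 2
    thus ?thesis using f by (auto simp: fwd_def)
  next
    case 3
    have "fwd (sq j) (sq i)" unfolding fwd_def r using 3 lt by auto
    thus ?thesis using b by blast
  qed
qed

lemma r4: "r (r (r (r i))) < i + N"
proof (rule ccontr)
  define b where "b = r i"
  define c where "c = r b"
  define d where "d = r c"
  assume "~ ?thesis"
  hence rd: "i + N <= r d" by (simp add: b_def c_def d_def)
  have lt: "i < b" "b < c" "c < d" by (simp_all add: b_def c_def d_def r_gt)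
  have g: "gam b <= gam i + 4" "gam c <= gam b + 4" "gam d <= gam c + 4" by (simp_all add: b_def c_def d_def gam_r)
  have dN: "d < i + N" using lt_period[of d i] g by linarith
  have "Fw d (i + N)" using Fw_iff rd dN by blast
  hence E4: "E (sq d) (sq i)" by (auto simp: Fw_def sq_N)
  have E123: "E (sq i) (sq b)" "E (sq b) (sq c)" "E (sq c) (sq d)"
    using Fw_r unfolding b_def c_def d_def Fw_def by blast+
  have "~ E (sq i) (sq c)" using adj_Fw[of i c] lt dN rd by (auto simp: Fw_iff b_def[symmetric] c_def[symmetric] d_def[symmetric])
  moreover have "~ E (sq b) (sq d)"
  proof
    assume "E (sq b) (sq d)"
    hence "Fw b d | Fw d (b + N)" using adj_Fw[of b d] lt dN by auto
    thus False
    proof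
      assume "Fw d (b + N)"
      hence "gam (b + N) <= gam d + 4" by (simp add: Fw_def)
      thus False using g gam_N[of b] by linarith
    qed (use lt in "auto simp: Fw_iff c_def[symmetric]")
  qed
  moreover have "sq i ~= sq c" "sq b ~= sq d" using sq_neq[of i c] sq_neq[of b d] lt dN by auto
  ultimately show False using no_C4[of "sq i" "sq b" "sq c" "sq d"] E123 E4 by blast
qed

text \<open>Since four arcs do not close up by \<open>r4\<close>, five arcs that do would have no
  chords, because each leads to the farthest forward neighbour. They would form an induced
  5-cycle.\<close>

lemma r5: "r (r (r (r (r i)))) < i + N"
proof (rule ccontr)
  define b where "b = r i"
  define c where "c = r b"
  define d where "d = r c"
  define e where "e = r d"
  assume "~ ?thesis"
  hence re: "i + N <= r e" by (simp add: b_def c_def d_def e_def)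
  have lt: "i < b" "b < c" "c < d" "d < e" by (simp_all add: b_def c_def d_def e_def r_gt)
  have g: "gam b <= gam i + 4" "gam c <= gam b + 4" "gam d <= gam c + 4" "gam e <= gam d + 4"
    by (simp_all add: b_def c_def d_def e_def gam_r)
  have eN: "e < i + N" using r4[of i] by (simp add: b_def c_def d_def e_def)
  have reN: "r e < b + N" using r4[of b] by (simp add: c_def d_def e_def)
  note defs = b_def[symmetric] c_def[symmetric] d_def[symmetric] e_def[symmetric]
  have "Fw e (i + N)" using Fw_iff re eN by blast
  hence E5: "E (sq e) (sq i)" by (auto simp: Fw_def sq_N)
  have E1234: "E (sq i) (sq b)" "E (sq b) (sq c)" "E (sq c) (sq d)" "E (sq d) (sq e)"
    using Fw_r unfolding b_def c_def d_def e_def Fw_def by blast+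
  have "~ E (sq i) (sq c)" using adj_Fw[of i c] lt eN by (auto simp: Fw_iff defs)
  moreover have "~ E (sq i) (sq d)" using adj_Fw[of i d] lt eN by (auto simp: Fw_iff defs)
  moreover have "~ E (sq b) (sq d)" using adj_Fw[of b d] lt eN by (auto simp: Fw_iff defs)
  moreover have "~ E (sq b) (sq e)" using adj_Fw[of b e] lt eN reN by (auto simp: Fw_iff defs)
  moreover have "~ E (sq c) (sq e)" using adj_Fw[of c e] lt eN reN by (auto simp: Fw_iff defs)
  ultimately show False using no_C5[of "sq i" "sq b" "sq c" "sq d" "sq e"] E1234 E5 E_comm by metis
qed

lemma fwd_clique: assumes w: "w \<in> Wp"
  defines "C \<equiv> insert w {x\<in>Wp. E w x & fwd w x}"
  shows "card C = fw w + 1" "!!x y. x \<in> C ==> y \<in> C ==> x ~= y ==> E x y"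
proof -
  show "card C = fw w + 1" using Wp E_irrefl by (simp add: C_def fw_def)
  have sw: "sq (rk w) = w" using sq_rk[OF w, of 0] by simp
  fix x y assume xy: "x \<in> C" "y \<in> C" "x ~= y"
  have ex: "\<exists>j. Fw (rk w) j & sq j = z" if "z \<in> C" "z ~= w" for z
    using fwd_Fw[of z "rk w"] that sw by (auto simp: C_def)
  have *: "E (sq j) (sq j')" if "Fw (rk w) j" "Fw (rk w) j'" "j < j'" for j j'
    using umbrella(2)[OF that(2), of j] that by (auto simp: Fw_def)
  show "E x y"
  proof (cases "x = w | y = w")
    case True thus ?thesis using xy E_sym by (auto simp: C_def)
  next
    case False
    obtain j j' where "Fw (rk w) j" "sq j = x" "Fw (rk w) j'" "sq j' = y" using ex False xy by metis
    thus ?thesis using *[of j j'] *[of j' j] xy E_sym by (metis nat_neq_iff)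
  qed
qed

text \<open>The interface to the program: \<open>D\<close> and \<open>cov\<close> are indexed by
  vertices instead of positions, and the greedy rule is assumed as a recursion, the form in which a
  loop computes it.\<close>

lemma color_positions:
  assumes k: "!!w. w \<in> Wp ==> fw w + 1 <= k" "N <= 3 * k"
    and cov: "!!w i. [|w \<in> Wp; i < N|] ==> cov w i <-> rk w <= i & i < rk w + fw w | i + N < rk w + fw w"
    and D0: "!!w. w \<in> Wp ==> D 0 w = fw w" and rem0: "rem 0 = 3 * k - N"
    and gi: "!!i. i < N ==> \<exists>mx. (\<forall>w\<in>Wp. cov w i --> D i w <= mx) & (\<exists>w\<in>Wp. cov w i & D i w = mx) & g i = min (rem i) (k - 1 - mx)"
    and DS: "!!i w. [|i < N; w \<in> Wp|] ==> D (Suc i) w = D i w + (if cov w i then g i else 0)"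
    and remS: "!!i. i < N ==> rem (Suc i) = rem i - g i"
    and uw: "u \<in> Wp" "w \<in> Wp" "E u w"
  shows "(rk u + (\<Sum>j<rk u. g j)) mod k ~= (rk w + (\<Sum>j<rk w. g j)) mod k"
proof -
  have rs: "rk (sq s) = s" if "s < N" for s using rk_sq[of s] that by simp
  interpret g: arc_gaps N k r "%i s. D i (sq s)" g rem "%s. cov (sq s)"
  proof
    fix i assume i: "i < N"
    obtain mx where mx: "\<forall>w\<in>Wp. cov w i --> D i w <= mx" "\<exists>w\<in>Wp. cov w i & D i w = mx" "g i = min (rem i) (k - 1 - mx)"
      using gi[OF i] by blast
    have "\<forall>s<N. cov (sq s) i --> D i (sq s) <= mx" using mx(1) sq_in by blast
    moreover have "\<exists>s<N. cov (sq s) i & D i (sq s) = mx"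
    proof -
      obtain w where w: "w \<in> Wp" "cov w i" "D i w = mx" using mx(2) by blast
      hence "rk w < N" "sq (rk w) = w" using rk_lt sq_rk[of w 0] by auto
      thus ?thesis using w by (intro exI[of _ "rk w"]) simp
    qed
    ultimately show "\<exists>mx. (\<forall>s<N. cov (sq s) i --> D i (sq s) <= mx) & (\<exists>s<N. cov (sq s) i & D i (sq s) = mx) & g i = min (rem i) (k - 1 - mx)"
      using mx(3) by blast
  qed (use N_pos r_gt r_mono r_N r5 k sq_in cov D0 rem0 DS remS rs in "auto simp: r_def")
  have P: "g.PP (rk w) = rk w + (\<Sum>j<rk w. g j)" if "w \<in> Wp" for w
    using g.PP_small[of "rk w"] rk_lt[OF that] by simp
  have *: "g.PP (rk u) mod k ~= g.PP (rk w) mod k" if uw: "u \<in> Wp" "w \<in> Wp" "E u w" "rk u < rk w" for u w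
  proof -
    have s: "sq (rk u) = u" "sq (rk w) = w" using sq_rk[of _ 0] uw by auto
    have lt: "rk w < N" "rk u < N" using rk_lt uw by auto
    have "Fw (rk u) (rk w) | Fw (rk w) (rk u + N)" using adj_Fw[of "rk u" "rk w"] uw s lt by simp
    thus ?thesis
    proof
      assume "Fw (rk u) (rk w)"
      thus ?thesis using g.positions[of "rk u" "rk w"] lt by (simp add: Fw_iff)
    next
      assume "Fw (rk w) (rk u + N)"
      hence "rk w < rk u + N" "rk u + N <= r (rk w)" by (auto simp: Fw_iff)
      hence "g.PP (rk w) mod k ~= g.PP ((rk u + N) mod N) mod k" by (rule g.positions[OF lt(1)])
      thus ?thesis using lt by simp
    qed
  qed
  have "rk u ~= rk w" using uw E_irrefl rk_bij inj_onD unfolding bij_betw_def by metis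
  thus ?thesis using *[of u w] *[of w u] uw P E_sym by (metis nat_neq_iff)
qed

text \<open>The colours on \<open>Up\<close> are pairwise different and do not occur on
  \<open>Wp\<close>. On \<open>Wp\<close> colours are counted by a forward clique or by the bound 3
  on stable sets; \<open>3 * k <= N + 2\<close> holds for \<open>N / 3\<close> rounded up.\<close>

lemma lower_bound:
  assumes U: "Up \<subseteq> hU h" "finite Up" and k: "k <= fw w + 1 & w \<in> Wp | 3 * k <= N + 2"
    and c: "!!x. x \<in> Up \<union> Wp ==> c x < (q :: nat)" "!!x y. [|x \<in> Up \<union> Wp; y \<in> Up \<union> Wp; E x y|] ==> c x ~= c y"
  shows "card Up + k <= q"
proof -
  have dUW: "Up \<inter> Wp = {}" using U Wp unfolding hU_def hW_def by blast
  have injU: "inj_on c Up"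
  proof (rule inj_onI)
    fix x y assume "x \<in> Up" "y \<in> Up" "c x = c y"
    thus "x = y" using c(2)[of x y] U_complete[OF H, of x y] U by blast
  qed
  have disj: "c ` Up \<inter> c ` Wp = {}"
  proof -
    have "c x ~= c y" if "x \<in> Up" "y \<in> Wp" for x y
      using c(2)[of x y] U_complete[OF H, of x y] that U WpW dUW by blast
    thus ?thesis by fastforce
  qed
  have kW: "k <= card (c ` Wp)"
  proof (rule disjE[OF k])
    assume a: "k <= fw w + 1 & w \<in> Wp"
    define C where "C = insert w {x\<in>Wp. E w x & fwd w x}"
    have C: "C \<subseteq> Wp" "card C = fw w + 1" "!!x y. x \<in> C ==> y \<in> C ==> x ~= y ==> E x y"
      using fwd_clique[of w, folded C_def] a unfolding C_def by blast+
    have "inj_on c C"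
    proof (rule inj_onI)
      fix x y assume "x \<in> C" "y \<in> C" "c x = c y"
      thus "x = y" using c(2)[of x y] C by blast
    qed
    hence "card (c ` C) = fw w + 1" using card_image C by metis
    moreover have "card (c ` C) <= card (c ` Wp)" using C Wp by (intro card_mono) auto
    ultimately show ?thesis using a by simp
  next
    assume a: "3 * k <= N + 2"
    have "N <= (\<Sum>b\<in>c ` Wp. card {w\<in>Wp. c w = b})"
    proof -
      have "Wp = (\<Union>b\<in>c ` Wp. {w\<in>Wp. c w = b})" by auto
      hence "N = card (\<Union>b\<in>c ` Wp. {w\<in>Wp. c w = b})" by (simp add: N_def)
      also have "\<dots> <= (\<Sum>b\<in>c ` Wp. card {w\<in>Wp. c w = b})" by (rule card_UN_le) (use Wp in auto)
      finally show ?thesis .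
    qed
    also have "\<dots> <= (\<Sum>b\<in>c ` Wp. 3)"
    proof (rule sum_mono)
      fix b assume "b \<in> c ` Wp"
      show "card {w\<in>Wp. c w = b} <= 3"
      proof (rule W_stable[OF H])
        show "{w \<in> Wp. c w = b} \<subseteq> hW h" using Wp by auto
        show "finite {w \<in> Wp. c w = b}" using Wp by auto
        show "~ E x y" if "x \<in> {w \<in> Wp. c w = b}" "y \<in> {w \<in> Wp. c w = b}" for x y using c(2)[of x y] that by auto
      qed
    qed
    finally show ?thesis using a by simp
  qed
  have "card (c ` Up \<union> c ` Wp) = card Up + card (c ` Wp)"
    using card_Un_disjoint[of "c ` Up" "c ` Wp"] disj U Wp card_image[OF injU] by simp
  moreover have "c ` Up \<union> c ` Wp \<subseteq> {..<q}" using c(1) by auto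
  hence "card (c ` Up \<union> c ` Wp) <= q" using card_mono[of "{..<q}"] by fastforce
  ultimately show ?thesis using kW by linarith
qed

end

section \<open>Kempe changes and recolouring\<close>

context pcc_free begin

section \<open>Chains between two neighbours of a vertex\<close>

lemma no_chain1: "[|E v x; E v y; ~ E x y; x ~= y; ~ E v a; v ~= a; E x a|] ==> ~ E a y"
  using no_C4[of v x a y] E_comm by metis

lemma no_chain2:
  "[|E v x; E v y; ~ E x y; x ~= y; ~ E v a; v ~= a; ~ E v b; v ~= b; E x a; E a b|] ==> ~ E b y"
  using no_C5[of v x a b y] no_chain1[of v x y a] no_chain1[of v x y b] E_comm by metis

text \<open>A chord would leave a chain with one or two inner vertices, and this closes to a 4- or
  5-cycle with \<open>v\<close>.\<close>

lemma chain3: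
  assumes v: "E v x" "E v y" "~ E x y" "x ~= y" and n: "~ E v a" "v ~= a" "~ E v b" "v ~= b" "~ E v c" "v ~= c"
    and p: "E x a" "E a b" "E b c" "E c y"
  shows "~ E x b" "~ E x c" "~ E a c" "~ E a y" "~ E b y"
  using no_chain1[OF v n(1,2) p(1)] no_chain1[OF v n(5,6)] no_chain2[OF v n(3-6)] no_chain2[OF v n(1,2,5,6)]
    no_chain2[OF v n(1-4)] p by blast+

lemma chain4:
  assumes v: "E v x" "E v y" "~ E x y" "x ~= y"
    and n: "~ E v a" "v ~= a" "~ E v b" "v ~= b" "~ E v c" "v ~= c" "~ E v d" "v ~= d"
    and p: "E x a" "E a b" "E b c" "E c d" "E d y"
    and no3: "!!a' b' c'. [|a' \<in> {a, b, c, d}; b' \<in> {a, b, c, d}; c' \<in> {a, b, c, d}; E x a'; E a' b'; E b' c'|] ==> ~ E c' y"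
  shows "C7 v x a b c d y"
proof -
  have "~ E x b" using no3[of b c d] p by blast
  moreover have "~ E x c" using no_chain2[OF v n(5-8)] p by blast
  moreover have "~ E x d" using no_chain1[OF v n(7,8)] p by blast
  moreover have "~ E a c" using no3[of a c d] p by blast
  moreover have "~ E a d" using no_chain2[OF v n(1,2,7,8)] p by blast
  moreover have "~ E a y" using no_chain1[OF v n(1,2)] p by blast
  moreover have "~ E b d" using no3[of a b d] p by blast
  moreover have "~ E b y" using no_chain2[OF v n(1-4)] p by blast
  moreover have "~ E c y" using no3[of a b c] p by blast
  ultimately show ?thesis using v n p unfolding C7_def by (simp add: E_comm)
qed

definition stp :: "'a set => ('a => nat) => 'a set => nat => 'a set" where
  "stp P c Q a = {w \<in> P. c w = a & (\<exists>u\<in>Q. E u w)}"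

end

text \<open>One Kempe change at the new vertex \<open>v\<close>, whose neighbourhood among the coloured vertices \<open>P\<close> is \<open>T\<close>. \<open>M\<close> consists of the vertices of \<open>T\<close>
  that are complete to the rest of \<open>T\<close>, the others form a disjoint union of cliques. The \<open>(a, b)\<close>-chains that start in \<open>B0\<close> are swapped.\<close>

locale kempe = pcc_free E for E :: "'a => 'a => bool" +
  fixes P :: "'a set" and v :: 'a and c :: "'a => nat" and T M :: "'a set" and a b :: nat
  assumes vP: "v \<notin> P" and T: "T = {w \<in> P. E v w}" and M: "M = {w \<in> T. \<forall>u\<in>T. u ~= w --> E u w}"
    and cliques: "[|x \<in> T - M; y \<in> T - M; z \<in> T - M; E x y; E y z; x ~= z|] ==> E x z"
    and proper: "[|x \<in> P; y \<in> P; E x y|] ==> c x ~= c y" and ab: "a ~= b"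
begin

section \<open>Two-coloured chains and their exchange\<close>

lemma TP: "x \<in> T ==> x \<in> P" and Tv: "x \<in> P ==> E v x <-> x \<in> T"
  using T by auto

lemma M_adj: "x \<in> M ==> u \<in> T ==> u ~= x ==> E u x" and MT: "x \<in> M ==> x \<in> T"
  using M by auto

lemma T_trans:
  assumes y: "y \<in> T" "x \<in> T" "z \<in> T" "x = y | E x y" "z = y | E z y" "x ~= z" "y \<notin> M"
  shows "E x z"
proof (cases "x \<in> M | z \<in> M")
  case True
  thus ?thesis using M_adj[of x z] M_adj[of z x] y E_sym by blast
next
  case False
  thus ?thesis using cliques[of x y z] y E_sym by blast
qed

text \<open>Only cliques of \<open>T\<close> that have \<open>b\<close> without \<open>a\<close>
  require a change; the exchange turns their \<open>b\<close> into \<open>a\<close>.\<close>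

definition "B0 = {w \<in> T. c w = b & ~ (\<exists>z\<in>T. c z = a & E z w)}"
definition "A1 = stp P c B0 a"
definition "B1 = stp P c A1 b"
definition "A2 = stp P c B1 a"
definition "B2 = stp P c A2 b"
definition "A3 = stp P c B2 a"
definition "R = B0 \<union> A1 \<union> B1 \<union> A2 \<union> B2 \<union> A3"

lemmas level_defs = A1_def B1_def A2_def B2_def A3_def stp_def

lemma B0D: "x \<in> B0 ==> x \<in> T & x \<in> P & c x = b"
  using TP by (auto simp: B0_def)

lemma RP: "x \<in> R ==> x \<in> P & (c x = a | c x = b)"
  using B0D by (auto simp: R_def level_defs)

text \<open>An earlier arrival at \<open>z\<close> is impossible: in \<open>A1\<close> it would have
  a neighbour of colour \<open>b\<close> in \<open>T\<close>, and in \<open>A2\<close> it would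
  close a 5-cycle with \<open>v\<close>. So the chain has no shortcut, and with \<open>v\<close> it
  is a hole.\<close>

lemma chain_C7:
  assumes y: "y0 \<in> B0" "y1 \<in> A1" "E y0 y1" "y2 \<in> B1" "E y1 y2" "y3 \<in> A2" "E y2 y3" "y4 \<in> B2" "E y3 y4"
    and z: "z \<in> A3" "E y4 z" "z \<in> T" "~ (\<exists>y\<in>T. c y = b & E y z)"
  shows "C7 v y0 y1 y2 y3 y4 z"
proof -
  have P: "y0 \<in> P" "y1 \<in> P" "y2 \<in> P" "y3 \<in> P" "y4 \<in> P" "z \<in> P"
    and cc: "c y0 = b" "c y1 = a" "c y2 = b" "c y3 = a" "c y4 = b" "c z = a"
    using y z B0D by (auto simp: level_defs)
  have y0: "y0 \<in> T" "!!z. z \<in> T ==> c z = a ==> ~ E z y0" using y(1) by (auto simp: B0_def)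
  have nz1: "z \<notin> A1" using z(4) B0D E_sym unfolding A1_def stp_def by blast
  have nz2: "z \<notin> A2"
  proof
    assume "z \<in> A2"
    then obtain x2 x1 x0 where x: "x2 \<in> P" "c x2 = b" "E x2 z" "x1 \<in> P" "c x1 = a" "E x1 x2" "x0 \<in> B0" "E x0 x1"
      unfolding A2_def B1_def A1_def stp_def by blast
    have x0: "x0 \<in> T" "c x0 = b" "~ E x1 v" using x(4,5,7,8) B0D[OF x(7)] Tv[OF x(4)] E_comm[of v x1] E_comm[of x0 x1] by (auto simp: B0_def)
    have "~ E x2 v" using z(4) x Tv[OF x(1)] E_comm by metis
    moreover have "~ E x0 z" using z(4) x0 by blast
    moreover have "~ E x0 x2" "~ E x1 z" using proper[of x0 x2] proper[of x1 z] x x0 cc P TP by metis+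
    ultimately show False using no_C5[of v x0 x1 x2 z] x x0 Tv[OF P(6)] Tv[OF TP[OF x0(1)]] z(3) E_comm by metis
  qed
  have v0: "E v y0" "E v z" using Tv P y0 z by blast+
  have v1: "~ E v y1" using y0(2)[of y1] cc y(3) E_sym Tv P by blast
  have v4: "~ E v y4" using z(2,4) cc Tv P by blast
  have s: "~ E y0 y2" "~ E y0 y4" "~ E y1 y3" "~ E y1 z" "~ E y2 y4" "~ E y3 z" using proper cc P by metis+
  have o: "~ E y0 y3"
  proof
    assume "E y0 y3"
    hence "y3 \<in> A1" using y P cc by (auto simp: A1_def stp_def)
    hence "y4 \<in> B1" using y P cc by (auto simp: B1_def stp_def)
    thus False using nz2 z P cc by (auto simp: A2_def stp_def)
  qed
  moreover have "~ E y1 y4"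
  proof
    assume "E y1 y4"
    hence "y4 \<in> B1" using y P cc by (auto simp: B1_def stp_def)
    thus False using nz2 z P cc by (auto simp: A2_def stp_def)
  qed
  moreover have "~ E y2 z" using nz2 y P cc by (auto simp: A2_def stp_def)
  moreover have "~ E y0 z" using nz1 y P cc by (auto simp: A1_def stp_def)
  moreover have "~ E v y2"
  proof
    assume "E v y2"
    moreover have "y0 ~= y2" using o y E_comm by metis
    ultimately show False using no_C4[of v y0 y1 y2] v0 v1 y s E_comm vP P by metis
  qed
  moreover have "~ E v y3"
  proof
    assume "E v y3"
    moreover have "y3 ~= z" using nz2 y by metis
    ultimately show False using no_C4[of v y3 y4 z] v0 v4 y z s E_comm vP P by metis
  qed
  ultimately show ?thesis using y z v0 v1 v4 s unfolding C7_def by (simp add: E_comm)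
qed

text \<open>A vertex outside would be the seventh on an induced path starting in \<open>B0\<close>:
  equal colours are non-adjacent, and any other chord would let the vertices appear at an earlier
  level. Hence five steps exhaust the chains.\<close>

lemma R_closed:
  assumes "u \<in> R" "w \<in> P" "E u w" "c w = a | c w = b"
  shows "w \<in> R"
proof (rule ccontr)
  assume nw: "w \<notin> R"
  have n: "w \<notin> B0" "w \<notin> A1" "w \<notin> B1" "w \<notin> A2" "w \<notin> B2" "w \<notin> A3" using nw by (auto simp: R_def)
  have cu: "c u ~= c w" using proper[of u w] RP[OF assms(1)] assms by blast
  have st: "w \<in> stp P c Q (c w)" if "u \<in> Q" for Q using that assms by (auto simp: stp_def)
  have cw: "c w = b"
  proof (rule ccontr)
    assume "c w ~= b"
    hence "c w = a" "c u = b" using assms(4) cu RP[OF assms(1)] by auto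
    hence "u \<in> B0 | u \<in> B1 | u \<in> B2" using assms(1) ab by (simp add: R_def level_defs)
    thus False using st[of B0] st[of B1] st[of B2] n \<open>c w = a\<close> unfolding A1_def A2_def A3_def by auto
  qed
  hence "c u = a" using cu RP[OF assms(1)] by auto
  hence "u \<notin> B0" "u \<notin> B1" "u \<notin> B2" using ab B0D[of u] by (auto simp: B1_def B2_def stp_def)
  moreover have "u \<notin> A1" "u \<notin> A2" using st[of A1] st[of A2] n cw unfolding B1_def B2_def by auto
  ultimately have u: "u \<in> A3" "u \<notin> A1" "u \<notin> A2" using assms(1) by (simp_all add: R_def)
  obtain y4 where 4: "y4 \<in> B2" "E y4 u" using u by (auto simp: A3_def stp_def)
  obtain y3 where 3: "y3 \<in> A2" "E y3 y4" using 4 by (auto simp: B2_def stp_def)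
  obtain y2 where 2: "y2 \<in> B1" "E y2 y3" using 3 by (auto simp: A2_def stp_def)
  obtain y1 where 1: "y1 \<in> A1" "E y1 y2" using 2 by (auto simp: B1_def stp_def)
  obtain y0 where 0: "y0 \<in> B0" "E y0 y1" using 1 by (auto simp: A1_def stp_def)
  have P: "y0 \<in> P" "y1 \<in> P" "y2 \<in> P" "y3 \<in> P" "y4 \<in> P" "u \<in> P"
    and cc: "c y0 = b" "c y1 = a" "c y2 = b" "c y3 = a" "c y4 = b" "c u = a"
    using 0 1 2 3 4 u B0D by (auto simp: level_defs)
  have s: "~ E y0 y2" "~ E y0 y4" "~ E y0 w" "~ E y1 y3" "~ E y1 u" "~ E y2 y4" "~ E y2 w" "~ E y3 u" "~ E y4 w"
    using proper cc cw P assms(2) by metis+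
  have "~ E y0 y3"
  proof
    assume "E y0 y3"
    hence "y3 \<in> A1" using 0 P cc by (auto simp: A1_def stp_def)
    hence "y4 \<in> B1" using 3 P cc by (auto simp: B1_def stp_def)
    thus False using u 4 P cc by (auto simp: A2_def stp_def)
  qed
  moreover have "~ E y1 y4"
  proof
    assume "E y1 y4"
    hence "y4 \<in> B1" using 1 P cc by (auto simp: B1_def stp_def)
    thus False using u 4 P cc by (auto simp: A2_def stp_def)
  qed
  moreover have "~ E y2 u" using u 2 P cc by (auto simp: A2_def stp_def)
  moreover have "~ E y0 u" using u 0 P cc by (auto simp: A1_def stp_def)
  moreover have "~ E y1 w" using n 1 assms cw by (auto simp: B1_def stp_def)
  moreover have "~ E y3 w" using n 3 assms cw by (auto simp: B2_def stp_def)
  ultimately show False using no_P7[of y0 y1 y2 y3 y4 u w] 0 1 2 3 4 assms(3) s by blast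
qed

definition swp :: "'a => nat" where
  "swp w = (if w \<in> R then if c w = a then b else a else c w)"

lemma swp_proper: "[|x \<in> P; y \<in> P; E x y|] ==> swp x ~= swp y"
  using proper[of x y] R_closed[of x y] R_closed[of y x] RP[of x] RP[of y] E_sym[of x y] ab unfolding swp_def by metis

lemma swp_other: "[|w \<in> P; d ~= a; d ~= b|] ==> swp w = d <-> c w = d"
  using RP[of w] by (auto simp: swp_def)

text \<open>Whenever a vertex of \<open>T\<close> with colour \<open>a\<close> is swapped, a vertex
  with colour \<open>b\<close> adjacent to it in \<open>T\<close> is swapped too: for
  \<open>A1\<close> this is immediate, for \<open>A2\<close> the alternative is a 5-cycle, and for
  \<open>A3\<close> it is assumed. Such cliques merely exchange the two colours, and the others lose
  \<open>b\<close> in favour of \<open>a\<close>. So every clique that keeps \<open>b\<close> has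
  \<open>a\<close>, and the other colours are undisturbed.\<close>

lemma swp_step:
  assumes bM: "b \<notin> c ` M" and tT: "!!z. [|z \<in> T; z \<in> A3; c z = a|] ==> \<exists>y\<in>T. c y = b & E y z"
    and old: "!!d y. [|d \<in> D; y \<in> T; c y = b|] ==> \<exists>z\<in>T. c z = d & E z y" and D: "a \<notin> D" "b \<notin> D"
  shows "b \<notin> swp ` M" "!!d y. [|d \<in> insert a D; y \<in> T; swp y = b|] ==> \<exists>z\<in>T. swp z = d & E z y"
proof -
  have nb: "\<exists>y\<in>T. y \<in> R & c y = b & E y z" if z: "z \<in> T" "z \<in> R" "c z = a" for z
  proof -
    have "\<exists>y\<in>T. c y = b & E y z"
    proof (cases "z \<in> A3")
      case False
      moreover have "z \<notin> B0" "z \<notin> B1" "z \<notin> B2" using z(3) ab B0D[of z] by (auto simp: B1_def B2_def stp_def)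
      ultimately have "z \<in> A1 | z \<in> A2" using z(2) by (simp add: R_def)
      thus ?thesis
      proof
        assume "z \<in> A1"
        then obtain y where "y \<in> B0" "E y z" by (auto simp: A1_def stp_def)
        thus ?thesis using B0D[of y] by blast
      next
        assume "z \<in> A2"
        show ?thesis
        proof (rule ccontr)
          assume n: "~ ?thesis"
          obtain x2 x1 x0 where x: "x2 \<in> P" "c x2 = b" "E x2 z" "x1 \<in> P" "c x1 = a" "E x1 x2" "x0 \<in> B0" "E x0 x1"
            using \<open>z \<in> A2\<close> unfolding A2_def B1_def A1_def stp_def by blast
          have x0: "x0 \<in> T" "c x0 = b" "~ E x1 v" using x(4,5,7,8) B0D[OF x(7)] Tv[OF x(4)] E_comm[of v x1] E_comm[of x0 x1] by (auto simp: B0_def)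
          have "~ E x2 v" using n x Tv[OF x(1)] E_comm by metis
          moreover have "~ E x0 z" using n x0 by blast
          moreover have "~ E x0 x2" "~ E x1 z" using proper[of x0 x2] proper[of x1 z] x x0 z TP by metis+
          ultimately show False using no_C5[of v x0 x1 x2 z] x x0 Tv[OF TP[OF z(1)]] Tv[OF TP[OF x0(1)]] z(1) E_comm by metis
        qed
      qed
    qed (use tT z in blast)
    thus ?thesis using R_closed[OF z(2)] TP E_sym by blast
  qed
  show "b \<notin> swp ` M"
  proof
    assume "b \<in> swp ` M"
    then obtain w where w: "w \<in> M" "swp w = b" by (metis imageE)
    have cb: "c w ~= b" using bM imageI[OF w(1), of c] by metis
    hence wR: "w \<in> R" using w(2) by (cases "w \<in> R") (simp_all add: swp_def)
    have cwa: "c w = a" using RP[OF wR] cb by blast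
    \<comment> \<open>If \<open>B0\<close> is empty, nothing is swapped. Otherwise a vertex of
      \<open>M\<close> with colour \<open>a\<close> would be adjacent to a member of
      \<open>B0\<close>, which the definition of \<open>B0\<close> forbids.\<close>
    have "B0 = {} ==> R = {}" by (simp add: R_def level_defs)
    then obtain y0 where y0: "y0 \<in> B0" using wR by blast
    have "y0 ~= w" using B0D[OF y0] cb by blast
    hence "E w y0" using M_adj[OF w(1), of y0] B0D[OF y0] E_sym by blast
    thus False using y0 MT[OF w(1)] cwa unfolding B0_def by blast
  qed
  fix d y assume d: "d \<in> insert a D" and y: "y \<in> T" "swp y = b"
  show "\<exists>z\<in>T. swp z = d & E z y"
  proof (cases "y \<in> R")
    case False
    hence cy: "c y = b" using y by (simp add: swp_def)
    show ?thesis
    proof (cases "d = a")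
      case True
      have "y \<notin> B0" using False by (auto simp: R_def)
      then obtain z where z: "z \<in> T" "c z = a" "E z y" using y cy by (auto simp: B0_def)
      have "z \<notin> R" using R_closed[of z y] z y cy False TP by blast
      hence "swp z = d" using z True by (simp add: swp_def)
      thus ?thesis using z by blast
    next
      case False
      then obtain z where "z \<in> T" "c z = d" "E z y" using old[of d y] d y cy by blast
      thus ?thesis using swp_other[of z d] TP D d False by blast
    qed
  next
    case True
    hence cy: "c y = a" using y(2) RP[OF True] ab by (cases "c y = a") (simp_all add: swp_def)
    obtain y' where y': "y' \<in> T" "y' \<in> R" "c y' = b" "E y' y" using nb[OF y(1) True cy] by blast
    show ?thesis
    proof (cases "d = a")
      case True
      hence "swp y' = d" using y' ab by (simp add: swp_def)
      thus ?thesis using y' by blast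
    next
      case False
      then obtain z where z: "z \<in> T" "c z = d" "E z y'" using old[of d y'] d y' by blast
      have "y' \<notin> M" using y'(3) bM by blast
      hence "E z y" using T_trans[of y' z y] y' z y E_sym cy False by blast
      thus ?thesis using z swp_other[of z d] TP D d False by blast
    qed
  qed
qed

end

context pcc_free begin

section \<open>Lower bounds and gluing of colourings\<close>

lemma clique_bound:
  fixes f :: "'a => nat"
  assumes z: "!!d. d < q ==> z d \<in> P & E v (z d)" "!!d e. [|d < q; e < q; d ~= e|] ==> E (z d) (z e)"
    and f: "!!x. x \<in> insert v P ==> f x < r" "!!x y. [|x \<in> insert v P; y \<in> insert v P; E x y|] ==> f x ~= f y"
  shows "q + 1 <= r"
proof -
  have "inj_on (f \<circ> z) {..<q}"
  proof (rule inj_onI)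
    fix d e assume "d \<in> {..<q}" "e \<in> {..<q}" "(f \<circ> z) d = (f \<circ> z) e"
    thus "d = e" using f(2)[of "z d" "z e"] z by auto
  qed
  hence "card ((f \<circ> z) ` {..<q}) = q" using card_image by fastforce
  moreover have "f v \<notin> (f \<circ> z) ` {..<q}" using f(2)[of v] z by force
  ultimately have "card (insert (f v) ((f \<circ> z) ` {..<q})) = q + 1" by simp
  moreover have "insert (f v) ((f \<circ> z) ` {..<q}) \<subseteq> {..<r}" using f(1) z by auto
  hence "card (insert (f v) ((f \<circ> z) ` {..<q})) <= r" using card_mono[of "{..<r}"] by fastforce
  ultimately show ?thesis by simp
qed

text \<open>On a component of \<open>Z\<close> the new colours arise from the old ones by one
  injective map that also carries the colours of the adjacent vertices of \<open>U\<close> and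
  \<open>W\<close>, so properness is inherited from \<open>c\<close>. The old colouring says nothing
  about \<open>v\<close>, hence \<open>W - {v}\<close>; but \<open>v\<close> has no neighbour in
  \<open>Z\<close>.\<close>

lemma recolor_proper:
  fixes c nw :: "'a => nat" and \<pi> :: "'b => nat => nat"
  assumes c: "!!x y. [|x \<in> U \<union> (W - {v}) \<union> Z; y \<in> U \<union> (W - {v}) \<union> Z; E x y|] ==> c x ~= c y"
    and dj: "U \<inter> W = {}" "U \<inter> Z = {}" "W \<inter> Z = {}" and vZ: "!!y. y \<in> Z ==> ~ E v y" "v \<in> W"
    and nW: "!!x y. [|x \<in> W; y \<in> W; E x y|] ==> nw x ~= nw y" "!!x. x \<in> W ==> nw x \<notin> c ` U"
    and l: "!!x y. [|x \<in> Z; y \<in> Z; E x y|] ==> l x = l y" and inj: "!!y. y \<in> Z ==> inj (\<pi> (l y))"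
    and piW: "!!w y. [|w \<in> W; y \<in> Z; E w y|] ==> \<pi> (l y) (c w) = nw w" and piU: "!!x y. [|x \<in> U; y \<in> Z|] ==> \<pi> (l y) (c x) = c x"
  defines "c' \<equiv> %x. if x \<in> Z then \<pi> (l x) (c x) else if x \<in> W then nw x else c x"
  assumes xy: "x \<in> U \<union> W \<union> Z" "y \<in> U \<union> W \<union> Z" "E x y"
  shows "c' x ~= c' y"
proof -
  have ZZ: "c' x ~= c' y" if "x \<in> Z" "y \<in> Z" "E x y" for x y
    using c[of x y] l[of x y] inj[of x] that by (auto simp: c'_def dest: injD)
  have WZ: "c' x ~= c' y" if "x \<in> W" "y \<in> Z" "E x y" for x y
  proof -
    have "x ~= v" using vZ that by blast
    hence "c x ~= c y" using c[of x y] that by blast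
    moreover have "c' x = \<pi> (l y) (c x)" "c' y = \<pi> (l y) (c y)" using piW[of x y] that dj by (auto simp: c'_def)
    ultimately show ?thesis using inj[of y] that by (auto dest: injD)
  qed
  have UZ: "c' x ~= c' y" if "x \<in> U" "y \<in> Z" "E x y" for x y
  proof -
    have "c x ~= c y" using c[of x y] that by blast
    moreover have "c' x = \<pi> (l y) (c x)" "c' y = \<pi> (l y) (c y)" using piU[of x y] that dj by (auto simp: c'_def)
    ultimately show ?thesis using inj[of y] that by (auto dest: injD)
  qed
  have WW: "c' x ~= c' y" if "x \<in> W" "y \<in> W" "E x y" for x y using nW(1)[OF that] that dj by (auto simp: c'_def)
  have UW: "c' x ~= c' y" if "x \<in> U" "y \<in> W" for x y
  proof -
    have "c x ~= nw y" using nW(2)[OF that(2)] imageI[OF that(1), of c] by metis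
    moreover have "x \<notin> W" "x \<notin> Z" "y \<notin> Z" using that dj by auto
    ultimately show ?thesis using that by (simp add: c'_def)
  qed
  have UU: "c' x ~= c' y" if "x \<in> U" "y \<in> U" "E x y" for x y using c[of x y] that dj by (auto simp: c'_def)
  show ?thesis using xy ZZ[of x y] WZ[of x y] WZ[of y x] UZ[of x y] UZ[of y x] WW[of x y] UW[of x y] UW[of y x] UU[of x y] E_sym[of x y]
    by (metis Un_iff)
qed

text \<open>A shortest path with six edges would already be an induced path on seven
  vertices.\<close>

lemma diameter:
  assumes Z: "conn Y" "x \<in> Y" "y \<in> Y"
  obtains k f where "k <= 5" "f 0 = x" "f k = y" "!!i. i < k ==> E (f i) (f (Suc i))" "!!i. i <= k ==> f i \<in> Y"
proof -
  have "(x, y) \<in> {(a, b). a \<in> Y & b \<in> Y & E a b}\<^sup>*" using Z by (auto simp: conn_def)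
  then obtain k0 f0 where "f0 0 = x" "f0 k0 = y" "\<forall>i<k0. E (f0 i) (f0 (Suc i))" "\<forall>i\<le>k0. f0 i \<in> Y"
    by (rule rtrancl_walk[OF _ Z(2)])
  hence "walk Y x {y} k0 f0" by (auto simp: walk_def)
  then obtain k f where w: "walk Y x {y} k f" and n: "!!i j. i + 1 < j ==> j <= k ==> ~ E (f i) (f j)"
    by (rule shortest_walk) blast
  have f: "f 0 = x" "f k = y" "!!i. i < k ==> E (f i) (f (Suc i))" "!!i. 0 < i ==> i < k ==> f i \<in> Y"
    using w by (auto simp: walk_def)
  have "k <= 5"
  proof (rule ccontr)
    assume "~ k <= 5"
    hence k: "6 <= k" by simp
    have "E (f 0) (f 1)" "E (f 1) (f 2)" "E (f 2) (f 3)" "E (f 3) (f 4)" "E (f 4) (f 5)" "E (f 5) (f 6)"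
      using f(3)[of 0] f(3)[of 1] f(3)[of 2] f(3)[of 3] f(3)[of 4] f(3)[of 5] k by (simp_all add: eval_nat_numeral)
    thus False using no_P7[of "f 0" "f 1" "f 2" "f 3" "f 4" "f 5" "f 6"] n k by simp
  qed
  moreover have "f i \<in> Y" if "i <= k" for i using f(1,2,4) Z(2,3) that by (cases "i = 0 | i = k") auto
  ultimately show thesis using that f by blast
qed

end

section \<open>A language with bounded loops and its compiler\<close>

datatype xop = OAdd | OSub | OMul | ODiv | OMod | OLess | OEq | OMin

text \<open>Values are unbounded natural numbers and every loop runs exactly \<open>n\<close> times,
  so termination is automatic and cost can be read off the syntax. The word bound returns only as a
  side condition of the compiler.\<close>

datatype xe = XC nat | XV name | XR name xe | XO xop xe xe | XIf xe xe xe | XSum name xe | XMax name xe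

datatype xc = XSkip | XAsg name xe | XPut name xe xe | XSeq xc xc | XIfC xe xc xc | XFor name xc

abbreviation nn :: "state => nat" where "nn s \<equiv> scalar s ''n''"

primrec opval :: "xop => nat => nat => nat" where
  "opval OAdd a b = a + b"
| "opval OSub a b = a - b"
| "opval OMul a b = a * b"
| "opval ODiv a b = a div b"
| "opval OMod a b = a mod b"
| "opval OLess a b = (if a < b then 1 else 0)"
| "opval OEq a b = (if a = b then 1 else 0)"
| "opval OMin a b = min a b"

primrec xval :: "xe => state => nat" where
  "xval (XC k) s = k"
| "xval (XV x) s = scalar s x"
| "xval (XR a e) s = array s a (xval e s)"
| "xval (XO p e f) s = opval p (xval e s) (xval f s)"
| "xval (XIf b e f) s = (if xval b s ~= 0 then xval e s else xval f s)"
| "xval (XSum i e) s = (\<Sum>j<nn s. xval e (set_scalar i j s))"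
| "xval (XMax i e) s = Max (insert 0 ((%j. xval e (set_scalar i j s)) ` {..<nn s}))"

primrec iter :: "(nat => 's => 's) => 's => nat => 's" where
  "iter f s 0 = s"
| "iter f s (Suc j) = f j (iter f s j)"

primrec xsem :: "xc => state => state" where
  "xsem XSkip s = s"
| "xsem (XAsg x e) s = set_scalar x (xval e s) s"
| "xsem (XPut a e f) s = set_array a (xval e s) (xval f s) s"
| "xsem (XSeq p q) s = xsem q (xsem p s)"
| "xsem (XIfC b p q) s = (if xval b s ~= 0 then xsem p s else xsem q s)"
| "xsem (XFor i p) s = set_scalar i 0 (iter (%j s. xsem p (set_scalar i j s)) s (nn s))"

text \<open>The constants 30 and 60 are generous bounds for the cost of the compiled fragments and
  avoid exact bookkeeping.\<close>

primrec etime :: "xe => state => nat" where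
  "etime (XC k) s = 30"
| "etime (XV x) s = 30"
| "etime (XR a e) s = etime e s + 30"
| "etime (XO p e f) s = etime e s + etime f s + 30"
| "etime (XIf b e f) s = etime b s + (if xval b s ~= 0 then etime e s else etime f s) + 30"
| "etime (XSum i e) s = (\<Sum>j<nn s. etime e (set_scalar i j s) + 30) + 60"
| "etime (XMax i e) s = (\<Sum>j<nn s. etime e (set_scalar i j s) + 30) + 60"

primrec ctime :: "xc => state => nat" where
  "ctime XSkip s = 30"
| "ctime (XAsg x e) s = etime e s + 30"
| "ctime (XPut a e f) s = etime e s + etime f s + 60"
| "ctime (XSeq p q) s = ctime p s + ctime q (xsem p s)"
| "ctime (XIfC b p q) s = etime b s + (if xval b s ~= 0 then ctime p s else ctime q s) + 30"
| "ctime (XFor i p) s = (\<Sum>j<nn s. ctime p (set_scalar i j (iter (%j s. xsem p (set_scalar i j s)) s j)) + 30) + 60"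

text \<open>Temporaries form a stack indexed by depth; the leading \<open>#\<close> keeps them apart
  from the names of a program, which are \<open>good\<close>.\<close>

definition tmp :: "nat => name" where "tmp d = CHR ''#'' # replicate d CHR ''x''"

definition good :: "name => bool" where "good x <-> take 1 x ~= ''#''"

lemma tmp_inj [simp]: "tmp d = tmp d' <-> d = d'"
  by (auto simp: tmp_def dest: arg_cong[of _ _ length])

lemma good_tmp: "good x ==> x ~= tmp d"
  by (auto simp: good_def tmp_def)

abbreviation tv :: "nat => aexp" where "tv d \<equiv> Var (tmp d)"

fun opc :: "xop => nat => com" where
  "opc OAdd d = Assign (tmp d) (Add (tv d) (tv (d + 1)))"
| "opc OSub d = Assign (tmp d) (Sub (tv d) (tv (d + 1)))"
| "opc OMul d = Assign (tmp d) (Mul (tv d) (tv (d + 1)))"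
| "opc ODiv d = Assign (tmp d) (Div (tv d) (tv (d + 1)))"
| "opc OMod d = Assign (tmp d) (Mod (tv d) (tv (d + 1)))"
| "opc OLess d = If (Less (tv d) (tv (d + 1))) (Assign (tmp d) (Const 1)) (Assign (tmp d) (Const 0))"
| "opc OEq d = If (Equal (tv d) (tv (d + 1))) (Assign (tmp d) (Const 1)) (Assign (tmp d) (Const 0))"
| "opc OMin d = If (Less (tv d) (tv (d + 1))) (Assign (tmp d) (tv d)) (Assign (tmp d) (tv (d + 1)))"

definition clear :: "nat => com" where "clear d = Assign (tmp d) (Const 0)"

definition loop :: "name => com => com" where
  "loop i p = While (Less (Var i) (Var ''n'')) (Seq p (Assign i (Add (Var i) (Const 1))))"

text \<open>The value is left in \<open>tmp d\<close>, while all temporaries above \<open>d\<close>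
  are 0 before and afterwards. A loop saves its counter in \<open>tmp (d + 1)\<close> and restores
  it, so evaluating an expression changes nothing but \<open>tmp d\<close>.\<close>

primrec ce :: "xe => nat => com" where
  "ce (XC k) d = Assign (tmp d) (Const k)"
| "ce (XV x) d = Assign (tmp d) (Var x)"
| "ce (XR a e) d = Seq (ce e d) (Assign (tmp d) (Read a (tv d)))"
| "ce (XO p e f) d = Seq (ce e d) (Seq (ce f (d + 1)) (Seq (opc p d) (clear (d + 1))))"
| "ce (XIf b e f) d = Seq (ce b d) (If (Less (Const 0) (tv d)) (ce e d) (ce f d))"
| "ce (XSum i e) d = Seq (Assign (tmp (d + 1)) (Var i)) (Seq (clear d) (Seq (Assign i (Const 0))
    (Seq (loop i (Seq (ce e (d + 2)) (Seq (Assign (tmp d) (Add (tv d) (tv (d + 2)))) (clear (d + 2)))))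
    (Seq (Assign i (tv (d + 1))) (clear (d + 1))))))"
| "ce (XMax i e) d = Seq (Assign (tmp (d + 1)) (Var i)) (Seq (clear d) (Seq (Assign i (Const 0))
    (Seq (loop i (Seq (ce e (d + 2)) (Seq (If (Less (tv d) (tv (d + 2))) (Assign (tmp d) (tv (d + 2))) (Assign (tmp d) (tv d))) (clear (d + 2)))))
    (Seq (Assign i (tv (d + 1))) (clear (d + 1))))))"

primrec cc :: "xc => com" where
  "cc XSkip = Skip"
| "cc (XAsg x e) = Seq (ce e 0) (Seq (Assign x (tv 0)) (clear 0))"
| "cc (XPut a e f) = Seq (ce e 0) (Seq (ce f 1) (Seq (Write a (tv 0) (tv 1)) (Seq (clear 0) (clear 1))))"
| "cc (XSeq p q) = Seq (cc p) (cc q)"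
| "cc (XIfC b p q) = Seq (ce b 0) (If (Less (Const 0) (tv 0)) (Seq (clear 0) (cc p)) (Seq (clear 0) (cc q)))"
| "cc (XFor i p) = Seq (Assign i (Const 0)) (Seq (loop i (cc p)) (Assign i (Const 0)))"

text \<open>A degree \<open>d\<close> stands for the value bound \<open>(n + 1) ^ d\<close>.\<close>

primrec xdg :: "(name => nat) => xe => nat" where
  "xdg \<Gamma> (XC k) = k - 1"
| "xdg \<Gamma> (XV x) = \<Gamma> x"
| "xdg \<Gamma> (XR a e) = \<Gamma> a"
| "xdg \<Gamma> (XO p e f) = (case p of OAdd => max (xdg \<Gamma> e) (xdg \<Gamma> f) + 1 | OSub => xdg \<Gamma> e | OMul => xdg \<Gamma> e + xdg \<Gamma> f
    | ODiv => xdg \<Gamma> e | OMod => xdg \<Gamma> e | OLess => 0 | OEq => 0 | OMin => min (xdg \<Gamma> e) (xdg \<Gamma> f))"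
| "xdg \<Gamma> (XIf b e f) = max (xdg \<Gamma> e) (xdg \<Gamma> f)"
| "xdg \<Gamma> (XSum i e) = 1 + xdg \<Gamma> e"
| "xdg \<Gamma> (XMax i e) = xdg \<Gamma> e"

primrec xok :: "(name => nat) => nat => xe => bool" where
  "xok \<Gamma> k (XC c) <-> c - 1 < k"
| "xok \<Gamma> k (XV x) <-> good x & \<Gamma> x < k"
| "xok \<Gamma> k (XR a e) <-> xok \<Gamma> k e & \<Gamma> a < k"
| "xok \<Gamma> k (XO p e f) <-> xok \<Gamma> k e & xok \<Gamma> k f & xdg \<Gamma> (XO p e f) < k"
| "xok \<Gamma> k (XIf b e f) <-> xok \<Gamma> k b & xok \<Gamma> k e & xok \<Gamma> k f"
| "xok \<Gamma> k (XSum i e) <-> xok \<Gamma> k e & good i & i ~= ''n'' & 1 <= \<Gamma> i & \<Gamma> i < k & 1 + xdg \<Gamma> e < k"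
| "xok \<Gamma> k (XMax i e) <-> xok \<Gamma> k e & good i & i ~= ''n'' & 1 <= \<Gamma> i & \<Gamma> i < k"

primrec wrs :: "xc => name set" where
  "wrs XSkip = {}"
| "wrs (XAsg x e) = {x}"
| "wrs (XPut a e f) = {}"
| "wrs (XSeq p q) = wrs p \<union> wrs q"
| "wrs (XIfC b p q) = wrs p \<union> wrs q"
| "wrs (XFor i p) = insert i (wrs p)"

primrec wra :: "xc => name set" where
  "wra XSkip = {}"
| "wra (XAsg x e) = {}"
| "wra (XPut a e f) = {a}"
| "wra (XSeq p q) = wra p \<union> wra q"
| "wra (XIfC b p q) = wra p \<union> wra q"
| "wra (XFor i p) = wra p"

primrec xck :: "(name => nat) => nat => xc => bool" where
  "xck \<Gamma> k XSkip <-> True"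
| "xck \<Gamma> k (XAsg x e) <-> xok \<Gamma> k e & xdg \<Gamma> e <= \<Gamma> x & good x & x ~= ''n''"
| "xck \<Gamma> k (XPut a e f) <-> xok \<Gamma> k e & xok \<Gamma> k f & xdg \<Gamma> f <= \<Gamma> a"
| "xck \<Gamma> k (XSeq p q) <-> xck \<Gamma> k p & xck \<Gamma> k q"
| "xck \<Gamma> k (XIfC b p q) <-> xok \<Gamma> k b & xck \<Gamma> k p & xck \<Gamma> k q"
| "xck \<Gamma> k (XFor i p) <-> xck \<Gamma> k p & good i & i ~= ''n'' & 1 <= \<Gamma> i & \<Gamma> i < k & i \<notin> wrs p"

definition bounded :: "(name => nat) => state => bool" where
  "bounded \<Gamma> s <-> (\<forall>x. good x --> scalar s x <= (nn s + 1) ^ \<Gamma> x) & (\<forall>a i. array s a i <= (nn s + 1) ^ \<Gamma> a)"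

lemma scalar_set_scalar [simp]: "scalar (set_scalar x v s) y = (if y = x then v else scalar s y)"
  and array_set_scalar [simp]: "array (set_scalar x v s) = array s"
  and scalar_set_array [simp]: "scalar (set_array a i v s) = scalar s"
  and array_set_array [simp]: "array (set_array a i v s) b = (if b = a then (array s a)(i := v) else array s b)"
  by (simp_all add: set_scalar_def set_array_def)

lemma state_eqI: "(!!x. scalar s x = scalar s' x) ==> (!!a. array s a = array s' a) ==> s = (s' :: state)"
  by (intro state.equality) auto

lemma good_n [simp]: "good ''n''" by (simp add: good_def)

lemma bounded_set_scalar:
  "bounded \<Gamma> s ==> x ~= ''n'' ==> (good x ==> v <= (nn s + 1) ^ \<Gamma> x) ==> bounded \<Gamma> (set_scalar x v s)"
  by (auto simp: bounded_def)

lemma le_pow1: "1 <= d ==> j <= n ==> j <= (n + 1 :: nat) ^ d"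
  using power_increasing[of 1 d "n + 1"] by simp

text \<open>The base \<open>n + 1\<close> is at least 2, which justifies the degree
  \<open>k - 1\<close> for a constant \<open>k\<close> in \<open>xdg\<close> and one additional
  degree for a sum.\<close>

lemma const_pow: "1 <= n ==> k <= (n + 1 :: nat) ^ (k - 1)"
  using less_exp[of "k - 1"] power_mono[of 2 "n + 1" "k - 1"] by linarith

lemma pow_le: "a <= b ==> (n + 1 :: nat) ^ a <= (n + 1) ^ b"
  by (rule power_increasing) auto

lemma xval_le:
  assumes "xok \<Gamma> k e" "bounded \<Gamma> s" "1 <= nn s"
  shows "xval e s <= (nn s + 1) ^ xdg \<Gamma> e"
  using assms
proof (induction e arbitrary: s)
  case (XC c)
  thus ?case using const_pow by simp
next
  case (XO p e f)
  let ?N = "nn s + 1"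
  have e: "xval e s <= ?N ^ xdg \<Gamma> e" and f: "xval f s <= ?N ^ xdg \<Gamma> f" using XO by auto
  show ?case
  proof (cases p)
    case OAdd
    have "xval e s + xval f s <= ?N ^ max (xdg \<Gamma> e) (xdg \<Gamma> f) + ?N ^ max (xdg \<Gamma> e) (xdg \<Gamma> f)"
      using e f pow_le[of "xdg \<Gamma> e" "max (xdg \<Gamma> e) (xdg \<Gamma> f)" "nn s"] pow_le[of "xdg \<Gamma> f" "max (xdg \<Gamma> e) (xdg \<Gamma> f)" "nn s"] by auto
    also have "\<dots> = 2 * ?N ^ max (xdg \<Gamma> e) (xdg \<Gamma> f)" by simp
    also have "\<dots> <= ?N * ?N ^ max (xdg \<Gamma> e) (xdg \<Gamma> f)" using XO(5) by (intro mult_right_mono) auto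
    finally show ?thesis using OAdd by simp
  next
    case OMul
    thus ?thesis using mult_mono[OF e f] by (simp add: power_add)
  next
    case OMin
    thus ?thesis using e f by (auto simp: min_def)
  qed (use e f in "auto intro: order_trans[OF diff_le_self] order_trans[OF div_le_dividend] order_trans[OF mod_less_eq_dividend]")
next
  case (XIf b e f)
  have "xval e s <= (nn s + 1) ^ max (xdg \<Gamma> e) (xdg \<Gamma> f)"
    by (rule order_trans[OF _ pow_le[of "xdg \<Gamma> e"]]) (use XIf in auto)
  moreover have "xval f s <= (nn s + 1) ^ max (xdg \<Gamma> e) (xdg \<Gamma> f)"
    by (rule order_trans[OF _ pow_le[of "xdg \<Gamma> f"]]) (use XIf in auto)
  ultimately show ?case by simp
next
  case (XSum i e)
  have "xval e (set_scalar i j s) <= (nn s + 1) ^ xdg \<Gamma> e" if "j < nn s" for j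
  proof -
    have "bounded \<Gamma> (set_scalar i j s)" by (rule bounded_set_scalar) (use XSum.prems that le_pow1[of "\<Gamma> i" j "nn s"] in auto)
    thus ?thesis using XSum.IH[of "set_scalar i j s"] XSum.prems by auto
  qed
  hence "xval (XSum i e) s <= (\<Sum>j<nn s. (nn s + 1) ^ xdg \<Gamma> e)" unfolding xval.simps by (intro sum_mono) simp
  thus ?case by simp
next
  case (XMax i e)
  have "xval e (set_scalar i j s) <= (nn s + 1) ^ xdg \<Gamma> e" if "j < nn s" for j
  proof -
    have "bounded \<Gamma> (set_scalar i j s)" by (rule bounded_set_scalar) (use XMax.prems that le_pow1[of "\<Gamma> i" j "nn s"] in auto)
    thus ?thesis using XMax.IH[of "set_scalar i j s"] XMax.prems by auto
  qed
  thus ?case by auto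
qed (auto simp: bounded_def)

lemma xdg_less: "xok \<Gamma> k e ==> xdg \<Gamma> e < k"
  by (induction e) auto

lemma xval_less:
  assumes "xok \<Gamma> k e" "bounded \<Gamma> s" "1 <= nn s"
  shows "xval e s < (nn s + 1) ^ k"
  using order.strict_trans1[OF xval_le[OF assms]] power_strict_increasing[OF xdg_less[OF assms(1)], of "nn s + 1"] assms(3) by auto

lemma xval_tmp: "xok \<Gamma> k e ==> xval e (set_scalar (tmp d) v s) = xval e s"
proof (induction e arbitrary: s)
  case (XSum i e)
  have "set_scalar i j (set_scalar (tmp d) v s) = set_scalar (tmp d) v (set_scalar i j s)" for j
    by (rule state_eqI) (use XSum good_tmp in auto)
  thus ?case using XSum good_tmp[of "''n''" d] by simp
next
  case (XMax i e)
  have "set_scalar i j (set_scalar (tmp d) v s) = set_scalar (tmp d) v (set_scalar i j s)" for j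
    by (rule state_eqI) (use XMax good_tmp in auto)
  thus ?case using XMax good_tmp[of "''n''" d] by simp
qed (auto simp: good_tmp)

lemma bounded_tmp: "bounded \<Gamma> s ==> bounded \<Gamma> (set_scalar (tmp d) v s)"
  using good_tmp by (auto simp: bounded_def)

section \<open>Executions within a time budget\<close>

definition runs :: "nat => com => state => nat => state => bool" where
  "runs W p s b s' <-> (\<exists>t\<le>b. exec W p s t s')"

lemma runs_mono: "runs W p s b s' ==> b <= b' ==> runs W p s b' s'"
  unfolding runs_def using order_trans by blast

lemma runs_Seq: "runs W p s b s' ==> runs W q s' b' s'' ==> runs W (Seq p q) s (b + b') s''"
  unfolding runs_def by (meson exec.Seq add_mono)

lemma runs_Assign: "s' = set_scalar x (aval W s e) s ==> acost e <= 5 ==> runs W (Assign x e) s 6 s'"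
  unfolding runs_def by (rule exI[of _ "1 + acost e"]) (use exec.Assign in auto)

lemma runs_Write: "s' = set_array a (aval W s e) (aval W s f) s ==> acost e + acost f <= 5 ==> runs W (Write a e f) s 6 s'"
  unfolding runs_def by (rule exI[of _ "1 + acost e + acost f"]) (use exec.Write in auto)

lemma runs_If: "runs W (if bval W s c then p else q) s b s' ==> bcost c <= 5 ==> runs W (If c p q) s (b + 6) s'"
proof -
  assume r: "runs W (if bval W s c then p else q) s b s'" and c: "bcost c <= 5"
  from r obtain t where t: "t <= b" "exec W (if bval W s c then p else q) s t s'" by (auto simp: runs_def)
  have "exec W (If c p q) s (1 + bcost c + t) s'"
    using t(2) exec.IfTrue[of W s c p t s' q] exec.IfFalse[of W s c q t s' p] by (cases "bval W s c") auto
  thus ?thesis unfolding runs_def using t(1) c by (intro exI[of _ "1 + bcost c + t"]) auto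
qed

lemma runs_IfA:
  assumes "s' = (if bval W s c then set_scalar x (aval W s e) s else set_scalar x (aval W s f) s)" "bcost c <= 5" "acost e <= 5" "acost f <= 5"
  shows "runs W (If c (Assign x e) (Assign x f)) s 12 s'"
  using runs_If[of W s c "Assign x e" "Assign x f" 6 s'] assms runs_Assign by auto

lemma runs_clear: "runs W (clear d) s 6 (set_scalar (tmp d) 0 s)"
  unfolding clear_def by (rule runs_Assign) auto

text \<open>\<open>st j\<close> is the state at the \<open>j\<close>-th test of the guard and
  \<open>st' j\<close> the state after the \<open>j\<close>-th run of the body. The induction goes
  backwards from the test that fails.\<close>

lemma runs_loop:
  assumes step: "!!j. j < N ==> runs W p (st j) (T j) (st' j)"
    and nxt: "!!j. j < N ==> st (Suc j) = set_scalar i (Suc j) (st' j)"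
    and i: "!!j. j <= N ==> scalar (st j) i = j" "!!j. j < N ==> scalar (st' j) i = j" "!!j. j <= N ==> nn (st j) = N" and W: "N < W"
  shows "runs W (loop i p) (st 0) ((\<Sum>j<N. T j + 10) + 5) (st N)"
proof -
  have "runs W (loop i p) (st (N - m)) ((\<Sum>j=N-m..<N. T j + 10) + 5) (st N)" if "m <= N" for m
    using that
  proof (induction m)
    case 0
    have "exec W (loop i p) (st N) (1 + bcost (Less (Var i) (Var ''n''))) (st N)"
      unfolding loop_def by (rule exec.WhileFalse) (use i in simp)
    thus ?case unfolding runs_def by (intro exI conjI) auto
  next
    case (Suc m)
    define j where "j = N - Suc m"
    have j: "j < N" "N - m = Suc j" using Suc by (auto simp: j_def)
    obtain t where t: "t <= T j" "exec W p (st j) t (st' j)" using step[OF j(1)] by (auto simp: runs_def)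
    obtain t' where t': "t' <= (\<Sum>j=Suc j..<N. T j + 10) + 5" "exec W (loop i p) (st (Suc j)) t' (st N)"
      using Suc j by (auto simp: runs_def)
    have "aval W (st' j) (Add (Var i) (Const 1)) = Suc j" using i(2)[OF j(1)] j W by simp
    hence "exec W (Assign i (Add (Var i) (Const 1))) (st' j) (1 + acost (Add (Var i) (Const 1))) (st (Suc j))"
      using exec.Assign[of W i "Add (Var i) (Const 1)" "st' j"] nxt[OF j(1)] by simp
    hence b: "exec W (Seq p (Assign i (Add (Var i) (Const 1)))) (st j) (t + 4) (st (Suc j))"
      using exec.Seq[OF t(2), of "Assign i (Add (Var i) (Const 1))" 4] by (simp add: numeral_eq_Suc)
    have g: "bval W (st j) (Less (Var i) (Var ''n''))" using i j by simp
    have "exec W (loop i p) (st j) (1 + bcost (Less (Var i) (Var ''n'')) + (t + 4) + t') (st N)"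
      using exec.WhileTrue[OF g b] t'(2) unfolding loop_def by blast
    moreover have "1 + bcost (Less (Var i) (Var ''n'')) + (t + 4) + t' <= (\<Sum>j=j..<N. T j + 10) + 5"
      using t t' j by (simp add: sum.atLeast_Suc_lessThan)
    ultimately show ?case unfolding runs_def j_def by blast
  qed
  from this[of N] show ?thesis by (simp add: atLeast0LessThan)
qed

lemma etime_tmp: "xok \<Gamma> k e ==> etime e (set_scalar (tmp d) v s) = etime e s"
proof (induction e arbitrary: s)
  case (XSum i e)
  have "set_scalar i j (set_scalar (tmp d) v s) = set_scalar (tmp d) v (set_scalar i j s)" for j
    by (rule state_eqI) (use XSum good_tmp in auto)
  thus ?case using XSum good_tmp[of "''n''" d] by simp
next
  case (XMax i e)
  have "set_scalar i j (set_scalar (tmp d) v s) = set_scalar (tmp d) v (set_scalar i j s)" for j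
    by (rule state_eqI) (use XMax good_tmp in auto)
  thus ?case using XMax good_tmp[of "''n''" d] by simp
qed (auto simp: good_tmp xval_tmp)

lemma runs_op:
  assumes "opval p (scalar s (tmp d)) (scalar s (tmp (d + 1))) < W" "1 < W"
  shows "runs W (opc p d) s 12 (set_scalar (tmp d) (opval p (scalar s (tmp d)) (scalar s (tmp (d + 1)))) s)"
  by (cases p) (use assms in "auto intro!: runs_mono[OF runs_Assign, where b' = 12] runs_IfA simp: min_def")

text \<open>Common to sums and maxima: \<open>acc j\<close> is the content of \<open>tmp d\<close>
  after \<open>j\<close> rounds, \<open>tmp (d + 1)\<close> holds the saved loop variable, and
  \<open>tmp (d + 2)\<close> receives the value of the body.\<close>

lemma runs_acc:
  fixes acc val :: "nat => nat"
  assumes i: "good i" "i ~= ''n''" and z: "!!d'. d' > d ==> scalar s (tmp d') = 0" and W: "nn s < W"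
    and st: "!!j. st j = set_scalar i j (set_scalar (tmp d) (acc j) (set_scalar (tmp (d + 1)) (scalar s i) s))"
    and body: "!!j. j < nn s ==> runs W p (st j) (T j) (set_scalar (tmp (d + 2)) (val j) (st j))"
    and opr: "!!j s'. [|j < nn s; scalar s' (tmp d) = acc j; scalar s' (tmp (d + 2)) = val j|] ==> runs W q s' 12 (set_scalar (tmp d) (acc (Suc j)) s')"
    and acc0: "acc 0 = 0"
  shows "runs W (Seq (Assign (tmp (d + 1)) (Var i)) (Seq (clear d) (Seq (Assign i (Const 0))
    (Seq (loop i (Seq p (Seq q (clear (d + 2)))))
    (Seq (Assign i (tv (d + 1))) (clear (d + 1))))))) s ((\<Sum>j<nn s. T j + 30) + 60) (set_scalar (tmp d) (acc (nn s)) s)"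
proof -
  note gt = good_tmp[OF i(1)] good_tmp[OF good_n]
  define st' where "st' j = set_scalar i j (set_scalar (tmp d) (acc (Suc j)) (set_scalar (tmp (d + 1)) (scalar s i) s))" for j
  have b: "runs W (Seq p (Seq q (clear (d + 2)))) (st j) (T j + (12 + 6)) (st' j)" if j: "j < nn s" for j
  proof (rule runs_Seq[OF body[OF j]], rule runs_Seq)
    show "runs W q (set_scalar (tmp (d + 2)) (val j) (st j)) 12 (set_scalar (tmp d) (acc (Suc j)) (set_scalar (tmp (d + 2)) (val j) (st j)))"
      by (rule opr[OF j]) (use gt in "auto simp: st")
    have "st' j = set_scalar (tmp (d + 2)) 0 (set_scalar (tmp d) (acc (Suc j)) (set_scalar (tmp (d + 2)) (val j) (st j)))"
      by (rule state_eqI) (use gt z[of "d + 2"] in "auto simp: st st'_def")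
    thus "runs W (clear (d + 2)) (set_scalar (tmp d) (acc (Suc j)) (set_scalar (tmp (d + 2)) (val j) (st j))) 6 (st' j)"
      using runs_clear by metis
  qed
  have L: "runs W (loop i (Seq p (Seq q (clear (d + 2))))) (st 0) ((\<Sum>j<nn s. T j + (12 + 6) + 10) + 5) (st (nn s))"
  proof (rule runs_loop[where st' = st'])
    show "st (Suc j) = set_scalar i (Suc j) (st' j)" for j
      by (rule state_eqI) (auto simp: st st'_def)
  qed (use b gt i W in "auto simp: st st'_def")
  have s0: "st 0 = set_scalar i 0 (set_scalar (tmp d) 0 (set_scalar (tmp (d + 1)) (scalar s i) s))" by (simp add: st acc0)
  have fin: "set_scalar (tmp d) (acc (nn s)) s = set_scalar (tmp (d + 1)) 0 (set_scalar i (scalar s i) (st (nn s)))"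
    by (rule state_eqI) (use gt z[of "d + 1"] in "auto simp: st")
  have "runs W (Seq (Assign (tmp (d + 1)) (Var i)) (Seq (clear d) (Seq (Assign i (Const 0))
    (Seq (loop i (Seq p (Seq q (clear (d + 2)))))
    (Seq (Assign i (tv (d + 1))) (clear (d + 1))))))) s (6 + (6 + (6 + (((\<Sum>j<nn s. T j + (12 + 6) + 10) + 5) + (6 + 6))))) (set_scalar (tmp d) (acc (nn s)) s)"
    unfolding fin
    by (rule runs_Seq[OF runs_Assign[OF refl] runs_Seq[OF runs_clear runs_Seq[OF runs_Assign runs_Seq[OF L runs_Seq[OF runs_Assign runs_clear]]]]])
      (use gt in "auto simp: acc0 st")
  thus ?thesis by (rule runs_mono) (auto simp: sum.distrib)
qed

lemma ce_correct:
  assumes "xok \<Gamma> k e" "bounded \<Gamma> s" "1 <= nn s" "W = (nn s + 1) ^ k" "!!d'. d' > d ==> scalar s (tmp d') = 0"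
  shows "runs W (ce e d) s (etime e s) (set_scalar (tmp d) (xval e s) s)"
  using assms
proof (induction e arbitrary: s d)
  case (XC c)
  hence "c < W" using xval_less[of \<Gamma> k "XC c" s] by simp
  thus ?case by (auto intro!: runs_mono[OF runs_Assign])
next
  case (XV x)
  thus ?case by (auto intro!: runs_mono[OF runs_Assign])
next
  case (XR a e)
  have "runs W (Seq (ce e d) (Assign (tmp d) (Read a (tv d)))) s (etime e s + 6) (set_scalar (tmp d) (array s a (xval e s)) s)"
    by (rule runs_Seq[OF XR.IH runs_Assign]) (use XR.prems in "auto intro!: state_eqI")
  thus ?case by (auto elim: runs_mono)
next
  case (XO p e f)
  define s1 where "s1 = set_scalar (tmp d) (xval e s) s"
  define s2 where "s2 = set_scalar (tmp (d + 1)) (xval f s) s1"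
  have ok: "xok \<Gamma> k e" "xok \<Gamma> k f" using XO.prems by auto
  have n1: "nn s1 = nn s" using good_tmp[OF good_n] by (simp add: s1_def)
  have r1: "runs W (ce e d) s (etime e s) s1" unfolding s1_def using XO by auto
  have "runs W (ce f (d + 1)) s1 (etime f s1) (set_scalar (tmp (d + 1)) (xval f s1) s1)"
    by (rule XO.IH(2)) (use XO.prems n1 bounded_tmp in "auto simp: s1_def")
  hence r2: "runs W (ce f (d + 1)) s1 (etime f s) s2"
    unfolding s2_def s1_def using xval_tmp[OF ok(2)] etime_tmp[OF ok(2)] by simp
  have v: "opval p (scalar s2 (tmp d)) (scalar s2 (tmp (d + 1))) = xval (XO p e f) s" by (simp add: s1_def s2_def)
  have "1 < W" using power_strict_increasing[of 0 k "nn s + 1"] xdg_less[OF XO.prems(1)] XO.prems(3,4) by auto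
  moreover have "xval (XO p e f) s < W" using xval_less[OF XO.prems(1-3)] XO.prems(4) by simp
  ultimately have r3: "runs W (opc p d) s2 12 (set_scalar (tmp d) (xval (XO p e f) s) s2)" using runs_op[of p s2 d W] v by simp
  have "set_scalar (tmp d) (xval (XO p e f) s) s = set_scalar (tmp (d + 1)) 0 (set_scalar (tmp d) (xval (XO p e f) s) s2)"
    by (rule state_eqI) (use XO.prems(5)[of "d + 1"] in "auto simp: s1_def s2_def")
  hence "runs W (ce (XO p e f) d) s (etime e s + (etime f s + (12 + 6))) (set_scalar (tmp d) (xval (XO p e f) s) s)"
    using runs_Seq[OF r1 runs_Seq[OF r2 runs_Seq[OF r3 runs_clear]]] by simp
  thus ?case by (rule runs_mono) simp
next
  case (XIf b e f)
  define s1 where "s1 = set_scalar (tmp d) (xval b s) s"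
  have n1: "nn s1 = nn s" using good_tmp[OF good_n] by (simp add: s1_def)
  have r1: "runs W (ce b d) s (etime b s) s1" unfolding s1_def using XIf by auto
  have s1: "bounded \<Gamma> s1" "1 <= nn s1" "W = (nn s1 + 1) ^ k" "!!d'. d' > d ==> scalar s1 (tmp d') = 0"
    using XIf.prems n1 bounded_tmp by (auto simp: s1_def)
  have ss: "set_scalar (tmp d) v s1 = set_scalar (tmp d) v s" for v by (rule state_eqI) (auto simp: s1_def)
  define g where "g = (if xval b s ~= 0 then e else f)"
  have ok: "xok \<Gamma> k g" using XIf.prems by (simp add: g_def)
  have "runs W (ce g d) s1 (etime g s1) (set_scalar (tmp d) (xval g s1) s1)"
    using XIf.IH(2,3)[OF _ s1] XIf.prems by (auto simp: g_def)
  hence "runs W (ce g d) s1 (etime g s) (set_scalar (tmp d) (xval g s) s)"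
    unfolding ss using xval_tmp[OF ok] etime_tmp[OF ok] by (simp add: s1_def)
  hence "runs W (If (Less (Const 0) (tv d)) (ce e d) (ce f d)) s1 (etime g s + 6) (set_scalar (tmp d) (xval g s) s)"
    by (intro runs_If) (auto simp: g_def s1_def)
  from runs_Seq[OF r1 this] show ?case by (auto simp: g_def elim!: runs_mono)
next
  case (XSum i e)
  define val where "val j = xval e (set_scalar i j s)" for j
  define acc where "acc j = (\<Sum>l<j. val l)" for j
  define st where "st j = set_scalar i j (set_scalar (tmp d) (acc j) (set_scalar (tmp (d + 1)) (scalar s i) s))" for j
  have i: "good i" "i ~= ''n''" "xok \<Gamma> k e" "1 <= \<Gamma> i" using XSum.prems by auto
  note gt = good_tmp[OF i(1)] good_tmp[OF good_n]
  have comm: "st j = set_scalar (tmp d) (acc j) (set_scalar (tmp (d + 1)) (scalar s i) (set_scalar i j s))" for j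
    by (rule state_eqI) (use gt in "auto simp: st_def")
  \<comment> \<open>The degree check covers the complete sum, and partial sums are smaller, so no
    addition wraps around.\<close>
  have lW: "acc (nn s) < W" using xval_less[OF XSum.prems(1-3)] XSum.prems(4) by (simp add: acc_def val_def)
  have am: "acc j <= acc (nn s)" if "j <= nn s" for j
    unfolding acc_def by (rule sum_mono2) (use that in auto)
  have nW: "nn s < W" using XSum.prems power_increasing[of 1 k "nn s + 1"] by auto
  have "runs W (ce (XSum i e) d) s ((\<Sum>j<nn s. etime e (set_scalar i j s) + 30) + 60) (set_scalar (tmp d) (acc (nn s)) s)"
    unfolding ce.simps
  proof (rule runs_acc[OF i(1,2) XSum.prems(5) nW, where st = st and val = val])
    fix j assume j: "j < nn s"
    have b: "bounded \<Gamma> (set_scalar i j s)" by (rule bounded_set_scalar) (use XSum.prems j le_pow1[OF i(4), of j "nn s"] in auto)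
    have "runs W (ce e (d + 2)) (st j) (etime e (st j)) (set_scalar (tmp (d + 2)) (xval e (st j)) (st j))"
    proof (rule XSum.IH[OF i(3)])
      show "bounded \<Gamma> (st j)" unfolding comm by (intro bounded_tmp b)
    qed (use XSum.prems i gt in "auto simp: st_def")
    thus "runs W (ce e (d + 2)) (st j) (etime e (set_scalar i j s)) (set_scalar (tmp (d + 2)) (val j) (st j))"
      unfolding comm xval_tmp[OF i(3)] etime_tmp[OF i(3)] val_def .
    show "runs W (Assign (tmp d) (Add (tv d) (tv (d + 2)))) s' 12 (set_scalar (tmp d) (acc (Suc j)) s')"
      if "scalar s' (tmp d) = acc j" "scalar s' (tmp (d + 2)) = val j" for s'
      by (rule runs_mono[OF runs_Assign]) (use that am[of "Suc j"] lW j in "auto simp: acc_def")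
  qed (auto simp: st_def acc_def)
  thus ?case by (simp add: acc_def val_def)
next
  case (XMax i e)
  define val where "val j = xval e (set_scalar i j s)" for j
  define acc where "acc j = Max (insert 0 (val ` {..<j}))" for j
  define st where "st j = set_scalar i j (set_scalar (tmp d) (acc j) (set_scalar (tmp (d + 1)) (scalar s i) s))" for j
  have i: "good i" "i ~= ''n''" "xok \<Gamma> k e" "1 <= \<Gamma> i" using XMax.prems by auto
  note gt = good_tmp[OF i(1)] good_tmp[OF good_n]
  have comm: "st j = set_scalar (tmp d) (acc j) (set_scalar (tmp (d + 1)) (scalar s i) (set_scalar i j s))" for j
    by (rule state_eqI) (use gt in "auto simp: st_def")
  have acS: "acc (Suc j) = max (val j) (acc j)" for j
    by (simp add: acc_def lessThan_Suc insert_commute[of 0])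
  have nW: "nn s < W" using XMax.prems power_increasing[of 1 k "nn s + 1"] by auto
  have "runs W (ce (XMax i e) d) s ((\<Sum>j<nn s. etime e (set_scalar i j s) + 30) + 60) (set_scalar (tmp d) (acc (nn s)) s)"
    unfolding ce.simps
  proof (rule runs_acc[OF i(1,2) XMax.prems(5) nW, where st = st and val = val])
    fix j assume j: "j < nn s"
    have b: "bounded \<Gamma> (set_scalar i j s)" by (rule bounded_set_scalar) (use XMax.prems j le_pow1[OF i(4), of j "nn s"] in auto)
    have "runs W (ce e (d + 2)) (st j) (etime e (st j)) (set_scalar (tmp (d + 2)) (xval e (st j)) (st j))"
    proof (rule XMax.IH[OF i(3)])
      show "bounded \<Gamma> (st j)" unfolding comm by (intro bounded_tmp b)
    qed (use XMax.prems i gt in "auto simp: st_def")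
    thus "runs W (ce e (d + 2)) (st j) (etime e (set_scalar i j s)) (set_scalar (tmp (d + 2)) (val j) (st j))"
      unfolding comm xval_tmp[OF i(3)] etime_tmp[OF i(3)] val_def .
    show "runs W (If (Less (tv d) (tv (d + 2))) (Assign (tmp d) (tv (d + 2))) (Assign (tmp d) (tv d))) s' 12 (set_scalar (tmp d) (acc (Suc j)) s')"
      if "scalar s' (tmp d) = acc j" "scalar s' (tmp (d + 2)) = val j" for s'
      by (rule runs_IfA) (use that in "auto simp: acS max_def")
  qed (auto simp: st_def acc_def)
  thus ?case by (simp add: acc_def val_def[abs_def])
qed

definition clean :: "state => bool" where "clean s <-> (\<forall>d. scalar s (tmp d) = 0)"

lemma scalar_xsem: "x \<notin> wrs c ==> scalar (xsem c s) x = scalar s x"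
proof (induction c arbitrary: s)
  case (XFor i p)
  have "scalar (iter (%j s. xsem p (set_scalar i j s)) s m) x = scalar s x" for m
    by (induction m) (use XFor in auto)
  thus ?case using XFor by simp
qed auto

lemma array_xsem: "a \<notin> wra c ==> array (xsem c s) a = array s a"
proof (induction c arbitrary: s)
  case (XFor i p)
  have "array (iter (%j s. xsem p (set_scalar i j s)) s m) a = array s a" for m
    by (induction m) (use XFor in auto)
  thus ?case by simp
qed auto

lemma xck_wrs: "xck \<Gamma> k c ==> x \<in> wrs c ==> good x & x ~= ''n''"
  by (induction c) auto

lemma clean_xsem: "xck \<Gamma> k c ==> clean s ==> clean (xsem c s)"
  unfolding clean_def using scalar_xsem[of _ c s] xck_wrs[of \<Gamma> k c] good_tmp by metis

lemma nn_xsem: "xck \<Gamma> k c ==> nn (xsem c s) = nn s"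
  using scalar_xsem[of "''n''" c s] xck_wrs[of \<Gamma> k c] by blast

lemma clean_set_scalar: "clean s ==> good i ==> clean (set_scalar i v s)"
  using good_tmp by (auto simp: clean_def)

lemma bounded_xsem:
  assumes "xck \<Gamma> k c" "bounded \<Gamma> s" "1 <= nn s"
  shows "bounded \<Gamma> (xsem c s)"
  using assms
proof (induction c arbitrary: s)
  case (XAsg x e)
  have "xval e s <= (nn s + 1) ^ \<Gamma> x"
    by (rule order_trans[OF xval_le pow_le]) (use XAsg in auto)
  thus ?case using XAsg by (auto intro!: bounded_set_scalar)
next
  case (XPut a e f)
  have "xval f s <= (nn s + 1) ^ \<Gamma> a"
    by (rule order_trans[OF xval_le pow_le]) (use XPut in auto)
  thus ?case using XPut by (auto simp: bounded_def)
next
  case (XSeq p q)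
  thus ?case using nn_xsem[of \<Gamma> k p s] by auto
next
  case (XFor i p)
  let ?I = "iter (%j s. xsem p (set_scalar i j s)) s"
  have i: "i ~= ''n''" "xck \<Gamma> k p" "1 <= \<Gamma> i" using XFor.prems by auto
  have "bounded \<Gamma> (?I m) & nn (?I m) = nn s" if "m <= nn s" for m
    using that
  proof (induction m)
    case (Suc m)
    hence IH: "bounded \<Gamma> (?I m)" "nn (?I m) = nn s" by auto
    have "bounded \<Gamma> (set_scalar i m (?I m))"
      by (rule bounded_set_scalar[OF IH(1) i(1)]) (use IH(2) Suc.prems le_pow1[OF i(3), of m "nn s"] in auto)
    moreover have "nn (set_scalar i m (?I m)) = nn s" using IH i by simp
    ultimately show ?case using XFor.IH[OF i(2)] XFor.prems nn_xsem[OF i(2)] by simp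
  qed (use XFor.prems in auto)
  thus ?case using i by (auto intro!: bounded_set_scalar)
qed auto

lemma cc_correct:
  assumes "xck \<Gamma> k c" "bounded \<Gamma> s" "1 <= nn s" "W = (nn s + 1) ^ k" "clean s"
  shows "runs W (cc c) s (ctime c s) (xsem c s)"
  using assms
proof (induction c arbitrary: s)
  case XSkip
  show ?case unfolding runs_def using exec.Skip[of W s] by (intro exI[of _ 1]) simp
next
  case (XAsg x e)
  have r: "runs W (ce e 0) s (etime e s) (set_scalar (tmp 0) (xval e s) s)"
    by (rule ce_correct) (use XAsg in "auto simp: clean_def")
  have "set_scalar x (xval e s) s = set_scalar (tmp 0) 0 (set_scalar x (xval e s) (set_scalar (tmp 0) (xval e s) s))"
    by (rule state_eqI) (use XAsg good_tmp in "auto simp: clean_def")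
  moreover have "runs W (Seq (ce e 0) (Seq (Assign x (tv 0)) (clear 0))) s (etime e s + (6 + 6))
      (set_scalar (tmp 0) 0 (set_scalar x (xval e s) (set_scalar (tmp 0) (xval e s) s)))"
    by (rule runs_Seq[OF r runs_Seq[OF runs_Assign runs_clear]]) auto
  ultimately show ?case by (auto elim: runs_mono)
next
  case (XPut a e f)
  define s1 where "s1 = set_scalar (tmp 0) (xval e s) s"
  define s2 where "s2 = set_scalar (tmp 1) (xval f s) s1"
  have ok: "xok \<Gamma> k e" "xok \<Gamma> k f" using XPut by auto
  have n1: "nn s1 = nn s" using good_tmp[OF good_n] by (simp add: s1_def)
  have r1: "runs W (ce e 0) s (etime e s) s1" unfolding s1_def
    by (rule ce_correct) (use XPut in "auto simp: clean_def")
  have "runs W (ce f 1) s1 (etime f s1) (set_scalar (tmp 1) (xval f s1) s1)"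
    by (rule ce_correct[OF ok(2)]) (use XPut n1 bounded_tmp in "auto simp: clean_def s1_def")
  hence r2: "runs W (ce f 1) s1 (etime f s) s2"
    unfolding s2_def s1_def using xval_tmp[OF ok(2)] etime_tmp[OF ok(2)] by simp
  have r3: "runs W (Write a (tv 0) (tv 1)) s2 6 (set_array a (xval e s) (xval f s) s2)"
    by (rule runs_Write) (auto simp: s1_def s2_def)
  have "xsem (XPut a e f) s = set_scalar (tmp 1) 0 (set_scalar (tmp 0) 0 (set_array a (xval e s) (xval f s) s2))"
    by (rule state_eqI) (use XPut in "auto simp: clean_def s1_def s2_def")
  hence "runs W (cc (XPut a e f)) s (etime e s + (etime f s + (6 + (6 + 6)))) (xsem (XPut a e f) s)"
    using runs_Seq[OF r1 runs_Seq[OF r2 runs_Seq[OF r3 runs_Seq[OF runs_clear runs_clear]]]] by simp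
  thus ?case by (rule runs_mono) simp
next
  case (XSeq p q)
  have p: "xck \<Gamma> k p" "xck \<Gamma> k q" using XSeq.prems by auto
  have n: "nn (xsem p s) = nn s" using nn_xsem[OF p(1)] .
  have "runs W (cc q) (xsem p s) (ctime q (xsem p s)) (xsem q (xsem p s))"
    by (rule XSeq.IH(2)[OF p(2) bounded_xsem[OF p(1)]]) (use XSeq.prems n clean_xsem[OF p(1)] in auto)
  moreover have "runs W (cc p) s (ctime p s) (xsem p s)" by (rule XSeq.IH(1)[OF p(1)]) (use XSeq.prems in auto)
  ultimately show ?case unfolding cc.simps ctime.simps xsem.simps by (intro runs_Seq)
next
  case (XIfC b p q)
  have r: "runs W (ce b 0) s (etime b s) (set_scalar (tmp 0) (xval b s) s)"
    by (rule ce_correct) (use XIfC in "auto simp: clean_def")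
  have c: "set_scalar (tmp 0) 0 (set_scalar (tmp 0) (xval b s) s) = s"
    by (rule state_eqI) (use XIfC in "auto simp: clean_def")
  have *: "runs W (Seq (clear 0) (cc p)) (set_scalar (tmp 0) (xval b s) s) (6 + t) s'" if "runs W (cc p) s t s'" for p t s'
    by (rule runs_Seq[OF runs_clear]) (use that c in simp)
  define g where "g = (if xval b s ~= 0 then p else q)"
  have "runs W (cc g) s (ctime g s) (xsem g s)" using XIfC by (auto simp: g_def)
  hence "runs W (Seq (clear 0) (cc g)) (set_scalar (tmp 0) (xval b s) s) (6 + ctime g s) (xsem g s)" by (rule *)
  hence "runs W (If (Less (Const 0) (tv 0)) (Seq (clear 0) (cc p)) (Seq (clear 0) (cc q))) (set_scalar (tmp 0) (xval b s) s)
      (6 + ctime g s + 6) (xsem g s)"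
    by (intro runs_If) (auto simp: g_def)
  from runs_Seq[OF r this] show ?case by (auto simp: g_def elim!: runs_mono)
next
  case (XFor i p)
  let ?I = "iter (%j s. xsem p (set_scalar i j s)) s"
  have i: "i ~= ''n''" "xck \<Gamma> k p" "1 <= \<Gamma> i" "good i" "i \<notin> wrs p" using XFor.prems by auto
  have nW: "nn s < W" using XFor.prems power_increasing[of 1 k "nn s + 1"] by auto
  have inv: "bounded \<Gamma> (?I m) & nn (?I m) = nn s & clean (?I m) & bounded \<Gamma> (set_scalar i m (?I m))" if "m <= nn s" for m
    using that
  proof (induction m)
    case 0
    thus ?case using XFor.prems i by (auto intro!: bounded_set_scalar)
  next
    case (Suc m)
    hence IH: "bounded \<Gamma> (set_scalar i m (?I m))" "nn (?I m) = nn s" "clean (?I m)" by auto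
    have "nn (set_scalar i m (?I m)) = nn s" using IH i by simp
    hence 1: "bounded \<Gamma> (?I (Suc m))" "nn (?I (Suc m)) = nn s" "clean (?I (Suc m))"
      using bounded_xsem[OF i(2) IH(1)] XFor.prems nn_xsem[OF i(2)] clean_xsem[OF i(2) clean_set_scalar[OF IH(3) i(4)]] by auto
    moreover have "bounded \<Gamma> (set_scalar i (Suc m) (?I (Suc m)))"
      by (rule bounded_set_scalar[OF 1(1) i(1)]) (use 1(2) Suc.prems le_pow1[OF i(3), of "Suc m" "nn s"] in simp)
    ultimately show ?case by blast
  qed
  define st where "st j = set_scalar i j (?I j)" for j
  have L: "runs W (loop i (cc p)) (st 0) ((\<Sum>j<nn s. ctime p (st j) + 10) + 5) (st (nn s))"
  proof (rule runs_loop[where st' = "%j. xsem p (st j)"])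
    fix j assume j: "j < nn s"
    show "runs W (cc p) (st j) (ctime p (st j)) (xsem p (st j))"
      unfolding st_def by (rule XFor.IH[OF i(2)]) (use inv[of j] j XFor.prems i clean_set_scalar in auto)
    show "st (Suc j) = set_scalar i (Suc j) (xsem p (st j))" by (simp add: st_def)
    show "scalar (xsem p (st j)) i = j" using scalar_xsem[OF i(5)] by (simp add: st_def)
  qed (use inv i nW in "auto simp: st_def")
  have "st 0 = set_scalar i (aval W s (Const 0)) s" by (simp add: st_def)
  moreover have "xsem (XFor i p) s = set_scalar i (aval W (st (nn s)) (Const 0)) (st (nn s))"
    by (rule state_eqI) (auto simp: st_def)
  ultimately have "runs W (cc (XFor i p)) s (6 + (((\<Sum>j<nn s. ctime p (st j) + 10) + 5) + 6)) (xsem (XFor i p) s)"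
    unfolding cc.simps by (intro runs_Seq[OF runs_Assign runs_Seq[OF L runs_Assign]]) auto
  thus ?case by (rule runs_mono) (simp add: st_def sum.distrib)
qed

section \<open>Derived expressions\<close>

definition xand :: "xe => xe => xe" where "xand a b = XIf a (XIf b (XC 1) (XC 0)) (XC 0)"
definition xor :: "xe => xe => xe" where "xor a b = XIf a (XC 1) (XIf b (XC 1) (XC 0))"
definition xnot :: "xe => xe" where "xnot a = XIf a (XC 0) (XC 1)"
definition xex :: "name => xe => xe" where "xex i e = XMax i (XIf e (XC 1) (XC 0))"
definition xcnt :: "name => xe => xe" where "xcnt i e = XSum i (XIf e (XC 1) (XC 0))"
text \<open>The least index is obtained from the greatest value of \<open>n - i\<close>. Without a
  witness this maximum is 0, and the result \<open>n\<close> signals failure.\<close>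

definition xfst :: "name => xe => xe" where
  "xfst i e = XO OSub (XV ''n'') (XMax i (XIf e (XO OSub (XV ''n'') (XV i)) (XC 0)))"

lemmas xdefs = xand_def xor_def xnot_def xex_def xcnt_def xfst_def

text \<open>The first \<open>i < n\<close> with \<open>P i\<close>, or \<open>n\<close> if there is none.\<close>

definition first :: "nat => (nat => bool) => nat" where
  "first n P = n - Max (insert 0 ((%j. if P j then n - j else 0) ` {..<n}))"

lemma first_some: assumes "j < n" "P j" shows "first n P < n" "P (first n P)" "first n P <= j"
proof -
  let ?M = "Max (insert 0 ((%j. if P j then n - j else 0) ` {..<n}))"
  have ge: "n - j <= ?M"
    by (rule Max_ge) (use assms in "auto simp: image_iff")
  have in_ins: "M = 0 | (\<exists>l<n. M = f l)" if "M \<in> insert 0 (f ` {..<n})" for M and f :: "nat => nat" using that by auto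
  have "?M \<in> insert 0 ((%j. if P j then n - j else 0) ` {..<n})" by (rule Max_in) auto
  from in_ins[OF this] consider "?M = 0" | l where "l < n" "?M = (if P l then n - l else 0)" by metis
  then obtain l where l: "l < n" "P l" "?M = n - l"
  proof cases
    case (2 l)
    thus thesis using that[of l] ge assms by (cases "P l") auto
  qed (use ge assms in simp)
  have "first n P = l" unfolding first_def l(3) using l(1) by simp
  thus "first n P < n" "P (first n P)" "first n P <= j" using l ge assms by auto
qed

lemma first_le: "first n P <= n"
  by (simp add: first_def)

lemma first_less_iff: "first n P < n <-> (\<exists>j<n. P j)"
proof
  assume l: "first n P < n"
  show "\<exists>j<n. P j"
  proof (rule ccontr)
    assume "~ ?thesis"
    hence "(%j. if P j then n - j else 0) ` {..<n} \<subseteq> {0}" by auto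
    hence "insert 0 ((%j. if P j then n - j else 0) ` {..<n}) = {0}" by blast
    hence "first n P = n" unfolding first_def by (simp only: Max_singleton diff_zero)
    thus False using l by simp
  qed
qed (use first_some in blast)

lemma first_P: "first n P < n ==> P (first n P)"
  using first_less_iff first_some(2) by metis

lemma first_not: "j < first n P ==> ~ P j"
  using first_some(3)[of j n P] first_le[of n P] by force

lemma xval_xand [simp]: "xval (xand a b) s = (if xval a s ~= 0 & xval b s ~= 0 then 1 else 0)"
  and xval_xor [simp]: "xval (xor a b) s = (if xval a s ~= 0 | xval b s ~= 0 then 1 else 0)"
  and xval_xnot [simp]: "xval (xnot a) s = (if xval a s ~= 0 then 0 else 1)"
  by (simp_all add: xdefs)

lemma xval_xex [simp]: "xval (xex i e) s = (if \<exists>j<nn s. xval e (set_scalar i j s) ~= 0 then 1 else 0)"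
proof -
  define S where "S = insert 0 ((%j. xval (XIf e (XC 1) (XC 0)) (set_scalar i j s)) ` {..<nn s})"
  have "xval (xex i e) s = Max S" by (simp only: xex_def xval.simps S_def)
  moreover have "Max S = (if \<exists>j<nn s. xval e (set_scalar i j s) ~= 0 then 1 else 0)"
  proof (cases "\<exists>j<nn s. xval e (set_scalar i j s) ~= 0")
    case True
    hence "S = {0, 1}" unfolding S_def by force
    thus ?thesis using True by simp
  next
    case False
    hence "S = {0}" unfolding S_def by auto
    thus ?thesis using False by simp
  qed
  ultimately show ?thesis by simp
qed

lemma xval_xcnt [simp]: "xval (xcnt i e) s = card {j. j < nn s & xval e (set_scalar i j s) ~= 0}"
proof -
  have "card {j. j < nn s & xval e (set_scalar i j s) ~= 0} = (\<Sum>j | j < nn s & xval e (set_scalar i j s) ~= 0. 1)" by simp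
  also have "\<dots> = (\<Sum>j<nn s. if xval e (set_scalar i j s) ~= 0 then 1 else 0)"
    by (rule sum.mono_neutral_cong_left) auto
  finally show ?thesis by (simp only: xcnt_def xval.simps)
qed

lemma xval_xfst: "i ~= ''n'' ==> xval (xfst i e) s = first (nn s) (%j. xval e (set_scalar i j s) ~= 0)"
proof -
  assume i: "i ~= ''n''"
  have "(%j. xval (XIf e (XO OSub (XV ''n'') (XV i)) (XC 0)) (set_scalar i j s)) = (%j. if xval e (set_scalar i j s) ~= 0 then nn s - j else 0)"
    using i by auto
  thus ?thesis by (simp only: xfst_def first_def xval.simps opval.simps)
qed

section \<open>Time bounds from the nesting of loops\<close>

primrec esz :: "xe => nat" where
  "esz (XC k) = 30"
| "esz (XV x) = 30"
| "esz (XR a e) = esz e + 30"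
| "esz (XO p e f) = esz e + esz f + 30"
| "esz (XIf b e f) = esz b + esz e + esz f + 30"
| "esz (XSum i e) = esz e + 90"
| "esz (XMax i e) = esz e + 90"

text \<open>The nesting depth of loops is the exponent of the running time; \<open>esz\<close>
  collects the constant factor.\<close>

primrec edg :: "xe => nat" where
  "edg (XC k) = 0"
| "edg (XV x) = 0"
| "edg (XR a e) = edg e"
| "edg (XO p e f) = max (edg e) (edg f)"
| "edg (XIf b e f) = max (edg b) (max (edg e) (edg f))"
| "edg (XSum i e) = edg e + 1"
| "edg (XMax i e) = edg e + 1"

primrec cdg :: "xc => nat" where
  "cdg XSkip = 0"
| "cdg (XAsg x e) = edg e"
| "cdg (XPut a e f) = max (edg e) (edg f)"
| "cdg (XSeq p q) = max (cdg p) (cdg q)"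
| "cdg (XIfC b p q) = max (edg b) (max (cdg p) (cdg q))"
| "cdg (XFor i p) = cdg p + 1"

primrec nfree :: "xe => bool" where
  "nfree (XC k) <-> True"
| "nfree (XV x) <-> True"
| "nfree (XR a e) <-> nfree e"
| "nfree (XO p e f) <-> nfree e & nfree f"
| "nfree (XIf b e f) <-> nfree b & nfree e & nfree f"
| "nfree (XSum i e) <-> i ~= ''n'' & nfree e"
| "nfree (XMax i e) <-> i ~= ''n'' & nfree e"

lemma pow_mul: "a <= (x::nat) * (m + 1) ^ d ==> d <= e ==> a <= x * (m + 1) ^ e"
  by (rule order_trans[OF _ mult_le_mono2[OF power_increasing]]) auto

lemma etime_loop_le:
  assumes "!!j. j < m ==> t j <= x * (m + 1) ^ d"
  shows "(\<Sum>j<m. t j + 30) + 60 <= (x + 90) * (m + 1 :: nat) ^ (d + 1)"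
proof -
  have p: "1 <= (m + 1) ^ d" by simp
  have "(\<Sum>j<m. t j + 30) <= (\<Sum>j<m. x * (m + 1) ^ d + 30 * (m + 1) ^ d)"
    by (rule sum_mono) (use assms p in "auto intro!: add_mono")
  also have "\<dots> = m * ((x + 30) * (m + 1) ^ d)" by (simp add: algebra_simps)
  also have "\<dots> + 60 <= (m + 1) * ((x + 90) * (m + 1) ^ d)"
  proof -
    have "60 <= 60 * (m + 1) ^ d" using p by simp
    also have "\<dots> <= (x + 90) * (m + 1) ^ d" by simp
    finally have "60 <= (x + 90) * (m + 1) ^ d" .
    moreover have "m * ((x + 30) * (m + 1) ^ d) <= m * ((x + 90) * (m + 1) ^ d)" by (intro mult_le_mono) auto
    ultimately show ?thesis by (simp only: add_mult_distrib mult_1)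
  qed
  finally show ?thesis by (simp only: power_add power_one_right mult_ac)
qed

lemma etime_le: "nfree e ==> etime e s <= esz e * (nn s + 1) ^ edg e"
proof (induction e arbitrary: s)
  case (XR a e)
  have "30 <= 30 * (nn s + 1) ^ edg e" by simp
  moreover have "etime e s <= esz e * (nn s + 1) ^ edg e" using XR by simp
  ultimately show ?case unfolding etime.simps esz.simps edg.simps add_mult_distrib by linarith
next
  case (XO p e f)
  let ?d = "max (edg e) (edg f)"
  have "30 <= 30 * (nn s + 1) ^ ?d" by simp
  moreover have "etime e s <= esz e * (nn s + 1) ^ ?d" by (rule pow_mul[OF XO.IH(1)]) (use XO.prems in auto)
  moreover have "etime f s <= esz f * (nn s + 1) ^ ?d" by (rule pow_mul[OF XO.IH(2)]) (use XO.prems in auto)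
  ultimately show ?case unfolding etime.simps esz.simps edg.simps add_mult_distrib by linarith
next
  case (XIf b e f)
  let ?d = "max (edg b) (max (edg e) (edg f))"
  have "30 <= 30 * (nn s + 1) ^ ?d" by simp
  moreover have "etime b s <= esz b * (nn s + 1) ^ ?d" by (rule pow_mul[OF XIf.IH(1)]) (use XIf.prems in auto)
  moreover have "etime e s <= esz e * (nn s + 1) ^ ?d" by (rule pow_mul[OF XIf.IH(2)]) (use XIf.prems in auto)
  moreover have "etime f s <= esz f * (nn s + 1) ^ ?d" by (rule pow_mul[OF XIf.IH(3)]) (use XIf.prems in auto)
  moreover have "etime (XIf b e f) s <= etime b s + etime e s + etime f s + 30" by simp
  ultimately show ?case unfolding esz.simps edg.simps add_mult_distrib by linarith
next
  case (XSum i e)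
  show ?case unfolding etime.simps esz.simps edg.simps
    by (rule etime_loop_le) (use XSum.IH[of "set_scalar i _ s"] XSum.prems in auto)
next
  case (XMax i e)
  show ?case unfolding etime.simps esz.simps edg.simps
    by (rule etime_loop_le) (use XMax.IH[of "set_scalar i _ s"] XMax.prems in auto)
qed auto

lemma xok_nfree: "xok \<Gamma> k e ==> nfree e"
  by (induction e) auto

definition tle :: "nat => xc => bool" where
  "tle d c <-> (\<exists>K. \<forall>s. ctime c s <= K * (nn s + 1) ^ d)"

lemma tle_mono: "tle d c ==> d <= e ==> tle e c"
  unfolding tle_def using pow_mul by metis

lemma tle_Skip: "tle d XSkip"
  unfolding tle_def by (intro exI[of _ 30]) auto

lemma tle_Asg: "nfree e ==> edg e <= d ==> tle d (XAsg x e)"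
proof -
  assume a: "nfree e" "edg e <= d"
  have "ctime (XAsg x e) s <= (esz e + 30) * (nn s + 1) ^ d" for s
  proof -
    have "30 <= 30 * (nn s + 1) ^ d" by simp
    thus ?thesis using pow_mul[OF etime_le[OF a(1)] a(2), of s] unfolding ctime.simps add_mult_distrib by linarith
  qed
  thus ?thesis unfolding tle_def by blast
qed

lemma tle_Put: "nfree e ==> nfree f ==> edg e <= d ==> edg f <= d ==> tle d (XPut a e f)"
proof -
  assume a: "nfree e" "nfree f" "edg e <= d" "edg f <= d"
  have "ctime (XPut a e f) s <= (esz e + esz f + 60) * (nn s + 1) ^ d" for s
  proof -
    have "60 <= 60 * (nn s + 1) ^ d" by simp
    thus ?thesis using pow_mul[OF etime_le[OF a(1)] a(3), of s] pow_mul[OF etime_le[OF a(2)] a(4), of s] unfolding ctime.simps add_mult_distrib by linarith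
  qed
  thus ?thesis unfolding tle_def by blast
qed

lemma tle_Seq: "tle d p ==> tle d q ==> ''n'' \<notin> wrs p ==> tle d (XSeq p q)"
proof -
  assume "tle d p" "tle d q" "''n'' \<notin> wrs p"
  then obtain K L where K: "!!s. ctime p s <= K * (nn s + 1) ^ d" "!!s. ctime q s <= L * (nn s + 1) ^ d" by (auto simp: tle_def)
  have "ctime (XSeq p q) s <= (K + L) * (nn s + 1) ^ d" for s
    using K(1)[of s] K(2)[of "xsem p s"] scalar_xsem[OF \<open>''n'' \<notin> wrs p\<close>, of s] by (simp add: add_mult_distrib)
  thus ?thesis unfolding tle_def by blast
qed

lemma tle_If: "nfree b ==> edg b <= d ==> tle d p ==> tle d q ==> tle d (XIfC b p q)"
proof -
  assume b: "nfree b" "edg b <= d" and "tle d p" "tle d q"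
  then obtain K L where K: "!!s. ctime p s <= K * (nn s + 1) ^ d" "!!s. ctime q s <= L * (nn s + 1) ^ d" by (auto simp: tle_def)
  have "ctime (XIfC b p q) s <= (esz b + K + L + 30) * (nn s + 1) ^ d" for s
  proof -
    have "30 <= 30 * (nn s + 1) ^ d" by simp
    moreover have if_le: "(if xval b s ~= 0 then ctime p s else ctime q s) <= K * (nn s + 1) ^ d + L * (nn s + 1) ^ d"
      using K(1)[of s] K(2)[of s] by auto
    ultimately show ?thesis using pow_mul[OF etime_le[OF b(1)] b(2), of s] K(1)[of s] K(2)[of s] if_le unfolding ctime.simps add_mult_distrib by linarith
  qed
  thus ?thesis unfolding tle_def by blast
qed

lemma nn_iter: "''n'' \<notin> wrs p ==> i ~= ''n'' ==> nn (iter (%j s. xsem p (set_scalar i j s)) s m) = nn s"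
  by (induction m) (auto simp: scalar_xsem)

lemma tle_For: "tle d p ==> ''n'' \<notin> wrs p ==> i ~= ''n'' ==> tle (d + 1) (XFor i p)"
proof -
  assume a: "tle d p" "''n'' \<notin> wrs p" "i ~= ''n''"
  then obtain K where K: "!!s. ctime p s <= K * (nn s + 1) ^ d" by (auto simp: tle_def)
  have "ctime (XFor i p) s <= (K + 90) * (nn s + 1) ^ (d + 1)" for s
    unfolding ctime.simps
  proof (rule etime_loop_le)
    show "ctime p (set_scalar i j (iter (%j s. xsem p (set_scalar i j s)) s j)) <= K * (nn s + 1) ^ d" for j
      using K[of "set_scalar i j (iter (%j s. xsem p (set_scalar i j s)) s j)"] nn_iter[OF a(2,3)] a(3) by auto
  qed
  thus ?thesis unfolding tle_def by blast
qed

lemma tle_cdg: "xck \<Gamma> k c ==> cdg c <= d ==> tle d c"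
proof (induction c arbitrary: d)
  case (XFor i p)
  hence "tle (cdg p) p" "''n'' \<notin> wrs p" "i ~= ''n''" using xck_wrs[of \<Gamma> k p] by auto
  thus ?case using tle_For tle_mono XFor.prems by (metis cdg.simps(6))
next
  case (XSeq p q)
  thus ?case using xck_wrs[of \<Gamma> k p] by (auto intro!: tle_Seq)
qed (auto intro!: tle_Skip tle_Asg tle_Put tle_If dest: xok_nfree)

primrec rds :: "xe => name set" where
  "rds (XC k) = {}"
| "rds (XV x) = {x}"
| "rds (XR a e) = rds e"
| "rds (XO p e f) = rds e \<union> rds f"
| "rds (XIf b e f) = rds b \<union> rds e \<union> rds f"
| "rds (XSum i e) = insert ''n'' (rds e - {i})"
| "rds (XMax i e) = insert ''n'' (rds e - {i})"

primrec rda :: "xe => name set" where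
  "rda (XC k) = {}"
| "rda (XV x) = {}"
| "rda (XR a e) = insert a (rda e)"
| "rda (XO p e f) = rda e \<union> rda f"
| "rda (XIf b e f) = rda b \<union> rda e \<union> rda f"
| "rda (XSum i e) = rda e"
| "rda (XMax i e) = rda e"

lemma xval_cong:
  "(!!x. x \<in> rds e ==> scalar s x = scalar s' x) ==> (!!a. a \<in> rda e ==> array s a = array s' a) ==> xval e s = xval e s'"
proof (induction e arbitrary: s s')
  case (XR a e)
  have "xval e s = xval e s'" by (rule XR.IH) (use XR.prems in auto)
  thus ?case using XR.prems(2)[of a] by simp
next
  case (XO p e f)
  have "xval e s = xval e s'" by (rule XO.IH(1)) (use XO.prems in auto)
  moreover have "xval f s = xval f s'" by (rule XO.IH(2)) (use XO.prems in auto)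
  ultimately show ?case by simp
next
  case (XIf b e f)
  have "xval b s = xval b s'" by (rule XIf.IH(1)) (use XIf.prems in auto)
  moreover have "xval e s = xval e s'" by (rule XIf.IH(2)) (use XIf.prems in auto)
  moreover have "xval f s = xval f s'" by (rule XIf.IH(3)) (use XIf.prems in auto)
  ultimately show ?case by simp
next
  case (XSum i e)
  have "xval e (set_scalar i j s) = xval e (set_scalar i j s')" for j by (rule XSum.IH) (use XSum.prems in auto)
  moreover have "nn s = nn s'" using XSum.prems by simp
  ultimately show ?case by simp
next
  case (XMax i e)
  have "xval e (set_scalar i j s) = xval e (set_scalar i j s')" for j by (rule XMax.IH) (use XMax.prems in auto)
  moreover have "nn s = nn s'" using XMax.prems by simp
  ultimately show ?case by simp
qed auto

definition xadj :: "xe => xe => xe" where "xadj u w = XR ''adj'' (XO OAdd (XO OMul u (XV ''n'')) w)"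

text \<open>Straight-line items: assignment, tabulation of an array, and the indicator array of the neighbourhood of a set.\<close>

datatype it = IA name xe | IT name name xe | IS name xe

definition tab :: "name => name => xe => xc" where "tab a i e = XFor i (XPut a (XV i) e)"

text \<open>Adjacency rows are scanned only for members of the set, so the cost is O(n) plus O(n)
  per member. Asking for every vertex whether it has a neighbour in the set would always be
  quadratic.\<close>

definition scat :: "name => xe => xc" where
  "scat R g = XSeq (tab R ''y'' (XC 0)) (XFor ''z'' (XIfC g (XFor ''y'' (XIfC (xadj (XV ''z'') (XV ''y'')) (XPut R (XV ''y'') (XC 1)) XSkip)) XSkip))"

primrec xit :: "it => xc" where
  "xit (IA x e) = XAsg x e"
| "xit (IT a i e) = tab a i e"
| "xit (IS R g) = scat R g"

primrec blk :: "it list => xc" where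
  "blk [] = XSkip"
| "blk (t # ts) = XSeq (xit t) (blk ts)"

primrec holds :: "state => it => bool" where
  "holds s (IA x e) <-> scalar s x = xval e s"
| "holds s (IT a i e) <-> (\<forall>w<nn s. array s a w = xval e (set_scalar i w s))"
| "holds s (IS R g) <-> (\<forall>w<nn s. array s R w = (if \<exists>z<nn s. xval g (set_scalar ''z'' z s) ~= 0 & array s ''adj'' (z * nn s + w) ~= 0 then 1 else 0))"

primrec its :: "it => name set" where
  "its (IA x e) = {x}"
| "its (IT a i e) = {i}"
| "its (IS R g) = {''y'', ''z''}"

primrec ita :: "it => name set" where
  "ita (IA x e) = {}"
| "ita (IT a i e) = {a}"
| "ita (IS R g) = {R}"

primrec irs :: "it => name set" where
  "irs (IA x e) = insert ''n'' (rds e)"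
| "irs (IT a i e) = insert ''n'' (rds e - {i})"
| "irs (IS R g) = insert ''n'' (rds g - {''z''})"

primrec ira :: "it => name set" where
  "ira (IA x e) = rda e"
| "ira (IT a i e) = rda e"
| "ira (IS R g) = insert ''adj'' (rda g)"

text \<open>A single-assignment condition: no item overwrites what it or an earlier item reads or
  has produced, apart from loop variables. Then the equations of all items hold simultaneously in
  the final state, see \<open>ssa_holds\<close>, and a block can be used like a list of
  definitions.\<close>

primrec ssa :: "it list => bool" where
  "ssa [] <-> True"
| "ssa (t # ts) <-> irs t \<inter> its t = {} & ira t \<inter> ita t = {} &
     (\<forall>t'\<in>set ts. its t' \<inter> irs t = {} & ita t' \<inter> ira t = {} & ita t' \<inter> ita t = {} & (case t of IA x e => x \<notin> its t' | _ => True)) & ssa ts"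

lemma wrs_it: "wrs (xit t) = its t" and wra_it: "wra (xit t) = ita t"
  by (cases t; auto simp: tab_def scat_def)+

lemma wrs_blk: "wrs (blk ts) = (\<Union>t\<in>set ts. its t)" and wra_blk: "wra (blk ts) = (\<Union>t\<in>set ts. ita t)"
  by (induction ts) (auto simp: wrs_it wra_it)

lemma iter_tab:
  assumes "i ~= ''n''" "a \<notin> rda e"
  shows "array (iter (%j s. xsem (XPut a (XV i) e) (set_scalar i j s)) s m) a w = (if w < m then xval e (set_scalar i w s) else array s a w)"
proof (induction m)
  case (Suc m)
  let ?s = "iter (%j s. xsem (XPut a (XV i) e) (set_scalar i j s)) s m"
  have "xval e (set_scalar i m ?s) = xval e (set_scalar i m s)"
  proof (rule xval_cong)
    show "scalar (set_scalar i m ?s) x = scalar (set_scalar i m s) x" for x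
    proof -
      have "x ~= i ==> scalar (iter (%j s. xsem (XPut a (XV i) e) (set_scalar i j s)) s m') x = scalar s x" for m'
        by (induction m') auto
      thus ?thesis by simp
    qed
    show "array (set_scalar i m ?s) b = array (set_scalar i m s) b" if "b \<in> rda e" for b
    proof -
      have "b ~= a" using assms that by auto
      hence "array (iter (%j s. xsem (XPut a (XV i) e) (set_scalar i j s)) s m') b = array s b" for m'
        by (induction m') auto
      thus ?thesis by simp
    qed
  qed
  thus ?case using Suc by (auto simp: less_Suc_eq)
qed simp

lemma array_tab:
  assumes "i ~= ''n''" "a \<notin> rda e"
  shows "array (xsem (tab a i e) s) a w = (if w < nn s then xval e (set_scalar i w s) else array s a w)"
  unfolding tab_def using iter_tab[OF assms, of s "nn s" w] by simp

lemma array_scat: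
  assumes g: "R \<notin> rda g" "R ~= ''adj''" "''y'' \<notin> rds g" "w < nn s"
  shows "array (xsem (scat R g) s) R w = (if \<exists>z<nn s. xval g (set_scalar ''z'' z s) ~= 0 & array s ''adj'' (z * nn s + w) ~= 0 then 1 else 0)"
proof -
  define s0 where "s0 = xsem (tab R ''y'' (XC 0)) s"
  define body where "body = XIfC (xadj (XV ''z'') (XV ''y'')) (XPut R (XV ''y'') (XC 1)) XSkip"
  define inner where "inner = XFor ''y'' body"
  have s0: "array s0 R w = 0" "!!b. b ~= R ==> array s0 b = array s b" "!!x. x ~= ''y'' ==> scalar s0 x = scalar s x"
    using array_tab[of "''y''" R "XC 0" s w] g(4) array_xsem[of _ "tab R ''y'' (XC 0)" s] scalar_xsem[of _ "tab R ''y'' (XC 0)" s]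
    by (auto simp: s0_def tab_def)
  have it: "array (iter (%j s. xsem body (set_scalar ''y'' j s)) t m) R w =
      (if w < m & array t ''adj'' (scalar t ''z'' * nn t + w) ~= 0 then 1 else array t R w)" for t m
  proof (induction m)
    case (Suc m)
    let ?t = "iter (%j s. xsem body (set_scalar ''y'' j s)) t m"
    have "x ~= ''y'' ==> scalar (iter (%j s. xsem body (set_scalar ''y'' j s)) t m') x = scalar t x" for m' x
      by (induction m') (auto simp: body_def)
    moreover have "array (iter (%j s. xsem body (set_scalar ''y'' j s)) t m') ''adj'' = array t ''adj''" for m'
      by (induction m') (use g(2) in "auto simp: body_def")
    ultimately show ?case using Suc by (auto simp: body_def xadj_def less_Suc_eq)
  qed simp
  have fr: "x ~= ''y'' ==> scalar (xsem inner t) x = scalar t x" "b ~= R ==> array (xsem inner t) b = array t b" for x b t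
    by (auto simp: inner_def body_def intro!: scalar_xsem array_xsem simp del: xsem.simps)
  let ?I = "iter (%j s. xsem (XIfC g inner XSkip) (set_scalar ''z'' j s)) s0"
  have frI: "x ~= ''y'' ==> x ~= ''z'' ==> scalar (?I m) x = scalar s x" for x m
    by (induction m) (auto simp: fr s0)
  have frA: "b ~= R ==> array (?I m) b = array s b" for b m
    by (induction m) (auto simp: fr s0)
  define G where "G z <-> xval g (set_scalar ''z'' z s) ~= 0 & array s ''adj'' (z * nn s + w) ~= 0" for z
  have step: "array (?I (Suc m)) R w = (if G m then 1 else array (?I m) R w)" for m
  proof -
    let ?t = "set_scalar ''z'' m (?I m)"
    have a: "xval g ?t = xval g (set_scalar ''z'' m s)"
    proof (rule xval_cong)
      show "scalar ?t x = scalar (set_scalar ''z'' m s) x" if "x \<in> rds g" for x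
      proof (cases "x = ''z''")
        case False
        have "x ~= ''y''" using that g(3) by blast
        from frI[OF this False, of m] show ?thesis using False by (simp only: scalar_set_scalar if_False)
      qed (simp only: scalar_set_scalar if_True simp_thms)
      show "array ?t b = array (set_scalar ''z'' m s) b" if "b \<in> rda g" for b
      proof -
        have "b ~= R" using that g(1) by blast
        from frA[OF this, of m] show ?thesis by (simp only: array_set_scalar)
      qed
    qed
    have b: "array (xsem inner ?t) R w = (if array s ''adj'' (m * nn s + w) ~= 0 then 1 else array ?t R w)"
    proof -
      have "scalar ?t ''z'' = m" "nn ?t = nn s" "array ?t ''adj'' = array s ''adj''"
        using frI[of "''n''" m] frA[of "''adj''" m] g(2) by auto
      moreover have "array (xsem inner ?t) R w = array (iter (%j s. xsem body (set_scalar ''y'' j s)) ?t (nn ?t)) R w"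
        unfolding inner_def by simp
      ultimately show ?thesis using it[of ?t "nn ?t"] g(4) by simp
    qed
    have c: "?I (Suc m) = (if xval g ?t ~= 0 then xsem inner ?t else ?t)" by simp
    show ?thesis
    proof (cases "xval g (set_scalar ''z'' m s) ~= 0")
      case True
      thus ?thesis unfolding G_def c a using b by (simp only: if_True simp_thms array_set_scalar)
    next
      case False
      thus ?thesis unfolding G_def c a by (simp only: if_False simp_thms array_set_scalar)
    qed
  qed
  have "array (?I m) R w = (if \<exists>z<m. G z then 1 else 0)" for m
    by (induction m) (simp add: s0, simp only: step, auto simp: less_Suc_eq)
  moreover have "xsem (scat R g) s = set_scalar ''z'' 0 (?I (nn s0))"
    by (simp add: scat_def s0_def inner_def body_def)
  ultimately show ?thesis using s0(3)[of "''n''"] by (simp add: G_def)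
qed

lemma holds_cong:
  assumes "holds s t" "!!x. x \<in> irs t ==> scalar s' x = scalar s x" "!!a. a \<in> ira t \<union> ita t ==> array s' a = array s a"
    "!!x e. t = IA x e ==> scalar s' x = scalar s x"
  shows "holds s' t"
proof (cases t)
  case (IA x e)
  have "xval e s' = xval e s" by (rule xval_cong) (use assms(2,3) IA in auto)
  thus ?thesis using assms(1,4) IA by simp
next
  case (IT a i e)
  have "xval e (set_scalar i w s') = xval e (set_scalar i w s)" for w by (rule xval_cong) (use assms(2,3) IT in auto)
  moreover have "nn s' = nn s" "array s' a = array s a" using assms(2,3) IT by auto
  ultimately show ?thesis using assms(1) IT by simp
next
  case (IS R g)
  have "xval g (set_scalar ''z'' w s') = xval g (set_scalar ''z'' w s)" for w by (rule xval_cong) (use assms(2,3) IS in auto)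
  moreover have "nn s' = nn s" "array s' R = array s R" "array s' ''adj'' = array s ''adj''" using assms(2,3) IS by auto
  ultimately show ?thesis using assms(1) IS by simp
qed

lemma holds_xit:
  assumes "irs t \<inter> its t = {}" "ira t \<inter> ita t = {}"
  shows "holds (xsem (xit t) s) t"
proof (cases t)
  case (IA x e)
  have "xval e (set_scalar x (xval e s) s) = xval e s" by (rule xval_cong) (use assms IA in auto)
  thus ?thesis using IA by simp
next
  case (IT a i e)
  have i: "i ~= ''n''" "a \<notin> rda e" using assms IT by auto
  have "xval e (set_scalar i w (xsem (tab a i e) s)) = xval e (set_scalar i w s)" for w
  proof (rule xval_cong)
    have w: "wrs (tab a i e) = {i}" "wra (tab a i e) = {a}" by (auto simp: tab_def)
    show "scalar (set_scalar i w (xsem (tab a i e) s)) x = scalar (set_scalar i w s) x" for x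
      using scalar_xsem[of x "tab a i e" s] w by simp
    show "array (set_scalar i w (xsem (tab a i e) s)) b = array (set_scalar i w s) b" if "b \<in> rda e" for b
    proof -
      have "b ~= a" using that i by blast
      thus ?thesis using array_xsem[of b "tab a i e" s] w by simp
    qed
  qed
  moreover have "nn (xsem (tab a i e) s) = nn s" using i by (intro scalar_xsem) (auto simp: tab_def)
  ultimately show ?thesis using array_tab[OF i] IT by simp
next
  case (IS R g)
  have i: "R \<notin> rda g" "R ~= ''adj''" "''y'' \<notin> rds g" using assms IS by auto
  have w: "wrs (scat R g) = {''y'', ''z''}" "wra (scat R g) = {R}" by (auto simp: scat_def tab_def)
  have "xval g (set_scalar ''z'' z (xsem (scat R g) s)) = xval g (set_scalar ''z'' z s)" for z
  proof (rule xval_cong)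
    show "scalar (set_scalar ''z'' z (xsem (scat R g) s)) x = scalar (set_scalar ''z'' z s) x" if "x \<in> rds g" for x
    proof (cases "x = ''z''")
      case False
      moreover have "x ~= ''y''" using that i by blast
      ultimately have "x \<notin> wrs (scat R g)" using w by simp
      thus ?thesis using scalar_xsem[of x "scat R g" s] by simp
    qed simp
    show "array (set_scalar ''z'' z (xsem (scat R g) s)) b = array (set_scalar ''z'' z s) b" if "b \<in> rda g" for b
      using array_xsem[of b "scat R g" s] w i that by auto
  qed
  moreover have "nn (xsem (scat R g) s) = nn s" by (rule scalar_xsem) (simp add: w)
  moreover have "array (xsem (scat R g) s) ''adj'' = array s ''adj''" by (rule array_xsem) (use w i in auto)
  ultimately show ?thesis using array_scat[OF i] IS by simp
qed

lemma ssa_holds: "ssa ts ==> t \<in> set ts ==> holds (xsem (blk ts) s) t"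
proof (induction ts arbitrary: s)
  case (Cons t' ts)
  show ?case
  proof (cases "t \<in> set ts")
    case True
    thus ?thesis using Cons by simp
  next
    case False
    hence t: "t = t'" using Cons.prems by simp
    have "holds (xsem (xit t) s) t" by (rule holds_xit) (use Cons.prems t in auto)
    hence "holds (xsem (blk ts) (xsem (xit t) s)) t"
    proof (rule holds_cong)
      show "scalar (xsem (blk ts) (xsem (xit t) s)) x = scalar (xsem (xit t) s) x" if "x \<in> irs t" for x
        by (rule scalar_xsem) (use Cons.prems t that in "auto simp: wrs_blk")
      show "array (xsem (blk ts) (xsem (xit t) s)) a = array (xsem (xit t) s) a" if "a \<in> ira t \<union> ita t" for a
        by (rule array_xsem) (use Cons.prems t that in "auto simp: wra_blk")
      show "scalar (xsem (blk ts) (xsem (xit t) s)) x = scalar (xsem (xit t) s) x" if "t = IA x e" for x e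
        by (rule scalar_xsem) (use Cons.prems t that in "auto simp: wrs_blk")
    qed
    thus ?thesis using t by simp
  qed
qed simp

lemma scalar_blk: "(\<forall>t\<in>set ts. x \<notin> its t) ==> scalar (xsem (blk ts) s) x = scalar s x"
  and array_blk: "(\<forall>t\<in>set ts. a \<notin> ita t) ==> array (xsem (blk ts) s) a = array s a"
  by (auto intro!: scalar_xsem array_xsem simp: wrs_blk wra_blk)

section \<open>Cost charged to the classes of an array\<close>

definition cnt_eq :: "state => name => nat => nat" where
  "cnt_eq s A a = card {w. w < nn s & array s A w = a}"

text \<open>Cost linear in \<open>n\<close> plus linear work for each \<open>w\<close> with \<open>A w = x\<close>; summed over all values of \<open>x\<close> this is quadratic.\<close>

definition tcl :: "name => name => xc => bool" where
  "tcl A x c <-> (\<exists>K. \<forall>s. ctime c s <= K * (nn s + 1) * (1 + cnt_eq s A (scalar s x)))"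

lemma tcl_tle: "tle 1 c ==> tcl A x c"
proof -
  assume "tle 1 c"
  then obtain K where K: "!!s. ctime c s <= K * (nn s + 1)" by (auto simp: tle_def)
  have "ctime c s <= K * (nn s + 1) * (1 + cnt_eq s A (scalar s x))" for s
    using K[of s] by (rule order_trans) simp
  thus ?thesis unfolding tcl_def by blast
qed

lemma tcl_Seq: "tcl A x p ==> tcl A x q ==> ''n'' \<notin> wrs p ==> x \<notin> wrs p ==> A \<notin> wra p ==> tcl A x (XSeq p q)"
proof -
  assume a: "''n'' \<notin> wrs p" "x \<notin> wrs p" "A \<notin> wra p" and "tcl A x p" "tcl A x q"
  then obtain K L where K: "!!s. ctime p s <= K * (nn s + 1) * (1 + cnt_eq s A (scalar s x))"
    "!!s. ctime q s <= L * (nn s + 1) * (1 + cnt_eq s A (scalar s x))" by (auto simp: tcl_def)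
  have "ctime (XSeq p q) s <= (K + L) * (nn s + 1) * (1 + cnt_eq s A (scalar s x))" for s
    using add_mono[OF K(1)[of s] K(2)[of "xsem p s"]] scalar_xsem[OF a(1)] scalar_xsem[OF a(2)] array_xsem[OF a(3)]
    by (simp add: cnt_eq_def add_mult_distrib)
  thus ?thesis unfolding tcl_def by blast
qed

lemma tcl_If: "nfree b ==> edg b <= 1 ==> tcl A x p ==> tcl A x q ==> tcl A x (XIfC b p q)"
proof -
  assume b: "nfree b" "edg b <= 1" and "tcl A x p" "tcl A x q"
  then obtain K L where K: "!!s. ctime p s <= K * (nn s + 1) * (1 + cnt_eq s A (scalar s x))"
    "!!s. ctime q s <= L * (nn s + 1) * (1 + cnt_eq s A (scalar s x))" by (auto simp: tcl_def)
  have "ctime (XIfC b p q) s <= (esz b + 30 + K + L) * (nn s + 1) * (1 + cnt_eq s A (scalar s x))" for s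
  proof -
    have "etime b s + 30 <= (esz b + 30) * (nn s + 1)"
      using pow_mul[OF etime_le[OF b(1)] b(2), of s] by (simp add: add_mult_distrib)
    also have "\<dots> <= (esz b + 30) * (nn s + 1) * (1 + cnt_eq s A (scalar s x))" by simp
    finally have "etime b s + 30 <= (esz b + 30) * (nn s + 1) * (1 + cnt_eq s A (scalar s x))" .
    moreover have "(if xval b s ~= 0 then ctime p s else ctime q s) <= K * (nn s + 1) * (1 + cnt_eq s A (scalar s x)) + L * (nn s + 1) * (1 + cnt_eq s A (scalar s x))"
      using K(1)[of s] K(2)[of s] by auto
    ultimately show ?thesis unfolding ctime.simps add_mult_distrib by linarith
  qed
  thus ?thesis unfolding tcl_def by blast
qed

text \<open>The body of an inner loop: constant cost for most indices, linear cost for those whose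
  value in \<open>A\<close> is the current \<open>x\<close>.\<close>

definition tg :: "name => name => name => xc => bool" where
  "tg A x i c <-> (\<exists>K. \<forall>s. ctime c s <= K * (1 + (if array s A (scalar s i) = scalar s x then nn s + 1 else 0)))"

lemma tcl_For:
  assumes "tg A x i p" and w: "''n'' \<notin> wrs p" "x \<notin> wrs p" "A \<notin> wra p" "i ~= x" "i ~= ''n''"
  shows "tcl A x (XFor i p)"
proof -
  obtain K where K: "!!s. ctime p s <= K * (1 + (if array s A (scalar s i) = scalar s x then nn s + 1 else 0))"
    using assms(1) by (auto simp: tg_def)
  have "ctime (XFor i p) s <= (K + 90) * (nn s + 1) * (1 + cnt_eq s A (scalar s x))" for s
  proof -
    let ?I = "iter (%j s. xsem p (set_scalar i j s)) s"
    have f: "nn (?I j) = nn s" "scalar (?I j) x = scalar s x" "array (?I j) A = array s A" for j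
    proof -
      show "nn (?I j) = nn s" by (rule nn_iter[OF w(1,5)])
      show "scalar (?I j) x = scalar s x" by (induction j) (use w scalar_xsem[OF w(2)] in auto)
      show "array (?I j) A = array s A" by (induction j) (use w array_xsem[OF w(3)] in auto)
    qed
    let ?g = "%j. if array s A j = scalar s x then nn s + 1 else 0"
    have "ctime p (set_scalar i j (?I j)) <= K * (1 + ?g j)" for j
      using K[of "set_scalar i j (?I j)"] f[of j] w(4,5) by (simp split: if_splits)
    hence "(\<Sum>j<nn s. ctime p (set_scalar i j (?I j)) + 30) <= (\<Sum>j<nn s. K * (1 + ?g j) + 30)"
      by (intro sum_mono) simp
    also have "\<dots> = (K + 30) * nn s + K * (\<Sum>j<nn s. ?g j)"
      by (simp add: sum.distrib sum_distrib_left[symmetric] algebra_simps)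
    also have "(\<Sum>j<nn s. ?g j) = (nn s + 1) * cnt_eq s A (scalar s x)"
    proof -
      have "(\<Sum>j<nn s. ?g j) = (\<Sum>j | j < nn s & array s A j = scalar s x. nn s + 1)"
        by (rule sum.mono_neutral_cong_right) auto
      thus ?thesis by (simp add: cnt_eq_def)
    qed
    finally have "ctime (XFor i p) s <= (K + 30) * nn s + K * ((nn s + 1) * cnt_eq s A (scalar s x)) + 60" by simp
    also have "\<dots> <= (K + 90) * (nn s + 1) + (K + 90) * ((nn s + 1) * cnt_eq s A (scalar s x))"
      by (rule order_trans[OF _ add_mono[OF order_refl mult_le_mono1[of K "K + 90"]]]) (simp_all add: add_mult_distrib)
    also have "\<dots> = (K + 90) * (nn s + 1) * (1 + cnt_eq s A (scalar s x))" by (simp add: algebra_simps)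
    finally show ?thesis .
  qed
  thus ?thesis unfolding tcl_def by blast
qed

definition guard :: "name => name => name => xe => xe" where
  "guard A x i r = xand (XO OEq (XR A (XV i)) (XV x)) r"

lemma guard_time:
  assumes "nfree r" "edg r = 0"
  shows "etime (guard A x i r) s <= esz r + 300"
    "xval (guard A x i r) s ~= 0 ==> array s A (scalar s i) = scalar s x"
  using etime_le[OF assms(1), of s] assms(2) by (simp_all add: guard_def xand_def split: if_splits)

lemma tg_If:
  assumes r: "nfree r" "edg r = 0" and "tle 1 p"
  shows "tg A x i (XIfC (guard A x i r) p XSkip)"
proof -
  obtain K where K: "!!s. ctime p s <= K * (nn s + 1)" using assms(3) by (auto simp: tle_def)
  have "ctime (XIfC (guard A x i r) p XSkip) s <= (K + esz r + 360) * (1 + (if array s A (scalar s i) = scalar s x then nn s + 1 else 0))" for s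
  proof (cases "xval (guard A x i r) s ~= 0")
    case True
    hence t: "array s A (scalar s i) = scalar s x" by (rule guard_time(2)[OF r])
    have "ctime (XIfC (guard A x i r) p XSkip) s <= (esz r + 330) + K * (nn s + 1)"
      using guard_time(1)[OF r, of A x i s] K[of s] True by simp
    also have "\<dots> <= (esz r + 360) * (nn s + 2) + K * (nn s + 2)" by (intro add_mono) auto
    also have "\<dots> = (K + esz r + 360) * (1 + (if array s A (scalar s i) = scalar s x then nn s + 1 else 0))"
      using t by (simp add: algebra_simps)
    finally show ?thesis .
  next
    case False
    hence "ctime (XIfC (guard A x i r) p XSkip) s <= esz r + 360" using guard_time(1)[OF r, of A x i s] by simp
    also have "\<dots> <= (K + esz r + 360) * 1" by simp
    also have "\<dots> <= (K + esz r + 360) * (1 + (if array s A (scalar s i) = scalar s x then nn s + 1 else 0))" by (intro mult_le_mono) auto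
    finally show ?thesis .
  qed
  thus ?thesis unfolding tg_def by blast
qed

lemma tg_Put:
  assumes r: "nfree r" "edg r = 0" and e: "nfree e" "edg e <= 1"
  shows "tg A x i (XPut a (XV i) (XIf (guard A x i r) e (XC 0)))"
proof -
  have K: "etime e s <= esz e * (nn s + 1)" for s using pow_mul[OF etime_le[OF e(1)] e(2), of s] by simp
  have "ctime (XPut a (XV i) (XIf (guard A x i r) e (XC 0))) s <= (esz e + esz r + 500) * (1 + (if array s A (scalar s i) = scalar s x then nn s + 1 else 0))" for s
  proof (cases "xval (guard A x i r) s ~= 0")
    case True
    hence t: "array s A (scalar s i) = scalar s x" by (rule guard_time(2)[OF r])
    have "ctime (XPut a (XV i) (XIf (guard A x i r) e (XC 0))) s <= (esz r + 500) + esz e * (nn s + 1)"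
      using guard_time(1)[OF r, of A x i s] K[of s] True by simp
    also have "\<dots> <= (esz r + 500) * (nn s + 2) + esz e * (nn s + 2)" by (intro add_mono) auto
    also have "\<dots> = (esz e + esz r + 500) * (1 + (if array s A (scalar s i) = scalar s x then nn s + 1 else 0))"
      using t by (simp add: algebra_simps)
    finally show ?thesis .
  next
    case False
    hence "ctime (XPut a (XV i) (XIf (guard A x i r) e (XC 0))) s <= esz r + 500" using guard_time(1)[OF r, of A x i s] by simp
    also have "\<dots> <= (esz e + esz r + 500) * 1" by simp
    also have "\<dots> <= (esz e + esz r + 500) * (1 + (if array s A (scalar s i) = scalar s x then nn s + 1 else 0))" by (intro mult_le_mono) auto
    finally show ?thesis .
  qed
  thus ?thesis unfolding tg_def by blast
qed

lemma tcl_tab: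
  assumes "nfree r" "edg r = 0" "nfree e" "edg e <= 1" "a ~= A" "i ~= x" "i ~= ''n''"
  shows "tcl A x (xit (IT a i (XIf (guard A x i r) e (XC 0))))"
  unfolding xit.simps tab_def by (rule tcl_For[OF tg_Put]) (use assms in auto)

lemma tcl_scat:
  assumes r: "nfree r" "edg r = 0" and "R ~= A" "x \<notin> {''n'', ''y'', ''z''}"
  shows "tcl A x (xit (IS R (guard A x ''z'' r)))"
proof -
  have t0: "tle 0 (XIfC (xadj (XV ''z'') (XV ''y'')) (XPut R (XV ''y'') (XC 1)) XSkip)"
    by (intro tle_If tle_Put tle_Skip) (auto simp: xadj_def)
  have t1: "tle 1 (XFor ''y'' (XIfC (xadj (XV ''z'') (XV ''y'')) (XPut R (XV ''y'') (XC 1)) XSkip))"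
    using tle_For[OF t0] by simp
  have t2: "tle 1 (tab R ''y'' (XC 0))"
    unfolding tab_def using tle_For[OF tle_Put[of "XV ''y''" "XC 0" 0 R], of "''y''"] by simp
  show ?thesis unfolding xit.simps scat_def
    by (rule tcl_Seq[OF tcl_tle[OF t2] tcl_For[OF tg_If[OF r t1]]]) (use assms in "auto simp: tab_def")
qed

text \<open>The classes of \<open>A\<close> are disjoint, so their sizes add up to at most
  \<open>n\<close> over all rounds. This relies on \<open>A\<close> being left unchanged by the
  body.\<close>

lemma tle_For_tcl:
  assumes "tcl A x p" and w: "''n'' \<notin> wrs p" "x \<notin> wrs p" "A \<notin> wra p" "x ~= ''n''"
  shows "tle 2 (XFor x p)"
proof -
  obtain K where K: "!!s. ctime p s <= K * (nn s + 1) * (1 + cnt_eq s A (scalar s x))" using assms(1) by (auto simp: tcl_def)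
  have "ctime (XFor x p) s <= (2 * K + 90) * (nn s + 1) ^ 2" for s
  proof -
    let ?I = "iter (%j s. xsem p (set_scalar x j s)) s"
    have f: "nn (?I j) = nn s" "array (?I j) A = array s A" for j
    proof -
      show "nn (?I j) = nn s" by (rule nn_iter[OF w(1,4)])
      show "array (?I j) A = array s A" by (induction j) (use w array_xsem[OF w(3)] in auto)
    qed
    have c: "(\<Sum>j<nn s. cnt_eq s A j) <= nn s"
    proof -
      have "(\<Sum>j<nn s. cnt_eq s A j) = card (\<Union>j<nn s. {w. w < nn s & array s A w = j})"
        unfolding cnt_eq_def by (rule card_UN_disjoint[symmetric]) auto
      also have "\<dots> <= card {..<nn s}" by (rule card_mono) auto
      finally show ?thesis by simp
    qed
    have "ctime p (set_scalar x j (?I j)) <= K * (nn s + 1) * (1 + cnt_eq s A j)" for j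
      using K[of "set_scalar x j (?I j)"] f[of j] w(4) by (simp add: cnt_eq_def)
    hence "(\<Sum>j<nn s. ctime p (set_scalar x j (?I j)) + 30) <= (\<Sum>j<nn s. K * (nn s + 1) * (1 + cnt_eq s A j) + 30)"
      by (intro sum_mono) simp
    also have "\<dots> = K * (nn s + 1) * (nn s + (\<Sum>j<nn s. cnt_eq s A j)) + 30 * nn s"
      unfolding sum.distrib sum_distrib_left[symmetric] by simp
    also have "\<dots> <= K * (nn s + 1) * (2 * nn s) + 30 * nn s" using c by (intro add_mono mult_le_mono) auto
    finally have "ctime (XFor x p) s <= K * (nn s + 1) * (2 * nn s) + 30 * nn s + 60" by simp
    also have "\<dots> <= (2 * K + 90) * (nn s + 1) ^ 2" by (simp add: power2_eq_square algebra_simps)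
    finally show ?thesis .
  qed
  thus ?thesis unfolding tle_def by blast
qed

section \<open>The program\<close>

abbreviation rd :: "name => name => xe" where "rd a x \<equiv> XR a (XV x)"
abbreviation ax :: "name => name => xe" where "ax u w \<equiv> xadj (XV u) (XV w)"
notation xand (infixr "\<and>\<and>" 35) and xor (infixr "\<or>\<or>" 30)
abbreviation xeq (infix "\<doteq>" 50) where "e \<doteq> f \<equiv> XO OEq e f"
abbreviation xless (infix "\<prec>" 50) where "e \<prec> f \<equiv> XO OLess e f"
abbreviation xplus (infixl "\<oplus>" 65) where "e \<oplus> f \<equiv> XO OAdd e f"
abbreviation xminus (infixl "\<ominus>" 65) where "e \<ominus> f \<equiv> XO OSub e f"
abbreviation xtimes (infixl "\<otimes>" 70) where "e \<otimes> f \<equiv> XO OMul e f"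

text \<open>With \<open>lead\<close> the first member of \<open>S\<close> in the closed
  neighbourhood, \<open>S\<close> is a disjoint union of cliques exactly if being equal or adjacent
  coincides with having the same \<open>lead\<close>. A bad pair is a counterexample, found in
  quadratic time.\<close>

definition badx :: "name => name => xe" where
  "badx u w = (rd ''S'' u \<and>\<and> rd ''S'' w \<and>\<and> xnot ((XV u \<doteq> XV w \<or>\<or> ax u w) \<doteq> (rd ''lead'' u \<doteq> rd ''lead'' w)))"

text \<open>LexBFS labels are kept as ranks. \<open>mx\<close> is the largest label of an unvisited
  vertex plus one, so that 0 can stand for visited vertices. The new rank \<open>nl\<close> counts
  the unvisited vertices with a smaller label, together with those of equal label that miss
  \<open>v\<close> while \<open>w\<close> sees it.\<close>

definition pick :: "it list" where
  "pick = [
    IA ''mx'' (XMax ''i'' (XIf (rd ''vis'' ''i'') (XC 0) (rd ''lab'' ''i'' \<oplus> XC 1))),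
    IA ''v'' (xfst ''i'' (xnot (rd ''vis'' ''i'') \<and>\<and> rd ''lab'' ''i'' \<oplus> XC 1 \<doteq> XV ''mx'')),
    IT ''nl'' ''w'' (xcnt ''u'' (xnot (rd ''vis'' ''u'') \<and>\<and>
      (rd ''lab'' ''u'' \<prec> rd ''lab'' ''w'' \<or>\<or> (rd ''lab'' ''u'' \<doteq> rd ''lab'' ''w'' \<and>\<and> ax ''v'' ''w'' \<and>\<and> xnot (ax ''v'' ''u''))))),
    IT ''nv'' ''w'' (rd ''vis'' ''w'' \<and>\<and> ax ''v'' ''w''),
    IT ''S'' ''w'' (rd ''nv'' ''w'' \<and>\<and> xex ''u'' (rd ''nv'' ''u'' \<and>\<and> xnot (XV ''u'' \<doteq> XV ''w'') \<and>\<and> xnot (ax ''u'' ''w''))),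
    IT ''M'' ''w'' (rd ''nv'' ''w'' \<and>\<and> xnot (rd ''S'' ''w'')),
    IT ''lead'' ''w'' (XIf (rd ''S'' ''w'') (xfst ''u'' (rd ''S'' ''u'' \<and>\<and> (XV ''u'' \<doteq> XV ''w'' \<or>\<or> ax ''u'' ''w''))) (XC 0)),
    IA ''bu'' (xfst ''u'' (xex ''w'' (badx ''u'' ''w''))),
    IA ''bw'' (xfst ''w'' (badx ''bu'' ''w'')),
    IA ''hole'' (XC 0)]"

definition sel7 :: "xe => xe => xe => xe => xe => xe => xe => xe" where
  "sel7 e0 e1 e2 e3 e4 e5 e6 = XIf (XV ''i'' \<doteq> XC 0) e0 (XIf (XV ''i'' \<doteq> XC 1) e1 (XIf (XV ''i'' \<doteq> XC 2) e2
    (XIf (XV ''i'' \<doteq> XC 3) e3 (XIf (XV ''i'' \<doteq> XC 4) e4 (XIf (XV ''i'' \<doteq> XC 5) e5 e6)))))"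

definition nbx :: "name => name => xe" where
  "nbx L t = xfst ''w'' (rd L ''w'' \<and>\<and> ax ''w'' t)"

definition lev :: "name => name => it" where
  "lev L L' = IT L' ''w'' ((rd ''vis'' ''w'' \<and>\<and> xnot (rd ''nv'' ''w'')) \<and>\<and> xex ''u'' (rd L ''u'' \<and>\<and> ax ''u'' ''w''))"

text \<open>The sets \<open>L1\<close> to \<open>L4\<close> contain endpoints of walks and need not
  be distance classes. A vertex \<open>e\<close> of the third set next to \<open>t\<close> leads to
  a 6-hole through \<open>v\<close>; otherwise \<open>d\<close> in the fourth leads to a 7-hole. The
  remaining vertices are recovered backwards.\<close>

definition bfs :: "name => name => name => name => name => name => name => name => name => name => name => it list" where
  "bfs s t L1 L2 L3 L4 e d c b a = [
    IT L1 ''w'' ((rd ''vis'' ''w'' \<and>\<and> xnot (rd ''nv'' ''w'')) \<and>\<and> ax s ''w''),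
    lev L1 L2, lev L2 L3, lev L3 L4,
    IA e (nbx L3 t), IA d (nbx L4 t),
    IA c (XIf (XV e \<prec> XV ''n'') (XV e) (nbx L3 d)), IA b (nbx L2 c), IA a (nbx L1 b)]"

text \<open>The bad pair and the leads give an induced path \<open>ax\<close>, \<open>p3\<close>,
  \<open>ay\<close> in \<open>S\<close>: a smaller lead cannot be adjacent to the vertex with the
  larger one. \<open>p1\<close> misses \<open>p3\<close>, and by \<open>gem_P4\<close> it sees
  exactly one end, which yields the path \<open>p1\<close>, \<open>p2\<close>, \<open>p3\<close>,
  \<open>p4\<close> required by \<open>emerald_C7\<close>.\<close>

definition gem :: "it list" where
  "gem = [
    IA ''ax'' (XIf (ax ''bu'' ''bw'') (XIf (rd ''lead'' ''bu'' \<prec> rd ''lead'' ''bw'') (rd ''lead'' ''bu'') (rd ''lead'' ''bw'')) (XV ''bu'')),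
    IA ''p3'' (XIf (ax ''bu'' ''bw'') (XIf (rd ''lead'' ''bu'' \<prec> rd ''lead'' ''bw'') (XV ''bu'') (XV ''bw'')) (rd ''lead'' ''bu'')),
    IA ''ay'' (XIf (ax ''bu'' ''bw'') (XIf (rd ''lead'' ''bu'' \<prec> rd ''lead'' ''bw'') (XV ''bw'') (XV ''bu'')) (XV ''bw'')),
    IA ''p1'' (xfst ''w'' (rd ''nv'' ''w'' \<and>\<and> xnot (XV ''w'' \<doteq> XV ''p3'') \<and>\<and> xnot (ax ''w'' ''p3''))),
    IA ''p2'' (XIf (ax ''p1'' ''ax'') (XV ''ax'') (XV ''ay'')),
    IA ''p4'' (XIf (ax ''p1'' ''ax'') (XV ''ay'') (XV ''ax''))] @
    bfs ''p1'' ''p3'' ''L1'' ''L2'' ''L3'' ''L4'' ''le'' ''ld'' ''lc'' ''lb'' ''la'' @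
    bfs ''p2'' ''p4'' ''Q1'' ''Q2'' ''Q3'' ''Q4'' ''qe'' ''qd'' ''qc'' ''qb'' ''qa'' @
    [IT ''h'' ''i'' (XIf (XV ''le'' \<prec> XV ''n'')
      (XIf (XV ''qe'' \<prec> XV ''n'')
        (sel7 (XV ''v'') (XV ''p4'') (XV ''lc'') (XV ''lb'') (XV ''qb'') (XV ''qa'') (XV ''p1''))
        (sel7 (XV ''v'') (XV ''p2'') (XV ''qa'') (XV ''qb'') (XV ''qc'') (XV ''qd'') (XV ''p4'')))
      (sel7 (XV ''v'') (XV ''p1'') (XV ''la'') (XV ''lb'') (XV ''lc'') (XV ''ld'') (XV ''p3''))),
     IA ''hole'' (XC 1)]"

text \<open>\<open>c0\<close> freezes the colours. A class other than that of \<open>b\<close> is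
  not altered before its own turn, so \<open>c0\<close> still identifies the vertices of colour
  \<open>a\<close> when \<open>a\<close> is treated, and a fixed array is what the cost argument
  needs. Uncoloured vertices get \<open>n\<close>, a value that \<open>a\<close> never
  reaches.\<close>

definition start :: "it list" where
  "start = [
    IA ''b'' (xfst ''x'' (XV ''x'' \<prec> XV ''q'' \<and>\<and> xnot (xex ''w'' (rd ''M'' ''w'' \<and>\<and> rd ''c'' ''w'' \<doteq> XV ''x'')))),
    IT ''c0'' ''w'' (XIf (rd ''vis'' ''w'') (rd ''c'' ''w'') (XV ''n''))]"

definition inA :: "name => xe => xe" where "inA i r = guard ''c0'' ''a'' i r"

definition stpA :: "name => name => it" where
  "stpA B A = IT A ''w'' (XIf (inA ''w'' (XC 1)) (xex ''u'' (rd B ''u'' \<and>\<and> ax ''u'' ''w'')) (XC 0))"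

definition stpB :: "name => name => name => it list" where
  "stpB A R B = [IS R (inA ''z'' (rd A ''z'')), IT B ''w'' (rd ''vis'' ''w'' \<and>\<and> rd ''c'' ''w'' \<doteq> XV ''b'' \<and>\<and> rd R ''w'')]"

definition levels :: "it list" where
  "levels = [IS ''R0'' (inA ''z'' (rd ''nv'' ''z'')),
    IT ''B0'' ''w'' (rd ''nv'' ''w'' \<and>\<and> rd ''c'' ''w'' \<doteq> XV ''b'' \<and>\<and> xnot (rd ''R0'' ''w'')),
    stpA ''B0'' ''A1''] @ stpB ''A1'' ''R1'' ''B1'' @ [stpA ''B1'' ''A2''] @ stpB ''A2'' ''R2'' ''B2'' @ [stpA ''B2'' ''A3'',
    IT ''TT'' ''w'' (XIf (inA ''w'' (rd ''A3'' ''w'' \<and>\<and> rd ''nv'' ''w''))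
      (xnot (xex ''y'' (rd ''nv'' ''y'' \<and>\<and> rd ''c'' ''y'' \<doteq> XV ''b'' \<and>\<and> ax ''y'' ''w''))) (XC 0)),
    IA ''tz'' (xfst ''w'' (rd ''TT'' ''w''))]"

definition chole :: "it list" where
  "chole = [IA ''z4'' (nbx ''B2'' ''tz''), IA ''z3'' (nbx ''A2'' ''z4''), IA ''z2'' (nbx ''B1'' ''z3''), IA ''z1'' (nbx ''A1'' ''z2''),
    IA ''z0'' (nbx ''B0'' ''z1''),
    IT ''h'' ''i'' (sel7 (XV ''v'') (XV ''z0'') (XV ''z1'') (XV ''z2'') (XV ''z3'') (XV ''z4'') (XV ''tz'')),
    IA ''hole'' (XC 1)]"

text \<open>New colours go to a separate array because an item must not overwrite what it
  reads.\<close>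

definition swap :: "it list" where
  "swap = [IT ''nc'' ''w'' (XIf (rd ''vis'' ''w'')
    (XIf (rd ''c'' ''w'' \<doteq> XV ''a'') (XIf (rd ''A1'' ''w'' \<or>\<or> rd ''A2'' ''w'' \<or>\<or> rd ''A3'' ''w'') (XV ''b'') (XV ''a''))
    (XIf (rd ''c'' ''w'' \<doteq> XV ''b'') (XIf (rd ''B0'' ''w'' \<or>\<or> rd ''B1'' ''w'' \<or>\<or> rd ''B2'' ''w'') (XV ''a'') (XV ''b''))
    (rd ''c'' ''w''))) (XC 0))]"

text \<open>The minimum with \<open>n\<close> lets the value check see that \<open>q\<close> keeps
  degree 1.\<close>

definition newcol :: "xc" where
  "newcol = XSeq (XPut ''c'' (XV ''v'') (XV ''q'')) (XAsg ''q'' (XO OMin (XV ''q'' \<oplus> XC 1) (XV ''n'')))"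

definition kstep :: "xc" where
  "kstep = XIfC (XV ''a'' \<prec> XV ''q'' \<and>\<and> xnot (XV ''a'' \<doteq> XV ''b'') \<and>\<and> xnot (XV ''hole''))
    (XSeq (blk levels) (XIfC (XV ''tz'' \<prec> XV ''n'') (blk chole) (XSeq (blk swap) (blk [IT ''c'' ''w'' (rd ''nc'' ''w'')])))) XSkip"

definition kemp :: "xc" where
  "kemp = XSeq (blk start) (XIfC (XV ''b'' \<prec> XV ''n'')
    (XSeq (XFor ''a'' kstep) (XIfC (XV ''hole'') XSkip
      (XIfC (xex ''w'' (rd ''nv'' ''w'' \<and>\<and> rd ''c'' ''w'' \<doteq> XV ''b'')) newcol (XPut ''c'' (XV ''v'') (XV ''b''))))) newcol)"

definition cnx :: "xe => xe" where "cnx i = (XV ''w'' \<doteq> XR ''h'' i \<or>\<or> xadj (XV ''w'') (XR ''h'' i))"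

definition dlx :: xe where
  "dlx = XO OMod (rd ''cl'' ''u'' \<oplus> XC 14 \<ominus> rd ''cl'' ''w'') (XC 14)"

definition nbW :: "xe => xe" where "nbW e = xcnt ''u'' (rd ''iW'' ''u'' \<and>\<and> ax ''w'' ''u'' \<and>\<and> e)"

text \<open>\<open>K\<close> packs the class, the shifted difference \<open>key\<close> and the
  vertex number into one word; \<open>2 * n + 1\<close> and \<open>n\<close> are the numbers of
  possible values of the last two. \<open>k\<close> is the larger of the clique bound
  \<open>k1\<close> and of \<open>N / 3\<close> rounded up.\<close>

definition arcblk :: "it list" where
  "arcblk = [
    IT ''cnt'' ''w'' (xcnt ''i'' (XV ''i'' \<prec> XC 7 \<and>\<and> cnx (XV ''i''))),
    IT ''st'' ''w'' (xfst ''i'' (XV ''i'' \<prec> XC 7 \<and>\<and> cnx (XV ''i'') \<and>\<and> xnot (cnx (XO OMod (XV ''i'' \<oplus> XC 6) (XC 7))))),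
    IT ''iW'' ''w'' (rd ''vis'' ''w'' \<and>\<and> rd ''cnt'' ''w'' \<and>\<and> rd ''cnt'' ''w'' \<prec> XC 7),
    IT ''iU'' ''w'' (rd ''vis'' ''w'' \<and>\<and> rd ''cnt'' ''w'' \<doteq> XC 7),
    IT ''iZ'' ''w'' (rd ''vis'' ''w'' \<and>\<and> xnot (rd ''cnt'' ''w'')),
    IT ''cl'' ''w'' (XC 2 \<otimes> rd ''st'' ''w'' \<oplus> rd ''cnt'' ''w'' \<ominus> XC 3),
    IT ''key'' ''w'' (XV ''n'' \<oplus> nbW (dlx \<doteq> XC 3 \<or>\<or> dlx \<doteq> XC 4) \<ominus> nbW (dlx \<doteq> XC 10 \<or>\<or> dlx \<doteq> XC 11)),
    IT ''K'' ''w'' ((rd ''cl'' ''w'' \<otimes> (XC 2 \<otimes> XV ''n'' \<oplus> XC 1) \<oplus> rd ''key'' ''w'') \<otimes> XV ''n'' \<oplus> XV ''w''),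
    IT ''rk'' ''w'' (xcnt ''u'' (rd ''iW'' ''u'' \<and>\<and> rd ''K'' ''u'' \<prec> rd ''K'' ''w'')),
    IT ''fw'' ''w'' (nbW (XC 0 \<prec> dlx \<and>\<and> dlx \<prec> XC 5 \<or>\<or> dlx \<doteq> XC 0 \<and>\<and> rd ''K'' ''w'' \<prec> rd ''K'' ''u'')),
    IA ''N'' (xcnt ''u'' (rd ''iW'' ''u'')),
    IA ''k1'' (XMax ''w'' (XIf (rd ''iW'' ''w'') (rd ''fw'' ''w'' \<oplus> XC 1) (XC 0))),
    IA ''k2'' (XO ODiv (XV ''N'' \<oplus> XC 2) (XC 3)),
    IA ''k'' (XIf (XV ''k1'' \<prec> XV ''k2'') (XV ''k2'') (XV ''k1'')),
    IT ''D'' ''w'' (rd ''fw'' ''w''),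
    IA ''rem'' (XC 3 \<otimes> XV ''k'' \<ominus> XV ''N'')]"

definition covx :: xe where
  "covx = (rd ''iW'' ''w'' \<and>\<and> ((xnot (XV ''j'' \<prec> rd ''rk'' ''w'') \<and>\<and> XV ''j'' \<prec> rd ''rk'' ''w'' \<oplus> rd ''fw'' ''w'') \<or>\<or>
     XV ''j'' \<oplus> XV ''N'' \<prec> rd ''rk'' ''w'' \<oplus> rd ''fw'' ''w''))"

text \<open>One step of the greedy insertion. The minimum with \<open>k\<close> gives
  \<open>D\<close> a degree that does not grow along the loop.\<close>

definition gap :: "it list" where
  "gap = [IA ''mm'' (XMax ''w'' (XIf covx (rd ''D'' ''w'') (XC 0))),
    IA ''gi'' (XO OMin (XV ''rem'') (XV ''k'' \<ominus> XC 1 \<ominus> XV ''mm'')),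
    IT ''nD'' ''w'' (XIf covx (XO OMin (rd ''D'' ''w'' \<oplus> XV ''gi'') (XV ''k'')) (rd ''D'' ''w''))]"

definition gstep :: xc where
  "gstep = XIfC (XV ''j'' \<prec> XV ''N'') (XSeq (blk gap) (XSeq (XPut ''g'' (XV ''j'') (XV ''gi''))
    (XSeq (blk [IT ''D'' ''w'' (rd ''nD'' ''w'')]) (XAsg ''rem'' (XV ''rem'' \<ominus> XV ''gi''))))) XSkip"

text \<open>The least label in the closed neighbourhood within \<open>Z\<close>, written with a
  maximum of \<open>n\<close> minus the label.\<close>

definition lbx :: "name => name => it" where
  "lbx L L' = IT L' ''w'' (XV ''n'' \<ominus> XMax ''u'' (XIf (rd ''iZ'' ''u'' \<and>\<and> (XV ''u'' \<doteq> XV ''w'' \<or>\<or> ax ''u'' ''w'')) (XV ''n'' \<ominus> rd L ''u'') (XC 0)))"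

definition newW :: "it list" where
  "newW = [
    IT ''ps'' ''w'' (rd ''rk'' ''w'' \<oplus> XSum ''u'' (XIf (XV ''u'' \<prec> rd ''rk'' ''w'') (rd ''g'' ''u'') (XC 0))),
    IA ''nu'' (xcnt ''u'' (rd ''iU'' ''u'')),
    IA ''nq'' (XO OMin (XV ''n'') (XIf (XV ''q'' \<prec> XV ''nu'' \<oplus> XV ''k'') (XV ''nu'' \<oplus> XV ''k'') (XV ''q''))),
    IT ''uu'' ''x'' (xex ''u'' (rd ''iU'' ''u'' \<and>\<and> rd ''c'' ''u'' \<doteq> XV ''x'')),
    IT ''ur'' ''x'' (xcnt ''y'' (XV ''y'' \<prec> XV ''x'' \<and>\<and> xnot (rd ''uu'' ''y''))),
    IT ''nw'' ''w'' (xfst ''x'' (xnot (rd ''uu'' ''x'') \<and>\<and> rd ''ur'' ''x'' \<doteq> XO OMod (rd ''ps'' ''w'') (XV ''k''))),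
    IT ''l0'' ''w'' (XV ''w''), lbx ''l0'' ''l1'', lbx ''l1'' ''l2'', lbx ''l2'' ''l3'', lbx ''l3'' ''l4'', lbx ''l4'' ''l5'',
    IT ''lb'' ''w'' (XIf (rd ''iZ'' ''w'') (rd ''l5'' ''w'') (XV ''n''))]"

definition comp0 :: "it list" where
  "comp0 = [IS ''RR'' (guard ''lb'' ''r'' ''z'' (rd ''iZ'' ''z'')), IT ''pi'' ''x'' (XV ''x''), IT ''pj'' ''x'' (XV ''x'')]"

text \<open>\<open>pi\<close> is composed with the transposition that makes it send the old colour
  of \<open>w\<close> to the new one. The inverse \<open>pj\<close> finds the other affected
  argument in constant time.\<close>

definition transp :: xc where
  "transp = XSeq (blk [IA ''tx'' (rd ''c'' ''w''), IA ''tt'' (rd ''nw'' ''w''), IA ''tc'' (rd ''pi'' ''tx''), IA ''to'' (rd ''pj'' ''tt'')])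
    (XSeq (XPut ''pi'' (XV ''tx'') (XV ''tt'')) (XSeq (XPut ''pi'' (XV ''to'') (XV ''tc''))
    (XSeq (XPut ''pj'' (XV ''tt'') (XV ''tx'')) (XPut ''pj'' (XV ''tc'') (XV ''to'')))))"

definition hang :: xc where
  "hang = XSeq (blk comp0) (XSeq (XFor ''w'' (XIfC (rd ''iW'' ''w'' \<and>\<and> rd ''RR'' ''w'') transp XSkip))
    (XFor ''y'' (XIfC (rd ''lb'' ''y'' \<doteq> XV ''r'' \<and>\<and> rd ''iZ'' ''y'') (XPut ''nw'' (XV ''y'') (XR ''pi'' (rd ''c'' ''y''))) XSkip)))"

text \<open>All new colours are first collected in \<open>nw\<close>: each component still needs the
  old colours of its vertices and of its neighbours in \<open>W\<close>.\<close>

definition recol :: xc where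
  "recol = XSeq (blk arcblk) (XSeq (XFor ''j'' gstep) (XSeq (blk newW) (XSeq (XFor ''r'' hang)
    (XSeq (XFor ''y'' (XIfC (rd ''vis'' ''y'' \<and>\<and> xnot (rd ''iU'' ''y'')) (XPut ''c'' (XV ''y'') (rd ''nw'' ''y'')) XSkip))
    (XAsg ''q'' (XV ''nq''))))))"

definition vstep :: xc where
  "vstep = XSeq (blk pick) (XSeq (XIfC (XV ''bu'' \<prec> XV ''n'') (blk gem) kemp) (XSeq (XPut ''vis'' (XV ''v'') (XC 1))
    (XSeq (XIfC (XV ''hole'') recol XSkip) (blk [IT ''lab'' ''w'' (rd ''nl'' ''w'')]))))"

definition prog :: xc where
  "prog = XSeq (XFor ''m'' vstep) (blk [IT ''col'' ''w'' (rd ''c'' ''w'' \<oplus> XC 1)])"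

text \<open>The degrees are crude, as a constant counts with its own size: the 14 in
  \<open>dlx\<close> already leads to degree 14, and the packed key \<open>K\<close> has degree 9.
  The word exponent 20 leaves room for this.\<close>

definition Gam :: "name => nat" where
  "Gam x = (if x \<in> {''mx'', ''key'', ''k1'', ''k2'', ''k'', ''D'', ''nD'', ''mm'', ''gi'', ''g'', ''col''} then 2 else if x = ''cl'' then 3
    else if x \<in> {''rem'', ''ps''} then 4 else if x = ''K'' then 9 else 1)"

lemma prog_ok: "xck Gam 20 prog" by code_simp

lemma prog_ssa: "ssa pick" "ssa gem" "ssa start" "ssa levels" "ssa chole" "ssa swap" "ssa arcblk" "ssa gap" "ssa newW" "ssa comp0"
  by code_simp+

lemma tle_Seq': "xck \<Gamma> k (XSeq p q) ==> tle d p ==> tle d q ==> tle d (XSeq p q)"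
  using xck_wrs[of \<Gamma> k p] by (intro tle_Seq) auto

lemma tcl_blk:
  "(!!t. t \<in> set ts ==> tcl A x (xit t) & ''n'' \<notin> its t & x \<notin> its t & A \<notin> ita t) ==> tcl A x (blk ts)"
proof (induction ts)
  case Nil
  thus ?case by (simp add: tcl_tle[OF tle_Skip])
next
  case (Cons t ts)
  thus ?case by (auto intro!: tcl_Seq simp: wrs_it wra_it)
qed

lemma tle_IT: "nfree e ==> edg e = 0 ==> i ~= ''n'' ==> tle 1 (xit (IT a i e))"
  using tle_For[OF tle_Put[of "XV i" e 0 a], of i] by (simp add: tab_def)

lemma tcl_levels: "tcl ''c0'' ''a'' (blk levels)"
proof (rule tcl_blk)
  fix t assume t: "t \<in> set levels"
  have stA: "tcl ''c0'' ''a'' (xit (stpA B A))" if "A ~= ''c0''" for A B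
    unfolding stpA_def inA_def by (rule tcl_tab) (use that in "auto simp: xex_def xand_def xadj_def")
  have sc: "tcl ''c0'' ''a'' (xit (IS R (inA ''z'' (rd A ''z''))))" if "R ~= ''c0''" for A R
    unfolding inA_def by (rule tcl_scat) (use that in auto)
  have it: "tcl ''c0'' ''a'' (xit (IT A ''w'' e))" if "nfree e" "edg e = 0" for A e
    by (rule tcl_tle[OF tle_IT[OF that]]) simp
  have ia: "tcl ''c0'' ''a'' (xit (IA x e))" if "nfree e" "edg e <= 1" for x e
    unfolding xit.simps by (rule tcl_tle[OF tle_Asg[OF that]])
  have TT: "tcl ''c0'' ''a'' (xit (IT ''TT'' ''w'' (XIf (inA ''w'' (rd ''A3'' ''w'' \<and>\<and> rd ''nv'' ''w''))
      (xnot (xex ''y'' (rd ''nv'' ''y'' \<and>\<and> rd ''c'' ''y'' \<doteq> XV ''b'' \<and>\<and> ax ''y'' ''w''))) (XC 0))))"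
    unfolding inA_def by (rule tcl_tab) (auto simp: xex_def xand_def xadj_def xnot_def)
  have "list_all (%t. tcl ''c0'' ''a'' (xit t)) levels"
    unfolding levels_def stpB_def append_Cons append_Nil list.pred_inject
    by (intro conjI TrueI TT stA sc it ia) (simp_all add: xand_def xnot_def xfst_def)
  hence "tcl ''c0'' ''a'' (xit t)" using t by (simp add: list_all_iff)
  moreover have "\<forall>t\<in>set levels. ''n'' \<notin> its t & ''a'' \<notin> its t & ''c0'' \<notin> ita t" by code_simp
  ultimately show "tcl ''c0'' ''a'' (xit t) & ''n'' \<notin> its t & ''a'' \<notin> its t & ''c0'' \<notin> ita t" using t by blast
qed

lemma kstep_ok: "xck Gam 20 kstep" and recol_ok: "xck Gam 20 recol" and vstep_ok: "xck Gam 20 vstep" and kemp_ok: "xck Gam 20 kemp"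
  and hang_ok: "xck Gam 20 hang" and gstep_ok: "xck Gam 20 gstep"
  using prog_ok by (simp_all only: prog_def vstep_def kemp_def recol_def xck.simps simp_thms)

lemma tcl_kstep: "tcl ''c0'' ''a'' kstep"
proof -
  have t: "tle 1 (XIfC (XV ''tz'' \<prec> XV ''n'') (blk chole) (XSeq (blk swap) (blk [IT ''c'' ''w'' (rd ''nc'' ''w'')])))" (is "tle 1 ?p")
  proof (rule tle_cdg)
    show "xck Gam 20 ?p" using kstep_ok by (simp only: kstep_def xck.simps simp_thms)
    show "cdg ?p <= 1" by code_simp
  qed
  have w: "''n'' \<notin> wrs (blk levels)" "''a'' \<notin> wrs (blk levels)" "''c0'' \<notin> wra (blk levels)" by code_simp+
  show ?thesis unfolding kstep_def
    by (rule tcl_If[OF _ _ tcl_Seq[OF tcl_levels tcl_tle[OF t] w] tcl_tle[OF tle_Skip]]) (auto simp: xand_def xnot_def)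
qed

text \<open>All Kempe changes for one vertex together are quadratic because each round is charged to
  its class in \<open>c0\<close>.\<close>

lemma tle_kemp: "tle 2 kemp"
proof -
  have w: "''n'' \<notin> wrs kstep" "''a'' \<notin> wrs kstep" "''c0'' \<notin> wra kstep" by code_simp+
  have K: "tle 2 (XFor ''a'' kstep)" by (rule tle_For_tcl[OF tcl_kstep w]) simp
  have a: "tle 2 (blk start)"
    by (rule tle_cdg[of Gam 20]) (use kemp_ok in "simp only: kemp_def xck.simps simp_thms", code_simp)
  have b: "tle 2 newcol" by (rule tle_cdg[of Gam 20]) (use kemp_ok in "simp only: kemp_def xck.simps simp_thms", code_simp)
  have c: "tle 2 (XIfC (XV ''hole'') XSkip (XIfC (xex ''w'' (rd ''nv'' ''w'' \<and>\<and> rd ''c'' ''w'' \<doteq> XV ''b'')) newcol (XPut ''c'' (XV ''v'') (XV ''b''))))"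
    by (rule tle_cdg[of Gam 20]) (use kemp_ok in "simp only: kemp_def xck.simps simp_thms", code_simp)
  have "tle 2 (XIfC (XV ''b'' \<prec> XV ''n'') (XSeq (XFor ''a'' kstep) (XIfC (XV ''hole'') XSkip (XIfC (xex ''w'' (rd ''nv'' ''w'' \<and>\<and> rd ''c'' ''w'' \<doteq> XV ''b'')) newcol (XPut ''c'' (XV ''v'') (XV ''b''))))) newcol)"
  proof (rule tle_If[OF _ _ tle_Seq'[of Gam 20, OF _ K c] b])
    show "xck Gam 20 (XSeq (XFor ''a'' kstep) (XIfC (XV ''hole'') XSkip (XIfC (xex ''w'' (rd ''nv'' ''w'' \<and>\<and> rd ''c'' ''w'' \<doteq> XV ''b'')) newcol (XPut ''c'' (XV ''v'') (XV ''b'')))))"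
      using kemp_ok by (simp only: kemp_def xck.simps simp_thms)
  qed simp_all
  from tle_Seq'[of Gam 20, OF _ a this] show ?thesis using kemp_ok unfolding kemp_def by blast
qed

text \<open>The loop over the component labels is charged to the array \<open>lb\<close>, whose
  classes below \<open>n\<close> are the components; the other parts have loop depth two.\<close>

lemma tle_recol: "tle 2 recol"
proof -
  have c0: "tcl ''lb'' ''r'' (blk comp0)"
  proof (rule tcl_blk)
    fix t assume "t \<in> set comp0"
    moreover have "tcl ''lb'' ''r'' (xit (IS ''RR'' (guard ''lb'' ''r'' ''z'' (rd ''iZ'' ''z''))))" by (rule tcl_scat) auto
    moreover have "tcl ''lb'' ''r'' (xit (IT A ''x'' (XV ''x'')))" for A by (rule tcl_tle[OF tle_IT]) auto
    ultimately show "tcl ''lb'' ''r'' (xit t) & ''n'' \<notin> its t & ''r'' \<notin> its t & ''lb'' \<notin> ita t"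
      unfolding comp0_def by auto
  qed
  have "tle 1 (XSeq (XFor ''w'' (XIfC (rd ''iW'' ''w'' \<and>\<and> rd ''RR'' ''w'') transp XSkip))
    (XFor ''y'' (XIfC (rd ''lb'' ''y'' \<doteq> XV ''r'' \<and>\<and> rd ''iZ'' ''y'') (XPut ''nw'' (XV ''y'') (XR ''pi'' (rd ''c'' ''y''))) XSkip)))"
    by (rule tle_cdg[of Gam 20]) (use hang_ok in "simp only: hang_def xck.simps simp_thms", code_simp)
  moreover have "''n'' \<notin> wrs (blk comp0)" "''r'' \<notin> wrs (blk comp0)" "''lb'' \<notin> wra (blk comp0)" by code_simp+
  ultimately have "tcl ''lb'' ''r'' hang" unfolding hang_def using c0 by (intro tcl_Seq[OF c0 tcl_tle])
  moreover have "''n'' \<notin> wrs hang" "''r'' \<notin> wrs hang" "''lb'' \<notin> wra hang" by code_simp+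
  ultimately have C: "tle 2 (XFor ''r'' hang)" by (rule tle_For_tcl) simp
  have "tle 2 (blk arcblk)" "tle 2 (XFor ''j'' gstep)" "tle 2 (blk newW)"
    "tle 2 (XFor ''y'' (XIfC (rd ''vis'' ''y'' \<and>\<and> xnot (rd ''iU'' ''y'')) (XPut ''c'' (XV ''y'') (rd ''nw'' ''y'')) XSkip))" "tle 2 (XAsg ''q'' (XV ''nq''))"
    by (rule tle_cdg[of Gam 20]; (use recol_ok in "simp only: recol_def xck.simps simp_thms"; fail | code_simp))+
  thus ?thesis unfolding recol_def
    by (intro tle_Seq'[of Gam 20] C) (use recol_ok in "simp_all only: recol_def xck.simps simp_thms")
qed

lemma tle_prog: "tle 3 prog"
proof -
  have "tle 2 (blk pick)" "tle 2 (blk gem)" "tle 2 (XPut ''vis'' (XV ''v'') (XC 1))" "tle 2 (blk [IT ''lab'' ''w'' (rd ''nl'' ''w'')])"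
    by (rule tle_cdg[of Gam 20]; (use vstep_ok in "simp only: vstep_def xck.simps simp_thms"; fail | code_simp))+
  hence "tle 2 vstep" unfolding vstep_def
    by (intro tle_Seq'[of Gam 20] tle_If tle_kemp tle_recol tle_Skip)
      (use vstep_ok in "simp_all only: vstep_def xck.simps nfree.simps edg.simps simp_thms")
  moreover have "''n'' \<notin> wrs vstep" using vstep_ok xck_wrs by blast
  ultimately have V: "tle 3 (XFor ''m'' vstep)" using tle_For[of 2 vstep "''m''"] by simp
  have "tle 3 (blk [IT ''col'' ''w'' (rd ''c'' ''w'' \<oplus> XC 1)])"
    by (rule tle_cdg[of Gam 20]) (use prog_ok in "simp only: prog_def xck.simps simp_thms", code_simp)
  thus ?thesis unfolding prog_def
    by (intro tle_Seq'[of Gam 20] V) (use prog_ok in "simp_all only: prog_def xck.simps simp_thms")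
qed

section \<open>Correctness of the program\<close>

lemma first_cong [cong]: "n = n' ==> (!!j. j < n' ==> P j = Q j) ==> first n P = first n' Q"
  unfolding first_def by (intro arg_cong2[where f = "(-)"] arg_cong[where f = Max] arg_cong2[where f = insert] image_cong) auto

lemma if_pos [simp]: "(0 < (if P then 1 else 0 :: nat)) = P" "((if P then 1 else 0 :: nat) = 0) = (~ P)"
  "(0 < (if P then 0 else 1 :: nat)) = (~ P)" "((if P then 0 else 1 :: nat) = 0) = P"
  "((if P then 1 else 0 :: nat) = (if Q then 1 else 0)) = (P = Q)"
  by simp_all

locale ram_graph = pcc_free E for E :: "nat => nat => bool" +
  fixes n :: nat
  assumes E_less: "E u w ==> u < n" and n_pos: "1 <= n"
begin

section \<open>Optimal colourings, labels and the choice of the next vertex\<close>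

definition base :: "state => bool" where
  "base s <-> nn s = n & (\<forall>u<n. \<forall>w<n. array s ''adj'' (u * n + w) ~= 0 <-> E u w)"

lemma base_frame: "base s ==> nn s' = nn s ==> array s' ''adj'' = array s ''adj'' ==> base s'"
  by (simp add: base_def)

lemma base_xsem: "base s ==> ''n'' \<notin> wrs c ==> ''adj'' \<notin> wra c ==> base (xsem c s)"
  by (rule base_frame) (auto simp: scalar_xsem array_xsem)

lemma adjE: "base s ==> u < n ==> w < n ==> (0 < array s ''adj'' (u * n + w)) = E u w"
  and adjE0: "base s ==> u < n ==> w < n ==> (array s ''adj'' (u * n + w) = 0) = (~ E u w)"
  unfolding base_def by (metis neq0_conv)+

lemma base_n: "base s ==> nn s = n"
  by (simp add: base_def)

definition vis :: "state => nat set" where "vis s = {w. w < n & array s ''vis'' w ~= 0}"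

definition prp :: "nat set => (nat => nat) => nat => bool" where
  "prp P c q <-> (\<forall>x\<in>P. c x < q) & (\<forall>x\<in>P. \<forall>y\<in>P. E x y --> c x ~= c y)"

definition opt :: "nat set => (nat => nat) => nat => bool" where
  "opt P c q <-> prp P c q & (\<forall>f r. prp P f r --> q <= r)"

lemma opt_le_card:
  assumes "opt P c q" "finite P"
  shows "q <= card P"
proof -
  obtain f :: "nat => nat" where f: "bij_betw f P {0..<card P}" using ex_bij_betw_finite_nat[OF assms(2)] by blast
  have "prp P f (card P)"
    unfolding prp_def
  proof (intro conjI ballI impI)
    fix x y assume "x \<in> P" "y \<in> P" "E x y"
    thus "f x ~= f y" using f by (metis E_irrefl bij_betw_imp_inj_on inj_onD)
  qed (use f in "auto simp: bij_betw_def")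
  thus ?thesis using assms(1) by (auto simp: opt_def)
qed

lemma prp_mono: "prp P c q ==> Q \<subseteq> P ==> q <= r ==> prp Q c r"
  unfolding prp_def by (meson order_less_le_trans subsetD)

lemma opt_lower: "opt P c q ==> P \<subseteq> Q ==> prp Q f r ==> q <= r"
  unfolding opt_def using prp_mono[of Q f r P r] by blast

text \<open>Ordering invariant: \<open>p\<close> enumerates the processed vertices, and the labels order the other vertices as LexBFS does.\<close>

definition ord :: "(nat => nat) => nat => state => bool" where
  "ord p m s <-> inj_on p {..<m} & vis s = p ` {..<m} & (\<forall>j<m. \<forall>i<j. ~ lexless p i (p i) (p j)) &
     (\<forall>u w. u < n --> w < n --> u \<notin> vis s --> w \<notin> vis s -->
        (array s ''lab'' u < array s ''lab'' w <-> lexless p m u w) & (\<forall>i<m. ~ lexless p i (p i) w))"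

lemma lexless_cong: "(!!l. l < i ==> p l = p' l) ==> lexless p i u w = lexless p' i u w"
proof -
  assume e: "!!l. l < i ==> p l = p' l"
  have "(~ E (p l) u & E (p l) w & (\<forall>l'<l. E (p l') u = E (p l') w)) <->
      (~ E (p' l) u & E (p' l) w & (\<forall>l'<l. E (p' l') u = E (p' l') w))" if "l < i" for l
    using e that by simp
  thus ?thesis unfolding lexless_def by blast
qed

text \<open>If neither label is smaller so far, the two vertices agree on the first \<open>i\<close>
  vertices, and \<open>p i\<close> alone decides.\<close>

lemma lexless_Suc: "lexless p (Suc i) u w <-> lexless p i u w | ~ lexless p i u w & ~ lexless p i w u & ~ E (p i) u & E (p i) w"
proof -
  have eq: "(\<forall>l<i. E (p l) u = E (p l) w) <-> ~ lexless p i u w & ~ lexless p i w u"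
  proof
    assume "~ lexless p i u w & ~ lexless p i w u"
    hence n: "~ lexless p i u w" "~ lexless p i w u" by auto
    show "\<forall>l<i. E (p l) u = E (p l) w"
    proof (intro allI impI)
      fix l assume "l < i"
      thus "E (p l) u = E (p l) w"
      proof (induction l rule: less_induct)
        case (less l)
        hence "\<forall>l'<l. E (p l') u = E (p l') w" by auto
        thus ?case using n less.prems unfolding lexless_def by metis
      qed
    qed
  qed (auto simp: lexless_def)
  have "lexless p (Suc i) u w <-> lexless p i u w | ~ E (p i) u & E (p i) w & (\<forall>l<i. E (p l) u = E (p l) w)"
    unfolding lexless_def less_Suc_eq by blast
  thus ?thesis using eq by blast
qed

lemma rank_less:
  fixes f :: "nat => nat"
  assumes "finite A" "u \<in> A" "w \<in> A"
  shows "card {x\<in>A. f x < f u} < card {x\<in>A. f x < f w} <-> f u < f w"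
proof -
  have *: "card {x\<in>A. f x < f u} < card {x\<in>A. f x < f w}" if "u \<in> A" "f u < f w" for u w
    by (rule psubset_card_mono) (use assms(1) that in auto)
  have "card {x\<in>A. f x < f w} <= card {x\<in>A. f x < f u}" if "f w <= f u"
    by (rule card_mono) (use assms(1) that in auto)
  thus ?thesis using *[OF assms(2)] by (meson not_less)
qed

lemma pick_facts:
  assumes b: "base s" and o: "ord p m s" and m: "m < n"
  defines "s' \<equiv> xsem (blk pick) s"
  defines "v \<equiv> scalar s' ''v''"
  shows "base s'" "vis s' = vis s" "array s' ''c'' = array s ''c''" "scalar s' ''q'' = scalar s ''q''"
    "v < n" "v \<notin> vis s" "lexbfs (p(m := v)) m"
    "ord (p(m := v)) (Suc m) (set_array ''vis'' v 1 (s'\<lparr>array := (array s')(''lab'' := array s' ''nl'')\<rparr>))"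
    "!!w. w < n ==> array s' ''nv'' w ~= 0 <-> w \<in> vis s & E v w"
    "!!w. w < n ==> array s' ''S'' w ~= 0 <-> w \<in> vis s & E v w & (\<exists>u\<in>vis s. E v u & u ~= w & ~ E u w)"
    "!!w. w < n ==> array s' ''M'' w ~= 0 <-> array s' ''nv'' w ~= 0 & array s' ''S'' w = 0"
    "!!w. w < n ==> array s' ''S'' w ~= 0 ==> array s' ''lead'' w = first n (%u. array s' ''S'' u ~= 0 & (u = w | E u w))"
    "scalar s' ''bu'' = first n (%u. \<exists>w<n. array s' ''S'' u ~= 0 & array s' ''S'' w ~= 0 & ((u = w | E u w) ~= (array s' ''lead'' u = array s' ''lead'' w)))"
    "scalar s' ''bu'' < n ==> scalar s' ''bw'' = first n (%w. array s' ''S'' (scalar s' ''bu'') ~= 0 & array s' ''S'' w ~= 0 &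
       ((scalar s' ''bu'' = w | E (scalar s' ''bu'') w) ~= (array s' ''lead'' (scalar s' ''bu'') = array s' ''lead'' w)))"
    "scalar s' ''hole'' = 0"
proof -
  have fs: "scalar s' x = scalar s x" if "x \<notin> {''mx'', ''v'', ''w'', ''bu'', ''bw'', ''hole''}" for x
    unfolding s'_def by (rule scalar_blk) (use that in "simp add: pick_def")
  have fa: "array s' a = array s a" if "a \<notin> {''nl'', ''nv'', ''S'', ''M'', ''lead''}" for a
    unfolding s'_def by (rule array_blk) (use that in "simp add: pick_def")
  show b': "base s'" by (rule base_frame[OF b]) (simp_all add: fs fa)
  note adj = adjE[OF b'] adjE0[OF b'] adjE[OF b] adjE0[OF b] and n' = base_n[OF b']
  show vis': "vis s' = vis s" "array s' ''c'' = array s ''c''" "scalar s' ''q'' = scalar s ''q''" by (simp_all add: vis_def fs fa)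
  have H: "!!t. t \<in> set pick ==> holds s' t" unfolding s'_def by (rule ssa_holds[OF prog_ssa(1)])
  have visE: "array s ''vis'' w ~= 0 <-> w \<in> vis s" "array s ''vis'' w = 0 <-> w \<notin> vis s" if "w < n" for w using that by (simp_all add: vis_def)
  have oo: "inj_on p {..<m}" "vis s = p ` {..<m}" "\<forall>j<m. \<forall>i<j. ~ lexless p i (p i) (p j)"
    "!!u w. [|u < n; w < n; u \<notin> vis s; w \<notin> vis s|] ==> array s ''lab'' u < array s ''lab'' w <-> lexless p m u w"
    "!!w i. [|w < n; w \<notin> vis s; i < m|] ==> ~ lexless p i (p i) w" using o unfolding ord_def by blast+
  have "card (vis s) = m" using oo(1,2) card_image by fastforce
  moreover have "finite (vis s)" unfolding oo(2) by simp
  ultimately have "~ {..<n} \<subseteq> vis s" using card_mono[of "vis s" "{..<n}"] m by auto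
  then obtain w0 where w0: "w0 < n" "w0 \<notin> vis s" by blast
  define f where "f i = (if i \<in> vis s then 0 else array s ''lab'' i + 1)" for i
  define mx where "mx = Max (insert 0 (f ` {..<n}))"
  have smx: "scalar s' ''mx'' = mx"
  proof -
    have "scalar s' ''mx'' = Max (insert 0 ((%j. if array s' ''vis'' j ~= 0 then 0 else array s' ''lab'' j + 1) ` {..<n}))"
      using H[of "IA ''mx'' (XMax ''i'' (XIf (rd ''vis'' ''i'') (XC 0) (rd ''lab'' ''i'' \<oplus> XC 1)))"] by (simp add: pick_def n' cong: image_cong)
    also have "(%j. if array s' ''vis'' j ~= 0 then 0 else array s' ''lab'' j + 1) ` {..<n} = f ` {..<n}"
      by (rule image_cong) (auto simp: f_def fa vis_def)
    finally show ?thesis by (simp add: mx_def)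
  qed
  have mxge: "f i <= mx" if "i < n" for i unfolding mx_def by (rule Max_ge) (use that in auto)
  have "mx \<in> insert 0 (f ` {..<n})" unfolding mx_def by (rule Max_in) auto
  moreover have "mx ~= 0" using mxge[OF w0(1)] w0(2) by (simp add: f_def)
  ultimately obtain i0 where i0: "i0 < n" "f i0 = mx" by auto
  have vdef: "v = first n (%i. i \<notin> vis s & array s ''lab'' i + 1 = mx)"
    using H[of "IA ''v'' (xfst ''i'' (xnot (rd ''vis'' ''i'') \<and>\<and> rd ''lab'' ''i'' \<oplus> XC 1 \<doteq> XV ''mx''))"] visE
    by (simp add: pick_def v_def xval_xfst n' smx fa cong: conj_cong)
  have "i0 \<notin> vis s & array s ''lab'' i0 + 1 = mx" using i0 \<open>mx ~= 0\<close> by (auto simp: f_def split: if_splits)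
  from first_some[OF i0(1), of "%i. i \<notin> vis s & array s ''lab'' i + 1 = mx", OF this]
  have v: "v < n" "v \<notin> vis s" and vlab: "array s ''lab'' v + 1 = mx" unfolding vdef by auto
  thus "v < n" "v \<notin> vis s" by auto
  have vmax: "~ lexless p m v w" if "w < n" "w \<notin> vis s" for w
    using mxge[OF that(1)] that(2) vlab oo(4)[OF v(1) that(1) v(2) that(2)] by (simp add: f_def)
  have lc: "lexless (p(m := v)) i a b = lexless p i a b" if "i <= m" for i a b by (rule lexless_cong) (use that in auto)
  have inj: "inj_on (p(m := v)) {..m}"
    using oo(1,2) v(2) by (auto simp: inj_on_def lessThan_Suc_atMost[symmetric] less_Suc_eq)
  have le: "~ lexless (p(m := v)) i ((p(m := v)) i) ((p(m := v)) j)" if "j <= m" "i < j" for i j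
    using that oo(3) oo(5)[OF v] by (auto simp: lc le_less)
  show "lexbfs (p(m := v)) m" using inj le by (auto simp: lexbfs_def)
  have nv: "array s' ''nv'' w ~= 0 <-> w \<in> vis s & E v w" if "w < n" for w
    using H[of "IT ''nv'' ''w'' (rd ''vis'' ''w'' \<and>\<and> ax ''v'' ''w'')"] that visE[OF that] v(1)
    by (simp add: pick_def xadj_def n' fa adj v_def[symmetric])
  thus "array s' ''nv'' w ~= 0 <-> w \<in> vis s & E v w" if "w < n" for w using that by blast
  \<comment> \<open>The adjacency to \<open>v\<close> is appended to the label as a last binary
    digit; \<open>nl\<close> is the rank with respect to this number.\<close>
  define k where "k w = 2 * array s ''lab'' w + (if E v w then 1 else 0)" for w
  have nl: "array s' ''nl'' w = card {u \<in> {u. u < n & u \<notin> vis s}. k u < k w}" if "w < n" for w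
  proof -
    let ?e = "xnot (rd ''vis'' ''u'') \<and>\<and>
      (rd ''lab'' ''u'' \<prec> rd ''lab'' ''w'' \<or>\<or> (rd ''lab'' ''u'' \<doteq> rd ''lab'' ''w'' \<and>\<and> ax ''v'' ''w'' \<and>\<and> xnot (ax ''v'' ''u'')))"
    have "IT ''nl'' ''w'' (xcnt ''u'' ?e) \<in> set pick" by (simp add: pick_def)
    from H[OF this] that have "array s' ''nl'' w = card {u. u < n & xval ?e (set_scalar ''u'' u (set_scalar ''w'' w s')) ~= 0}"
      by (simp only: holds.simps n' xval_xcnt) (simp add: n')
    also have "{u. u < n & xval ?e (set_scalar ''u'' u (set_scalar ''w'' w s')) ~= 0} = {u \<in> {u. u < n & u \<notin> vis s}. k u < k w}"
    proof (rule Collect_cong)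
      fix u
      have "xval ?e (set_scalar ''u'' u (set_scalar ''w'' w s')) ~= 0 <-> u \<notin> vis s & k u < k w" if "u < n"
      proof -
        have "xval ?e (set_scalar ''u'' u (set_scalar ''w'' w s')) ~= 0 <-> ~ array s ''vis'' u ~= 0 &
            (array s ''lab'' u < array s ''lab'' w | array s ''lab'' u = array s ''lab'' w & E v w & ~ E v u)"
          using that \<open>w < n\<close> v(1) by (simp add: xadj_def n' fa adj v_def[symmetric] conj_commute conj_left_commute)
        thus ?thesis unfolding visE(1)[OF that] by (auto simp: k_def)
      qed
      thus "(u < n & xval ?e (set_scalar ''u'' u (set_scalar ''w'' w s')) ~= 0) = (u \<in> {u. u < n & u \<notin> vis s} & k u < k w)" by blast
    qed
    finally show ?thesis .
  qed
  show "ord (p(m := v)) (Suc m) (set_array ''vis'' v 1 (s'\<lparr>array := (array s')(''lab'' := array s' ''nl'')\<rparr>))" (is "ord _ _ ?s")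
  proof -
    have vs: "vis ?s = insert v (vis s)" using v(1) by (auto simp: vis_def fa)
    have lab: "array ?s ''lab'' = array s' ''nl''" by simp
    show ?thesis unfolding ord_def vs lab
    proof (intro conjI allI impI)
      show "inj_on (p(m := v)) {..<Suc m}" using inj by (simp add: lessThan_Suc_atMost)
      show "insert v (vis s) = (p(m := v)) ` {..<Suc m}" using oo(2) by (auto simp: lessThan_Suc)
      show "~ lexless (p(m := v)) i ((p(m := v)) i) ((p(m := v)) j)" if "j < Suc m" "i < j" for i j using le[of j i] that by simp
      fix u w assume uw: "u < n" "w < n" "u \<notin> insert v (vis s)" "w \<notin> insert v (vis s)"
      have "array s' ''nl'' u < array s' ''nl'' w <-> k u < k w"
        unfolding nl[OF uw(1)] nl[OF uw(2)] by (rule rank_less) (use uw in auto)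
      also have "\<dots> <-> array s ''lab'' u < array s ''lab'' w | array s ''lab'' u = array s ''lab'' w & ~ E v u & E v w"
        by (auto simp: k_def)
      also have "\<dots> <-> lexless p m u w | ~ lexless p m u w & ~ lexless p m w u & ~ E v u & E v w"
        using oo(4)[of u w] oo(4)[of w u] uw by auto
      also have "\<dots> <-> lexless (p(m := v)) (Suc m) u w" unfolding lexless_Suc by (simp add: lc)
      finally show "array s' ''nl'' u < array s' ''nl'' w <-> lexless (p(m := v)) (Suc m) u w" .
      show "~ lexless (p(m := v)) i ((p(m := v)) i) w" if "i < Suc m" for i
        using that oo(5)[OF uw(2)] vmax[OF uw(2)] uw(4) by (auto simp: lc less_Suc_eq)
    qed
  qed
  show S: "array s' ''S'' w ~= 0 <-> w \<in> vis s & E v w & (\<exists>u\<in>vis s. E v u & u ~= w & ~ E u w)" if "w < n" for w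
  proof -
    have "array s' ''S'' w ~= 0 <-> array s' ''nv'' w ~= 0 & (\<exists>u<n. array s' ''nv'' u ~= 0 & u ~= w & ~ E u w)"
      using H[of "IT ''S'' ''w'' (rd ''nv'' ''w'' \<and>\<and> xex ''u'' (rd ''nv'' ''u'' \<and>\<and> xnot (XV ''u'' \<doteq> XV ''w'') \<and>\<and> xnot (ax ''u'' ''w'')))"] that
      by (auto simp: pick_def xadj_def n' adj)
    thus ?thesis using nv that unfolding vis_def by blast
  qed
  show "array s' ''M'' w ~= 0 <-> array s' ''nv'' w ~= 0 & array s' ''S'' w = 0" if "w < n" for w
    using H[of "IT ''M'' ''w'' (rd ''nv'' ''w'' \<and>\<and> xnot (rd ''S'' ''w''))"] that by (simp add: pick_def n')
  show "array s' ''lead'' w = first n (%u. array s' ''S'' u ~= 0 & (u = w | E u w))" if "w < n" "array s' ''S'' w ~= 0" for w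
    using H[of "IT ''lead'' ''w'' (XIf (rd ''S'' ''w'') (xfst ''u'' (rd ''S'' ''u'' \<and>\<and> (XV ''u'' \<doteq> XV ''w'' \<or>\<or> ax ''u'' ''w''))) (XC 0))"] that
    by (simp add: pick_def xval_xfst xadj_def n' adj)
  show "scalar s' ''bu'' = first n (%u. \<exists>w<n. array s' ''S'' u ~= 0 & array s' ''S'' w ~= 0 & ((u = w | E u w) ~= (array s' ''lead'' u = array s' ''lead'' w)))"
    using H[of "IA ''bu'' (xfst ''u'' (xex ''w'' (badx ''u'' ''w'')))"]
    by (simp add: pick_def badx_def xval_xfst xadj_def n' adj)
  show "scalar s' ''bw'' = first n (%w. array s' ''S'' (scalar s' ''bu'') ~= 0 & array s' ''S'' w ~= 0 &
       ((scalar s' ''bu'' = w | E (scalar s' ''bu'') w) ~= (array s' ''lead'' (scalar s' ''bu'') = array s' ''lead'' w)))" if "scalar s' ''bu'' < n"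
    using H[of "IA ''bw'' (xfst ''w'' (badx ''bu'' ''w''))"] that
    by (simp add: pick_def badx_def xval_xfst xadj_def n' adj)
  show "scalar s' ''hole'' = 0" using H[of "IA ''hole'' (XC 0)"] by (simp add: pick_def)
qed

end

context pcc_free begin

text \<open>Seeing both ends would close a 4-cycle with \<open>z\<close>; seeing neither is excluded
  by \<open>no_P3_K1\<close>.\<close>

lemma gem_P4:
  assumes D: "conn D" "v \<notin> D" "!!u. u \<in> D ==> ~ E v u"
    and at: "!!s u. [|s \<in> T; u \<in> T; u ~= s; ~ E s u|] ==> \<exists>d\<in>D. E s d" and T: "!!w. w \<in> T ==> E v w"
    and xyz: "x \<in> T" "y \<in> T" "z \<in> T" "E x z" "E z y" "~ E x y" "x ~= y" and w: "w \<in> T" "w ~= z" "~ E w z"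
  shows "E w x & ~ E w y | E w y & ~ E w x"
proof -
  have wxy: "w ~= x" "w ~= y" using xyz w E_sym by auto
  have "~ (E w x & E w y)" using no_C4[of w x z y] xyz w wxy E_comm by metis
  moreover have "E w x | E w y"
  proof (rule ccontr)
    assume n: "~ ?thesis"
    obtain dx dy dw where "dx \<in> D" "E x dx" "dy \<in> D" "E y dy" "dw \<in> D" "E w dw"
      using at[of x y] at[of y x] at[of w z] xyz w E_comm by metis
    from no_P3_K1[OF D this, of z] show False using T xyz w wxy n E_comm by metis
  qed
  ultimately show ?thesis by blast
qed

end

context ram_graph begin

text \<open>The third set contains every possible third inner vertex of a chain. If none is adjacent
  to \<open>t\<close>, then \<open>hole_through\<close> guarantees a chain with four inner vertices,
  and the absence of shorter chains makes the one found induced by \<open>chain4\<close>.\<close>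

lemma bfs_paths:
  fixes A L1 L2 L3 L4 :: "nat => bool"
  assumes v: "E v s" "E v t" "~ E s t" "s ~= t" and A: "!!w. A w ==> w < n & ~ E v w & v ~= w"
    and D: "conn D" "!!u. u \<in> D ==> A u" "d0 \<in> D" "E s d0" "e0 \<in> D" "E t e0"
    and L: "!!w. w < n ==> L1 w <-> A w & E s w" "!!w. w < n ==> L2 w <-> A w & (\<exists>u<n. L1 u & E u w)"
      "!!w. w < n ==> L3 w <-> A w & (\<exists>u<n. L2 u & E u w)" "!!w. w < n ==> L4 w <-> A w & (\<exists>u<n. L3 u & E u w)"
    and e: "e = first n (%w. L3 w & E w t)" and d: "d = first n (%w. L4 w & E w t)"
    and c: "e < n ==> c = e" "d < n ==> ~ e < n ==> c = first n (%w. L3 w & E w d)"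
    and b: "c < n ==> b = first n (%w. L2 w & E w c)" and a: "b < n ==> a = first n (%w. L1 w & E w b)"
  shows "A a & A b & A c & E s a & E a b & E b c" "e < n ==> E c t" "~ e < n ==> A d & C7 v s a b c d t"
proof -
  have bk: "A a & A b & A c & E s a & E a b & E b c" if c3: "c < n" "L3 c"
  proof -
    have "b < n & L2 b & E b c" using L(3)[OF c3(1)] c3 first_P[of n "%w. L2 w & E w c"] first_less_iff[of n "%w. L2 w & E w c"] b by metis
    moreover from this have "a < n & L1 a & E a b"
      using L(2)[of b] first_P[of n "%w. L1 w & E w b"] first_less_iff[of n "%w. L1 w & E w b"] a by metis
    ultimately show ?thesis using L(1)[of a] L(2)[of b] L(3)[OF c3(1)] c3(2) by blast
  qed
  have e1: "e < n & L3 e & E e t" if "e < n" using that first_P[of n "%w. L3 w & E w t"] e by metis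
  have L3I: "L3 z" if "A x" "A y" "A z" "E s x" "E x y" "E y z" for x y z
  proof -
    have l: "x < n" "y < n" "z < n" using A that by auto
    hence "L1 x" "L2 y" using L(1)[of x] L(2)[of y] that by blast+
    thus ?thesis using L(3)[of z] l that by blast
  qed
  have 4: "A d & E d t & c < n & L3 c & E c d" if ne: "~ e < n"
  proof -
    have no3: "~ (A x & A y & A z & E s x & E x y & E y z & E z t)" for x y z
      using L3I[of x y z] A[of z] ne first_less_iff[of n "%w. L3 w & E w t"] e by blast
    have "\<exists>w<n. L4 w & E w t"
    proof (rule hole_through[OF D(1,3,4,5,6) v(1,2,3,4)])
      show "~ E v u" if "u \<in> D" for u using A D(2) that by blast
      show "v \<notin> D" using A D(2) by blast
      fix x y z assume "x \<in> D" "y \<in> D" "z \<in> D" "E s x" "E x y" "E y z" "E z t"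
      thus ?thesis using no3[of x y z] D(2) by blast
    next
      fix x y z u assume *: "x \<in> D" "y \<in> D" "z \<in> D" "u \<in> D" "E s x" "E x y" "E y z" "E z u" "E u t"
      hence "L3 z" using L3I[of x y z] D(2) by blast
      thus ?thesis using L(4)[of u] A[of u] A[of z] D(2) * by blast
    qed
    hence d4: "d < n" "L4 d" "E d t" using first_P[of n "%w. L4 w & E w t"] first_less_iff[of n "%w. L4 w & E w t"] d by metis+
    hence "c < n & L3 c & E c d"
      using L(4)[of d] first_P[of n "%w. L3 w & E w d"] first_less_iff[of n "%w. L3 w & E w d"] c(2) ne by metis
    thus ?thesis using d4 L(4)[of d] by blast
  qed
  show 1: "A a & A b & A c & E s a & E a b & E b c" using bk e1 4 c(1) by (cases "e < n") auto
  show "e < n ==> E c t" using e1 c(1) by auto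
  show "A d & C7 v s a b c d t" if ne: "~ e < n"
  proof
    show "A d" using 4[OF ne] by blast
    show "C7 v s a b c d t"
    proof (rule chain4[OF v])
      fix x y z assume *: "x \<in> {a, b, c, d}" "y \<in> {a, b, c, d}" "z \<in> {a, b, c, d}" "E s x" "E x y" "E y z"
      have "A x" "A y" "A z" using * 1 4[OF ne] by auto
      thus "~ E z t" using L3I[of x y z] * A[of z] ne first_less_iff[of n "%w. L3 w & E w t"] e by blast
    qed (use 1 4[OF ne] A in auto)
  qed
qed

lemma C7_n7: "C7 a b c d e f g ==> 7 <= n"
proof -
  assume C: "C7 a b c d e f g"
  have "{a, b, c, d, e, f, g} \<subseteq> {..<n}" using C E_less unfolding C7_def by (auto dest: E_sym)
  hence "card {a, b, c, d, e, f, g} <= n" using card_mono[of "{..<n}"] by fastforce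
  thus ?thesis using C7_distinct[OF C] by simp
qed

text \<open>The array is tabulated only below \<open>n\<close>, so its seven entries are available
  thanks to \<open>7 <= n\<close>, which the hole itself provides by \<open>C7_n7\<close>.\<close>

lemma sel7_array:
  assumes "7 <= n" "!!i. i < n ==> f i = (if i = 0 then x0 else if i = 1 then x1 else if i = 2 then x2 else if i = 3 then x3 else if i = 4 then x4 else if i = 5 then x5 else x6)"
    "C7 x0 x1 x2 x3 x4 x5 x6" "x0 = v" "{x1, x2, x3, x4, x5, x6} \<subseteq> P"
  shows "hole f & f 0 = v & f ` {..<7} \<subseteq> insert v P"
proof -
  have f: "f 0 = x0" "f 1 = x1" "f 2 = x2" "f 3 = x3" "f 4 = x4" "f 5 = x5" "f 6 = x6" using assms(1,2) by auto
  have "f i \<in> insert v P" if "i < 7" for i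
  proof -
    have "i = 0 | i = 1 | i = 2 | i = 3 | i = 4 | i = 5 | i = 6" using that by linarith
    thus ?thesis using f assms(4,5) by (elim disjE) auto
  qed
  thus ?thesis using f assms(3,4) unfolding hole_def by auto
qed

lemma gem_facts:
  assumes b: "base s" and v: "v = scalar s ''v''" "v < n" "v \<notin> vis s"
    and D: "conn D" "v \<notin> D" "D \<subseteq> vis s" "!!u. u \<in> D ==> ~ E v u"
      "!!u x. [|u \<in> vis s; x \<in> vis s; E v u; E v x; x ~= u; ~ E u x|] ==> \<exists>d\<in>D. E u d"
    and nv: "!!w. w < n ==> array s ''nv'' w ~= 0 <-> w \<in> vis s & E v w"
    and S: "!!w. w < n ==> array s ''S'' w ~= 0 <-> w \<in> vis s & E v w & (\<exists>u\<in>vis s. E v u & u ~= w & ~ E u w)"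
    and lead: "!!w. w < n ==> array s ''S'' w ~= 0 ==> array s ''lead'' w = first n (%u. array s ''S'' u ~= 0 & (u = w | E u w))"
    and bu: "scalar s ''bu'' = first n (%u. \<exists>w<n. array s ''S'' u ~= 0 & array s ''S'' w ~= 0 & ((u = w | E u w) ~= (array s ''lead'' u = array s ''lead'' w)))"
      "scalar s ''bu'' < n"
    and bw: "scalar s ''bw'' = first n (%w. array s ''S'' (scalar s ''bu'') ~= 0 & array s ''S'' w ~= 0 &
       ((scalar s ''bu'' = w | E (scalar s ''bu'') w) ~= (array s ''lead'' (scalar s ''bu'') = array s ''lead'' w)))"
  defines "s' \<equiv> xsem (blk gem) s"
  shows "hole (array s' ''h'') & array s' ''h'' 0 = v & array s' ''h'' ` {..<7} \<subseteq> insert v (vis s)" "scalar s' ''hole'' = 1"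
proof -
  have H: "!!t. t \<in> set gem ==> holds s' t" unfolding s'_def by (rule ssa_holds[OF prog_ssa(2)])
  have fs: "scalar s' x = scalar s x" if "x \<in> {''n'', ''v'', ''bu'', ''bw''}" for x
    unfolding s'_def by (rule scalar_blk) (use that in "auto simp: gem_def bfs_def lev_def")
  have fa: "array s' a = array s a" if "a \<in> {''adj'', ''vis'', ''nv'', ''lead''}" for a
    unfolding s'_def by (rule array_blk) (use that in "auto simp: gem_def bfs_def lev_def")
  have b': "base s'" by (rule base_frame[OF b]) (simp_all add: fs fa)
  note adj = adjE[OF b'] adjE0[OF b'] adjE[OF b] adjE0[OF b] and n' = base_n[OF b'] base_n[OF b]
  define u w where "u = scalar s ''bu''" and "w = scalar s ''bw''"
  define T where "T = {x \<in> vis s. E v x}"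
  have visn: "x \<in> vis s ==> x < n" for x by (simp add: vis_def)
  have ST: "x \<in> T & (\<exists>y\<in>T. y ~= x & ~ E y x)" if "x < n" "array s ''S'' x ~= 0" for x using S[OF that(1)] that(2) by (auto simp: T_def)
  define Q where "Q u w <-> array s ''S'' u ~= 0 & array s ''S'' w ~= 0 & ((u = w | E u w) ~= (array s ''lead'' u = array s ''lead'' w))" for u w
  have un: "u < n" using bu(2) by (simp add: u_def)
  have uQ: "u = first n (%u. \<exists>w<n. Q u w)" and wQ: "w = first n (Q u)"
    using bu(1) bw unfolding u_def[symmetric] w_def[symmetric] Q_def by auto
  from un have "\<exists>w<n. Q u w" using first_P[of n "%u. \<exists>w<n. Q u w"] unfolding uQ[symmetric] by blast
  hence "w < n" "Q u w" using first_less_iff[of n "Q u"] first_P[of n "Q u"] unfolding wQ[symmetric] by blast+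
  hence uw: "w < n" "array s ''S'' u ~= 0" "array s ''S'' w ~= 0" "(u = w | E u w) ~= (array s ''lead'' u = array s ''lead'' w)"
    unfolding Q_def by blast+
  define l where "l x = array s ''lead'' x" for x
  have l: "l x < n" "array s ''S'' (l x) ~= 0" "l x = x | E (l x) x" "!!y. [|y < l x; array s ''S'' y ~= 0|] ==> y ~= x & ~ E y x"
    if x: "x < n" "array s ''S'' x ~= 0" for x
  proof -
    define R where "R u <-> array s ''S'' u ~= 0 & (u = x | E u x)" for u
    have lx: "l x = first n R" using lead[OF x] by (simp add: l_def R_def)
    have "R x" using x by (simp add: R_def)
    from first_some[OF x(1), of R, OF this] show "l x < n" "array s ''S'' (l x) ~= 0" "l x = x | E (l x) x"
      unfolding lx[symmetric] by (auto simp: R_def)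
    show "y ~= x & ~ E y x" if "y < l x" "array s ''S'' y ~= 0" for y
      using first_not[of y n R] that unfolding lx[symmetric] by (auto simp: R_def)
  qed
  define xx where "xx = scalar s' ''ax''"
  define zz where "zz = scalar s' ''p3''"
  define yy where "yy = scalar s' ''ay''"
  have eqs: "xx = (if E u w then if l u < l w then l u else l w else u)" "zz = (if E u w then if l u < l w then u else w else l u)"
    "yy = (if E u w then if l u < l w then w else u else w)"
    using H[of "IA ''ax'' (XIf (ax ''bu'' ''bw'') (XIf (rd ''lead'' ''bu'' \<prec> rd ''lead'' ''bw'') (rd ''lead'' ''bu'') (rd ''lead'' ''bw'')) (XV ''bu''))"]
      H[of "IA ''p3'' (XIf (ax ''bu'' ''bw'') (XIf (rd ''lead'' ''bu'' \<prec> rd ''lead'' ''bw'') (XV ''bu'') (XV ''bw'')) (rd ''lead'' ''bu''))"]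
      H[of "IA ''ay'' (XIf (ax ''bu'' ''bw'') (XIf (rd ''lead'' ''bu'' \<prec> rd ''lead'' ''bw'') (XV ''bw'') (XV ''bu'')) (XV ''bw''))"] un uw(1)
    by (simp_all add: gem_def xadj_def n' adj fs fa u_def[symmetric] w_def[symmetric] l_def xx_def yy_def zz_def)
  have xyz: "xx \<in> T" "yy \<in> T" "zz \<in> T" "E xx zz" "E zz yy" "~ E xx yy" "xx ~= yy" "\<exists>t\<in>T. t ~= zz & ~ E t zz"
  proof -
    have T: "u \<in> T" "w \<in> T" "l u \<in> T" "l w \<in> T" and sT: "\<exists>t\<in>T. t ~= u & ~ E t u" "\<exists>t\<in>T. t ~= w & ~ E t w" "\<exists>t\<in>T. t ~= l u & ~ E t (l u)"
      using ST[OF un uw(2)] ST[OF uw(1,3)] ST[OF l(1,2)[OF un uw(2)]] ST[OF l(1,2)[OF uw(1,3)]] by auto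
    show "xx \<in> T" "yy \<in> T" "zz \<in> T" "\<exists>t\<in>T. t ~= zz & ~ E t zz" unfolding eqs using T sT by auto
    have "E xx zz & E zz yy & ~ E xx yy & xx ~= yy"
    proof (cases "E u w")
      case True
      hence ne: "l u ~= l w" using uw(4) by (auto simp: l_def)
      have *: "E (l x) x & ~ E (l x) y & l x ~= y" if "x < n" "array s ''S'' x ~= 0" "y < n" "array s ''S'' y ~= 0" "E x y" "l x < l y" for x y
        using l[OF that(1,2)] l(4)[OF that(3,4,6)] that(5) by auto
      show ?thesis unfolding eqs using True ne *[OF un uw(2) uw(1,3)] *[OF uw(1,3) un uw(2)] E_sym[OF True] by auto
    next
      case False
      hence "u ~= w" "l u = l w" using uw(4) by (auto simp: l_def)
      moreover from this have "l u ~= u" "l u ~= w" using False l(3)[OF un uw(2)] l(3)[OF uw(1,3)] E_sym by auto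
      ultimately show ?thesis unfolding eqs using False l(3)[OF un uw(2)] l(3)[OF uw(1,3)] E_sym by auto
    qed
    thus "E xx zz" "E zz yy" "~ E xx yy" "xx ~= yy" by auto
  qed
  have zn: "zz < n" "xx < n" "yy < n" using xyz visn by (auto simp: T_def)
  define q where "q = scalar s' ''p1''"
  have "q = first n (%w. array s ''nv'' w ~= 0 & w ~= zz & ~ E w zz)"
    using H[of "IA ''p1'' (xfst ''w'' (rd ''nv'' ''w'' \<and>\<and> xnot (XV ''w'' \<doteq> XV ''p3'') \<and>\<and> xnot (ax ''w'' ''p3'')))"] zn
    by (simp add: gem_def xval_xfst xadj_def n' adj fs fa zz_def[symmetric] q_def)
  moreover obtain t where "t \<in> T" "t ~= zz" "~ E t zz" using xyz(8) by blast
  hence "\<exists>w<n. array s ''nv'' w ~= 0 & w ~= zz & ~ E w zz" using nv visn by (auto simp: T_def)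
  ultimately have q: "q < n" "array s ''nv'' q ~= 0" "q ~= zz" "~ E q zz"
    using first_P[of n "%w. array s ''nv'' w ~= 0 & w ~= zz & ~ E w zz"] first_less_iff[of n "%w. array s ''nv'' w ~= 0 & w ~= zz & ~ E w zz"] by metis+
  have qT: "q \<in> T" using nv[OF q(1)] q(2) by (auto simp: T_def)
  have Dat: "\<exists>d\<in>D. E x d" if "x \<in> T" "y \<in> T" "y ~= x" "~ E x y" for x y using D(5)[of x y] that by (auto simp: T_def)
  have q4: "E q xx & ~ E q yy | E q yy & ~ E q xx"
    by (rule gem_P4[OF D(1,2,4) Dat _ xyz(1-7) qT q(3,4)]) (auto simp: T_def)
  define p2 where "p2 = scalar s' ''p2''"
  define p4 where "p4 = scalar s' ''p4''"
  have p24: "p2 = (if E q xx then xx else yy)" "p4 = (if E q xx then yy else xx)"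
    using H[of "IA ''p2'' (XIf (ax ''p1'' ''ax'') (XV ''ax'') (XV ''ay''))"] H[of "IA ''p4'' (XIf (ax ''p1'' ''ax'') (XV ''ay'') (XV ''ax''))"] zn q(1)
    by (simp_all add: gem_def xadj_def n' adj p2_def p4_def q_def[symmetric] xx_def[symmetric] yy_def[symmetric])
  have P: "p2 \<in> T" "p4 \<in> T" "E q p2" "E p2 zz" "E zz p4" "~ E q p4" "~ E p2 p4" "p2 ~= p4"
    using p24 q4 xyz E_comm by (auto split: if_splits)
  have pn: "p2 < n" "p4 < n" using P visn by (auto simp: T_def)
  define A where "A w <-> w \<in> vis s & ~ E v w" for w
  have An: "A w ==> w < n & ~ E v w & v ~= w" for w using v visn by (auto simp: A_def)
  have AD: "x \<in> D ==> A x" for x using D(3,4) by (auto simp: A_def)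
  have Ax: "array s ''vis'' w ~= 0 & array s ''nv'' w = 0 <-> A w" if "w < n" for w
    using nv[OF that] that by (auto simp: A_def vis_def)
  have B: "!!x. x \<in> T ==> E v x" by (simp add: T_def)
  define L where "L X w <-> array s' X w ~= 0" for X w
  have nbx: "xval (nbx X t) s' = first n (%w. L X w & E w (scalar s' t))" if "scalar s' t < n" "t ~= ''w''" for X t
    using that by (simp add: nbx_def xval_xfst xadj_def n' adj L_def)
  have levx: "L L' w <-> A w & (\<exists>u<n. L L0 u & E u w)" if "holds s' (lev L0 L')" "w < n" for L0 L' w
    using that Ax[OF that(2)] unfolding L_def by (auto simp: lev_def xadj_def n' adj fa)
  have lev1: "L L' w <-> A w & E (scalar s' t) w"
    if "holds s' (IT L' ''w'' ((rd ''vis'' ''w'' \<and>\<and> xnot (rd ''nv'' ''w'')) \<and>\<and> ax t ''w''))" "w < n" "scalar s' t < n" "t ~= ''w''" for L' t w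
    using that Ax[OF that(2)] unfolding L_def by (auto simp: xadj_def n' adj fa)
  have cx: "xval (XIf (XV e \<prec> XV ''n'') (XV e) f) s' = (if scalar s' e < n then scalar s' e else xval f s')" for e f by (simp add: n')
  obtain d1 e1 where d1: "d1 \<in> D" "E q d1" "e1 \<in> D" "E zz e1" using Dat[OF qT xyz(3)] Dat[OF xyz(3) qT] q(3,4) E_comm by metis
  obtain d2 e2 where d2: "d2 \<in> D" "E p2 d2" "e2 \<in> D" "E p4 e2" using Dat[OF P(1,2)] Dat[OF P(2,1)] P(7,8) E_comm by metis
  have sub: "set (bfs ''p1'' ''p3'' ''L1'' ''L2'' ''L3'' ''L4'' ''le'' ''ld'' ''lc'' ''lb'' ''la'') \<subseteq> set gem"
    "set (bfs ''p2'' ''p4'' ''Q1'' ''Q2'' ''Q3'' ''Q4'' ''qe'' ''qd'' ''qc'' ''qb'' ''qa'') \<subseteq> set gem" by (auto simp: gem_def)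
  let ?s = "scalar s'"
  have R1: "A (?s ''la'') & A (?s ''lb'') & A (?s ''lc'') & E q (?s ''la'') & E (?s ''la'') (?s ''lb'') & E (?s ''lb'') (?s ''lc'')"
    "?s ''le'' < n ==> E (?s ''lc'') zz" "~ ?s ''le'' < n ==> A (?s ''ld'') & C7 v q (?s ''la'') (?s ''lb'') (?s ''lc'') (?s ''ld'') zz"
  proof -
    have HB: "!!t. t \<in> set (bfs ''p1'' ''p3'' ''L1'' ''L2'' ''L3'' ''L4'' ''le'' ''ld'' ''lc'' ''lb'' ''la'') ==> holds s' t" using sub H by blast
    note r = bfs_paths[where A = A, OF B[OF qT] B[OF xyz(3)] q(4,3) An D(1) AD d1, where ?L1.0 = "L ''L1''" and ?L2.0 = "L ''L2''" and ?L3.0 = "L ''L3''" and ?L4.0 = "L ''L4''"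
      and e = "?s ''le''" and d = "?s ''ld''" and c = "?s ''lc''" and b = "?s ''lb''" and a = "?s ''la''"]
    have g1: "L ''L1'' w <-> A w & E q w" if "w < n" for w
      using lev1[OF HB that, of "''L1''" "''p1''"] q(1) by (simp add: bfs_def q_def[symmetric])
    have g2: "L ''L2'' w <-> A w & (\<exists>u<n. L ''L1'' u & E u w)" if "w < n" for w by (rule levx[OF HB that]) (simp add: bfs_def)
    have g3: "L ''L3'' w <-> A w & (\<exists>u<n. L ''L2'' u & E u w)" if "w < n" for w by (rule levx[OF HB that]) (simp add: bfs_def)
    have g4: "L ''L4'' w <-> A w & (\<exists>u<n. L ''L3'' u & E u w)" if "w < n" for w by (rule levx[OF HB that]) (simp add: bfs_def)
    have i: "holds s' (IA ''le'' (nbx ''L3'' ''p3''))" "holds s' (IA ''ld'' (nbx ''L4'' ''p3''))"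
      "holds s' (IA ''lc'' (XIf (XV ''le'' \<prec> XV ''n'') (XV ''le'') (nbx ''L3'' ''ld'')))" "holds s' (IA ''lb'' (nbx ''L2'' ''lc''))" "holds s' (IA ''la'' (nbx ''L1'' ''lb''))"
      by (rule HB, simp add: bfs_def)+
    have e: "?s ''le'' = first n (%w. L ''L3'' w & E w zz)" using i(1) nbx[of "''p3''" "''L3''"] zn by (simp add: zz_def)
    have d: "?s ''ld'' = first n (%w. L ''L4'' w & E w zz)" using i(2) nbx[of "''p3''" "''L4''"] zn by (simp add: zz_def)
    have c: "?s ''le'' < n ==> ?s ''lc'' = ?s ''le''" "?s ''ld'' < n ==> ~ ?s ''le'' < n ==> ?s ''lc'' = first n (%w. L ''L3'' w & E w (?s ''ld''))"
      using i(3) cx[of "''le''"] nbx[of "''ld''" "''L3''"] by simp_all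
    have b: "?s ''lc'' < n ==> ?s ''lb'' = first n (%w. L ''L2'' w & E w (?s ''lc''))" using i(4) nbx[of "''lc''" "''L2''"] by simp
    have a: "?s ''lb'' < n ==> ?s ''la'' = first n (%w. L ''L1'' w & E w (?s ''lb''))" using i(5) nbx[of "''lb''" "''L1''"] by simp
    show "A (?s ''la'') & A (?s ''lb'') & A (?s ''lc'') & E q (?s ''la'') & E (?s ''la'') (?s ''lb'') & E (?s ''lb'') (?s ''lc'')"
      "?s ''le'' < n ==> E (?s ''lc'') zz" "~ ?s ''le'' < n ==> A (?s ''ld'') & C7 v q (?s ''la'') (?s ''lb'') (?s ''lc'') (?s ''ld'') zz"
      by (rule r[OF _ _ g1 g2 g3 g4 e d c b a]; assumption)+
  qed
  have R2: "A (?s ''qa'') & A (?s ''qb'') & A (?s ''qc'') & E p2 (?s ''qa'') & E (?s ''qa'') (?s ''qb'') & E (?s ''qb'') (?s ''qc'')"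
    "?s ''qe'' < n ==> E (?s ''qc'') p4" "~ ?s ''qe'' < n ==> A (?s ''qd'') & C7 v p2 (?s ''qa'') (?s ''qb'') (?s ''qc'') (?s ''qd'') p4"
  proof -
    have HB: "!!t. t \<in> set (bfs ''p2'' ''p4'' ''Q1'' ''Q2'' ''Q3'' ''Q4'' ''qe'' ''qd'' ''qc'' ''qb'' ''qa'') ==> holds s' t" using sub H by blast
    note r = bfs_paths[where A = A, OF B[OF P(1)] B[OF P(2)] P(7,8) An D(1) AD d2, where ?L1.0 = "L ''Q1''" and ?L2.0 = "L ''Q2''" and ?L3.0 = "L ''Q3''" and ?L4.0 = "L ''Q4''"
      and e = "?s ''qe''" and d = "?s ''qd''" and c = "?s ''qc''" and b = "?s ''qb''" and a = "?s ''qa''"]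
    have g1: "L ''Q1'' w <-> A w & E p2 w" if "w < n" for w
      using lev1[OF HB that, of "''Q1''" "''p2''"] pn by (simp add: bfs_def p2_def[symmetric])
    have g2: "L ''Q2'' w <-> A w & (\<exists>u<n. L ''Q1'' u & E u w)" if "w < n" for w by (rule levx[OF HB that]) (simp add: bfs_def)
    have g3: "L ''Q3'' w <-> A w & (\<exists>u<n. L ''Q2'' u & E u w)" if "w < n" for w by (rule levx[OF HB that]) (simp add: bfs_def)
    have g4: "L ''Q4'' w <-> A w & (\<exists>u<n. L ''Q3'' u & E u w)" if "w < n" for w by (rule levx[OF HB that]) (simp add: bfs_def)
    have i: "holds s' (IA ''qe'' (nbx ''Q3'' ''p4''))" "holds s' (IA ''qd'' (nbx ''Q4'' ''p4''))"
      "holds s' (IA ''qc'' (XIf (XV ''qe'' \<prec> XV ''n'') (XV ''qe'') (nbx ''Q3'' ''qd'')))" "holds s' (IA ''qb'' (nbx ''Q2'' ''qc''))" "holds s' (IA ''qa'' (nbx ''Q1'' ''qb''))"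
      by (rule HB, simp add: bfs_def)+
    have e: "?s ''qe'' = first n (%w. L ''Q3'' w & E w p4)" using i(1) nbx[of "''p4''" "''Q3''"] pn by (simp add: p4_def)
    have d: "?s ''qd'' = first n (%w. L ''Q4'' w & E w p4)" using i(2) nbx[of "''p4''" "''Q4''"] pn by (simp add: p4_def)
    have c: "?s ''qe'' < n ==> ?s ''qc'' = ?s ''qe''" "?s ''qd'' < n ==> ~ ?s ''qe'' < n ==> ?s ''qc'' = first n (%w. L ''Q3'' w & E w (?s ''qd''))"
      using i(3) cx[of "''qe''"] nbx[of "''qd''" "''Q3''"] by simp_all
    have b: "?s ''qc'' < n ==> ?s ''qb'' = first n (%w. L ''Q2'' w & E w (?s ''qc''))" using i(4) nbx[of "''qc''" "''Q2''"] by simp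
    have a: "?s ''qb'' < n ==> ?s ''qa'' = first n (%w. L ''Q1'' w & E w (?s ''qb''))" using i(5) nbx[of "''qb''" "''Q1''"] by simp
    show "A (?s ''qa'') & A (?s ''qb'') & A (?s ''qc'') & E p2 (?s ''qa'') & E (?s ''qa'') (?s ''qb'') & E (?s ''qb'') (?s ''qc'')"
      "?s ''qe'' < n ==> E (?s ''qc'') p4" "~ ?s ''qe'' < n ==> A (?s ''qd'') & C7 v p2 (?s ''qa'') (?s ''qb'') (?s ''qc'') (?s ''qd'') p4"
      by (rule r[OF _ _ g1 g2 g3 g4 e d c b a]; assumption)+
  qed
  have Avis: "A x ==> x \<in> vis s" "x \<in> T ==> x \<in> vis s" for x by (auto simp: A_def T_def)
  have hI: "holds s' (IT ''h'' ''i'' (XIf (XV ''le'' \<prec> XV ''n'')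
      (XIf (XV ''qe'' \<prec> XV ''n'')
        (sel7 (XV ''v'') (XV ''p4'') (XV ''lc'') (XV ''lb'') (XV ''qb'') (XV ''qa'') (XV ''p1''))
        (sel7 (XV ''v'') (XV ''p2'') (XV ''qa'') (XV ''qb'') (XV ''qc'') (XV ''qd'') (XV ''p4'')))
      (sel7 (XV ''v'') (XV ''p1'') (XV ''la'') (XV ''lb'') (XV ''lc'') (XV ''ld'') (XV ''p3''))))"
    by (rule H) (simp add: gem_def)
  have hv: "array s' ''h'' i = (if ?s ''le'' < n then if ?s ''qe'' < n
        then (if i = 0 then v else if i = 1 then p4 else if i = 2 then ?s ''lc'' else if i = 3 then ?s ''lb'' else if i = 4 then ?s ''qb'' else if i = 5 then ?s ''qa'' else q)
        else (if i = 0 then v else if i = 1 then p2 else if i = 2 then ?s ''qa'' else if i = 3 then ?s ''qb'' else if i = 4 then ?s ''qc'' else if i = 5 then ?s ''qd'' else p4)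
        else (if i = 0 then v else if i = 1 then q else if i = 2 then ?s ''la'' else if i = 3 then ?s ''lb'' else if i = 4 then ?s ''lc'' else if i = 5 then ?s ''ld'' else zz))" if "i < n" for i
    using hI that by (simp add: sel7_def n' fs v(1) p4_def p2_def q_def zz_def)
  show "hole (array s' ''h'') & array s' ''h'' 0 = v & array s' ''h'' ` {..<7} \<subseteq> insert v (vis s)"
  proof (cases "?s ''le'' < n")
    case False
    from R1(3)[OF False] have C: "C7 v q (?s ''la'') (?s ''lb'') (?s ''lc'') (?s ''ld'') zz" by blast
    show ?thesis
      by (rule sel7_array[OF C7_n7[OF C] _ C refl]) (use hv False R1 R1(3)[OF False] Avis qT xyz(3) in auto)
  next
    case le: True
    show ?thesis
    proof (cases "?s ''qe'' < n")
      case False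
      from R2(3)[OF False] have C: "C7 v p2 (?s ''qa'') (?s ''qb'') (?s ''qc'') (?s ''qd'') p4" by blast
      show ?thesis
        by (rule sel7_array[OF C7_n7[OF C] _ C refl]) (use hv le False R2 R2(3)[OF False] Avis P in auto)
    next
      case qe: True
      \<comment> \<open>Two 6-holes were found; \<open>chain3\<close> supplies the non-edges along
        their paths that \<open>emerald_C7\<close> demands.\<close>
      note c1 = chain3[OF B[OF qT] B[OF xyz(3)] q(4,3), of "?s ''la''" "?s ''lb''" "?s ''lc''"]
      note c2 = chain3[OF B[OF P(1)] B[OF P(2)] P(7,8), of "?s ''qa''" "?s ''qb''" "?s ''qc''"]
      have C: "C7 v p4 (?s ''lc'') (?s ''lb'') (?s ''qb'') (?s ''qa'') q"
        by (rule emerald_C7[where p = q and q = p2 and r = zz and s = p4 and a = "?s ''la''" and c' = "?s ''qc''"])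
          (use B qT xyz(3) P q R1(1) R1(2)[OF le] R2(1) R2(2)[OF qe] An c1 c2 in auto)
      show ?thesis
        by (rule sel7_array[OF C7_n7[OF C] _ C refl]) (use hv le qe R1 R2 Avis P qT in auto)
    qed
  qed
  show "scalar s' ''hole'' = 1" using H[of "IA ''hole'' (XC 1)"] by (simp add: gem_def)
qed

section \<open>The loop of Kempe changes\<close>

definition nbT :: "nat set => nat => nat set" where "nbT P v = {w \<in> P. E v w}"
definition nbM :: "nat set => nat => nat set" where "nbM P v = {w \<in> nbT P v. \<forall>u\<in>nbT P v. u ~= w --> E u w}"

definition khole :: "nat set => nat => state => bool" where
  "khole P v s <-> hole (array s ''h'') & array s ''h'' 0 = v & array s ''h'' ` {..<7} \<subseteq> insert v P"

text \<open>Colours below \<open>a\<close> are settled: wherever \<open>b\<close> occurs in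
  \<open>T\<close>, they occur next to it. Colours from \<open>a\<close> on, except
  \<open>b\<close>, are still those of \<open>c0\<close>. Once a hole has been found, that hole
  replaces these conditions.\<close>

definition kinv :: "nat set => nat => nat => nat => nat => state => bool" where
  "kinv P v b q a s <-> base s & vis s = P & scalar s ''v'' = v & scalar s ''b'' = b & scalar s ''q'' = q & prp P (array s ''c'') q &
     (\<forall>w<n. array s ''nv'' w ~= 0 <-> w \<in> nbT P v) & (\<forall>w<n. w \<notin> P --> array s ''c0'' w = n) &
     (if scalar s ''hole'' = 0 then b \<notin> array s ''c'' ` nbM P v &
        (\<forall>d<a. d ~= b --> d < q --> (\<forall>y\<in>nbT P v. array s ''c'' y = b --> (\<exists>z\<in>nbT P v. array s ''c'' z = d & E z y))) &
        (\<forall>d. a <= d --> d ~= b --> (\<forall>w\<in>P. array s ''c'' w = d <-> array s ''c0'' w = d))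
      else khole P v s)"

text \<open>The computed arrays are the level sets of the locale \<open>kempe\<close>. A vertex
  \<open>tz\<close> violates the hypothesis of \<open>swp_step\<close>, and \<open>chain_C7\<close>
  turns it into a hole; without such a vertex the exchange settles colour \<open>a\<close>.\<close>

lemma kstep_inv:
  assumes k: "kinv P v b q a s" and a: "a < n" and q: "q <= n" "b < q" and v: "v < n" "v \<notin> P"
    and cl: "!!x y z. [|x \<in> nbT P v - nbM P v; y \<in> nbT P v - nbM P v; z \<in> nbT P v - nbM P v; E x y; E y z; x ~= z|] ==> E x z"
  shows "kinv P v b q (Suc a) (xsem kstep (set_scalar ''a'' a s))"
proof -
  define s0 where "s0 = set_scalar ''a'' a s"
  have ks: "base s" "vis s = P" "scalar s ''v'' = v" "scalar s ''b'' = b" "scalar s ''q'' = q" "prp P (array s ''c'') q"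
    "!!w. w < n ==> array s ''nv'' w ~= 0 <-> w \<in> nbT P v" "!!w. w < n ==> w \<notin> P ==> array s ''c0'' w = n"
    using k unfolding kinv_def by blast+
  have k0: "base s0" "vis s0 = P" "scalar s0 ''v'' = v" "scalar s0 ''b'' = b" "scalar s0 ''q'' = q" "scalar s0 ''a'' = a" "prp P (array s ''c'') q"
    "array s0 = array s" "scalar s0 ''hole'' = scalar s ''hole''" "!!w. w < n ==> array s ''nv'' w ~= 0 <-> w \<in> nbT P v" "!!w. w < n ==> w \<notin> P ==> array s ''c0'' w = n"
    using ks by (simp_all add: s0_def vis_def base_def del: neq0_conv)
  have visP: "w \<in> P <-> w < n & array s ''vis'' w ~= 0" for w using ks(2) unfolding vis_def by blast
  have Pn: "w \<in> P ==> w < n" for w using visP by blast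
  have inT: "w \<in> nbT P v <-> w \<in> P & E v w" for w by (simp add: nbT_def)
  show ?thesis
  proof (cases "a < q & a ~= b & scalar s ''hole'' = 0")
    case False
    hence "xsem kstep s0 = s0" using k0 by (auto simp: kstep_def)
    moreover have "kinv P v b q (Suc a) s0"
    proof (cases "scalar s ''hole'' = 0")
      case True
      hence "a \<ge> q | a = b" using False by auto
      thus ?thesis using k True unfolding kinv_def s0_def by (auto simp: base_def vis_def less_Suc_eq)
    next
      case False
      thus ?thesis using k unfolding kinv_def s0_def khole_def by (auto simp: base_def vis_def)
    qed
    ultimately show ?thesis by (simp add: s0_def)
  next
    case True
    define c where "c = array s ''c''"
    have kk: "b \<notin> c ` nbM P v" "!!d y. [|d < a; d ~= b; d < q; y \<in> nbT P v; c y = b|] ==> \<exists>z\<in>nbT P v. c z = d & E z y"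
      "!!d w. [|a <= d; d ~= b; w \<in> P|] ==> c w = d <-> array s ''c0'' w = d"
      using k True unfolding kinv_def c_def by auto
    have pr: "prp P c q" using k0 by (simp add: c_def)
    interpret K: kempe E P v c "nbT P v" "nbM P v" a b
    proof
      show "c x ~= c y" if "x \<in> P" "y \<in> P" "E x y" for x y using pr that by (simp add: prp_def)
      show "E x z" if "x \<in> nbT P v - nbM P v" "y \<in> nbT P v - nbM P v" "z \<in> nbT P v - nbM P v" "E x y" "E y z" "x ~= z" for x y z
        using cl that by blast
      show "nbT P v = {w \<in> P. E v w}" by (rule nbT_def)
      show "nbM P v = {w \<in> nbT P v. \<forall>u\<in>nbT P v. u ~= w --> E u w}" by (rule nbM_def)
      show "v \<notin> P" "a ~= b" using v True by blast+
    qed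
    define t where "t = xsem (blk levels) s0"
    have H: "!!i. i \<in> set levels ==> holds t i" unfolding t_def by (rule ssa_holds[OF prog_ssa(4)])
    have fs: "scalar t x = scalar s0 x" if "x \<in> {''n'', ''v'', ''b'', ''q'', ''a'', ''hole''}" for x
      unfolding t_def by (rule scalar_blk) (use that in "auto simp: levels_def stpA_def stpB_def")
    have fa: "array t x = array s x" if "x \<in> {''adj'', ''vis'', ''nv'', ''c'', ''c0'', ''h''}" for x
      unfolding t_def k0(8)[symmetric] by (rule array_blk) (use that in "auto simp: levels_def stpA_def stpB_def")
    have bt: "base t" by (rule base_frame[OF k0(1)]) (simp_all add: fs fa k0)
    note adj = adjE[OF bt] adjE0[OF bt] adjE[OF ks(1)] adjE0[OF ks(1)] and n' = base_n[OF bt]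
    have c0: "array s ''c0'' w = a <-> w \<in> P & c w = a" if "w < n" for w
      using kk(3)[of a w] k0(11)[OF that] True a by auto
    define L where "L X = {w. w < n & array t X w ~= 0}" for X
    have gd: "xval (inA i r) s' = (if array s' ''c0'' (scalar s' i) = scalar s' ''a'' & xval r s' ~= 0 then 1 else 0)" for i r s'
      by (simp add: inA_def guard_def)
    have stA: "L X = stp P c (L B) a" if h: "holds t (stpA B X)" for B X
    proof -
      have "array t X w ~= 0 <-> array s ''c0'' w = a & (\<exists>u<n. array t B u ~= 0 & E u w)" if "w < n" for w
        using h that by (auto simp: stpA_def gd xadj_def n' adj fs fa k0(6))
      thus ?thesis unfolding L_def stp_def using c0 Pn by blast
    qed
    have scA: "array t R w ~= 0 <-> (\<exists>u\<in>L X \<inter> {u\<in>P. c u = a}. E u w)"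
      if h: "holds t (IS R (inA ''z'' (rd X ''z'')))" and w: "w < n" for X R w
    proof -
      have "array t R w ~= 0 <-> (\<exists>z<n. (array s ''c0'' z = a & array t X z ~= 0) & E z w)"
        using h w by (auto simp: gd n' adj fs fa k0(6))
      thus ?thesis unfolding L_def using c0 by blast
    qed
    have stB: "L B = stp P c (L X) b" if h: "holds t (IS R (inA ''z'' (rd X ''z'')))"
        "holds t (IT B ''w'' (rd ''vis'' ''w'' \<and>\<and> rd ''c'' ''w'' \<doteq> XV ''b'' \<and>\<and> rd R ''w''))" and X: "L X \<subseteq> {u\<in>P. c u = a}" for B X R
    proof -
      have "array t B w ~= 0 <-> w \<in> P & c w = b & array t R w ~= 0" if "w < n" for w
        using h(2) that visP[of w] by (auto simp: n' fs fa k0 c_def)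
      moreover have "L X \<inter> {u\<in>P. c u = a} = L X" using X by blast
      ultimately have "array t B w ~= 0 <-> w \<in> P & c w = b & (\<exists>u\<in>L X. E u w)" if "w < n" for w
        using scA[OF h(1) that] that by simp
      thus ?thesis unfolding stp_def L_def[of B] using Pn by blast
    qed
    have lev_mem: "IS ''R0'' (inA ''z'' (rd ''nv'' ''z'')) \<in> set levels" "IT ''B0'' ''w'' (rd ''nv'' ''w'' \<and>\<and> rd ''c'' ''w'' \<doteq> XV ''b'' \<and>\<and> xnot (rd ''R0'' ''w'')) \<in> set levels"
      "stpA ''B0'' ''A1'' \<in> set levels" "IS ''R1'' (inA ''z'' (rd ''A1'' ''z'')) \<in> set levels"
      "IT ''B1'' ''w'' (rd ''vis'' ''w'' \<and>\<and> rd ''c'' ''w'' \<doteq> XV ''b'' \<and>\<and> rd ''R1'' ''w'') \<in> set levels"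
      "stpA ''B1'' ''A2'' \<in> set levels" "IS ''R2'' (inA ''z'' (rd ''A2'' ''z'')) \<in> set levels"
      "IT ''B2'' ''w'' (rd ''vis'' ''w'' \<and>\<and> rd ''c'' ''w'' \<doteq> XV ''b'' \<and>\<and> rd ''R2'' ''w'') \<in> set levels" "stpA ''B2'' ''A3'' \<in> set levels"
      "IT ''TT'' ''w'' (XIf (inA ''w'' (rd ''A3'' ''w'' \<and>\<and> rd ''nv'' ''w''))
      (xnot (xex ''y'' (rd ''nv'' ''y'' \<and>\<and> rd ''c'' ''y'' \<doteq> XV ''b'' \<and>\<and> ax ''y'' ''w''))) (XC 0)) \<in> set levels"
      "IA ''tz'' (xfst ''w'' (rd ''TT'' ''w'')) \<in> set levels"
      by (simp_all only: levels_def stpB_def set_append list.set Un_iff insert_iff simp_thms)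
    have LB0: "L ''B0'' = K.B0"
    proof -
      have nvL: "L ''nv'' \<inter> {u\<in>P. c u = a} = {u\<in>nbT P v. c u = a}" using k0(10) Pn by (auto simp: L_def fa inT)
      have "array t ''B0'' w ~= 0 <-> w \<in> nbT P v & c w = b & ~ array t ''R0'' w ~= 0" if "w < n" for w
        using H[OF lev_mem(2)] that k0(10)[OF that] by (auto simp: n' fs fa k0 c_def)
      moreover have "array t ''R0'' w ~= 0 <-> (\<exists>u\<in>nbT P v. c u = a & E u w)" if "w < n" for w
        using scA[OF H[OF lev_mem(1)] that] nvL by auto
      ultimately show ?thesis unfolding K.B0_def L_def[of "''B0''"] using Pn inT by blast
    qed
    have LA1: "L ''A1'' = K.A1" using stA[OF H[OF lev_mem(3)]] LB0 by (simp add: K.A1_def)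
    have LB1: "L ''B1'' = K.B1" using stB[OF H[OF lev_mem(4)] H[OF lev_mem(5)]] LA1 unfolding K.B1_def by (auto simp: K.A1_def stp_def)
    have LA2: "L ''A2'' = K.A2" using stA[OF H[OF lev_mem(6)]] LB1 by (simp add: K.A2_def)
    have LB2: "L ''B2'' = K.B2" using stB[OF H[OF lev_mem(7)] H[OF lev_mem(8)]] LA2 unfolding K.B2_def by (auto simp: K.A2_def stp_def)
    have LA3: "L ''A3'' = K.A3" using stA[OF H[OF lev_mem(9)]] LB2 by (simp add: K.A3_def)
    have TT: "array t ''TT'' w ~= 0 <-> w \<in> K.A3 & w \<in> nbT P v & ~ (\<exists>y\<in>nbT P v. c y = b & E y w)" if "w < n" for w
    proof -
      have "array t ''TT'' w ~= 0 <-> (array s ''c0'' w = a & array t ''A3'' w ~= 0 & array s ''nv'' w ~= 0) & ~ (\<exists>y<n. array s ''nv'' y ~= 0 & c y = b & E y w)"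
        using H[OF lev_mem(10)] that by (auto simp: gd xadj_def n' adj fs fa k0(4,6) c_def)
      moreover have "array t ''A3'' w ~= 0 <-> w \<in> K.A3" using LA3 that by (auto simp: L_def)
      moreover have "w \<in> K.A3 ==> array s ''c0'' w = a" using c0[OF that] by (auto simp: K.A3_def stp_def)
      ultimately show ?thesis using k0(10) Pn inT that by blast
    qed
    have tz: "scalar t ''tz'' = first n (%w. array t ''TT'' w ~= 0)" using H[OF lev_mem(11)] by (simp add: xval_xfst n')
    have kst: "xsem kstep s0 = xsem (XIfC (XV ''tz'' \<prec> XV ''n'') (blk chole) (XSeq (blk swap) (blk [IT ''c'' ''w'' (rd ''nc'' ''w'')]))) t"
      unfolding kstep_def xsem.simps(5)[of _ _ _ s0] using True k0 by (simp add: t_def)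
    show ?thesis
    proof (cases "scalar t ''tz'' < n")
      case tzn: True
      define z where "z = scalar t ''tz''"
      have z: "z \<in> K.A3" "z \<in> nbT P v" "~ (\<exists>y\<in>nbT P v. c y = b & E y z)"
        using first_P[of n "%w. array t ''TT'' w ~= 0"] tzn TT[of z] unfolding z_def tz[symmetric] by blast+
      define t' where "t' = xsem (blk chole) t"
      have H': "!!i. i \<in> set chole ==> holds t' i" unfolding t'_def by (rule ssa_holds[OF prog_ssa(5)])
      have fs': "scalar t' x = scalar t x" if "x \<in> {''n'', ''v'', ''b'', ''q'', ''tz''}" for x
        unfolding t'_def by (rule scalar_blk) (use that in "auto simp: chole_def")
      have fa': "array t' x = array t x" if "x ~= ''h''" for x
        unfolding t'_def by (rule array_blk) (use that in "auto simp: chole_def")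
      have bt': "base t'" by (rule base_frame[OF bt]) (simp_all add: fs' fa')
      note adj' = adjE[OF bt'] adjE0[OF bt'] adj and n'' = base_n[OF bt']
      have step: "scalar t' x \<in> L X & E (scalar t' x) y"
        if h: "IA x (nbx X yn) \<in> set chole" and X: "X ~= ''h''" and yn: "scalar t' yn = y" "yn ~= ''w''" "y < n" "\<exists>u\<in>L X. E u y" for x X yn y
      proof -
        have "scalar t' x = first n (%w. array t X w ~= 0 & E w y)"
          using H'[OF h] yn X by (simp add: nbx_def xval_xfst xadj_def n'' adj' fa')
        moreover have "\<exists>w<n. array t X w ~= 0 & E w y" using yn(4) by (auto simp: L_def)
        ultimately show ?thesis
          using first_less_iff[of n "%w. array t X w ~= 0 & E w y"] first_P[of n "%w. array t X w ~= 0 & E w y"] by (auto simp: L_def)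
      qed
      have Ln: "x \<in> L X ==> x < n" for x X by (simp add: L_def)
      have mem: "IA ''z4'' (nbx ''B2'' ''tz'') \<in> set chole" "IA ''z3'' (nbx ''A2'' ''z4'') \<in> set chole" "IA ''z2'' (nbx ''B1'' ''z3'') \<in> set chole"
        "IA ''z1'' (nbx ''A1'' ''z2'') \<in> set chole" "IA ''z0'' (nbx ''B0'' ''z1'') \<in> set chole"
        "IT ''h'' ''i'' (sel7 (XV ''v'') (XV ''z0'') (XV ''z1'') (XV ''z2'') (XV ''z3'') (XV ''z4'') (XV ''tz'')) \<in> set chole" "IA ''hole'' (XC 1) \<in> set chole"
        by (simp_all add: chole_def)
      have zn: "scalar t' ''tz'' = z" "z < n" using fs' tzn by (auto simp: z_def)
      have 4: "scalar t' ''z4'' \<in> L ''B2'' & E (scalar t' ''z4'') z"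
        by (rule step[OF mem(1) _ zn(1) _ zn(2)]) (use z LB2 in "auto simp: K.A3_def stp_def")
      have 3: "scalar t' ''z3'' \<in> L ''A2'' & E (scalar t' ''z3'') (scalar t' ''z4'')"
        by (rule step[OF mem(2) _ refl]) (use 4 Ln LB2 LA2 in "auto simp: K.B2_def stp_def")
      have 2: "scalar t' ''z2'' \<in> L ''B1'' & E (scalar t' ''z2'') (scalar t' ''z3'')"
        by (rule step[OF mem(3) _ refl]) (use 3 Ln LA2 LB1 in "auto simp: K.A2_def stp_def")
      have 1: "scalar t' ''z1'' \<in> L ''A1'' & E (scalar t' ''z1'') (scalar t' ''z2'')"
        by (rule step[OF mem(4) _ refl]) (use 2 Ln LB1 LA1 in "auto simp: K.B1_def stp_def")
      have 0: "scalar t' ''z0'' \<in> L ''B0'' & E (scalar t' ''z0'') (scalar t' ''z1'')"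
        by (rule step[OF mem(5) _ refl]) (use 1 Ln LA1 LB0 in "auto simp: K.A1_def stp_def")
      have C: "C7 v (scalar t' ''z0'') (scalar t' ''z1'') (scalar t' ''z2'') (scalar t' ''z3'') (scalar t' ''z4'') z"
        by (rule K.chain_C7) (use 0 1 2 3 4 z LB0 LA1 LB1 LA2 LB2 in auto)
      have inP: "x \<in> P" if "x \<in> L ''B0'' | x \<in> L ''A1'' | x \<in> L ''B1'' | x \<in> L ''A2'' | x \<in> L ''B2''" for x
        using that LB0 LA1 LB1 LA2 LB2 K.RP[of x] unfolding K.R_def by blast
      have "hole (array t' ''h'') & array t' ''h'' 0 = v & array t' ''h'' ` {..<7} \<subseteq> insert v P"
      proof (rule sel7_array[OF C7_n7[OF C] _ C refl])
        show "array t' ''h'' i = (if i = 0 then v else if i = 1 then scalar t' ''z0'' else if i = 2 then scalar t' ''z1'' else if i = 3 then scalar t' ''z2''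
          else if i = 4 then scalar t' ''z3'' else if i = 5 then scalar t' ''z4'' else z)" if "i < n" for i
          using H'[OF mem(6)] that by (simp add: sel7_def n'' fs' fs k0 z_def)
        show "{scalar t' ''z0'', scalar t' ''z1'', scalar t' ''z2'', scalar t' ''z3'', scalar t' ''z4'', z} \<subseteq> P"
          using inP 0 1 2 3 4 z(2) inT by blast
      qed
      moreover have "scalar t' ''hole'' = 1" using H'[OF mem(7)] by simp
      moreover have "xsem kstep s0 = t'" unfolding kst using tzn n' by (simp add: t'_def)
      ultimately show ?thesis using k0 bt' visP unfolding s0_def[symmetric] kinv_def khole_def vis_def
        by (simp add: fs' fa' fs fa)
    next
      case False
      define t1 where "t1 = xsem (blk swap) t"
      define t' where "t' = xsem (blk [IT ''c'' ''w'' (rd ''nc'' ''w'')]) t1"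
      have H1: "holds t1 (IT ''nc'' ''w'' (XIf (rd ''vis'' ''w'')
    (XIf (rd ''c'' ''w'' \<doteq> XV ''a'') (XIf (rd ''A1'' ''w'' \<or>\<or> rd ''A2'' ''w'' \<or>\<or> rd ''A3'' ''w'') (XV ''b'') (XV ''a''))
    (XIf (rd ''c'' ''w'' \<doteq> XV ''b'') (XIf (rd ''B0'' ''w'' \<or>\<or> rd ''B1'' ''w'' \<or>\<or> rd ''B2'' ''w'') (XV ''a'') (XV ''b''))
    (rd ''c'' ''w''))) (XC 0)))" unfolding t1_def by (rule ssa_holds[OF prog_ssa(6)]) (simp add: swap_def)
      have fs1: "scalar t1 x = scalar t x" if "x ~= ''w''" for x unfolding t1_def by (rule scalar_blk) (use that in "simp add: swap_def")
      have fa1: "array t1 x = array t x" if "x ~= ''nc''" for x unfolding t1_def by (rule array_blk) (use that in "simp add: swap_def")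
      have H2: "holds t' (IT ''c'' ''w'' (rd ''nc'' ''w''))" unfolding t'_def by (rule ssa_holds) simp_all
      have fs2: "scalar t' x = scalar t1 x" if "x ~= ''w''" for x unfolding t'_def by (rule scalar_blk) (use that in simp)
      have fa2: "array t' x = array t1 x" if "x ~= ''c''" for x unfolding t'_def by (rule array_blk) (use that in simp)
      have bt': "base t'" by (rule base_frame[OF bt]) (simp_all add: fs1 fs2 fa1 fa2)
      have Lm: "w \<in> L X <-> array t X w ~= 0" if "w < n" for X w using that by (simp add: L_def)
      have sw: "array t' ''c'' w = K.swp w" if "w \<in> P" for w
      proof -
        have wn: "w < n" using Pn that by blast
        have "array t' ''c'' w = array t1 ''nc'' w" using H2 wn base_n[OF bt'] by (simp add: fa2)
        also have "\<dots> = (if c w = a then if w \<in> L ''A1'' | w \<in> L ''A2'' | w \<in> L ''A3'' then b else a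
            else if c w = b then if w \<in> L ''B0'' | w \<in> L ''B1'' | w \<in> L ''B2'' then a else b else c w)"
          using H1 wn n' visP[of w] that Lm[OF wn] by (simp add: fs1 fa1 fs fa k0 c_def)
        also have "\<dots> = K.swp w"
        proof -
          have "w \<in> K.R <-> (c w = a & (w \<in> K.A1 | w \<in> K.A2 | w \<in> K.A3)) | (c w = b & (w \<in> K.B0 | w \<in> K.B1 | w \<in> K.B2))"
          proof -
            have "w \<in> K.A1 ==> c w = a" "w \<in> K.A2 ==> c w = a" "w \<in> K.A3 ==> c w = a" "w \<in> K.B1 ==> c w = b" "w \<in> K.B2 ==> c w = b"
              unfolding K.A1_def K.A2_def K.A3_def K.B1_def K.B2_def stp_def by blast+
            thus ?thesis unfolding K.R_def using K.B0D[of w] by blast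
          qed
          thus ?thesis unfolding K.swp_def LA1 LA2 LA3 LB0 LB1 LB2 using K.ab by (cases "c w = a"; cases "c w = b") simp_all
        qed
        finally show ?thesis .
      qed
      have TA: "\<exists>y\<in>nbT P v. c y = b & E y x" if "x \<in> nbT P v" "x \<in> K.A3" for x
      proof (rule ccontr)
        assume "~ ?thesis"
        moreover have "x < n" using that inT Pn by blast
        ultimately have "\<exists>w<n. array t ''TT'' w ~= 0" using TT[of x] that by blast
        thus False using False first_less_iff[of n "%w. array t ''TT'' w ~= 0"] tz by simp
      qed
      define D where "D = {d. d < a & d ~= b & d < q}"
      have nT: "x \<in> nbT P v ==> x \<in> P" and nM: "x \<in> nbM P v ==> x \<in> P" for x by (auto simp: nbT_def nbM_def)
      have S1: "b \<notin> K.swp ` nbM P v" by (rule K.swp_step(1)[OF kk(1), of D]) (use TA kk(2) in "auto simp: D_def")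
      have S2: "\<exists>z\<in>nbT P v. K.swp z = d & E z y" if "d \<in> insert a D" "y \<in> nbT P v" "K.swp y = b" for d y
        by (rule K.swp_step(2)[OF kk(1), of D]) (use TA kk(2) that in "auto simp: D_def")
      have prs: "prp P (array t' ''c'') q"
      proof -
        have "K.swp x < q" if "x \<in> P" for x using pr that True q unfolding prp_def K.swp_def by auto
        thus ?thesis using sw K.swp_proper unfolding prp_def by auto
      qed
      have "kinv P v b q (Suc a) t'" unfolding kinv_def
      proof (intro conjI)
        show "vis t' = P" using visP by (auto simp: vis_def fa1 fa2 fa)
        have "scalar t' ''hole'' = 0" using True by (simp add: fs1 fs2 fs k0)
        moreover have "array t' ''c'' ` nbM P v = K.swp ` nbM P v" by (rule image_cong[OF refl]) (rule sw[OF nM])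
        hence "b \<notin> array t' ''c'' ` nbM P v" using S1 by simp
        moreover have "\<exists>z\<in>nbT P v. array t' ''c'' z = d & E z y"
          if d: "d < Suc a" "d ~= b" "d < q" "y \<in> nbT P v" "array t' ''c'' y = b" for d y
        proof -
          have "d \<in> insert a D" using d by (auto simp: D_def)
          then obtain z where "z \<in> nbT P v" "K.swp z = d" "E z y" using S2[of d y] d sw nT by metis
          thus ?thesis using sw nT by metis
        qed
        moreover have "array t' ''c'' w = d <-> array t' ''c0'' w = d" if "Suc a <= d" "d ~= b" "w \<in> P" for d w
          using kk(3)[of d w] K.swp_other[of w d] that sw by (simp add: fa1 fa2 fa)
        ultimately show "if scalar t' ''hole'' = 0 then b \<notin> array t' ''c'' ` nbM P v &
          (\<forall>d<Suc a. d ~= b --> d < q --> (\<forall>y\<in>nbT P v. array t' ''c'' y = b --> (\<exists>z\<in>nbT P v. array t' ''c'' z = d & E z y))) &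
          (\<forall>d\<ge>Suc a. d ~= b --> (\<forall>w\<in>P. array t' ''c'' w = d <-> array t' ''c0'' w = d)) else khole P v t'" by auto
      qed (use bt' prs k0 in "simp_all add: fs1 fs2 fs fa1 fa2 fa")
      moreover have "xsem kstep s0 = t'" unfolding kst using False n' by (simp add: t'_def t1_def del: blk.simps)
      ultimately show ?thesis by (simp add: s0_def)
    qed
  qed
qed

end

lemma For_inv:
  assumes "I 0 s" "!!j s. j < m ==> I j s ==> I (Suc j) (xsem p (set_scalar i j s))"
  shows "I m (iter (%j s. xsem p (set_scalar i j s)) s m)"
proof -
  have "I j (iter (%j s. xsem p (set_scalar i j s)) s j)" if "j <= m" for j
    using that by (induction j) (use assms in auto)
  thus ?thesis by blast
qed

context ram_graph begin

lemma opt_same: "opt P c q ==> prp P c' q ==> opt P c' q"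
  by (auto simp: opt_def)

lemma prp_insert:
  assumes "prp P c q" "v \<notin> P" "d < r" "q <= r" "!!y. y \<in> nbT P v ==> c y ~= d"
  shows "prp (insert v P) (c(v := d)) r"
proof -
  have "c x < r" if "x \<in> P" for x using assms(1,4) that unfolding prp_def by (meson order_less_le_trans)
  moreover have "c x ~= d" if "x \<in> P" "E v x | E x v" for x using assms(5)[of x] that E_sym by (auto simp: nbT_def)
  ultimately show ?thesis using assms unfolding prp_def by auto
qed

lemma opt_free:
  assumes o: "opt P c q" and v: "v \<notin> P" and d: "d < q" "!!y. y \<in> nbT P v ==> c y ~= d"
  shows "opt (insert v P) (c(v := d)) q"
  unfolding opt_def
proof (intro conjI allI impI)
  show "prp (insert v P) (c(v := d)) q" by (rule prp_insert) (use o v d in "auto simp: opt_def")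
  show "q <= r" if "prp (insert v P) f r" for f r using opt_lower[OF o _ that] by blast
qed

lemma opt_new:
  assumes o: "opt P c q" and v: "v \<notin> P"
    and z: "!!d. d < q ==> z d \<in> nbT P v" "!!d e. [|d < q; e < q; d ~= e|] ==> E (z d) (z e)"
  shows "opt (insert v P) (c(v := q)) (q + 1)"
  unfolding opt_def
proof (intro conjI allI impI)
  have "c y ~= q" if "y \<in> nbT P v" for y using o that by (auto simp: opt_def prp_def nbT_def)
  thus "prp (insert v P) (c(v := q)) (q + 1)" by (intro prp_insert) (use o v in "auto simp: opt_def")
  show "q + 1 <= r" if "prp (insert v P) f r" for f r
  proof (rule clique_bound[of q z P v f])
    show "z d \<in> P & E v (z d)" if "d < q" for d using z(1)[OF that] by (auto simp: nbT_def)
  qed (use z(2) that in "auto simp: prp_def")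
qed

lemma nbM_adj: "x \<in> nbM P v ==> u \<in> nbT P v ==> u ~= x ==> E u x"
  by (simp add: nbM_def)

lemma nbM_trans:
  assumes cl: "!!x y z. [|x \<in> nbT P v - nbM P v; y \<in> nbT P v - nbM P v; z \<in> nbT P v - nbM P v; E x y; E y z; x ~= z|] ==> E x z"
    and y: "y \<in> nbT P v" "x \<in> nbT P v" "z \<in> nbT P v" "x = y | E x y" "z = y | E z y" "x ~= z" "y \<notin> nbM P v"
  shows "E x z"
proof (cases "x \<in> nbM P v | z \<in> nbM P v")
  case True
  thus ?thesis using nbM_adj[of x P v z] nbM_adj[of z P v x] y(2,3,6) E_sym by blast
next
  case False
  thus ?thesis using cl[of x y z] y E_sym by blast
qed

lemma newcol_sem:
  assumes b: "base s" and q: "scalar s ''q'' < n" and s': "s' = xsem newcol s"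
  shows "base s'" "vis s' = vis s" "scalar s' ''v'' = scalar s ''v''" "scalar s' ''hole'' = scalar s ''hole''"
    "array s' ''c'' = (array s ''c'')(scalar s ''v'' := scalar s ''q'')" "scalar s' ''q'' = scalar s ''q'' + 1"
  using b q base_n[OF b] unfolding s' by (auto simp: newcol_def base_def vis_def)

text \<open>If no colour is missing on \<open>M\<close>, or if \<open>b\<close> survives in
  \<open>T\<close> next to all other colours, then one vertex per colour gives a clique of size
  \<open>q\<close> among the neighbours of \<open>v\<close>, so a new colour is unavoidable. If
  \<open>b\<close> has vanished from \<open>T\<close>, it is free for \<open>v\<close>.\<close>

lemma kemp_facts:
  assumes b: "base s" "vis s = P" and v: "v = scalar s ''v''" "v < n" "v \<notin> P"
    and nv: "!!w. w < n ==> array s ''nv'' w ~= 0 <-> w \<in> nbT P v" and M: "!!w. w < n ==> array s ''M'' w ~= 0 <-> w \<in> nbM P v"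
    and cl: "!!x y z. [|x \<in> nbT P v - nbM P v; y \<in> nbT P v - nbM P v; z \<in> nbT P v - nbM P v; E x y; E y z; x ~= z|] ==> E x z"
    and o: "opt P (array s ''c'') q" "q = scalar s ''q''" and h0: "scalar s ''hole'' = 0"
  defines "s' \<equiv> xsem kemp s"
  shows "base s'" "vis s' = P" "scalar s' ''v'' = v"
    "scalar s' ''hole'' = 0 & opt (insert v P) (array s' ''c'') (scalar s' ''q'') |
     scalar s' ''hole'' ~= 0 & khole P v s' & scalar s' ''q'' = q & opt P (array s' ''c'') q"
proof -
  have Pn: "P \<subseteq> {..<n}" using b(2) by (auto simp: vis_def)
  have "q <= card P" by (rule opt_le_card[OF o(1) finite_subset[OF Pn]]) simp
  also have "card P < card {..<n}" by (rule psubset_card_mono) (use Pn v in auto)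
  finally have qn: "q < n" by simp
  define s1 where "s1 = xsem (blk start) s"
  have H: "!!i. i \<in> set start ==> holds s1 i" unfolding s1_def by (rule ssa_holds[OF prog_ssa(3)])
  have fs: "scalar s1 x = scalar s x" if "x \<in> {''n'', ''v'', ''q'', ''hole''}" for x
    unfolding s1_def by (rule scalar_blk) (use that in "auto simp: start_def")
  have fa: "array s1 x = array s x" if "x ~= ''c0''" for x
    unfolding s1_def by (rule array_blk) (use that in "auto simp: start_def")
  have b1: "base s1" by (rule base_frame[OF b(1)]) (simp_all add: fs fa)
  have vis1: "vis s1 = P" using b(2) by (simp add: vis_def fa)
  note n' = base_n[OF b1]
  define bb where "bb = scalar s1 ''b''"
  define F where "F x <-> x < q & ~ (\<exists>w\<in>nbM P v. array s ''c'' w = x)" for x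
  have Mn: "w \<in> nbM P v ==> w < n" for w using Pn by (auto simp: nbM_def nbT_def)
  have bbF: "bb = first n F"
  proof -
    have "bb = first n (%x. x < q & ~ (\<exists>w<n. array s ''M'' w ~= 0 & array s ''c'' w = x))"
      using H[of "IA ''b'' (xfst ''x'' (XV ''x'' \<prec> XV ''q'' \<and>\<and> xnot (xex ''w'' (rd ''M'' ''w'' \<and>\<and> rd ''c'' ''w'' \<doteq> XV ''x''))))"]
      by (simp add: start_def xval_xfst n' fs fa o(2) bb_def)
    also have "\<dots> = first n F"
    proof (rule first_cong[OF refl])
      show "(j < q & ~ (\<exists>w<n. array s ''M'' w ~= 0 & array s ''c'' w = j)) = F j" if "j < n" for j
        unfolding F_def using M Mn by blast
    qed
    finally show ?thesis .
  qed
  have c0: "array s1 ''c0'' w = n" if "w < n" "w \<notin> P" for w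
  proof -
    have "array s ''vis'' w = 0" using that b(2) by (auto simp: vis_def)
    thus ?thesis using H[of "IT ''c0'' ''w'' (XIf (rd ''vis'' ''w'') (rd ''c'' ''w'') (XV ''n''))"] that
      by (simp add: start_def n' fa)
  qed
  have c0P: "array s1 ''c0'' w = array s ''c'' w" if "w \<in> P" for w
  proof -
    have "array s ''vis'' w ~= 0" "w < n" using that b(2) by (auto simp: vis_def)
    thus ?thesis using H[of "IT ''c0'' ''w'' (XIf (rd ''vis'' ''w'') (rd ''c'' ''w'') (XV ''n''))"]
      by (simp add: start_def n' fa)
  qed
  have ks: "s' = (if bb < n then xsem (XSeq (XFor ''a'' kstep) (XIfC (XV ''hole'') XSkip
      (XIfC (xex ''w'' (rd ''nv'' ''w'' \<and>\<and> rd ''c'' ''w'' \<doteq> XV ''b'')) newcol (XPut ''c'' (XV ''v'') (XV ''b''))))) s1 else xsem newcol s1)"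
    unfolding s'_def kemp_def xsem.simps(4)[of "blk start"] s1_def[symmetric] xsem.simps(5)[of "XV ''b'' \<prec> XV ''n''"] using n' by (simp add: bb_def)
  have "base s' & vis s' = P & scalar s' ''v'' = v & (scalar s' ''hole'' = 0 & opt (insert v P) (array s' ''c'') (scalar s' ''q'') |
     scalar s' ''hole'' ~= 0 & khole P v s' & scalar s' ''q'' = q & opt P (array s' ''c'') q)"
  proof (cases "bb < n")
    case False
    hence "\<exists>w\<in>nbM P v. array s ''c'' w = d" if "d < q" for d
      using first_less_iff[of n F] that qn unfolding bbF F_def by auto
    then obtain z where z: "!!d. d < q ==> z d \<in> nbM P v & array s ''c'' (z d) = d" by metis
    have o': "opt (insert v P) ((array s ''c'')(v := q)) (q + 1)"
    proof (rule opt_new[OF o(1) v(3), of z])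
      show "z d \<in> nbT P v" if "d < q" for d using z[OF that] by (simp add: nbM_def)
      show "E (z d) (z e)" if "d < q" "e < q" "d ~= e" for d e
      proof (rule nbM_adj)
        show "z e \<in> nbM P v" "z d \<in> nbT P v" using z that by (simp_all add: nbM_def)
        show "z d ~= z e" using z[OF that(1)] z[OF that(2)] that(3) by metis
      qed
    qed
    have "s' = xsem newcol s1" using ks False by simp
    from newcol_sem[OF b1 _ this] show ?thesis using o' qn vis1 h0 v(1) o(2) by (simp add: fs fa)
  next
    case True
    have bq: "bb < q" and bM: "~ (\<exists>w\<in>nbM P v. array s ''c'' w = bb)"
      using first_P[of n F] True unfolding bbF F_def by blast+
    have k0: "kinv P v bb q 0 s1"
      unfolding kinv_def using b1 vis1 v(1) o qn nv c0 c0P bM h0 by (auto simp: fs fa bb_def opt_def)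
    let ?I = "iter (%j s. xsem kstep (set_scalar ''a'' j s)) s1"
    have kn: "kinv P v bb q n (?I n)"
      by (rule For_inv[of "kinv P v bb q", OF k0]) (rule kstep_inv[OF _ _ _ bq v(2,3) cl], use qn in auto)
    define s2 where "s2 = set_scalar ''a'' 0 (?I n)"
    have k2: "kinv P v bb q n s2" using kn unfolding kinv_def s2_def khole_def by (simp add: base_def vis_def)
    have kk: "base s2" "vis s2 = P" "scalar s2 ''v'' = v" "scalar s2 ''b'' = bb" "scalar s2 ''q'' = q" "prp P (array s2 ''c'') q"
      "!!w. w < n ==> array s2 ''nv'' w ~= 0 <-> w \<in> nbT P v" using k2 unfolding kinv_def by blast+
    have x2: "xsem (XFor ''a'' kstep) s1 = s2" using n' by (simp add: s2_def)
    have s'2: "s' = (if scalar s2 ''hole'' ~= 0 then s2 else if \<exists>w<n. array s2 ''nv'' w ~= 0 & array s2 ''c'' w = bb then xsem newcol s2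
        else set_array ''c'' v bb s2)"
      using ks True base_n[OF kk(1)] kk(3,4) unfolding xsem.simps(4)[of "XFor ''a'' kstep"] x2
    by (cases "\<exists>w<n. array s2 ''nv'' w ~= 0 & array s2 ''c'' w = bb") auto
    have o2: "opt P (array s2 ''c'') q" by (rule opt_same[OF o(1) kk(6)])
    show ?thesis
    proof (cases "scalar s2 ''hole'' = 0")
      case False
      hence "khole P v s2" using k2 unfolding kinv_def by simp
      thus ?thesis using False s'2 kk o2 by simp
    next
      case hole0: True
      have inv: "bb \<notin> array s2 ''c'' ` nbM P v" "!!d y. [|d < n; d ~= bb; d < q; y \<in> nbT P v; array s2 ''c'' y = bb|] ==> \<exists>z\<in>nbT P v. array s2 ''c'' z = d & E z y"
        using k2 hole0 unfolding kinv_def by auto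
      show ?thesis
      proof (cases "\<exists>w<n. array s2 ''nv'' w ~= 0 & array s2 ''c'' w = bb")
        case True
        then obtain y where y: "y \<in> nbT P v" "array s2 ''c'' y = bb" using kk(7) by blast
        have "\<exists>z\<in>nbT P v. array s2 ''c'' z = d & (z = y | E z y)" if "d < q" for d
          using inv(2)[of d y] y that qn by (cases "d = bb") auto
        then obtain z where z: "!!d. d < q ==> z d \<in> nbT P v & array s2 ''c'' (z d) = d & (z d = y | E (z d) y)" by metis
        have yM: "y \<notin> nbM P v" using inv(1) y(2) by blast
        have o': "opt (insert v P) ((array s2 ''c'')(v := q)) (q + 1)"
        proof (rule opt_new[OF o2 v(3), of z])
          show "z d \<in> nbT P v" if "d < q" for d using z[OF that] by simp
          show "E (z d) (z e)" if "d < q" "e < q" "d ~= e" for d e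
          proof (rule nbM_trans[OF cl y(1)])
            show "z d ~= z e" using z[OF that(1)] z[OF that(2)] that(3) by metis
          qed (use z that yM in auto)
        qed
        have "s' = xsem newcol s2" using s'2 hole0 True by simp
        from newcol_sem[OF kk(1) _ this] show ?thesis using o' qn kk hole0 by simp
      next
        case False
        have "array s2 ''c'' y ~= bb" if "y \<in> nbT P v" for y
        proof -
          have "y < n" using that Pn by (auto simp: nbT_def)
          thus ?thesis using False kk(7) that by blast
        qed
        from opt_free[OF o2 v(3) bq this] have "opt (insert v P) ((array s2 ''c'')(v := bb)) q" .
        moreover have "s' = set_array ''c'' v bb s2" using s'2 hole0 False by auto
        ultimately show ?thesis using kk hole0 by (auto simp: base_def vis_def)
      qed
    qed
  qed
  thus "base s'" "vis s' = P" "scalar s' ''v'' = v"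
    "scalar s' ''hole'' = 0 & opt (insert v P) (array s' ''c'') (scalar s' ''q'') |
     scalar s' ''hole'' ~= 0 & khole P v s' & scalar s' ''q'' = q & opt P (array s' ''c'') q" by blast+
qed

end

context pcc_free begin

text \<open>It reconciles the least number in \<open>cls\<close> with the search of the program,
  which runs over \<open>i < 7\<close> and computes modulo 7.\<close>

lemma cls_start:
  assumes w: "w \<in> hW h"
  shows "\<exists>i<7. cn h w i & ~ cn h w ((i + 6) mod 7)" "(LEAST s. cn h w s & ~ cn h w (s + 6)) < 7"
    "cn h w (LEAST s. cn h w s & ~ cn h w (s + 6)) & ~ cn h w (((LEAST s. cn h w s & ~ cn h w (s + 6)) + 6) mod 7)"
proof -
  obtain i j where ij: "i < 7" "cn h w i" "j < 7" "~ cn h w j" using w by (auto simp: hW_def)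
  show ex: "\<exists>i<7. cn h w i & ~ cn h w ((i + 6) mod 7)"
  proof (rule ccontr)
    assume "~ ?thesis"
    hence st: "cn h w ((m + 6) mod 7)" if "cn h w m" for m
      using that cn_mod[of h w m] cn_mod[of h w "m + 6"] mod_less_divisor[of 7 m] mod_add_left_eq[of m 7 6] by (metis zero_less_numeral)
    have "cn h w ((i + 6 * m) mod 7)" for m
    proof (induction m)
      case (Suc m)
      have "((i + 6 * m) mod 7 + 6) mod 7 = (i + 6 * Suc m) mod 7" by (simp add: mod_simps algebra_simps)
      thus ?case using st[OF Suc] by simp
    qed (use ij cn_mod in simp)
    from this[of "i + 6 * j"] have "cn h w ((i + 6 * (i + 6 * j)) mod 7)" .
    moreover have "i + 6 * (i + 6 * j) = j + 7 * (i + 5 * j)" by simp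
    hence "(i + 6 * (i + 6 * j)) mod 7 = j" using ij(3) mod_mult_self2[of j 7 "i + 5 * j"] by (simp only: mod_less)
    ultimately show False using ij by simp
  qed
  then obtain i where i: "i < 7" "cn h w i" "~ cn h w ((i + 6) mod 7)" by blast
  have iP: "cn h w i & ~ cn h w (i + 6)" using i cn_mod by metis
  have "(LEAST s. cn h w s & ~ cn h w (s + 6)) <= i" by (rule Least_le) (rule iP)
  thus "(LEAST s. cn h w s & ~ cn h w (s + 6)) < 7" using i by simp
  have "cn h w (LEAST s. cn h w s & ~ cn h w (s + 6)) & ~ cn h w ((LEAST s. cn h w s & ~ cn h w (s + 6)) + 6)"
    by (rule LeastI[of _ i]) (rule iP)
  thus "cn h w (LEAST s. cn h w s & ~ cn h w (s + 6)) & ~ cn h w (((LEAST s. cn h w s & ~ cn h w (s + 6)) + 6) mod 7)"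
    using cn_mod by metis
qed

end

section \<open>Recolouring around a 7-hole\<close>

locale recolor = ram_graph E n for E :: "nat => nat => bool" and n :: nat +
  fixes P :: "nat set" and v :: nat and h :: "nat => nat" and c :: "nat => nat" and q :: nat
  assumes v: "v < n" "v \<notin> P" and P: "P \<subseteq> {..<n}" and H: "hole h" "h 0 = v" "h ` {..<7} \<subseteq> insert v P" and o: "opt P c q"
begin

definition "V = insert v P"
definition "Wp = V \<inter> hW h"
definition "Up = V \<inter> hU h"
definition "Zp = V \<inter> hZ h"
definition "ff w = card {u\<in>Wp. E w u & dl h w u \<in> {3, 4}}"
definition "bf w = card {u\<in>Wp. E w u & dl h w u \<in> {10, 11}}"
definition "ky w = n + ff w - bf w"
definition "K w = (cls h w * (2 * n + 1) + ky w) * n + w"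

lemma V: "V \<subseteq> {..<n}" and finV: "finite V" and subV: "Wp \<subseteq> V" "Up \<subseteq> V" "Zp \<subseteq> V"
  and VUWZ: "V = Up \<union> Wp \<union> Zp" "Up \<inter> Wp = {}" "Up \<inter> Zp = {}" "Wp \<inter> Zp = {}"
proof -
  show 1: "V \<subseteq> {..<n}" using v P by (auto simp: V_def)
  thus "finite V" by (rule finite_subset) simp
  show "Wp \<subseteq> V" "Up \<subseteq> V" "Zp \<subseteq> V" by (auto simp: Wp_def Up_def Zp_def)
  have "(0::nat) < 7" by simp
  show "V = Up \<union> Wp \<union> Zp" unfolding Up_def Wp_def Zp_def hU_def hW_def hZ_def by blast
  show "Up \<inter> Wp = {}" "Up \<inter> Zp = {}" "Wp \<inter> Zp = {}" unfolding Up_def Wp_def Zp_def hU_def hW_def hZ_def using \<open>(0::nat) < 7\<close> by blast+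
qed

lemma finW: "finite Wp" and finU: "finite Up" and hWp: "h ` {..<7} \<subseteq> Wp"
proof -
  show "finite Wp" "finite Up" using finV subV finite_subset by blast+
  show "h ` {..<7} \<subseteq> Wp" using H(3) cls_hole(1)[OF H(1)] by (auto simp: Wp_def V_def)
qed

lemma vW: "v \<in> Wp" using hWp H(2) by force

lemma card_le_n: "card {u\<in>Wp. Q u} <= n"
proof -
  have "card {u\<in>Wp. Q u} <= card {..<n}" by (rule card_mono) (use subV V in auto)
  thus ?thesis by simp
qed

lemma ky_le: "ky w <= 2 * n" and bf_le: "bf w <= n"
  using card_le_n[of "%u. E w u & dl h w u \<in> {3, 4}"] card_le_n[of "%u. E w u & dl h w u \<in> {10, 11}"]
  by (simp_all add: ky_def ff_def bf_def)

lemma K_div: "w < n ==> K w div n = cls h w * (2 * n + 1) + ky w" "w < n ==> K w mod n = w"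
  by (simp_all add: K_def)

sublocale A: arcs E h Wp K
proof
  have Wn: "w < n" if "w \<in> Wp" for w using that subV V by auto
  show "inj_on K Wp"
  proof (rule inj_onI)
    fix u w assume uw: "u \<in> Wp" "w \<in> Wp" "K u = K w"
    have "u = K u mod n" by (rule K_div(2)[OF Wn[OF uw(1)], symmetric])
    also have "\<dots> = w" unfolding uw(3) by (rule K_div(2)[OF Wn[OF uw(2)]])
    finally show "u = w" .
  qed
  show "K u < K w" if "u \<in> Wp" "w \<in> Wp" "cls h u < cls h w" for u w
  proof (rule ccontr)
    assume "~ ?thesis"
    hence "K w div n <= K u div n" by (intro div_le_mono) simp
    hence le: "cls h w * (2 * n + 1) + ky w <= cls h u * (2 * n + 1) + ky u" unfolding K_div(1)[OF Wn[OF that(1)]] K_div(1)[OF Wn[OF that(2)]] .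
    have "(cls h u + 1) * (2 * n + 1) <= cls h w * (2 * n + 1)" using that(3) by (intro mult_le_mono1) simp
    thus False using le ky_le[of u] by simp
  qed
  show "card {x\<in>Wp. E u x & dl h u x \<in> {3, 4}} + card {x\<in>Wp. E w x & dl h w x \<in> {10, 11}}
      <= card {x\<in>Wp. E w x & dl h w x \<in> {3, 4}} + card {x\<in>Wp. E u x & dl h u x \<in> {10, 11}}"
    if "u \<in> Wp" "w \<in> Wp" "cls h u = cls h w" "K u < K w" for u w
  proof -
    have "K u div n <= K w div n" using that by (intro div_le_mono) simp
    hence "ky u <= ky w" unfolding K_div(1)[OF Wn[OF that(1)]] K_div(1)[OF Wn[OF that(2)]] that(3) by simp
    thus ?thesis using bf_le[of u] bf_le[of w] unfolding ky_def ff_def bf_def by linarith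
  qed
qed (use H finW hWp in "auto simp: Wp_def")

definition "k2 = (A.N + 2) div 3"
definition "k1 = Max (insert 0 ((%w. if w \<in> Wp then A.fw w + 1 else 0) ` {..<n}))"
definition "k = (if k1 < k2 then k2 else k1)"
definition "cov w i <-> A.rk w <= i & i < A.rk w + A.fw w | i + A.N < A.rk w + A.fw w"

lemma k_facts: "w \<in> Wp ==> A.fw w + 1 <= k" "A.N <= 3 * k" "(\<exists>w\<in>Wp. k <= A.fw w + 1) | 3 * k <= A.N + 2" "0 < k"
proof -
  have 1: "A.fw w + 1 <= k1" if "w \<in> Wp" for w
    unfolding k1_def by (rule Max_ge) (use that subV V in "force+")
  thus a: "A.fw w + 1 <= k" if "w \<in> Wp" for w using 1[OF that] by (simp add: k_def)
  show "0 < k" using a[OF vW] by simp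
  have k2: "A.N <= 3 * k2" "3 * k2 <= A.N + 2" unfolding k2_def by linarith+
  thus "A.N <= 3 * k" unfolding k_def by auto
  show "(\<exists>w\<in>Wp. k <= A.fw w + 1) | 3 * k <= A.N + 2"
  proof (cases "k1 < k2")
    case False
    have "k1 \<in> insert 0 ((%w. if w \<in> Wp then A.fw w + 1 else 0) ` {..<n})" unfolding k1_def by (rule Max_in) auto
    moreover have "k1 ~= 0" using 1[OF vW] by simp
    ultimately have "\<exists>w\<in>Wp. k1 = A.fw w + 1" by (auto split: if_splits)
    thus ?thesis using False unfolding k_def by auto
  qed (use k2 in "simp add: k_def")
qed

lemma lower: assumes "prp V f r" shows "q <= r" "card Up + k <= r"
proof -
  show "q <= r" using opt_lower[OF o _ assms] by (auto simp: V_def)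
  obtain w where w: "k <= A.fw w + 1 & w \<in> Wp | 3 * k <= A.N + 2" using k_facts(3) by blast
  show "card Up + k <= r"
    by (rule A.lower_bound[OF _ finU w, of f]) (use assms subV in "auto simp: prp_def Up_def Wp_def")
qed

text \<open>Both terms are lower bounds by \<open>lower\<close>, so any proper colouring with
  \<open>Q\<close> colours is optimal.\<close>

definition "Q = max q (card Up + k)"

lemma Q_le: "Q <= n"
proof -
  have "prp V (%x. x) n" unfolding prp_def using V by auto
  thus ?thesis using lower[of "%x. x" n] by (simp add: Q_def)
qed

lemma arcs_facts:
  assumes b: "base s" and vs: "vis s = V" and hs: "array s ''h'' = h"
  defines "s' \<equiv> xsem (blk arcblk) s"
  shows "base s'" "!!x. x \<in> {''v'', ''q''} ==> scalar s' x = scalar s x" "!!x. x \<in> {''c'', ''vis'', ''nl''} ==> array s' x = array s x"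
    "!!w. w < n ==> array s' ''iW'' w ~= 0 <-> w \<in> Wp" "!!w. w < n ==> array s' ''iU'' w ~= 0 <-> w \<in> Up" "!!w. w < n ==> array s' ''iZ'' w ~= 0 <-> w \<in> Zp"
    "!!w. w \<in> Wp ==> array s' ''rk'' w = A.rk w" "!!w. w \<in> Wp ==> array s' ''fw'' w = A.fw w"
    "scalar s' ''N'' = A.N" "scalar s' ''k'' = k" "!!w. w \<in> Wp ==> array s' ''D'' w = A.fw w" "scalar s' ''rem'' = 3 * k - A.N"
proof -
  have I: "!!t. t \<in> set arcblk ==> holds s' t" unfolding s'_def by (rule ssa_holds[OF prog_ssa(7)])
  have fs: "scalar s' x = scalar s x" if "x \<in> {''n'', ''v'', ''q''}" for x
    unfolding s'_def by (rule scalar_blk) (use that in "auto simp: arcblk_def")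
  have fa: "array s' x = array s x" if "x \<in> {''adj'', ''c'', ''vis'', ''nl'', ''h''}" for x
    unfolding s'_def by (rule array_blk) (use that in "auto simp: arcblk_def")
  show b': "base s'" by (rule base_frame[OF b]) (simp_all add: fs fa)
  show "!!x. x \<in> {''v'', ''q''} ==> scalar s' x = scalar s x" "!!x. x \<in> {''c'', ''vis'', ''nl''} ==> array s' x = array s x"
    using fs fa by auto
  note adj = adjE[OF b'] adjE0[OF b'] adjE[OF b] adjE0[OF b] and n' = base_n[OF b']
  have n7: "7 <= n" using C7_n7 H(1) by (auto simp: hole_def)
  have hn: "h i < n" if "i < 7" for i using H(3) V that by (auto simp: V_def)
  have Wn: "w < n" if "w \<in> Wp" for w using that subV V by auto
  have cnx: "xval (cnx e) t = (if cn h (scalar t ''w'') (xval e t) then 1 else 0)"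
    if "nn t = n" "array t = array s'" "scalar t ''w'' < n" "xval e t < 7" for e t
    using that hn[OF that(4)] by (simp add: cnx_def cn_def xadj_def adj fa hs)
  have cnt: "array s' ''cnt'' w = card {i. i < 7 & cn h w i}" if "w < n" for w
  proof -
    let ?e = "XV ''i'' \<prec> XC 7 \<and>\<and> cnx (XV ''i'')"
    have "IT ''cnt'' ''w'' (xcnt ''i'' ?e) \<in> set arcblk" by (simp add: arcblk_def)
    from I[OF this] that have "array s' ''cnt'' w = card {i. i < n & xval ?e (set_scalar ''i'' i (set_scalar ''w'' w s')) ~= 0}"
      by (simp only: holds.simps n' xval_xcnt) (simp add: n')
    also have "{i. i < n & xval ?e (set_scalar ''i'' i (set_scalar ''w'' w s')) ~= 0} = {i. i < 7 & cn h w i}"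
    proof (rule Collect_cong)
      fix i
      have "xval (cnx (XV ''i'')) (set_scalar ''i'' i (set_scalar ''w'' w s')) = (if cn h w i then 1 else 0)" if "i < 7"
        by (subst cnx) (use that \<open>w < n\<close> n' in auto)
      thus "(i < n & xval ?e (set_scalar ''i'' i (set_scalar ''w'' w s')) ~= 0) = (i < 7 & cn h w i)" using n7 by auto
    qed
    finally show ?thesis .
  qed
  have st: "array s' ''st'' w = (LEAST s. cn h w s & ~ cn h w (s + 6))" if "w \<in> Wp" for w
  proof -
    have w: "w < n" "w \<in> hW h" using that Wn by (auto simp: Wp_def)
    let ?e = "XV ''i'' \<prec> XC 7 \<and>\<and> cnx (XV ''i'') \<and>\<and> xnot (cnx (XO OMod (XV ''i'' \<oplus> XC 6) (XC 7)))"
    have "IT ''st'' ''w'' (xfst ''i'' ?e) \<in> set arcblk" by (simp add: arcblk_def)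
    from I[OF this] w have "array s' ''st'' w = first n (%i. xval ?e (set_scalar ''i'' i (set_scalar ''w'' w s')) ~= 0)"
      by (simp only: holds.simps n') (simp add: n' xval_xfst)
    also have "\<dots> = first n (%i. i < 7 & cn h w i & ~ cn h w ((i + 6) mod 7))"
    proof (rule first_cong[OF refl])
      fix i
      have "xval (cnx (XV ''i'')) (set_scalar ''i'' i (set_scalar ''w'' w s')) = (if cn h w i then 1 else 0)" if "i < 7"
        by (subst cnx) (use that w n' in auto)
      moreover have "xval (cnx (XO OMod (XV ''i'' \<oplus> XC 6) (XC 7))) (set_scalar ''i'' i (set_scalar ''w'' w s')) = (if cn h w ((i + 6) mod 7) then 1 else 0)"
        by (subst cnx) (use w n' in auto)
      ultimately show "(xval ?e (set_scalar ''i'' i (set_scalar ''w'' w s')) ~= 0) = (i < 7 & cn h w i & ~ cn h w ((i + 6) mod 7))" by auto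
    qed
    also have "\<dots> = (LEAST s. cn h w s & ~ cn h w (s + 6))" (is "first n ?R = ?L")
    proof -
      have L: "?L < 7" "?R ?L" using cls_start(2,3)[OF w(2)] by auto
      hence f: "first n ?R < n" "?R (first n ?R)" "first n ?R <= ?L" using first_some[of ?L n ?R] n7 by auto
      have "cn h w (first n ?R) & ~ cn h w (first n ?R + 6)" using f(2) unfolding cn_mod by blast
      hence "?L <= first n ?R" by (rule Least_le)
      thus ?thesis using f(3) by simp
    qed
    finally show ?thesis .
  qed
  have c7: "card {i. i < 7 & cn h w i} = 7 <-> (\<forall>i<7. cn h w i)" "card {i. i < 7 & cn h w i} = 0 <-> (\<forall>i<7. ~ cn h w i)"
    "card {i. i < 7 & cn h w i} <= 7" for w
  proof -
    have sub: "{i. i < 7 & cn h w i} \<subseteq> {..<7}" by auto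
    show "card {i. i < 7 & cn h w i} <= 7" using card_mono[OF _ sub] by simp
    show "card {i. i < 7 & cn h w i} = 7 <-> (\<forall>i<7. cn h w i)"
    proof
      assume "card {i. i < 7 & cn h w i} = 7"
      hence "{i. i < 7 & cn h w i} = {..<7}" using card_subset_eq[OF _ sub] by simp
      thus "\<forall>i<7. cn h w i" by blast
    next
      assume "\<forall>i<7. cn h w i"
      hence "{i. i < 7 & cn h w i} = {..<7}" by auto
      thus "card {i. i < 7 & cn h w i} = 7" by simp
    qed
    have "finite {i. i < 7 & cn h w i}" by simp
    thus "card {i. i < 7 & cn h w i} = 0 <-> (\<forall>i<7. ~ cn h w i)" by auto
  qed
  have visV: "array s ''vis'' w ~= 0 <-> w \<in> V" if "w < n" for w using vs that by (auto simp: vis_def)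
  show iW: "array s' ''iW'' w ~= 0 <-> w \<in> Wp" if "w < n" for w
  proof -
    have "array s' ''iW'' w ~= 0 <-> array s ''vis'' w ~= 0 & array s' ''cnt'' w ~= 0 & array s' ''cnt'' w < 7"
      using I[of "IT ''iW'' ''w'' (rd ''vis'' ''w'' \<and>\<and> rd ''cnt'' ''w'' \<and>\<and> rd ''cnt'' ''w'' \<prec> XC 7)"] that by (simp add: arcblk_def n' fa)
    also have "array s' ''cnt'' w < 7 <-> ~ (\<forall>i<7. cn h w i)" unfolding c7(1)[of w, symmetric] cnt[OF that] using c7(3)[of w] by linarith
    also have "array s' ''cnt'' w ~= 0 <-> ~ (\<forall>i<7. ~ cn h w i)" using cnt[OF that] c7(2)[of w] by simp
    finally show ?thesis using visV[OF that] unfolding Wp_def hW_def by blast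
  qed
  show iU: "array s' ''iU'' w ~= 0 <-> w \<in> Up" if "w < n" for w
    using I[of "IT ''iU'' ''w'' (rd ''vis'' ''w'' \<and>\<and> rd ''cnt'' ''w'' \<doteq> XC 7)"] that cnt[OF that] c7(1)[of w] visV[OF that]
    by (simp add: arcblk_def n' fa Up_def hU_def)
  show iZ: "array s' ''iZ'' w ~= 0 <-> w \<in> Zp" if "w < n" for w
  proof -
    have "array s' ''iZ'' w ~= 0 <-> array s ''vis'' w ~= 0 & array s' ''cnt'' w = 0"
      using I[of "IT ''iZ'' ''w'' (rd ''vis'' ''w'' \<and>\<and> xnot (rd ''cnt'' ''w''))"] that by (simp add: arcblk_def n' fa)
    thus ?thesis using cnt[OF that] c7(2)[of w] visV[OF that] unfolding Zp_def hZ_def by auto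
  qed
  have cl: "array s' ''cl'' w = cls h w" if "w \<in> Wp" for w
    using I[of "IT ''cl'' ''w'' (XC 2 \<otimes> rd ''st'' ''w'' \<oplus> rd ''cnt'' ''w'' \<ominus> XC 3)"] Wn[OF that] st[OF that] cnt[OF Wn[OF that]]
    by (simp add: arcblk_def n' cls_def)
  have dlx: "xval dlx (set_scalar ''u'' u (set_scalar ''w'' w s')) = dl h w u" if "u \<in> Wp" "w \<in> Wp" for u w
    using cl that by (simp add: dlx_def dl_def)
  have nbW: "xval (nbW e) (set_scalar ''w'' w s') = card {u\<in>Wp. E w u & R w u}"
    if w: "w \<in> Wp" and e: "!!u. u \<in> Wp ==> xval e (set_scalar ''u'' u (set_scalar ''w'' w s')) ~= 0 <-> R w u" for e R w
  proof -
    have "xval (nbW e) (set_scalar ''w'' w s') = card {u. u < n & array s' ''iW'' u ~= 0 & E w u & xval e (set_scalar ''u'' u (set_scalar ''w'' w s')) ~= 0}"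
      unfolding nbW_def xval_xcnt using Wn[OF w] by (intro arg_cong[where f = card] Collect_cong) (auto simp: n' xadj_def adj)
    also have "{u. u < n & array s' ''iW'' u ~= 0 & E w u & xval e (set_scalar ''u'' u (set_scalar ''w'' w s')) ~= 0} = {u\<in>Wp. E w u & R w u}"
      using iW e Wn by blast
    finally show ?thesis .
  qed
  have ky: "array s' ''key'' w = ky w" if "w \<in> Wp" for w
  proof -
    have "array s' ''key'' w = n + xval (nbW (dlx \<doteq> XC 3 \<or>\<or> dlx \<doteq> XC 4)) (set_scalar ''w'' w s') - xval (nbW (dlx \<doteq> XC 10 \<or>\<or> dlx \<doteq> XC 11)) (set_scalar ''w'' w s')"
      using I[of "IT ''key'' ''w'' (XV ''n'' \<oplus> nbW (dlx \<doteq> XC 3 \<or>\<or> dlx \<doteq> XC 4) \<ominus> nbW (dlx \<doteq> XC 10 \<or>\<or> dlx \<doteq> XC 11))"] Wn[OF that]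
      by (simp add: arcblk_def n')
    moreover have "xval (nbW (dlx \<doteq> XC 3 \<or>\<or> dlx \<doteq> XC 4)) (set_scalar ''w'' w s') = ff w"
      unfolding ff_def by (rule nbW[OF that]) (use dlx that in auto)
    moreover have "xval (nbW (dlx \<doteq> XC 10 \<or>\<or> dlx \<doteq> XC 11)) (set_scalar ''w'' w s') = bf w"
      unfolding bf_def by (rule nbW[OF that]) (use dlx that in auto)
    ultimately show ?thesis by (simp add: ky_def)
  qed
  have K: "array s' ''K'' w = K w" if "w \<in> Wp" for w
    using I[of "IT ''K'' ''w'' ((rd ''cl'' ''w'' \<otimes> (XC 2 \<otimes> XV ''n'' \<oplus> XC 1) \<oplus> rd ''key'' ''w'') \<otimes> XV ''n'' \<oplus> XV ''w'')"] Wn[OF that] ky[OF that] cl[OF that]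
    by (simp add: arcblk_def n' K_def)
  show rk: "array s' ''rk'' w = A.rk w" if "w \<in> Wp" for w
  proof -
    have "array s' ''rk'' w = card {u. u < n & array s' ''iW'' u ~= 0 & array s' ''K'' u < array s' ''K'' w}"
      using I[of "IT ''rk'' ''w'' (xcnt ''u'' (rd ''iW'' ''u'' \<and>\<and> rd ''K'' ''u'' \<prec> rd ''K'' ''w''))"] Wn[OF that] by (simp add: arcblk_def n')
    also have "{u. u < n & array s' ''iW'' u ~= 0 & array s' ''K'' u < array s' ''K'' w} = {u\<in>Wp. K u < K w}"
      using iW K that Wn by auto
    finally show ?thesis by (simp add: A.rk_def)
  qed
  show fw: "array s' ''fw'' w = A.fw w" if "w \<in> Wp" for w
  proof -
    have "array s' ''fw'' w = xval (nbW (XC 0 \<prec> dlx \<and>\<and> dlx \<prec> XC 5 \<or>\<or> dlx \<doteq> XC 0 \<and>\<and> rd ''K'' ''w'' \<prec> rd ''K'' ''u'')) (set_scalar ''w'' w s')"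
      using I[of "IT ''fw'' ''w'' (nbW (XC 0 \<prec> dlx \<and>\<and> dlx \<prec> XC 5 \<or>\<or> dlx \<doteq> XC 0 \<and>\<and> rd ''K'' ''w'' \<prec> rd ''K'' ''u''))"] Wn[OF that]
      by (simp add: arcblk_def n')
    also have "\<dots> = A.fw w"
      unfolding A.fw_def by (rule nbW[OF that]) (use dlx that K in "auto simp: A.fwd_def")
    finally show ?thesis .
  qed
  show N: "scalar s' ''N'' = A.N"
  proof -
    have "scalar s' ''N'' = card {u. u < n & array s' ''iW'' u ~= 0}" using I[of "IA ''N'' (xcnt ''u'' (rd ''iW'' ''u''))"] by (simp add: arcblk_def n')
    also have "{u. u < n & array s' ''iW'' u ~= 0} = Wp" using iW Wn by auto
    finally show ?thesis by (simp add: A.N_def)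
  qed
  have k1: "scalar s' ''k1'' = k1"
  proof -
    have "scalar s' ''k1'' = Max (insert 0 ((%w. if array s' ''iW'' w ~= 0 then array s' ''fw'' w + 1 else 0) ` {..<n}))"
      using I[of "IA ''k1'' (XMax ''w'' (XIf (rd ''iW'' ''w'') (rd ''fw'' ''w'' \<oplus> XC 1) (XC 0)))"] by (simp add: arcblk_def n' cong: image_cong)
    also have "(%w. if array s' ''iW'' w ~= 0 then array s' ''fw'' w + 1 else 0) ` {..<n} = (%w. if w \<in> Wp then A.fw w + 1 else 0) ` {..<n}"
      by (rule image_cong[OF refl]) (use iW fw in auto)
    finally show ?thesis by (simp add: k1_def)
  qed
  have k2: "scalar s' ''k2'' = k2" using I[of "IA ''k2'' (XO ODiv (XV ''N'' \<oplus> XC 2) (XC 3))"] N by (simp add: arcblk_def k2_def)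
  show k: "scalar s' ''k'' = k"
    using I[of "IA ''k'' (XIf (XV ''k1'' \<prec> XV ''k2'') (XV ''k2'') (XV ''k1''))"] k1 k2 by (simp add: arcblk_def k_def)
  show "array s' ''D'' w = A.fw w" if "w \<in> Wp" for w using I[of "IT ''D'' ''w'' (rd ''fw'' ''w'')"] Wn[OF that] fw[OF that] by (simp add: arcblk_def n')
  show "scalar s' ''rem'' = 3 * k - A.N" using I[of "IA ''rem'' (XC 3 \<otimes> XV ''k'' \<ominus> XV ''N'')"] N k by (simp add: arcblk_def)
qed

end

text \<open>The rank of \<open>x\<close> among the numbers outside \<open>C\<close> grows in steps
  of at most one and exceeds \<open>j\<close> at \<open>Q\<close>; the point just before it first
  exceeds \<open>j\<close> is the number wanted.\<close>

lemma card_UNIV_rank: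
  assumes "finite C" "card C + k <= Q" "j < k"
  shows "\<exists>x<Q. x \<notin> C & card {y. y < x & y \<notin> C} = (j :: nat)"
proof -
  define f where "f x = card {y. y < x & y \<notin> C}" for x :: nat
  have fS: "f (Suc x) = f x + (if x \<in> C then 0 else 1)" for x
  proof -
    have "{y. y < Suc x & y \<notin> C} = (if x \<in> C then {y. y < x & y \<notin> C} else insert x {y. y < x & y \<notin> C})"
      by (auto simp: less_Suc_eq)
    thus ?thesis by (simp add: f_def)
  qed
  have "{..<Q} - C \<subseteq> {y. y < Q & y \<notin> C}" by auto
  hence "card ({..<Q} - C) <= f Q" unfolding f_def by (intro card_mono) auto
  moreover have "card {..<Q} - card C <= card ({..<Q} - C)" by (rule diff_card_le_card_Diff[OF assms(1)])
  ultimately have "j < f Q" using assms by simp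
  moreover have "0 < Q" using assms by simp
  ultimately have ex: "j < f (Suc (Q - 1))" by simp
  define x where "x = (LEAST x. j < f (Suc x))"
  have x: "j < f (Suc x)" unfolding x_def by (rule LeastI[of _ "Q - 1"]) (rule ex)
  have "x <= Q - 1" unfolding x_def by (rule Least_le) (rule ex)
  hence "x < Q" using \<open>0 < Q\<close> by simp
  have "f x <= j"
  proof (cases x)
    case 0
    thus ?thesis by (simp add: f_def)
  next
    case (Suc x')
    hence "~ j < f (Suc x')" unfolding x_def using not_less_Least by (metis lessI)
    thus ?thesis using Suc by simp
  qed
  hence "x \<notin> C" "f x = j" using x fS[of x] by (auto split: if_splits)
  thus ?thesis using \<open>x < Q\<close> by (auto simp: f_def)
qed

context recolor begin

definition gctx :: "state => bool" where
  "gctx t <-> base t & (\<forall>w<n. array t ''iW'' w ~= 0 <-> w \<in> Wp) & (\<forall>w\<in>Wp. array t ''rk'' w = A.rk w & array t ''fw'' w = A.fw w) &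
     scalar t ''N'' = A.N & scalar t ''k'' = k"

definition gmx :: "state => nat => nat" where
  "gmx t j = Max (insert 0 ((%w. if w \<in> Wp & cov w j then array t ''D'' w else 0) ` {..<n}))"

lemma gstep_facts:
  assumes g: "gctx t" and j: "j < A.N"
  defines "t' \<equiv> xsem gstep (set_scalar ''j'' j t)" and "gi \<equiv> min (scalar t ''rem'') (k - 1 - gmx t j)"
  shows "array t' ''g'' = (array t ''g'')(j := gi)" "scalar t' ''rem'' = scalar t ''rem'' - gi"
    "!!w. w \<in> Wp ==> array t' ''D'' w = (if cov w j then min (array t ''D'' w + gi) k else array t ''D'' w)"
proof -
  have g': "base t" "!!w. w < n ==> array t ''iW'' w ~= 0 <-> w \<in> Wp" "!!w. w \<in> Wp ==> array t ''rk'' w = A.rk w" "!!w. w \<in> Wp ==> array t ''fw'' w = A.fw w"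
    "scalar t ''N'' = A.N" "scalar t ''k'' = k" using g unfolding gctx_def by blast+
  define s0 where "s0 = set_scalar ''j'' j t"
  define s1 where "s1 = xsem (blk gap) s0"
  have I: "!!i. i \<in> set gap ==> holds s1 i" unfolding s1_def by (rule ssa_holds[OF prog_ssa(8)])
  have fs: "scalar s1 x = scalar s0 x" if "x \<in> {''n'', ''j'', ''N'', ''k'', ''rem''}" for x
    unfolding s1_def by (rule scalar_blk) (use that in "auto simp: gap_def")
  have fa: "array s1 x = array t x" if "x ~= ''nD''" for x
  proof -
    have "array s1 x = array s0 x" unfolding s1_def by (rule array_blk) (use that in "auto simp: gap_def")
    thus ?thesis by (simp add: s0_def)
  qed
  have n': "nn s1 = n" "nn s0 = n" using base_n[OF g'(1)] by (simp_all add: fs s0_def)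
  have cv: "xval covx (set_scalar ''w'' w s1) ~= 0 <-> w \<in> Wp & cov w j" if "w < n" for w
    using g'(2)[OF that] g'(3,4)[of w] g'(5) by (auto simp: covx_def cov_def fs fa s0_def)
  have mm: "scalar s1 ''mm'' = gmx t j"
  proof -
    have "IA ''mm'' (XMax ''w'' (XIf covx (rd ''D'' ''w'') (XC 0))) \<in> set gap" by (simp add: gap_def)
    from I[OF this] have "scalar s1 ''mm'' = Max (insert 0 ((%w. xval (XIf covx (rd ''D'' ''w'') (XC 0)) (set_scalar ''w'' w s1)) ` {..<n}))"
      by (simp only: holds.simps xval.simps(7) n')
    also have "(%w. xval (XIf covx (rd ''D'' ''w'') (XC 0)) (set_scalar ''w'' w s1)) ` {..<n} = (%w. if w \<in> Wp & cov w j then array t ''D'' w else 0) ` {..<n}"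
      by (rule image_cong[OF refl]) (use cv in "simp add: fa")
    finally show ?thesis by (simp add: gmx_def)
  qed
  have gi: "scalar s1 ''gi'' = gi"
    using I[of "IA ''gi'' (XO OMin (XV ''rem'') (XV ''k'' \<ominus> XC 1 \<ominus> XV ''mm''))"] mm g'(6) by (simp add: gap_def gi_def fs s0_def)
  have nD: "array s1 ''nD'' w = (if cov w j then min (array t ''D'' w + gi) k else array t ''D'' w)" if "w \<in> Wp" for w
  proof -
    have wn: "w < n" using that subV V by auto
    have "IT ''nD'' ''w'' (XIf covx (XO OMin (rd ''D'' ''w'' \<oplus> XV ''gi'') (XV ''k'')) (rd ''D'' ''w'')) \<in> set gap" by (simp add: gap_def)
    from I[OF this] wn have "array s1 ''nD'' w = xval (XIf covx (XO OMin (rd ''D'' ''w'' \<oplus> XV ''gi'') (XV ''k'')) (rd ''D'' ''w'')) (set_scalar ''w'' w s1)"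
      by (simp only: holds.simps n')
    thus ?thesis using cv[OF wn] that gi g'(6) by (simp add: fa fs s0_def)
  qed
  have t': "t' = xsem (XSeq (XPut ''g'' (XV ''j'') (XV ''gi'')) (XSeq (blk [IT ''D'' ''w'' (rd ''nD'' ''w'')]) (XAsg ''rem'' (XV ''rem'' \<ominus> XV ''gi'')))) s1"
    unfolding t'_def s0_def[symmetric] gstep_def xsem.simps(5)[of _ _ _ s0] using j g'(5) by (simp add: s1_def s0_def del: blk.simps)
  define s2 where "s2 = set_array ''g'' j gi s1"
  define s3 where "s3 = xsem (blk [IT ''D'' ''w'' (rd ''nD'' ''w'')]) s2"
  have t'3: "t' = set_scalar ''rem'' (scalar s3 ''rem'' - scalar s3 ''gi'') s3"
    unfolding t' by (simp add: s3_def s2_def gi fs s0_def del: blk.simps)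
  have H3: "holds s3 (IT ''D'' ''w'' (rd ''nD'' ''w''))" unfolding s3_def by (rule ssa_holds) simp_all
  have fs3: "scalar s3 x = scalar s2 x" if "x ~= ''w''" for x unfolding s3_def by (rule scalar_blk) (use that in simp)
  have fa3: "array s3 x = array s2 x" if "x ~= ''D''" for x unfolding s3_def by (rule array_blk) (use that in simp)
  show "array t' ''g'' = (array t ''g'')(j := gi)" by (simp add: t'3 fa3 s2_def fa)
  show "scalar t' ''rem'' = scalar t ''rem'' - gi" by (simp add: t'3 fs3 s2_def fs gi s0_def)
  show "array t' ''D'' w = (if cov w j then min (array t ''D'' w + gi) k else array t ''D'' w)" if "w \<in> Wp" for w
  proof -
    have "w < n" using that subV V by auto
    thus ?thesis using H3 nD[OF that] n' by (simp add: t'3 fs3 fa3 s2_def)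
  qed
qed

lemma gctx_step: "gctx t ==> gctx (xsem gstep (set_scalar ''j'' j t))"
proof -
  assume g: "gctx t"
  have w: "''n'' \<notin> wrs gstep" "''N'' \<notin> wrs gstep" "''k'' \<notin> wrs gstep" "''adj'' \<notin> wra gstep" "''iW'' \<notin> wra gstep" "''rk'' \<notin> wra gstep" "''fw'' \<notin> wra gstep"
    by (simp_all add: gstep_def gap_def tab_def)
  have "base (set_scalar ''j'' j t)" using g by (simp add: gctx_def base_def)
  thus ?thesis using g base_xsem[OF _ w(1,4)] unfolding gctx_def by (simp add: scalar_xsem array_xsem w)
qed

lemma gap_loop:
  assumes g: "gctx s" and D: "!!w. w \<in> Wp ==> array s ''D'' w = A.fw w" and rm: "scalar s ''rem'' = 3 * k - A.N"
  defines "s' \<equiv> iter (%j s. xsem gstep (set_scalar ''j'' j s)) s n"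
  shows "gctx s'" "!!u w. [|u \<in> Wp; w \<in> Wp; E u w|] ==>
    (A.rk u + (\<Sum>j<A.rk u. array s' ''g'' j)) mod k ~= (A.rk w + (\<Sum>j<A.rk w. array s' ''g'' j)) mod k"
proof -
  define S where "S m = iter (%j s. xsem gstep (set_scalar ''j'' j s)) s m" for m
  have S0: "S 0 = s" and SS: "S (Suc m) = xsem gstep (set_scalar ''j'' m (S m))" for m by (simp_all add: S_def)
  have gS: "gctx (S m)" for m by (induction m) (use g gctx_step S0 SS in auto)
  thus "gctx s'" by (simp add: s'_def S_def)
  define G where "G i = min (scalar (S i) ''rem'') (k - 1 - gmx (S i) i)" for i
  have st: "array (S (Suc m)) ''g'' = (array (S m) ''g'')(m := G m)" "scalar (S (Suc m)) ''rem'' = scalar (S m) ''rem'' - G m"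
    "!!w. w \<in> Wp ==> array (S (Suc m)) ''D'' w = (if cov w m then min (array (S m) ''D'' w + G m) k else array (S m) ''D'' w)" if "m < A.N" for m
    unfolding SS G_def by (rule gstep_facts[OF gS that]; assumption?)+
  have Nn: "A.N <= n"
  proof -
    have "card Wp <= card {..<n}" by (rule card_mono) (use subV V in auto)
    thus ?thesis by (simp add: A.N_def)
  qed
  have gfin: "array (S m) ''g'' i = G i" if "i < m" "i < A.N" for m i
    using that
  proof (induction m)
    case (Suc m)
    show ?case
    proof (cases "m < A.N")
      case True
      thus ?thesis using Suc st(1)[OF True] by (auto simp: less_Suc_eq)
    next
      case False
      have "scalar (set_scalar ''j'' m (S m)) ''N'' = A.N" using gS[of m] by (simp add: gctx_def)
      hence "S (Suc m) = set_scalar ''j'' m (S m)" using False by (simp add: SS gstep_def)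
      thus ?thesis using Suc False by (auto simp: less_Suc_eq)
    qed
  qed simp
  have mxge: "array (S i) ''D'' w <= gmx (S i) i" if "w \<in> Wp" "cov w i" for w i
    unfolding gmx_def by (rule Max_ge) (use that subV V in "force+")
  have Dk: "w \<in> Wp ==> i <= A.N ==> array (S i) ''D'' w <= k" for i w
  proof (induction i)
    case 0
    thus ?case using k_facts(1)[of w] D[of w] by (simp add: S0)
  next
    case (Suc i)
    thus ?case using st(3)[of i w] by auto
  qed
  have *: "(A.rk u + (\<Sum>j<A.rk u. G j)) mod k ~= (A.rk w + (\<Sum>j<A.rk w. G j)) mod k" if uw: "u \<in> Wp" "w \<in> Wp" "E u w" for u w
  proof (rule A.color_positions[where cov = cov and D = "%i w. array (S i) ''D'' w" and rem = "%i. scalar (S i) ''rem''" and g = G and k = k])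
    fix i assume i: "i < A.N"
    have "gmx (S i) i \<in> insert 0 ((%w. if w \<in> Wp & cov w i then array (S i) ''D'' w else 0) ` {..<n})"
      unfolding gmx_def by (rule Max_in) auto
    then consider "gmx (S i) i = 0" | w where "w \<in> Wp" "cov w i" "array (S i) ''D'' w = gmx (S i) i" by (auto split: if_splits)
    hence "\<exists>w\<in>Wp. cov w i & array (S i) ''D'' w = gmx (S i) i"
    proof cases
      \<comment> \<open>The value 0 may be the inserted default; the window that starts at position
        \<open>i\<close> covers the gap behind \<open>i\<close> and attains it.\<close>
      case 1
      have "A.rk (A.sq i) = i" using A.rk_sq[of i] i by simp
      hence "cov (A.sq i) i" using A.r_gt[of i] by (simp add: cov_def A.r_def)
      thus ?thesis using mxge[OF A.sq_in] A.sq_in 1 by (metis le_zero_eq)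
    qed blast
    thus "\<exists>mx. (\<forall>w\<in>Wp. cov w i --> array (S i) ''D'' w <= mx) & (\<exists>w\<in>Wp. cov w i & array (S i) ''D'' w = mx) & G i = min (scalar (S i) ''rem'') (k - 1 - mx)"
      using mxge unfolding G_def by blast
    show "array (S (Suc i)) ''D'' w = array (S i) ''D'' w + (if cov w i then G i else 0)" if "w \<in> Wp" for w
    proof (cases "cov w i")
      case True
      have "array (S i) ''D'' w <= gmx (S i) i" "array (S i) ''D'' w <= k" using mxge[OF that True] Dk[OF that] i by auto
      hence "array (S i) ''D'' w + G i <= k" unfolding G_def by auto
      thus ?thesis using st(3)[OF i that] True by simp
    qed (use st(3)[OF i that] in simp)
    show "scalar (S (Suc i)) ''rem'' = scalar (S i) ''rem'' - G i" by (rule st(2)[OF i])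
  qed (use k_facts D rm uw S0 in "auto simp: cov_def")
  have eq: "(\<Sum>j<A.rk w. array s' ''g'' j) = (\<Sum>j<A.rk w. G j)" if "w \<in> Wp" for w
    by (rule sum.cong[OF refl]) (use gfin[of _ n] A.rk_lt[OF that] Nn in "auto simp: s'_def S_def")
  show "(A.rk u + (\<Sum>j<A.rk u. array s' ''g'' j)) mod k ~= (A.rk w + (\<Sum>j<A.rk w. array s' ''g'' j)) mod k" if "u \<in> Wp" "w \<in> Wp" "E u w" for u w
    using *[OF that] eq that by simp
qed

section \<open>Component labels and colour permutations\<close>

definition rel :: "(nat \<times> nat) set" where "rel = {(a, b). a \<in> Zp & b \<in> Zp & E a b}"

lemma rel_sym: "(x, y) \<in> rel\<^sup>* ==> (y, x) \<in> rel\<^sup>*"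
proof -
  have "sym rel" using E_sym by (auto simp: sym_def rel_def)
  thus "(x, y) \<in> rel\<^sup>* ==> (y, x) \<in> rel\<^sup>*" using sym_rtrancl symD by metis
qed

lemma rel_Zp: "(x, y) \<in> rel\<^sup>* ==> x \<in> Zp ==> y \<in> Zp"
  by (induction rule: rtrancl_induct) (auto simp: rel_def)

definition mn :: "nat => nat" where "mn x = (LEAST y. (x, y) \<in> rel\<^sup>*)"

lemma mn: "(x, mn x) \<in> rel\<^sup>*" "(x, y) \<in> rel\<^sup>* ==> mn x <= y" "(x, y) \<in> rel\<^sup>* ==> mn x = mn y"
proof -
  show a: "(x, mn x) \<in> rel\<^sup>*" for x unfolding mn_def by (rule LeastI[of _ x]) simp
  show b: "(x, y) \<in> rel\<^sup>* ==> mn x <= y" for x y unfolding mn_def by (rule Least_le)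
  show "(x, y) \<in> rel\<^sup>* ==> mn x = mn y" using a[of x] a[of y] b rel_sym by (meson antisym rtrancl_trans)
qed

lemma mn_conn: "conn {y\<in>Zp. mn y = r}"
  unfolding conn_def
proof (intro ballI)
  fix x y assume xy: "x \<in> {y\<in>Zp. mn y = r}" "y \<in> {y\<in>Zp. mn y = r}"
  let ?Y = "{y\<in>Zp. mn y = r}"
  have "(x, z) \<in> {(a, b). a \<in> ?Y & b \<in> ?Y & E a b}\<^sup>*" if "(x, z) \<in> rel\<^sup>*" for z
    using that
  proof (induction rule: rtrancl_induct)
    case (step z z')
    have xz: "(x, z') \<in> rel\<^sup>*" by (rule rtrancl_into_rtrancl[OF step(1,2)])
    have "mn z = r" "mn z' = r" using mn(3)[OF step(1)] mn(3)[OF xz] xy(1) by simp_all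
    hence "(z, z') \<in> {(a, b). a \<in> ?Y & b \<in> ?Y & E a b}" using step(2) by (simp add: rel_def)
    with step(3) show ?case by (rule rtrancl_into_rtrancl)
  qed simp
  moreover have "(x, y) \<in> rel\<^sup>*" using mn(1)[of x] mn(1)[of y] xy rel_sym by (metis (mono_tags, lifting) mem_Collect_eq rtrancl_trans)
  ultimately show "(x, y) \<in> {(a, b). a \<in> ?Y & b \<in> ?Y & E a b}\<^sup>*" by blast
qed

text \<open>Every label stems from the component of \<open>w\<close>, so it is at least
  \<open>mn w\<close>. By \<open>diameter\<close> the least vertex is at distance at most 5, and its
  number travels one edge per round.\<close>

lemma labels:
  fixes l :: "nat => nat => nat"
  assumes l0: "!!w. w < n ==> l 0 w = w"
    and lS: "!!i w. i < 5 ==> w < n ==> l (Suc i) w = n - Max (insert 0 ((%u. if u \<in> Zp & (u = w | E u w) then n - l i u else 0) ` {..<n}))"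
    and w: "w \<in> Zp"
  shows "l 5 w = mn w"
proof -
  have Zn: "x \<in> Zp ==> x < n" for x using subV V by auto
  have main: "(x, l i x) \<in> rel\<^sup>*" if "i <= 5" "x \<in> Zp" for i x
    using that
  proof (induction i arbitrary: x)
    case 0
    thus ?case using l0 Zn by simp
  next
    case (Suc i)
    define M where "M = Max (insert 0 ((%u. if u \<in> Zp & (u = x | E u x) then n - l i u else 0) ` {..<n}))"
    have "n - l i x <= M" unfolding M_def by (rule Max_ge) (use Suc.prems Zn in "force+")
    moreover have "l i x < n" using rel_Zp[OF Suc.IH Suc.prems(2)] Suc.prems Zn by simp
    moreover have "M \<in> insert 0 ((%u. if u \<in> Zp & (u = x | E u x) then n - l i u else 0) ` {..<n})" unfolding M_def by (rule Max_in) auto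
    ultimately obtain u where u: "u \<in> Zp" "u = x | E u x" "M = n - l i u" by (auto split: if_splits)
    have ui: "(u, l i u) \<in> rel\<^sup>*" using Suc u by simp
    hence "l i u < n" using rel_Zp u(1) Zn by blast
    hence "l (Suc i) x = l i u" using lS[of i x] Suc.prems Zn u(3) unfolding M_def by simp
    moreover have "(x, u) \<in> rel\<^sup>*" using u Suc.prems(2) E_sym by (auto simp: rel_def)
    ultimately show ?case using ui by simp
  qed
  have step: "l (Suc i) x <= l i u" if "i < 5" "x \<in> Zp" "u \<in> Zp" "u = x | E u x" for i x u
  proof -
    have "n - l i u <= Max (insert 0 ((%u. if u \<in> Zp & (u = x | E u x) then n - l i u else 0) ` {..<n}))"
      by (rule Max_ge) (use that Zn in "force+")
    thus ?thesis unfolding lS[OF that(1) Zn[OF that(2)]] by linarith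
  qed
  have "conn {y\<in>Zp. mn y = mn w}" by (rule mn_conn)
  moreover have "mn w \<in> {y\<in>Zp. mn y = mn w}" using mn(1,3) rel_Zp w by fastforce
  ultimately obtain m f where f: "m <= 5" "f 0 = mn w" "f m = w" "!!i. i < m ==> E (f i) (f (Suc i))" "!!i. i <= m ==> f i \<in> {y\<in>Zp. mn y = mn w}"
    by (rule diameter[where y = w]) (use w in auto)
  have "l i (f i) <= mn w" if "i <= m" for i
    using that
  proof (induction i)
    case 0
    thus ?case using f(2) f(5)[of 0] l0 Zn by auto
  next
    case (Suc i)
    have "l (Suc i) (f (Suc i)) <= l i (f i)" by (rule step) (use Suc.prems f in auto)
    thus ?case using Suc by simp
  qed
  from this[of m] have m: "l m w <= mn w" using f by simp
  have "l i w <= mn w" if "m <= i" "i <= 5" for i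
    using that
  proof (induction i)
    case (Suc i)
    show ?case
    proof (cases "m = Suc i")
      case False
      have "l (Suc i) w <= l i w" by (rule step) (use Suc.prems w in auto)
      thus ?thesis using Suc False by simp
    qed (use m in simp)
  qed (use m in simp)
  hence "l 5 w <= mn w" using f(1) by simp
  moreover have "mn w <= l 5 w" by (rule mn(2)) (use main[of 5] w in simp)
  ultimately show ?thesis by simp
qed

definition "C = c ` Up"

lemma UpP: "u \<in> Up ==> u \<in> P" and ZpP: "y \<in> Zp ==> y \<in> P" and WpP: "w \<in> Wp ==> w ~= v ==> w \<in> P"
  using VUWZ vW by (auto simp: V_def)

lemma c_less: "x \<in> P ==> c x < q" and c_neq: "x \<in> P ==> y \<in> P ==> E x y ==> c x ~= c y"
  using o by (auto simp: opt_def prp_def)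

lemma qQ: "q <= Q" and CQ: "finite C" "card C + k <= Q" "C \<subseteq> {..<Q}"
proof -
  show "q <= Q" by (simp add: Q_def)
  show "finite C" using finU by (simp add: C_def)
  have "card C <= card Up" unfolding C_def by (rule card_image_le[OF finU])
  thus "card C + k <= Q" by (simp add: Q_def)
  show "C \<subseteq> {..<Q}" using c_less UpP by (force simp: C_def Q_def)
qed

definition hctx :: "state => bool" where
  "hctx t <-> base t & vis t = V & array t ''c'' = c & (\<forall>w<n. array t ''iW'' w ~= 0 <-> w \<in> Wp) & (\<forall>w<n. array t ''iU'' w ~= 0 <-> w \<in> Up) &
     (\<forall>w<n. array t ''iZ'' w ~= 0 <-> w \<in> Zp)"

lemma hctxD: "hctx t ==> base t" "hctx t ==> vis t = V" "hctx t ==> array t ''c'' = c" "hctx t ==> w < n ==> array t ''iW'' w ~= 0 <-> w \<in> Wp"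
  "hctx t ==> w < n ==> array t ''iU'' w ~= 0 <-> w \<in> Up" "hctx t ==> w < n ==> array t ''iZ'' w ~= 0 <-> w \<in> Zp"
  unfolding hctx_def by blast+

lemma hctx_frame:
  "hctx t ==> nn t' = nn t ==> (!!a. a \<in> {''adj'', ''vis'', ''c'', ''iW'', ''iU'', ''iZ''} ==> array t' a = array t a) ==> hctx t'"
  unfolding hctx_def base_def vis_def by simp

lemma newW_facts:
  assumes t: "hctx s" "gctx s" "scalar s ''q'' = q"
    and g: "!!u w. [|u \<in> Wp; w \<in> Wp; E u w|] ==> (A.rk u + (\<Sum>j<A.rk u. array s ''g'' j)) mod k ~= (A.rk w + (\<Sum>j<A.rk w. array s ''g'' j)) mod k"
  defines "s' \<equiv> xsem (blk newW) s"
  shows "hctx s'" "scalar s' ''nq'' = Q" "!!w. w < n ==> array s' ''lb'' w = (if w \<in> Zp then mn w else n)"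
    "!!w. w \<in> Wp ==> array s' ''nw'' w < Q & array s' ''nw'' w \<notin> C"
    "!!u w. [|u \<in> Wp; w \<in> Wp; E u w|] ==> array s' ''nw'' u ~= array s' ''nw'' w"
proof -
  have I: "!!t. t \<in> set newW ==> holds s' t" unfolding s'_def by (rule ssa_holds[OF prog_ssa(9)])
  have fs: "scalar s' x = scalar s x" if "x \<in> {''n'', ''q'', ''k''}" for x
    unfolding s'_def by (rule scalar_blk) (use that in "auto simp: newW_def lbx_def")
  have fa: "array s' x = array s x" if "x \<in> {''adj'', ''vis'', ''c'', ''iW'', ''iU'', ''iZ'', ''rk'', ''g''}" for x
    unfolding s'_def by (rule array_blk) (use that in "auto simp: newW_def lbx_def")
  show h': "hctx s'" by (rule hctx_frame[OF t(1)]) (auto simp: fs fa)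
  note b' = hctxD(1)[OF h'] and b = hctxD(1)[OF t(1)]
  note adj = adjE[OF b'] adjE0[OF b'] adjE[OF b] adjE0[OF b] and n' = base_n[OF b']
  have gk: "scalar s ''k'' = k" "!!w. w \<in> Wp ==> array s ''rk'' w = A.rk w" using t(2) by (auto simp: gctx_def)
  have Wn: "w < n" if "w \<in> Wp" for w using that subV V by auto
  have Un: "w < n" if "w \<in> Up" for w using that subV V by auto
  have rkn: "A.rk w < n" if "w \<in> Wp" for w
  proof -
    have "card Wp <= card {..<n}" by (rule card_mono) (use subV V in auto)
    thus ?thesis using A.rk_lt[OF that] by (simp add: A.N_def)
  qed
  define G where "G w = A.rk w + (\<Sum>j<A.rk w. array s ''g'' j)" for w
  have ps: "array s' ''ps'' w = G w" if "w \<in> Wp" for w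
  proof -
    have if1: "(0 < (if B then Suc 0 else 0)) = B" for B by simp
    have "array s' ''ps'' w = A.rk w + (\<Sum>u<n. if u < A.rk w then array s ''g'' u else 0)"
      using I[of "IT ''ps'' ''w'' (rd ''rk'' ''w'' \<oplus> XSum ''u'' (XIf (XV ''u'' \<prec> rd ''rk'' ''w'') (rd ''g'' ''u'') (XC 0)))"] Wn[OF that] gk(2)[OF that]
      by (simp add: newW_def n' fa if1 cong: if_cong)
    also have "(\<Sum>u<n. if u < A.rk w then array s ''g'' u else 0) = (\<Sum>u<A.rk w. array s ''g'' u)"
      by (rule sum.mono_neutral_cong_right) (use rkn[OF that] in auto)
    finally show ?thesis by (simp add: G_def)
  qed
  have nu: "scalar s' ''nu'' = card Up"
  proof -
    have "scalar s' ''nu'' = card {u. u < n & array s ''iU'' u ~= 0}" using I[of "IA ''nu'' (xcnt ''u'' (rd ''iU'' ''u''))"] by (simp add: newW_def n' fa)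
    also have "{u. u < n & array s ''iU'' u ~= 0} = Up" using hctxD(5)[OF t(1)] Un by auto
    finally show ?thesis .
  qed
  show "scalar s' ''nq'' = Q"
    using I[of "IA ''nq'' (XO OMin (XV ''n'') (XIf (XV ''q'' \<prec> XV ''nu'' \<oplus> XV ''k'') (XV ''nu'' \<oplus> XV ''k'') (XV ''q'')))"] nu gk(1) t(3) Q_le
    by (auto simp: newW_def n' fs Q_def min_def max_def split: if_splits)
  have uu: "array s' ''uu'' x = 0 <-> x \<notin> C" if "x < n" for x
  proof -
    have "array s' ''uu'' x ~= 0 <-> (\<exists>u<n. array s ''iU'' u ~= 0 & c u = x)"
      using I[of "IT ''uu'' ''x'' (xex ''u'' (rd ''iU'' ''u'' \<and>\<and> rd ''c'' ''u'' \<doteq> XV ''x''))"] that hctxD(3)[OF t(1)] by (simp add: newW_def n' fa)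
    thus ?thesis using hctxD(5)[OF t(1)] Un unfolding C_def by blast
  qed
  define R where "R x = card {y. y < x & y \<notin> C}" for x :: nat
  have ur: "array s' ''ur'' x = R x" if "x < n" for x
  proof -
    have "array s' ''ur'' x = card {y. y < n & y < x & array s' ''uu'' y = 0}"
      using I[of "IT ''ur'' ''x'' (xcnt ''y'' (XV ''y'' \<prec> XV ''x'' \<and>\<and> xnot (rd ''uu'' ''y'')))"] that by (simp add: newW_def n')
    also have "{y. y < n & y < x & array s' ''uu'' y = 0} = {y. y < x & y \<notin> C}" using that uu by auto
    finally show ?thesis by (simp add: R_def)
  qed
  define T where "T w x <-> x \<notin> C & R x = G w mod k" for w x
  have nw: "array s' ''nw'' w = first n (T w)" if "w \<in> Wp" for w
  proof -
    have "array s' ''nw'' w = first n (%x. array s' ''uu'' x = 0 & array s' ''ur'' x = array s' ''ps'' w mod k)"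
      using I[of "IT ''nw'' ''w'' (xfst ''x'' (xnot (rd ''uu'' ''x'') \<and>\<and> rd ''ur'' ''x'' \<doteq> XO OMod (rd ''ps'' ''w'') (XV ''k'')))"] Wn[OF that] gk(1)
      by (simp add: newW_def n' xval_xfst fs)
    also have "\<dots> = first n (T w)" by (rule first_cong[OF refl]) (use uu ur ps[OF that] in "auto simp: T_def")
    finally show ?thesis .
  qed
  have nwT: "first n (T w) < Q & T w (first n (T w))" for w
  proof -
    obtain x where x: "x < Q" "T w x"
      using card_UNIV_rank[OF CQ(1,2), of "G w mod k"] k_facts(4) unfolding T_def R_def by auto
    hence "x < n" using Q_le by simp
    from first_some[OF this, of "T w", OF x(2)] show ?thesis using x(1) by simp
  qed
  show "array s' ''nw'' w < Q & array s' ''nw'' w \<notin> C" if "w \<in> Wp" for w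
    using nwT[of w] unfolding nw[OF that] by (auto simp: T_def)
  show "array s' ''nw'' u ~= array s' ''nw'' w" if "u \<in> Wp" "w \<in> Wp" "E u w" for u w
  proof
    assume e: "array s' ''nw'' u = array s' ''nw'' w"
    have "G u mod k = R (array s' ''nw'' u)" using nwT[of u] unfolding nw[OF that(1)] T_def by simp
    moreover have "G w mod k = R (array s' ''nw'' w)" using nwT[of w] unfolding nw[OF that(2)] T_def by simp
    ultimately show False using g[OF that] e unfolding G_def by simp
  qed
  define l where "l i = array s' (if i = 0 then ''l0'' else if i = 1 then ''l1'' else if i = 2 then ''l2'' else if i = 3 then ''l3'' else if i = 4 then ''l4'' else ''l5'')" for i :: nat
  have lbx: "array s' L' w = n - Max (insert 0 ((%u. if u \<in> Zp & (u = w | E u w) then n - array s' L u else 0) ` {..<n}))"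
    if m: "lbx L L' \<in> set newW" and w: "w < n" for L L' w
  proof -
    let ?e = "XIf (rd ''iZ'' ''u'' \<and>\<and> (XV ''u'' \<doteq> XV ''w'' \<or>\<or> ax ''u'' ''w'')) (XV ''n'' \<ominus> rd L ''u'') (XC 0)"
    have "array s' L' w = n - xval (XMax ''u'' ?e) (set_scalar ''w'' w s')"
      using I[OF m] w by (simp add: lbx_def n' del: xval.simps(7))
    also have "xval (XMax ''u'' ?e) (set_scalar ''w'' w s') = Max (insert 0 ((%u. xval ?e (set_scalar ''u'' u (set_scalar ''w'' w s'))) ` {..<n}))"
      by (simp only: xval.simps(7)) (simp add: n')
    also have "(%u. xval ?e (set_scalar ''u'' u (set_scalar ''w'' w s'))) ` {..<n} = (%u. if u \<in> Zp & (u = w | E u w) then n - array s' L u else 0) ` {..<n}"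
      by (rule image_cong[OF refl]) (use hctxD(6)[OF h'] w in "auto simp: n' xadj_def adj fa")
    finally show ?thesis .
  qed
  have l5: "array s' ''l5'' w = mn w" if "w \<in> Zp" for w
  proof -
    have "l 5 w = mn w"
    proof (rule labels[OF _ _ that])
      show "l 0 w = w" if "w < n" for w using I[of "IT ''l0'' ''w'' (XV ''w'')"] that by (simp add: newW_def l_def n')
      show "l (Suc i) w = n - Max (insert 0 ((%u. if u \<in> Zp & (u = w | E u w) then n - l i u else 0) ` {..<n}))" if i: "i < 5" and w: "w < n" for i w
      proof -
        have "i = 0 | i = 1 | i = 2 | i = 3 | i = 4" using i by linarith
        moreover have m: "lbx ''l0'' ''l1'' \<in> set newW" "lbx ''l1'' ''l2'' \<in> set newW" "lbx ''l2'' ''l3'' \<in> set newW" "lbx ''l3'' ''l4'' \<in> set newW" "lbx ''l4'' ''l5'' \<in> set newW"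
          by (simp_all add: newW_def)
        ultimately show ?thesis using lbx[OF m(1) w] lbx[OF m(2) w] lbx[OF m(3) w] lbx[OF m(4) w] lbx[OF m(5) w]
          by (elim disjE) (simp_all only: l_def, simp_all)
      qed
    qed
    thus ?thesis by (simp add: l_def)
  qed
  show "array s' ''lb'' w = (if w \<in> Zp then mn w else n)" if "w < n" for w
  proof -
    have "array s' ''lb'' w = (if array s' ''iZ'' w ~= 0 then array s' ''l5'' w else n)"
      using I[of "IT ''lb'' ''w'' (XIf (rd ''iZ'' ''w'') (rd ''l5'' ''w'') (XV ''n''))"] that by (simp add: newW_def n')
    thus ?thesis using l5 hctxD(6)[OF h' that] by simp
  qed
qed

definition okp :: "(nat => nat) => nat => (nat => nat) => bool" where
  "okp nw r p <-> inj p & (\<forall>x\<in>C. p x = x) & (\<forall>x<Q. p x < Q) & (\<forall>w\<in>Wp. \<forall>y\<in>Zp. mn y = r --> E w y --> p (c w) = nw w)"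

definition "At r = {w\<in>Wp. \<exists>y\<in>Zp. mn y = r & E w y}"

text \<open>Attached vertices have odd class by \<open>hang_odd\<close>, whereas the hole vertex
  \<open>v\<close> has even class. So \<open>v\<close>, which has no old colour, is not attached.
  The attached vertices form a clique by \<open>hang_clique\<close> and thus have different old
  colours.\<close>

lemma At_facts:
  assumes "w \<in> At r"
  shows "w \<in> P" "c w < Q" "c w \<notin> C" "!!w'. w' \<in> At r ==> w' ~= w ==> E w w' & c w' ~= c w"
proof -
  obtain y where y: "w \<in> Wp" "y \<in> Zp" "mn y = r" "E w y" using assms by (auto simp: At_def)
  have wv: "w' ~= v" if wA: "w' \<in> At r" for w'
  proof
    assume "w' = v"
    moreover obtain y where y: "w' \<in> Wp" "y \<in> Zp" "E w' y" using wA by (auto simp: At_def)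
    ultimately have "odd (cls h v)" using hang_odd[OF H(1), of w' y] E_sym[OF y(3)] by (simp add: Wp_def Zp_def)
    thus False using cls_hole(2)[OF H(1), of 0] H(2) by simp
  qed
  show wP: "w \<in> P" using WpP[OF y(1) wv[OF assms]] .
  thus "c w < Q" using c_less qQ by (meson order_less_le_trans)
  show "c w \<notin> C"
  proof
    assume "c w \<in> C"
    then obtain u where u: "u \<in> Up" "c w = c u" by (auto simp: C_def)
    have "E u w" by (rule U_complete[OF H(1)]) (use u y VUWZ(2) in "auto simp: Up_def Wp_def")
    thus False using c_neq[OF UpP[OF u(1)] wP] u(2) by simp
  qed
  fix w' assume w': "w' \<in> At r" "w' ~= w"
  obtain y' where y': "w' \<in> Wp" "y' \<in> Zp" "mn y' = r" "E w' y'" using w' by (auto simp: At_def)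
  have "E w w'"
    by (rule hang_clique[OF H(1) mn_conn[of r], where y = y and y' = y']) (use y y' w' in "auto simp: Zp_def Wp_def")
  thus "E w w' & c w' ~= c w" using c_neq[OF wP WpP[OF y'(1) wv[OF w'(1)]]] by auto
qed

text \<open>The permutation moves only colours outside \<open>C\<close>, so the colours of
  \<open>U\<close> stay fixed without further care.\<close>

definition pinv :: "nat => (nat => nat) => nat => state => bool" where
  "pinv r nw j t <-> hctx t & array t ''nw'' = nw & scalar t ''r'' = r & (\<forall>w<n. array t ''RR'' w ~= 0 <-> (\<exists>y\<in>Zp. mn y = r & E w y)) &
     (\<forall>w<n. array t ''lb'' w = (if w \<in> Zp then mn w else n)) &
     (\<exists>p. p permutes ({..<Q} - C) & (\<forall>x<n. array t ''pi'' x = p x & array t ''pj'' x = inv p x) & (\<forall>w\<in>At r. w < j --> p (c w) = nw w))"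

text \<open>A transposition changes the permutation at two arguments, \<open>x\<close> and
  \<open>y'\<close>. Neither is the old colour of an attached vertex treated before, since attached
  vertices are pairwise adjacent and so differ in both their old and their new colours.\<close>

lemma transp_step:
  assumes i: "pinv r nw j t" and j: "j < n" and nw: "!!w. w \<in> Wp ==> nw w < Q & nw w \<notin> C" "!!u w. [|u \<in> Wp; w \<in> Wp; E u w|] ==> nw u ~= nw w"
  shows "pinv r nw (Suc j) (xsem (XIfC (rd ''iW'' ''w'' \<and>\<and> rd ''RR'' ''w'') transp XSkip) (set_scalar ''w'' j t))"
proof -
  have h: "hctx t" "array t ''nw'' = nw" "scalar t ''r'' = r" "!!w. w < n ==> array t ''RR'' w ~= 0 <-> (\<exists>y\<in>Zp. mn y = r & E w y)"
    "!!w. w < n ==> array t ''lb'' w = (if w \<in> Zp then mn w else n)" using i unfolding pinv_def by blast+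
  obtain p where p: "p permutes ({..<Q} - C)" "!!x. x < n ==> array t ''pi'' x = p x & array t ''pj'' x = inv p x" "!!w. w \<in> At r ==> w < j ==> p (c w) = nw w"
    using i unfolding pinv_def by blast
  let ?u = "set_scalar ''w'' j t"
  have jA: "array t ''iW'' j ~= 0 & array t ''RR'' j ~= 0 <-> j \<in> At r" using hctxD(4)[OF h(1) j] h(4)[OF j] by (auto simp: At_def)
  show ?thesis
  proof (cases "j \<in> At r")
    case False
    hence "xsem (XIfC (rd ''iW'' ''w'' \<and>\<and> rd ''RR'' ''w'') transp XSkip) ?u = ?u" using jA by auto
    moreover have "pinv r nw (Suc j) ?u"
      unfolding pinv_def
    proof (intro conjI exI[of _ p] ballI impI allI)
      show "hctx ?u" by (rule hctx_frame[OF h(1)]) auto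
      show "p (c w) = nw w" if "w \<in> At r" "w < Suc j" for w using p(3)[OF that(1)] that False by (cases "w = j") auto
    qed (use h p in auto)
    ultimately show ?thesis by simp
  next
    case True
    note a = At_facts[OF True]
    define x where "x = c j"
    define y where "y = nw j"
    define x' where "x' = p x"
    define y' where "y' = inv p y"
    let ?S = "{..<Q} - C"
    have jW: "j \<in> Wp" using True by (simp add: At_def)
    have S: "x \<in> ?S" "y \<in> ?S" using a(2,3) nw(1)[OF jW] by (auto simp: x_def y_def)
    have S': "x' \<in> ?S" "y' \<in> ?S" using permutes_in_image[OF p(1)] permutes_in_image[OF permutes_inv[OF p(1)]] S by (simp_all add: x'_def y'_def)
    have lt: "x < n" "y < n" "x' < n" "y' < n" using S S' Q_le by auto
    have xx: "inv p x' = x" "p y' = y" unfolding x'_def y'_def using p(1) by (simp_all add: permutes_inverses)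
    define p' where "p' = transpose x' y \<circ> p"
    have pp: "p' permutes ?S" unfolding p'_def by (rule permutes_compose[OF p(1) permutes_swap_id]) (use S S' in auto)
    have inj: "p a = p b <-> a = b" for a b using permutes_inj[OF p(1)] by (auto dest: injD)
    have p'v: "p' z = (if z = y' then x' else if z = x then y else p z)" for z
    proof -
      have "p z = y <-> z = y'" using inj[of z y'] xx by simp
      moreover have "p z = x' <-> z = x" using inj[of z x] by (simp add: x'_def)
      ultimately show ?thesis by (auto simp: p'_def transpose_def)
    qed
    have ip': "inv p' z = (if z = x' then y' else if z = y then x else inv p z)" for z
    proof -
      have e: "p' (if z = x' then y' else if z = y then x else inv p z) = z"
      proof -
        have "p (inv p z) = z" using p(1) by (simp add: permutes_inverses)
        moreover from this have "inv p z = y' <-> z = y" "inv p z = x <-> z = x'"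
          using inj[of "inv p z" y'] inj[of "inv p z" x] xx by (simp_all add: x'_def)
        moreover have "x = y' <-> x' = y" using inj[of x y'] xx by (simp add: x'_def)
        ultimately show ?thesis by (auto simp: p'v)
      qed
      show ?thesis by (rule permutes_inverses(2)[OF pp, of "if z = x' then y' else if z = y then x else inv p z", unfolded e])
    qed
    define u where "u = xsem (XIfC (rd ''iW'' ''w'' \<and>\<and> rd ''RR'' ''w'') transp XSkip) ?u"
    have ux: "u = xsem transp ?u" using True jA by (simp add: u_def)
    have pi: "array u ''pi'' = (array t ''pi'')(x := y, y' := x')" "array u ''pj'' = (array t ''pj'')(y := x, x' := y')"
      unfolding ux using p(2)[OF lt(1)] p(2)[OF lt(2)]
      by (simp_all add: transp_def h(2) hctxD(3)[OF h(1)] x_def[symmetric] y_def[symmetric] x'_def[symmetric] y'_def[symmetric])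
    have fa: "array u a = array t a" if "a \<notin> {''pi'', ''pj''}" for a
      unfolding ux using that by (subst array_xsem) (auto simp: transp_def)
    have fs: "scalar u a = scalar t a" if "a \<in> {''n'', ''r''}" for a
      unfolding ux using that by (subst scalar_xsem) (auto simp: transp_def)
    have "pinv r nw (Suc j) u"
      unfolding pinv_def
    proof (intro conjI exI[of _ p'] ballI impI allI)
      show "hctx u" by (rule hctx_frame[OF h(1)]) (auto simp: fs fa)
      show "p' permutes ?S" by (rule pp)
      show "array u ''pi'' z = p' z" "array u ''pj'' z = inv p' z" if "z < n" for z
        using p(2)[OF that] by (auto simp: pi p'v ip')
      show "p' (c w) = nw w" if w: "w \<in> At r" "w < Suc j" for w
      proof (cases "w = j")
        case True
        thus ?thesis using xx by (auto simp: p'v x_def[symmetric] y_def[symmetric] x'_def)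
      next
        case False
        hence "w < j" using w by simp
        hence pc: "p (c w) = nw w" using p(3) w by blast
        have "c w ~= x" "E j w" using a(4)[OF w(1) False] by (auto simp: x_def)
        moreover have "nw w ~= y" using nw(2)[OF jW _ \<open>E j w\<close>] w(1) by (auto simp: At_def y_def)
        hence "c w ~= y'" using pc xx by auto
        ultimately show ?thesis using pc by (simp add: p'v)
      qed
    qed (use h in "auto simp: fs fa")
    thus ?thesis by (simp only: u_def)
  qed
qed

lemma hang_facts:
  assumes h: "hctx t" and lb: "!!w. w < n ==> array t ''lb'' w = (if w \<in> Zp then mn w else n)" and r: "r < n"
    and nw: "!!w. w \<in> Wp ==> array t ''nw'' w < Q & array t ''nw'' w \<notin> C" "!!u w. [|u \<in> Wp; w \<in> Wp; E u w|] ==> array t ''nw'' u ~= array t ''nw'' w"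
  defines "t' \<equiv> xsem hang (set_scalar ''r'' r t)"
  shows "hctx t'" "array t' ''lb'' = array t ''lb''" "scalar t' ''nq'' = scalar t ''nq''"
    "\<exists>p. okp (array t ''nw'') r p & (\<forall>y. array t' ''nw'' y = (if y \<in> Zp & mn y = r then p (c y) else array t ''nw'' y))"
proof -
  let ?nw = "array t ''nw''"
  define t0 where "t0 = set_scalar ''r'' r t"
  define t1 where "t1 = xsem (blk comp0) t0"
  have I: "!!i. i \<in> set comp0 ==> holds t1 i" unfolding t1_def by (rule ssa_holds[OF prog_ssa(10)])
  have fs: "scalar t1 x = scalar t0 x" if "x \<in> {''n'', ''r''}" for x
    unfolding t1_def by (rule scalar_blk) (use that in "auto simp: comp0_def")
  have fa: "array t1 x = array t x" if "x \<notin> {''RR'', ''pi'', ''pj''}" for x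
  proof -
    have "array t1 x = array t0 x" unfolding t1_def by (rule array_blk) (use that in "auto simp: comp0_def")
    thus ?thesis by (simp add: t0_def)
  qed
  have h1: "hctx t1" by (rule hctx_frame[OF h]) (auto simp: fs fa t0_def)
  note b1 = hctxD(1)[OF h1]
  note n' = base_n[OF b1]
  have Zn: "y \<in> Zp ==> y < n" for y using subV V by auto
  have RR: "array t1 ''RR'' w ~= 0 <-> (\<exists>y\<in>Zp. mn y = r & E w y)" if "w < n" for w
  proof -
    have "array t1 ''RR'' w ~= 0 <-> (\<exists>z<n. (array t ''lb'' z = r & array t ''iZ'' z ~= 0) & array t ''adj'' (z * n + w) ~= 0)"
      using I[of "IS ''RR'' (guard ''lb'' ''r'' ''z'' (rd ''iZ'' ''z''))"] that by (auto simp: comp0_def guard_def n' fa fs t0_def)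
    moreover have "array t ''adj'' (z * n + w) ~= 0 <-> E w z" if "z < n" for z
      using hctxD(1)[OF h] that \<open>w < n\<close> E_comm unfolding base_def by blast
    moreover have "(array t ''lb'' z = r & array t ''iZ'' z ~= 0) <-> z \<in> Zp & mn z = r" if "z < n" for z
      using lb[OF that] hctxD(6)[OF h that] by auto
    ultimately show ?thesis using Zn by blast
  qed
  have pi1: "array t1 ''pi'' x = x" "array t1 ''pj'' x = x" if "x < n" for x
    using I[of "IT ''pi'' ''x'' (XV ''x'')"] I[of "IT ''pj'' ''x'' (XV ''x'')"] that by (simp_all add: comp0_def n')
  have k0: "pinv r ?nw 0 t1"
    unfolding pinv_def
  proof (intro conjI exI[of _ id])
    show "id permutes ({..<Q} - C)" by (rule permutes_id)
  qed (use h1 RR lb pi1 in "auto simp: fa fs t0_def")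
  define t2 where "t2 = set_scalar ''w'' 0 (iter (%j s. xsem (XIfC (rd ''iW'' ''w'' \<and>\<and> rd ''RR'' ''w'') transp XSkip) (set_scalar ''w'' j s)) t1 n)"
  have "pinv r ?nw n (iter (%j s. xsem (XIfC (rd ''iW'' ''w'' \<and>\<and> rd ''RR'' ''w'') transp XSkip) (set_scalar ''w'' j s)) t1 n)"
    by (rule For_inv[of "pinv r ?nw", OF k0]) (rule transp_step[OF _ _ nw])
  then obtain p where p: "p permutes ({..<Q} - C)" "!!x. x < n ==> array t2 ''pi'' x = p x" "!!w. w \<in> At r ==> w < n ==> p (c w) = ?nw w"
    and h2: "hctx t2" "array t2 ''nw'' = ?nw" "scalar t2 ''r'' = r" "!!w. w < n ==> array t2 ''lb'' w = (if w \<in> Zp then mn w else n)"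
    unfolding pinv_def t2_def hctx_def base_def vis_def by auto
  have x2: "xsem (XFor ''w'' (XIfC (rd ''iW'' ''w'' \<and>\<and> rd ''RR'' ''w'') transp XSkip)) t1 = t2"
    unfolding t2_def xsem.simps(6) n' ..
  define t3 where "t3 m = iter (%j s. xsem (XIfC (rd ''lb'' ''y'' \<doteq> XV ''r'' \<and>\<and> rd ''iZ'' ''y'') (XPut ''nw'' (XV ''y'') (XR ''pi'' (rd ''c'' ''y''))) XSkip) (set_scalar ''y'' j s)) t2 m" for m
  have f3: "a ~= ''nw'' ==> array (t3 m) a = array t2 a" "x ~= ''y'' ==> scalar (t3 m) x = scalar t2 x" for a x m
  proof -
    show "array (t3 m) a = array t2 a" if "a ~= ''nw''" using that by (induction m) (simp_all add: t3_def)
    show "scalar (t3 m) x = scalar t2 x" if "x ~= ''y''" using that by (induction m) (simp_all add: t3_def)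
  qed
  have nw3: "array (t3 m) ''nw'' y = (if y < m & y \<in> Zp & mn y = r then p (c y) else ?nw y)" if "m <= n" for m y
    using that
  proof (induction m)
    case 0
    thus ?case by (simp add: t3_def h2)
  next
    case (Suc m)
    let ?u = "set_scalar ''y'' m (t3 m)"
    have mn': "m < n" using Suc by simp
    have g: "array t2 ''lb'' m = r & array t2 ''iZ'' m ~= 0 <-> m \<in> Zp & mn m = r"
      using h2(4)[OF mn'] hctxD(6)[OF h2(1) mn'] by auto
    have t3S: "t3 (Suc m) = xsem (XIfC (rd ''lb'' ''y'' \<doteq> XV ''r'' \<and>\<and> rd ''iZ'' ''y'') (XPut ''nw'' (XV ''y'') (XR ''pi'' (rd ''c'' ''y''))) XSkip) ?u"
      unfolding t3_def by (rule iter.simps(2))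
    have "t3 (Suc m) = (if array t2 ''lb'' m = r & array t2 ''iZ'' m ~= 0 then set_array ''nw'' m (array t2 ''pi'' (array t2 ''c'' m)) ?u else ?u)"
      unfolding t3S using h2(3) f3 by simp
    hence st: "array (t3 (Suc m)) ''nw'' = (if m \<in> Zp & mn m = r then (array (t3 m) ''nw'')(m := array t2 ''pi'' (c m)) else array (t3 m) ''nw'')"
      unfolding g using hctxD(3)[OF h2(1)] by simp
    have pc: "array t2 ''pi'' (c m) = p (c m)" if "m \<in> Zp"
    proof (rule p(2))
      show "c m < n" using c_less[OF ZpP[OF that]] qQ Q_le by simp
    qed
    show ?case using Suc st pc by (auto simp: less_Suc_eq)
  qed
  have t'3: "t' = set_scalar ''y'' 0 (t3 n)"
  proof -
    have "t' = xsem (XFor ''y'' (XIfC (rd ''lb'' ''y'' \<doteq> XV ''r'' \<and>\<and> rd ''iZ'' ''y'') (XPut ''nw'' (XV ''y'') (XR ''pi'' (rd ''c'' ''y''))) XSkip)) t2"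
      unfolding t'_def t0_def[symmetric] hang_def xsem.simps(4) t1_def[symmetric] x2 ..
    thus ?thesis unfolding xsem.simps(6) t3_def using base_n[OF hctxD(1)[OF h2(1)]] by simp
  qed
  show "hctx t'" by (rule hctx_frame[OF h2(1)]) (auto simp: t'3 f3)
  show "array t' ''lb'' = array t ''lb''" unfolding t'_def by (subst array_xsem) (simp_all add: hang_def comp0_def transp_def tab_def scat_def)
  show "scalar t' ''nq'' = scalar t ''nq''" unfolding t'_def by (subst scalar_xsem) (simp_all add: hang_def comp0_def transp_def tab_def scat_def)
  have "okp ?nw r p"
    unfolding okp_def
  proof (intro conjI ballI allI impI)
    show "inj p" by (rule permutes_inj[OF p(1)])
    show "p x = x" if "x \<in> C" for x using permutes_not_in[OF p(1)] that by simp
    show "p x < Q" if "x < Q" for x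
    proof (cases "x \<in> C")
      case True
      thus ?thesis using permutes_not_in[OF p(1), of x] that by simp
    next
      case False
      hence "x \<in> {..<Q} - C" using that by simp
      hence "p x \<in> {..<Q} - C" using permutes_in_image[OF p(1)] by blast
      thus ?thesis by simp
    qed
    fix w y assume wy: "w \<in> Wp" "y \<in> Zp" "mn y = r" "E w y"
    hence "w \<in> At r" by (auto simp: At_def)
    moreover have "w < n" using wy(1) subV V by auto
    ultimately show "p (c w) = ?nw w" by (rule p(3))
  qed
  moreover have "array t' ''nw'' y = (if y \<in> Zp & mn y = r then p (c y) else ?nw y)" for y
    using nw3[of n y] Zn by (auto simp: t'3)
  ultimately show "\<exists>p. okp ?nw r p & (\<forall>y. array t' ''nw'' y = (if y \<in> Zp & mn y = r then p (c y) else ?nw y))" by blast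
qed

lemma okp_cong: "(!!w. w \<in> Wp ==> nw w = nw' w) ==> okp nw r p = okp nw' r p"
  unfolding okp_def by simp

lemma recol_facts:
  assumes b: "base s" and vs: "vis s = V" and hs: "array s ''h'' = h" and cs: "array s ''c'' = c" and qs: "scalar s ''q'' = q"
  defines "s' \<equiv> xsem recol s"
  shows "base s'" "vis s' = V" "opt V (array s' ''c'') (scalar s' ''q'')"
proof -
  define s1 where "s1 = xsem (blk arcblk) s"
  note a = arcs_facts[OF b vs hs, folded s1_def]
  have h1: "hctx s1" using a(1,4,5,6) vs cs unfolding hctx_def vis_def by (simp add: a(3))
  have g1: "gctx s1" unfolding gctx_def by (intro conjI allI impI ballI a)
  define s2 where "s2 = xsem (XFor ''j'' gstep) s1"
  have s2: "s2 = set_scalar ''j'' 0 (iter (%j s. xsem gstep (set_scalar ''j'' j s)) s1 n)"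
    unfolding s2_def xsem.simps(6) base_n[OF a(1)] ..
  have gl: "gctx (iter (%j s. xsem gstep (set_scalar ''j'' j s)) s1 n)" "!!u w. [|u \<in> Wp; w \<in> Wp; E u w|] ==>
      (A.rk u + (\<Sum>j<A.rk u. array (iter (%j s. xsem gstep (set_scalar ''j'' j s)) s1 n) ''g'' j)) mod k ~=
      (A.rk w + (\<Sum>j<A.rk w. array (iter (%j s. xsem gstep (set_scalar ''j'' j s)) s1 n) ''g'' j)) mod k"
    by (rule gap_loop[OF g1]; (rule a)?; assumption?)+
  have g2: "gctx s2" using gl(1) unfolding s2 by (simp add: gctx_def base_def)
  have fa2: "array s2 x = array s1 x" if "x \<in> {''adj'', ''vis'', ''c'', ''iW'', ''iU'', ''iZ''}" for x
    unfolding s2_def by (rule array_xsem) (use that in "auto simp: gstep_def gap_def tab_def")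
  have fs2: "scalar s2 x = scalar s1 x" if "x \<in> {''n'', ''q''}" for x
    unfolding s2_def by (rule scalar_xsem) (use that in "auto simp: gstep_def gap_def tab_def")
  have h2: "hctx s2" by (rule hctx_frame[OF h1]) (auto simp: fa2 fs2)
  have q2: "scalar s2 ''q'' = q" by (simp add: fs2 a(2) qs)
  define s3 where "s3 = xsem (blk newW) s2"
  define nw0 where "nw0 = array s3 ''nw''"
  have gg: "(A.rk u + (\<Sum>j<A.rk u. array s2 ''g'' j)) mod k ~= (A.rk w + (\<Sum>j<A.rk w. array s2 ''g'' j)) mod k" if "u \<in> Wp" "w \<in> Wp" "E u w" for u w
    using gl(2)[OF that] by (simp add: s2)
  have w: "hctx s3" "scalar s3 ''nq'' = Q" "!!w. w < n ==> array s3 ''lb'' w = (if w \<in> Zp then mn w else n)"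
    "!!w. w \<in> Wp ==> nw0 w < Q & nw0 w \<notin> C" "!!u w. [|u \<in> Wp; w \<in> Wp; E u w|] ==> nw0 u ~= nw0 w"
    unfolding nw0_def s3_def by (rule newW_facts[OF h2 g2 q2 gg]; assumption)+
  \<comment> \<open>Outside \<open>Z\<close> the array \<open>nw\<close> never changes, so later
    components are still matched to the same colours \<open>nw0\<close> of \<open>W\<close>.\<close>
  define I where "I j t <-> hctx t & array t ''lb'' = array s3 ''lb'' & scalar t ''nq'' = Q & (\<forall>x. x \<notin> Zp --> array t ''nw'' x = nw0 x) &
      (\<forall>r<j. \<exists>p. okp nw0 r p & (\<forall>y\<in>Zp. mn y = r --> array t ''nw'' y = p (c y)))" for j :: nat and t
  define s4 where "s4 = iter (%j s. xsem hang (set_scalar ''r'' j s)) s3 n"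
  have I4: "I n s4" unfolding s4_def
  proof (rule For_inv[of I])
    show "I 0 s3" unfolding I_def using w(1,2) by (simp add: nw0_def)
    fix j t assume j: "j < n" and i: "I j t"
    have t: "hctx t" "array t ''lb'' = array s3 ''lb''" "scalar t ''nq'' = Q" "!!x. x \<notin> Zp ==> array t ''nw'' x = nw0 x"
      "!!r. r < j ==> \<exists>p. okp nw0 r p & (\<forall>y\<in>Zp. mn y = r --> array t ''nw'' y = p (c y))" using i unfolding I_def by blast+
    have nW: "array t ''nw'' x = nw0 x" if "x \<in> Wp" for x by (rule t(4)) (use that VUWZ(4) in blast)
    have lb: "array t ''lb'' x = (if x \<in> Zp then mn x else n)" if "x < n" for x using w(3)[OF that] t(2) by simp
    have n1: "array t ''nw'' x < Q & array t ''nw'' x \<notin> C" if "x \<in> Wp" for x using w(4)[OF that] nW[OF that] by simp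
    have n2: "array t ''nw'' x ~= array t ''nw'' y" if "x \<in> Wp" "y \<in> Wp" "E x y" for x y using w(5)[OF that] nW that by simp
    have hf: "hctx (xsem hang (set_scalar ''r'' j t))" "array (xsem hang (set_scalar ''r'' j t)) ''lb'' = array t ''lb''"
      "scalar (xsem hang (set_scalar ''r'' j t)) ''nq'' = scalar t ''nq''"
      "\<exists>p. okp (array t ''nw'') j p & (\<forall>y. array (xsem hang (set_scalar ''r'' j t)) ''nw'' y = (if y \<in> Zp & mn y = j then p (c y) else array t ''nw'' y))"
      by (rule hang_facts[OF t(1) lb j n1 n2]; assumption)+
    obtain p where p: "okp (array t ''nw'') j p"
      "!!y. array (xsem hang (set_scalar ''r'' j t)) ''nw'' y = (if y \<in> Zp & mn y = j then p (c y) else array t ''nw'' y)"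
      using hf(4) by blast
    have okj: "okp nw0 j p" using p(1) okp_cong[of "array t ''nw''" nw0 j p] nW by blast
    show "I (Suc j) (xsem hang (set_scalar ''r'' j t))"
      unfolding I_def
    proof (intro conjI allI impI)
      fix r assume "r < Suc j"
      then consider "r = j" | "r < j" by linarith
      thus "\<exists>p. okp nw0 r p & (\<forall>y\<in>Zp. mn y = r --> array (xsem hang (set_scalar ''r'' j t)) ''nw'' y = p (c y))"
      proof cases
        case 1
        thus ?thesis using okj by (auto simp: p(2))
      next
        case 2
        then obtain p' where "okp nw0 r p'" "\<forall>y\<in>Zp. mn y = r --> array t ''nw'' y = p' (c y)" using t(5) by blast
        thus ?thesis using 2 by (auto simp: p(2))
      qed
    qed (use hf(1-3) t in "auto simp: p(2)")
  qed
  define s5 where "s5 = set_scalar ''r'' 0 s4"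
  have h5: "hctx s5" by (rule hctx_frame[of s4]) (use I4 in "auto simp: I_def s5_def")
  have x5: "xsem (XFor ''r'' hang) s3 = s5" unfolding xsem.simps(6) s5_def s4_def base_n[OF hctxD(1)[OF w(1)]] ..
  define nw where "nw = array s4 ''nw''"
  define J where "J m t <-> base t & vis t = V & array t ''iU'' = array s5 ''iU'' & array t ''nw'' = nw & scalar t ''nq'' = Q &
    (\<forall>x\<in>V. array t ''c'' x = (if x < m & x \<notin> Up then nw x else c x))" for m :: nat and t
  let ?b = "XIfC (rd ''vis'' ''y'' \<and>\<and> xnot (rd ''iU'' ''y'')) (XPut ''c'' (XV ''y'') (rd ''nw'' ''y'')) XSkip"
  have "J n (iter (%j s. xsem ?b (set_scalar ''y'' j s)) s5 n)"
  proof (rule For_inv[of J])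
    show "J 0 s5" unfolding J_def using hctxD(1-3)[OF h5] I4 by (simp add: nw_def I_def s5_def)
    fix m t assume m: "m < n" and j: "J m t"
    have t: "base t" "vis t = V" "array t ''iU'' = array s5 ''iU''" "array t ''nw'' = nw" "scalar t ''nq'' = Q"
      "!!x. x \<in> V ==> array t ''c'' x = (if x < m & x \<notin> Up then nw x else c x)" using j unfolding J_def by blast+
    have mv: "array t ''vis'' m ~= 0 <-> m \<in> V" using t(2) m by (auto simp: vis_def)
    have mu: "array t ''iU'' m = 0 <-> m \<notin> Up" using hctxD(5)[OF h5 m] t(3) by auto
    have "xsem ?b (set_scalar ''y'' m t) = (if m \<in> V & m \<notin> Up then set_array ''c'' m (nw m) (set_scalar ''y'' m t) else set_scalar ''y'' m t)"
      unfolding mv[symmetric] mu[symmetric] by (simp add: t(4))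
    moreover have "J (Suc m) (if m \<in> V & m \<notin> Up then set_array ''c'' m (nw m) (set_scalar ''y'' m t) else set_scalar ''y'' m t)"
      using t unfolding J_def by (auto simp: base_def vis_def less_Suc_eq)
    ultimately show "J (Suc m) (xsem ?b (set_scalar ''y'' m t))" by simp
  qed
  moreover define s6 where "s6 = iter (%j s. xsem ?b (set_scalar ''y'' j s)) s5 n"
  ultimately have J6: "J n s6" by simp
  have x6: "xsem (XFor ''y'' ?b) s5 = set_scalar ''y'' 0 s6" unfolding xsem.simps(6) s6_def base_n[OF hctxD(1)[OF h5]] ..
  have s': "s' = set_scalar ''q'' Q (set_scalar ''y'' 0 s6)"
    unfolding s'_def recol_def xsem.simps(4) s1_def[symmetric] s2_def[symmetric] s3_def[symmetric] x5 x6
    using J6 by (simp add: J_def)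
  show "base s'" "vis s' = V" using J6 by (simp_all add: s' J_def base_def vis_def)
  have "\<exists>p. okp nw0 r p & (\<forall>y\<in>Zp. mn y = r --> nw y = p (c y))" if "r < n" for r using I4 that unfolding I_def nw_def by blast
  then obtain p where p: "!!r. r < n ==> okp nw0 r (p r)" "!!r y. r < n ==> y \<in> Zp ==> mn y = r ==> nw y = p r (c y)" by metis
  have nwW: "nw x = nw0 x" if "x \<notin> Zp" for x using I4 that unfolding I_def nw_def by blast
  have mnn: "mn y < n" if "y \<in> Zp" for y using rel_Zp[OF mn(1) that] subV V by auto
  have c': "array s' ''c'' x = (if x \<in> Zp then p (mn x) (c x) else if x \<in> Wp then nw0 x else c x)" if "x \<in> V" for x
  proof -
    have "x < n" using that V by auto
    hence "array s' ''c'' x = (if x \<notin> Up then nw x else c x)" using J6 that by (simp add: s' J_def)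
    moreover have "nw x = p (mn x) (c x)" "x \<notin> Up" if "x \<in> Zp" using p(2)[OF mnn[OF that] that refl] that VUWZ(3) by auto
    moreover have "x \<in> Up | x \<in> Wp | x \<in> Zp" using that VUWZ(1) by blast
    ultimately show ?thesis using nwW[of x] VUWZ(2) by auto
  qed
  have okp: "inj (p (mn y))" "!!x. x \<in> C ==> p (mn y) x = x" "!!x. x < Q ==> p (mn y) x < Q" "!!w. w \<in> Wp ==> E w y ==> p (mn y) (c w) = nw0 w"
    if "y \<in> Zp" for y using p(1)[OF mnn[OF that]] that unfolding okp_def by blast+
  have inP: "x \<in> P" if "x \<in> Up \<union> (Wp - {v}) \<union> Zp" for x using that UpP ZpP WpP by blast
  have "prp V (array s' ''c'') Q"
    unfolding prp_def
  proof (intro conjI ballI impI)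
    fix x assume x: "x \<in> V"
    have "c x < Q" if "x \<in> P" using c_less[OF that] qQ by linarith
    thus "array s' ''c'' x < Q" unfolding c'[OF x] using x okp(3)[of x] w(4)[of x] VUWZ(1) inP by auto
  next
    fix x y assume xy: "x \<in> V" "y \<in> V" "E x y"
    show "array s' ''c'' x ~= array s' ''c'' y" unfolding c'[OF xy(1)] c'[OF xy(2)]
    proof (rule recolor_proper[where U = Up and W = Wp and Z = Zp and l = mn and \<pi> = p and c = c and nw = nw0 and v = v])
      show "c x ~= c y" if "x \<in> Up \<union> (Wp - {v}) \<union> Zp" "y \<in> Up \<union> (Wp - {v}) \<union> Zp" "E x y" for x y
        by (rule c_neq) (use that inP in blast)+
      have "v \<in> h ` {..<7}" using H(2) by force
      thus "~ E v y" if "y \<in> Zp" for y using hZ_hole[OF H(1), of y v] that E_comm by (auto simp: Zp_def)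
      show "nw0 x \<notin> c ` Up" if "x \<in> Wp" for x using w(4)[OF that] by (simp add: C_def)
      show "mn x = mn y" if "x \<in> Zp" "y \<in> Zp" "E x y" for x y by (rule mn(3)) (use that in "auto simp: rel_def")
      show "p (mn y) (c x) = c x" if "x \<in> Up" "y \<in> Zp" for x y using okp(2)[OF that(2)] that(1) by (simp add: C_def)
    qed (use VUWZ vW w(5) okp(1,4) xy in auto)
  qed
  moreover have "Q <= r" if "prp V f r" for f r using lower[OF that] by (simp add: Q_def)
  ultimately show "opt V (array s' ''c'') (scalar s' ''q'')" by (simp add: s' opt_def)
qed

end

context ram_graph begin

section \<open>The loop over the vertices\<close>

definition Inv :: "nat => state => bool" where
  "Inv m s <-> base s & (\<exists>p. ord p m s) & opt (vis s) (array s ''c'') (scalar s ''q'')"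

lemma ord_cong: "ord p m s ==> vis s' = vis s ==> (!!w. w < n ==> array s' ''lab'' w = array s ''lab'' w) ==> ord p m s'"
  unfolding ord_def by simp

lemma step_facts:
  assumes b: "base s" and o: "ord p m s" and m: "m < n" and op: "opt (vis s) (array s ''c'') (scalar s ''q'')"
  defines "s1 \<equiv> xsem (blk pick) s"
  defines "v \<equiv> scalar s1 ''v''" and "s2 \<equiv> xsem (XIfC (XV ''bu'' \<prec> XV ''n'') (blk gem) kemp) s1"
  shows "base s2" "vis s2 = vis s" "scalar s2 ''v'' = v"
    "scalar s2 ''hole'' = 0 & opt (insert v (vis s)) (array s2 ''c'') (scalar s2 ''q'') |
     scalar s2 ''hole'' ~= 0 & khole (vis s) v s2 & opt (vis s) (array s2 ''c'') (scalar s2 ''q'')"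
proof -
  note pk = pick_facts[OF b o m, folded s1_def, folded v_def]
  define P where "P = vis s"
  have pP: "(p(m := v)) ` {..<m} = P" using o by (auto simp: ord_def P_def)
  have v1: "v = scalar s1 ''v''" by (simp add: v_def)
  have op1: "opt P (array s1 ''c'') (scalar s1 ''q'')" using op pk(3,4) by (simp add: P_def)
  have vs1: "vis s1 = P" using pk(2) by (simp add: P_def)
  have vP: "v \<notin> P" using pk(6) by (simp add: P_def)
  have Pn: "w < n" if "w \<in> P" for w using that by (auto simp: P_def vis_def)
  have nv: "array s1 ''nv'' w ~= 0 <-> w \<in> P & E v w" if "w < n" for w using pk(9)[OF that] unfolding P_def .
  have S: "array s1 ''S'' w ~= 0 <-> w \<in> P & E v w & (\<exists>u\<in>P. E v u & u ~= w & ~ E u w)" if "w < n" for w using pk(10)[OF that] unfolding P_def .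
  have "base s2 & vis s2 = P & scalar s2 ''v'' = v & (scalar s2 ''hole'' = 0 & opt (insert v P) (array s2 ''c'') (scalar s2 ''q'') |
     scalar s2 ''hole'' ~= 0 & khole P v s2 & opt P (array s2 ''c'') (scalar s2 ''q''))"
  proof (cases "scalar s1 ''bu'' < n")
    case True
    have s2: "s2 = xsem (blk gem) s1" using True base_n[OF pk(1)] by (simp add: s2_def del: blk.simps)
    obtain D where D: "conn D" "(p(m := v)) m \<notin> D" "D \<subseteq> (p(m := v)) ` {..<m}" "!!u. u \<in> D ==> ~ E ((p(m := v)) m) u"
      "!!s x. [|s \<in> (p(m := v)) ` {..<m}; x \<in> (p(m := v)) ` {..<m}; E ((p(m := v)) m) s; E ((p(m := v)) m) x; x ~= s; ~ E s x|] ==> \<exists>d\<in>D. E s d"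
      by (rule lexbfs_component[OF pk(7)]) blast
    have D': "v \<notin> D" "D \<subseteq> vis s1" "!!u. u \<in> D ==> ~ E v u" "!!u x. [|u \<in> vis s1; x \<in> vis s1; E v u; E v x; x ~= u; ~ E u x|] ==> \<exists>d\<in>D. E u d"
      using D(2-5) unfolding pP vs1 by simp_all
    have g: "hole (array s2 ''h'') & array s2 ''h'' 0 = v & array s2 ''h'' ` {..<7} \<subseteq> insert v (vis s1)" "scalar s2 ''hole'' = 1"
      unfolding s2
      by (rule gem_facts[OF pk(1) v1 pk(5) _ D(1) D' _ _ pk(12) pk(13) True pk(14)[OF True]]; (simp only: vs1 vP nv S not_False_eq_True)?; assumption?)+
    have fs: "scalar s2 x = scalar s1 x" if "x \<in> {''n'', ''v'', ''q''}" for x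
      unfolding s2 by (rule scalar_blk) (use that in "auto simp: gem_def bfs_def lev_def")
    have fa: "array s2 x = array s1 x" if "x \<in> {''adj'', ''vis'', ''c''}" for x
      unfolding s2 by (rule array_blk) (use that in "auto simp: gem_def bfs_def lev_def")
    have "base s2" by (rule base_frame[OF pk(1)]) (simp_all add: fs fa)
    thus ?thesis using g vs1 op1 by (simp add: fs fa v_def khole_def vis_def)
  next
    case False
    have s2: "s2 = xsem kemp s1" using False base_n[OF pk(1)] by (simp add: s2_def)
    have nT: "w \<in> nbT P v <-> w \<in> P & E v w" for w by (simp add: nbT_def)
    have nST: "array s1 ''S'' w ~= 0 <-> w \<in> nbT P v - nbM P v" if "w < n" for w
      unfolding S[OF that] nbM_def nbT_def by blast
    define B where "B u <-> (\<exists>w<n. array s1 ''S'' u ~= 0 & array s1 ''S'' w ~= 0 & ((u = w | E u w) ~= (array s1 ''lead'' u = array s1 ''lead'' w)))" for u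
    have "scalar s1 ''bu'' = first n B" using pk(13) unfolding B_def .
    hence nB: "~ B u" if "u < n" for u using first_some[OF that, of B] False by auto
    have l: "E u w <-> array s1 ''lead'' u = array s1 ''lead'' w" if "u \<in> nbT P v - nbM P v" "w \<in> nbT P v - nbM P v" "u ~= w" for u w
    proof -
      have "u < n" "w < n" using that Pn by (auto simp: nT)
      thus ?thesis using nB[of u] nST that unfolding B_def by blast
    qed
    have cl: "E x z" if "x \<in> nbT P v - nbM P v" "y \<in> nbT P v - nbM P v" "z \<in> nbT P v - nbM P v" "E x y" "E y z" "x ~= z" for x y z
      using l[OF that(1,2)] l[OF that(2,3)] l[OF that(1,3)] that(4-6) E_irrefl by metis
    have M: "array s1 ''M'' w ~= 0 <-> w \<in> nbM P v" if "w < n" for w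
      unfolding pk(11)[OF that] nv[OF that] using nST[OF that] nT[of w] by (auto simp: nbM_def nbT_def)
    have nvT: "array s1 ''nv'' w ~= 0 <-> w \<in> nbT P v" if "w < n" for w unfolding nv[OF that] nT ..
    have k: "base s2" "vis s2 = P" "scalar s2 ''v'' = v" "scalar s2 ''hole'' = 0 & opt (insert v P) (array s2 ''c'') (scalar s2 ''q'') |
        scalar s2 ''hole'' ~= 0 & khole P v s2 & scalar s2 ''q'' = scalar s1 ''q'' & opt P (array s2 ''c'') (scalar s1 ''q'')"
      unfolding s2 by (rule kemp_facts[OF pk(1) vs1 v1 pk(5) vP nvT M cl op1 refl pk(15)]; assumption)+
    thus ?thesis by auto
  qed
  thus "base s2" "vis s2 = vis s" "scalar s2 ''v'' = v"
    "scalar s2 ''hole'' = 0 & opt (insert v (vis s)) (array s2 ''c'') (scalar s2 ''q'') |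
     scalar s2 ''hole'' ~= 0 & khole (vis s) v s2 & opt (vis s) (array s2 ''c'') (scalar s2 ''q'')" unfolding P_def by blast+
qed

lemma nl_frame: "''nl'' \<notin> wra (XIfC (XV ''bu'' \<prec> XV ''n'') (blk gem) kemp)" "''nl'' \<notin> wra recol"
  by code_simp+

lemma vstep_inv:
  assumes i: "Inv m s" and m: "m < n"
  shows "Inv (Suc m) (xsem vstep (set_scalar ''m'' m s))"
proof -
  define s0 where "s0 = set_scalar ''m'' m s"
  obtain p where p: "ord p m s" using i by (auto simp: Inv_def)
  have b0: "base s0" and o0: "ord p m s0" and op: "opt (vis s0) (array s0 ''c'') (scalar s0 ''q'')"
    using i ord_cong[OF p, of s0] by (auto simp: s0_def Inv_def base_def vis_def)
  define s1 where "s1 = xsem (blk pick) s0"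
  define v where "v = scalar s1 ''v''"
  define s2 where "s2 = xsem (XIfC (XV ''bu'' \<prec> XV ''n'') (blk gem) kemp) s1"
  note pk = pick_facts[OF b0 o0 m, folded s1_def, folded v_def]
  note st = step_facts[OF b0 o0 m op, folded s1_def, folded v_def, folded s2_def]
  define P where "P = vis s0"
  define s3 where "s3 = set_array ''vis'' v 1 s2"
  have b3: "base s3" by (rule base_frame[OF st(1)]) (simp_all add: s3_def)
  have v3: "vis s3 = insert v P" using st(2) pk(5) by (auto simp: s3_def vis_def P_def)
  define s4 where "s4 = xsem (XIfC (XV ''hole'') recol XSkip) s3"
  have s4: "base s4 & vis s4 = insert v P & opt (insert v P) (array s4 ''c'') (scalar s4 ''q'')"
  proof (cases "scalar s2 ''hole'' = 0")
    case True
    hence "s4 = s3" by (simp add: s4_def s3_def)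
    thus ?thesis using b3 v3 st(4) True by (simp add: s3_def P_def)
  next
    case False
    hence s4: "s4 = xsem recol s3" by (simp add: s4_def s3_def)
    have k: "khole P v s2" "opt P (array s2 ''c'') (scalar s2 ''q'')" using st(4) False by (auto simp: P_def)
    interpret R: recolor E n P v "array s2 ''h''" "array s2 ''c''" "scalar s2 ''q''"
      by unfold_locales (use k pk(5,6) in "auto simp: khole_def P_def vis_def")
    have "vis s3 = R.V" by (simp add: v3 R.V_def)
    moreover have "array s3 ''h'' = array s2 ''h''" "array s3 ''c'' = array s2 ''c''" "scalar s3 ''q'' = scalar s2 ''q''" by (simp_all add: s3_def)
    ultimately have "base (xsem recol s3)" "vis (xsem recol s3) = R.V" "opt R.V (array (xsem recol s3) ''c'') (scalar (xsem recol s3) ''q'')"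
      by (rule R.recol_facts[OF b3])+
    thus ?thesis unfolding s4 R.V_def by blast
  qed
  have nl: "array s4 ''nl'' = array s1 ''nl''"
  proof -
    have "''nl'' \<notin> wra (XIfC (XV ''hole'') recol XSkip)" using nl_frame(2) by simp
    from array_xsem[OF this, of s3] array_xsem[OF nl_frame(1), of s1] show ?thesis unfolding s4_def s3_def s2_def by simp
  qed
  define s5 where "s5 = xsem (blk [IT ''lab'' ''w'' (rd ''nl'' ''w'')]) s4"
  have x: "xsem vstep s0 = s5"
    unfolding vstep_def xsem.simps(4) s1_def[symmetric] s2_def[symmetric] s5_def s4_def s3_def using st(3) by (simp del: blk.simps)
  have fs5: "scalar s5 x = scalar s4 x" if "x ~= ''w''" for x unfolding s5_def by (rule scalar_blk) (use that in simp)
  have fa5: "array s5 x = array s4 x" if "x ~= ''lab''" for x unfolding s5_def by (rule array_blk) (use that in simp)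
  have "holds s5 (IT ''lab'' ''w'' (rd ''nl'' ''w''))" unfolding s5_def by (rule ssa_holds) simp_all
  hence lab: "array s5 ''lab'' w = array s1 ''nl'' w" if "w < n" for w using that nl base_n[of s4] s4 by (simp add: fa5 fs5)
  have "base s5" by (rule base_frame[of s4]) (use s4 in "simp_all add: fs5 fa5")
  moreover have v5: "vis s5 = insert v P" using s4 by (simp add: vis_def fa5)
  moreover have "ord (p(m := v)) (Suc m) s5"
    by (rule ord_cong[OF pk(8)]) (use lab v5 pk(2,5) in "auto simp: vis_def P_def")
  ultimately show ?thesis using s4 unfolding s0_def[symmetric] x Inv_def by (auto simp: fs5 fa5)
qed

lemma prog_final:
  assumes b: "base s" and z: "!!w. array s ''vis'' w = 0" "!!w. array s ''lab'' w = 0" "scalar s ''q'' = 0"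
  obtains c q where "opt {..<n} c q" "!!w. w < n ==> array (xsem prog s) ''col'' w = c w + 1"
proof -
  have "Inv 0 s" unfolding Inv_def
  proof (intro conjI exI)
    show "ord id 0 s" by (simp add: ord_def vis_def z lexless_def)
    show "opt (vis s) (array s ''c'') (scalar s ''q'')" by (simp add: opt_def prp_def vis_def z)
  qed (rule b)
  hence I: "Inv n (iter (%j s. xsem vstep (set_scalar ''m'' j s)) s n)"
    by (rule For_inv[of Inv]) (rule vstep_inv)
  define t where "t = set_scalar ''m'' 0 (iter (%j s. xsem vstep (set_scalar ''m'' j s)) s n)"
  have "Inv n t" using I by (auto simp: t_def Inv_def ord_def base_def vis_def)
  then obtain p where p: "base t" "ord p n t" "opt (vis t) (array t ''c'') (scalar t ''q'')" by (auto simp: Inv_def)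
  have "card (vis t) = n" using p(2) card_image[of p "{..<n}"] by (simp add: ord_def)
  hence "vis t = {..<n}" using card_subset_eq[of "{..<n}" "vis t"] by (auto simp: vis_def)
  moreover have "array (xsem prog s) ''col'' w = array t ''c'' w + 1" if "w < n" for w
  proof -
    define u where "u = xsem (blk [IT ''col'' ''w'' (rd ''c'' ''w'' \<oplus> XC 1)]) t"
    have "xsem prog s = u" unfolding prog_def xsem.simps(4) xsem.simps(6) base_n[OF b] u_def t_def ..
    moreover have "holds u (IT ''col'' ''w'' (rd ''c'' ''w'' \<oplus> XC 1))" unfolding u_def by (rule ssa_holds) simp_all
    moreover have "nn u = n" using base_n[OF p(1)] scalar_blk[where x = "''n''" and ts = "[IT ''col'' ''w'' (rd ''c'' ''w'' \<oplus> XC 1)]" and s = t] by (simp add: u_def del: blk.simps)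
    moreover have "array u ''c'' = array t ''c''" unfolding u_def by (rule array_blk) simp
    ultimately show ?thesis using that by simp
  qed
  ultimately show thesis using that p(3) by metis
qed

end

section \<open>From forbidden induced subgraphs to the edge relation\<close>

lemma not_free:
  assumes "h ` {..<k} \<subseteq> verts G" "inj_on h {..<k}" "verts H = {..<k}"
    and "!!i j. i < k ==> j < k ==> {h i, h j} \<in> edges G <-> {i, j} \<in> edges H" and "H \<in> \<H>"
  shows "~ graph_free \<H> G"
proof -
  have "bij_betw (inv_into {..<k} h) (h ` {..<k}) {..<k}" by (rule bij_betw_inv_into[OF inj_on_imp_bij_betw[OF assms(2)]])
  hence "graph_isomorphic (induced_subgraph G (h ` {..<k})) H"
    unfolding graph_isomorphic_def using assms(2-4) by (intro exI[of _ "inv_into {..<k} h"]) (auto simp: induced_subgraph_def)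
  thus ?thesis using assms(1,5) unfolding graph_free_def by blast
qed

lemma path_edge: "{i, j} \<in> edges (path_graph k) <-> i < k & j < k & (j = Suc i | i = Suc j)"
  by (auto simp: path_graph_def doubleton_eq_iff)

lemma cycle_edge: "{i, j} \<in> edges (cycle_graph k) <-> i < k & j = Suc i mod k | j < k & i = Suc j mod k"
  by (auto simp: cycle_graph_def doubleton_eq_iff)

lemma all_less: "(\<forall>i<4. P i) <-> P 0 & P 1 & P 2 & P (3::nat)" "(\<forall>i<5. P i) <-> P 0 & P 1 & P 2 & P 3 & P (4::nat)"
  "(\<forall>i<7. P i) <-> P 0 & P 1 & P 2 & P 3 & P 4 & P 5 & P (6::nat)"
  by (auto simp: numeral_eq_Suc All_less_Suc)

lemma pcc_of_free:
  assumes g: "simple_graph G" and f: "graph_free {path_graph 7, cycle_graph 4, cycle_graph 5} G"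
  defines "E \<equiv> %u v. {u, v} \<in> edges G"
  shows "pcc_free E"
proof
  show sym: "E x y ==> E y x" for x y by (simp add: E_def insert_commute)
  hence comm: "E x y = E y x" for x y by blast
  show irr: "~ E x x" for x using g by (fastforce simp: simple_graph_def E_def)
  have vt: "E x y ==> x \<in> verts G & y \<in> verts G" for x y using g by (auto simp: simple_graph_def E_def)
  have no: False if "length xs = k" "set xs \<subseteq> verts G" "distinct xs" "verts H = {..<k}" "\<forall>i<k. \<forall>j<k. E (xs ! i) (xs ! j) <-> {i, j} \<in> edges H"
    "H \<in> {path_graph 7, cycle_graph 4, cycle_graph 5}" for xs k H
  proof -
    have "(!) xs ` {..<k} = set xs" using that(1) by (auto simp: in_set_conv_nth)
    hence i: "(!) xs ` {..<k} \<subseteq> verts G" using that(2) by simp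
    have "inj_on ((!) xs) {..<k}" using that(1,3) by (auto intro: inj_on_nth)
    from not_free[OF i this that(4) _ that(6)] show False using f that(5) unfolding E_def by simp
  qed
  show False if "E a b" "E b c" "E c d" "E d a" "~ E a c" "~ E b d" "a ~= c" "b ~= d" for a b c d
  proof (rule no[of "[a, b, c, d]" 4 "cycle_graph 4"])
    show "distinct [a, b, c, d]" using that irr by auto
    show "\<forall>i<4. \<forall>j<4. E ([a, b, c, d] ! i) ([a, b, c, d] ! j) <-> {i, j} \<in> edges (cycle_graph 4)"
      using that irr comm by (simp add: all_less cycle_edge)
  qed (use that vt in "auto simp: cycle_graph_def")
  show False if "E a b" "E b c" "E c d" "E d e" "E e a" "~ E a c" "~ E a d" "~ E b d" "~ E b e" "~ E c e" for a b c d e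
  proof (rule no[of "[a, b, c, d, e]" 5 "cycle_graph 5"])
    show "distinct [a, b, c, d, e]" using that irr sym by auto
    show "\<forall>i<5. \<forall>j<5. E ([a, b, c, d, e] ! i) ([a, b, c, d, e] ! j) <-> {i, j} \<in> edges (cycle_graph 5)"
      using that irr comm by (simp add: all_less cycle_edge)
  qed (use that vt in "auto simp: cycle_graph_def")
  show False if "E a b" "E b c" "E c d" "E d e" "E e f" "E f g"
      "~ E a c" "~ E a d" "~ E a e" "~ E a f" "~ E a g" "~ E b d" "~ E b e" "~ E b f" "~ E b g"
      "~ E c e" "~ E c f" "~ E c g" "~ E d f" "~ E d g" "~ E e g" for a b c d e f g
  proof (rule no[of "[a, b, c, d, e, f, g]" 7 "path_graph 7"])
    show "distinct [a, b, c, d, e, f, g]" using that irr sym by auto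
    show "\<forall>i<7. \<forall>j<7. E ([a, b, c, d, e, f, g] ! i) ([a, b, c, d, e, f, g] ! j) <-> {i, j} \<in> edges (path_graph 7)"
      using that irr comm by (simp add: all_less path_edge)
  qed (use that vt in "auto simp: path_graph_def")
qed

lemma prog_minimum:
  assumes g: "simple_graph G" "verts G = {..<n}" and f: "graph_free {path_graph 7, cycle_graph 4, cycle_graph 5} G"
  shows "is_minimum_coloring G (output_coloring (xsem prog (input_state G)))" "nn (input_state G) = n" "1 <= n"
    "bounded Gam (input_state G)" "clean (input_state G)"
proof -
  define s where "s = input_state G"
  have s: "scalar s = (%x. if x = ''n'' then n else 0)" "array s = (%a i. if a = ''adj'' & i < n * n & {i div n, i mod n} \<in> edges G then 1 else 0)"
    by (simp_all add: s_def input_state_def Let_def g(2))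
  show "nn (input_state G) = n" using s(1) by (simp add: s_def)
  show n: "1 <= n" using g by (cases n) (auto simp: simple_graph_def)
  show "clean (input_state G)" using s(1) by (simp add: s_def clean_def tmp_def)
  show "bounded Gam (input_state G)" unfolding bounded_def s_def[symmetric] using s by (simp add: Gam_def)
  define E where "E u v <-> {u, v} \<in> edges G" for u v
  have e: "u < n" "w < n" if "E u w" for u w using that g by (auto simp: E_def simple_graph_def)
  interpret pcc_free E using pcc_of_free[OF g(1) f] unfolding E_def[abs_def] .
  interpret ram_graph E n by unfold_locales (use e n in auto)
  have "base s" unfolding base_def
  proof (intro conjI allI impI)
    fix u w assume uw: "u < n" "w < n"
    have "u * n + w < n * n"
    proof -
      have "(u + 1) * n <= n * n" by (rule mult_le_mono1) (use uw in simp)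
      thus ?thesis using uw by simp
    qed
    thus "array s ''adj'' (u * n + w) ~= 0 <-> E u w" using uw by (simp add: s E_def)
  qed (simp add: s)
  then obtain c q where c: "opt {..<n} c q" "!!w. w < n ==> array (xsem prog s) ''col'' w = c w + 1"
    by (rule prog_final) (simp_all add: s)
  have co: "is_coloring q G (output_coloring (xsem prog s))"
    unfolding is_coloring_def g(2) output_coloring_def
  proof (intro conjI allI impI)
    have "c w < q" if "w < n" for w using c(1) that by (simp add: opt_def prp_def)
    thus "array (xsem prog s) ''col'' \<in> {..<n} \<rightarrow> {1..q}" by (auto simp: c(2) Suc_le_eq)
    fix u w assume "{u, w} \<in> edges G"
    hence uw: "E u w" by (simp add: E_def)
    have "c u ~= c w" using c(1) uw e[OF uw] by (simp add: opt_def prp_def)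
    thus "array (xsem prog s) ''col'' u ~= array (xsem prog s) ''col'' w" using e[OF uw] by (simp add: c(2))
  qed
  moreover have "q <= r" if "is_coloring r G f" for r f
  proof -
    have f: "1 <= f x & f x <= r" if "x < n" for x using \<open>is_coloring r G f\<close> that unfolding is_coloring_def g(2) by (auto simp: Pi_iff)
    \<comment> \<open>Colours are numbered from 1 in \<open>is_coloring\<close> and from 0 in
      \<open>prp\<close>.\<close>
    have "prp {..<n} (%x. f x - 1) r"
      unfolding prp_def
    proof (intro conjI ballI impI)
      fix x assume "x \<in> {..<n}"
      thus "f x - 1 < r" using f[of x] by auto
    next
      fix x y assume xy: "x \<in> {..<n}" "y \<in> {..<n}" "E x y"
      hence "f x ~= f y" using that by (auto simp: is_coloring_def E_def)
      thus "f x - 1 ~= f y - 1" using f[of x] f[of y] xy by auto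
    qed
    thus ?thesis using c(1) by (auto simp: opt_def)
  qed
  ultimately have "chromatic_number G = q" unfolding chromatic_number_def by (intro Least_equality) blast+
  thus "is_minimum_coloring G (output_coloring (xsem prog (input_state G)))" using co by (simp add: is_minimum_coloring_def s_def)
qed

theorem theorem4p13:
  "\<exists>(p :: com) (k :: nat) (T :: nat \<Rightarrow> nat).
     (\<lambda>n. real (T n)) \<in> O(\<lambda>n. real n ^ 3) \<and>
     finds_minimum_coloring p k T (graph_free {path_graph 7, cycle_graph 4, cycle_graph 5})"
proof -
  obtain K where K: "!!s. ctime prog s <= K * (nn s + 1) ^ 3" using tle_prog unfolding tle_def by blast
  let ?T = "%n. K * (n + 1) ^ 3"
  have "(%n. real (?T n)) \<in> O(%n. real n ^ 3)"
  \<comment> \<open>The factor 8 is \<open>2 ^ 3\<close>, from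
    \<open>n + 1 <= 2 * n\<close>.\<close>
  proof (rule bigoI[where c = "8 * real K"])
    show "\<forall>\<^sub>F n in sequentially. norm (real (?T n)) <= 8 * real K * norm (real n ^ 3)"
      unfolding eventually_sequentially
    proof (intro exI[of _ 1] allI impI)
      fix n :: nat assume "1 <= n"
      hence "(n + 1) ^ 3 <= (2 * n) ^ 3" by (intro power_mono) auto
      hence "?T n <= 8 * K * n ^ 3" by (simp add: power_mult_distrib)
      hence "real (?T n) <= real (8 * K * n ^ 3)" by (rule of_nat_mono)
      also have "\<dots> = 8 * real K * real n ^ 3" by simp
      finally show "norm (real (?T n)) <= 8 * real K * norm (real n ^ 3)" by (simp del: of_nat_mult of_nat_power)
    qed
  qed
  moreover have "finds_minimum_coloring (cc prog) 20 ?T (graph_free {path_graph 7, cycle_graph 4, cycle_graph 5})"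
    unfolding finds_minimum_coloring_def
  proof (intro allI impI)
    fix n and G :: "nat ugraph" assume a: "simple_graph G & verts G = {..<n} & graph_free {path_graph 7, cycle_graph 4, cycle_graph 5} G"
    hence "simple_graph G" "verts G = {..<n}" "graph_free {path_graph 7, cycle_graph 4, cycle_graph 5} G" by auto
    note m = prog_minimum[OF this]
    have "runs ((n + 1) ^ 20) (cc prog) (input_state G) (ctime prog (input_state G)) (xsem prog (input_state G))"
      by (rule cc_correct[OF prog_ok m(4)]) (use m in simp_all)
    then obtain t where t: "t <= ctime prog (input_state G)" "exec ((n + 1) ^ 20) (cc prog) (input_state G) t (xsem prog (input_state G))"
      unfolding runs_def by blast
    have "t <= ?T n" using t(1) K[of "input_state G"] unfolding m(2) by linarith
    thus "\<exists>t s. exec ((n + 1) ^ 20) (cc prog) (input_state G) t s & t <= ?T n & is_minimum_coloring G (output_coloring s)"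
      using t(2) m(1) by blast
  qed
  ultimately show ?thesis by (intro exI[of _ "cc prog"] exI[of _ 20] exI[of _ ?T] conjI)
qed

end
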